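(* Let $B$ satisfy $B = (\log N)^{O(1)}$ (equivalently $1+\log_B\log N = O(\log_B \log N)$). Then the Belga B-tree is $O(\log\log N)$-competitive in the B-tree model on search sequences of length $m = \Omega(N)$: for every search sequence $X$ over the keys $\{1,\dots,N\}$ with $|X| = m = \Omega(N)$, the cost of the Belga B-tree on $X$ (excluding the fixed one-time cost of transforming the initial tree into a Belga B-tree) is $O(\log\log N \cdot \mathrm{OPT}_{\mathrm{Btree}}(X))$.
   Context: B-tree model with parameter $B\ge 2$: each node stores at most $B-1$ sorted keys and has one more child pointer than keys, obeying the search-tree order. A search for $x_i$ starts with a pointer at the root (unit cost) and performs unit-cost operations until the node containing $x_i$ is touched: move the pointer to a child or parent; split a node with at least three keys at a non-extreme key that moves up into its non-full parent (creating a new root first if splitting the root); join two siblings with at most $B-2$ keys in total together with the parent key separating them (removing the parent if it becomes empty); rotate the edge between the current node $u$ and its parent, replacing the contiguous interval formed by $u$'s keys within the sorted union of keys of $u$ and its parent by any other contiguous interval, provided both nodes keep at most $B-1$ keys. The cost is the number of unit-cost operations; $\mathrm{OPT}_{\mathrm{Btree}}(X)$ is the minimum cost over all offline B-tree-model algorithms. Belga B-tree: fix a complete binary search tree $P$ on $\{1,\dots,N\}$; each internal node of $P$ has a preferred child (left or right) according to whether the last search in its subtree was for $v$ or a key in its left subtree (left) or in its right subtree (right); preferred paths are maximal paths following preferred children. The Belga B-tree stores each preferred path in an augmented classic (balanced, all leaves at equal depth) B-tree, where each key records its depth in $P$ and each node records the minimum and maximum depth in its subtree, and these auxiliary trees are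 linked into one B-tree, with auxiliary-tree roots marked. A search walks down from the root; at each marked node $v$ reached, with $Q$ the path of the parent's auxiliary tree, $R$ the path of $v$'s auxiliary tree and $d$ the minimum depth in $R$, the auxiliary tree of $Q$ is cut into keys of depth $\le d-1$ and $> d-1$, and the former is merged with $v$'s auxiliary tree, after which the search continues. Competitive ratio is the ratio of the algorithm's cost to $\mathrm{OPT}_{\mathrm{Btree}}$.
   Formalization: The competitive bound is proved for all B ≥ 2, but that the Belga B-tree can be built and run with O(1+log_B k) cuts and merges is proved only for B ≥ 4 and large N: for B ≤ 3 the model permits no split or join, so the Belga B-tree cannot be maintained. *)

theory Defs
  imports Complex_Main "HOL-Library.Tree"
begin

section \<open>The B-tree model\<close>

text \<open>The label type \<open>'a\<close> holds auxiliary data; the model itself uses \<open>unit\<close>.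
  \<open>BNil\<close> is the null pointer.\<close>

datatype 'a btree =
  BNil | BNode (label: 'a) (node_keys: "nat list") (children: "'a btree list")
where
  "node_keys BNil = []"
| "children BNil = []"

fun weave :: "'b list list \<Rightarrow> 'b list \<Rightarrow> 'b list" where
  "weave (xs # xss) (k # ks) = xs @ k # weave xss ks"
| "weave xss _ = concat xss"

fun keys_inorder :: "'a btree \<Rightarrow> nat list" where
  "keys_inorder BNil = []"
| "keys_inorder (BNode a ks ts) = weave (map keys_inorder ts) ks"

definition keys :: "'a btree \<Rightarrow> nat set" where
  "keys t = set (keys_inorder t)"

fun node_sizes_ok :: "nat \<Rightarrow> 'a btree \<Rightarrow> bool" where
  "node_sizes_ok B BNil = True"
| "node_sizes_ok B (BNode a ks ts) =
    (1 \<le> length ks \<and> length ks \<le> B - 1 \<and> length ts = length ks + 1 \<and>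
     (\<forall>t\<in>set ts. node_sizes_ok B t))"

definition btree_on :: "nat \<Rightarrow> nat \<Rightarrow> 'a btree \<Rightarrow> bool" where
  "btree_on B N t \<longleftrightarrow> node_sizes_ok B t \<and> keys_inorder t = [1..<N + 1]"

text \<open>A node is addressed by the list of child indices leading to it from the root.\<close>

fun sub_at :: "'a btree \<Rightarrow> nat list \<Rightarrow> 'a btree" where
  "sub_at t [] = t"
| "sub_at (BNode a ks ts) (i # p) = sub_at (ts ! i) p"
| "sub_at BNil (i # p) = BNil"

fun put_at :: "'a btree \<Rightarrow> nat list \<Rightarrow> 'a btree \<Rightarrow> 'a btree" where
  "put_at t [] s = s"
| "put_at (BNode a ks ts) (i # p) s = BNode a ks (ts[i := put_at (ts ! i) p s])"
| "put_at BNil (i # p) s = BNil"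

type_synonym config = "unit btree \<times> nat list"

abbreviation node :: "nat list \<Rightarrow> unit btree list \<Rightarrow> unit btree" where
  "node \<equiv> BNode ()"

text \<open>The unit-cost operations. \<open>split\<close>, \<open>join\<close> and \<open>rotate\<close> act on the edge between the current
  node and its parent, which has address \<open>q\<close>. After a join that empties the parent, the joined
  node takes the parent's place. In \<open>rotate\<close>, \<open>as @ us @ cs\<close> is the sorted union of the keys of
  parent and child, and \<open>us\<close> is replaced by the interval \<open>us'\<close>; no node may become empty.\<close>

inductive step :: "nat \<Rightarrow> config \<Rightarrow> config \<Rightarrow> bool" for B :: nat where
  move_child:
    "\<lbrakk>i < length (children (sub_at t p)); children (sub_at t p) ! i \<noteq> BNil\<rbrakk>
     \<Longrightarrow> step B (t, p) (t, p @ [i])"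
| move_parent:
    "step B (t, p @ [i]) (t, p)"
| split:
    "\<lbrakk>sub_at t q = node (ks1 @ ks2) (ts1 @ node (us1 @ k # us2) (vs1 @ vs2) # ts2);
      length ts1 = length ks1; length vs1 = length us1 + 1;
      us1 \<noteq> []; us2 \<noteq> []; length (ks1 @ ks2) < B - 1\<rbrakk>
     \<Longrightarrow> step B (t, q @ [length ts1])
           (put_at t q (node (ks1 @ k # ks2) (ts1 @ node us1 vs1 # node us2 vs2 # ts2)), q)"
| split_root:
    "\<lbrakk>length vs1 = length us1 + 1; us1 \<noteq> []; us2 \<noteq> []\<rbrakk>
     \<Longrightarrow> step B (node (us1 @ k # us2) (vs1 @ vs2), [])
           (node [k] [node us1 vs1, node us2 vs2], [])"
| join:
    "\<lbrakk>sub_at t q = node (ks1 @ k # ks2) (ts1 @ node us1 vs1 # node us2 vs2 # ts2);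
      length ts1 = length ks1; length us1 + length us2 \<le> B - 2;
      i = length ts1 \<or> i = length ts1 + 1;
      u = node (us1 @ k # us2) (vs1 @ vs2)\<rbrakk>
     \<Longrightarrow> step B (t, q @ [i])
           (put_at t q (if ks1 @ ks2 = [] then u else node (ks1 @ ks2) (ts1 @ u # ts2)), q)"
| rotate:
    "\<lbrakk>sub_at t q = node (as @ cs) (ts1 @ node us vs # ts2); length ts1 = length as;
      as @ us @ cs = as' @ us' @ cs'; us' \<noteq> us;
      ts1 @ vs @ ts2 = ts1' @ vs' @ ts2';
      length ts1' = length as'; length vs' = length us' + 1; length ts2' = length cs';
      us' \<noteq> []; as' @ cs' \<noteq> []; length us' \<le> B - 1; length (as' @ cs') \<le> B - 1\<rbrakk>
     \<Longrightarrow> step B (t, q @ [length ts1])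
           (put_at t q (node (as' @ cs') (ts1' @ node us' vs' # ts2')), q @ [length ts1'])"

text \<open>A search for \<open>x\<close> is the list of configurations it goes through. Its length is its cost: one
  for placing the pointer at the root plus one per operation. Restructuring after \<open>x\<close> has been
  touched is permitted, and is paid for.\<close>

definition model_search :: "nat \<Rightarrow> nat \<Rightarrow> unit btree \<Rightarrow> config list \<Rightarrow> unit btree \<Rightarrow> bool" where
  "model_search B x t cs t' \<longleftrightarrow>
     cs \<noteq> [] \<and> hd cs = (t, []) \<and> successively (step B) cs \<and> fst (last cs) = t' \<and>
     (\<exists>(s, p)\<in>set cs. x \<in> set (node_keys (sub_at s p)))"

inductive model_run :: "nat \<Rightarrow> unit btree \<Rightarrow> nat list \<Rightarrow> nat \<Rightarrow> bool" for B :: nat where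
  "model_run B t [] 0"
| "\<lbrakk>model_search B x t cs t'; model_run B t' X n\<rbrakk> \<Longrightarrow> model_run B t (x # X) (length cs + n)"

text \<open>The offline optimum may also choose its initial tree.\<close>

definition OPT_Btree :: "nat \<Rightarrow> nat \<Rightarrow> nat list \<Rightarrow> nat" where
  "OPT_Btree B N X = Inf {n. \<exists>t. btree_on B N t \<and> model_run B t X n}"


section \<open>The reference tree and its preferred paths\<close>

definition reference_tree :: "nat \<Rightarrow> nat tree \<Rightarrow> bool" where
  "reference_tree N P \<longleftrightarrow> acomplete P \<and> inorder P = [1..<N + 1]"

fun subtree_of :: "nat tree \<Rightarrow> nat \<Rightarrow> nat tree" where
  "subtree_of \<langle>\<rangle> x = \<langle>\<rangle>"
| "subtree_of \<langle>l, v, r\<rangle> x =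
    (if x = v then \<langle>l, v, r\<rangle> else if x < v then subtree_of l x else subtree_of r x)"

fun depth :: "nat tree \<Rightarrow> nat \<Rightarrow> nat" where
  "depth \<langle>\<rangle> x = 0"
| "depth \<langle>l, v, r\<rangle> x =
    (if x = v then 0 else if x < v then Suc (depth l x) else Suc (depth r x))"

datatype side = L | R

type_synonym preference = "nat \<Rightarrow> side"

definition side_of :: "nat \<Rightarrow> nat \<Rightarrow> side" where
  "side_of x v = (if x \<le> v then L else R)"

definition after_search :: "nat tree \<Rightarrow> nat \<Rightarrow> preference \<Rightarrow> preference" where
  "after_search P x pref =
     (\<lambda>v. if x \<in> set_tree (subtree_of P v) then side_of x v else pref v)"

text \<open>The preferred path from the root, and the subtrees hanging off it, both in key order.\<close>

fun preferred_path :: "preference \<Rightarrow> nat tree \<Rightarrow> nat list" where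
  "preferred_path pref \<langle>\<rangle> = []"
| "preferred_path pref \<langle>l, v, r\<rangle> =
    (case pref v of L \<Rightarrow> preferred_path pref l @ [v] | R \<Rightarrow> v # preferred_path pref r)"

fun hanging :: "preference \<Rightarrow> nat tree \<Rightarrow> nat tree list" where
  "hanging pref \<langle>\<rangle> = [\<langle>\<rangle>]"
| "hanging pref \<langle>l, v, r\<rangle> =
    (case pref v of L \<Rightarrow> hanging pref l @ [r] | R \<Rightarrow> l # hanging pref r)"


section \<open>Belga B-trees\<close>

datatype aux_label =
  AuxLabel (marked: bool) (key_depths: "nat list") (min_depth: nat) (max_depth: nat)

type_synonym atree = "aux_label btree"

definition erase :: "atree \<Rightarrow> unit btree" where
  "erase = map_btree (\<lambda>_. ())"

definition is_link :: "atree \<Rightarrow> bool" where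
  "is_link t \<longleftrightarrow> t = BNil \<or> marked (label t)"

text \<open>\<open>aux_tree t\<close> is the part of \<open>t\<close> in the same auxiliary tree as its root, and \<open>links t\<close> lists
  in key order what hangs off that part (marked nodes with their subtrees, or null pointers).\<close>

fun prune :: "atree \<Rightarrow> atree" where
  "prune BNil = BNil"
| "prune (BNode a ks ts) = (if marked a then BNil else BNode a ks (map prune ts))"

fun aux_tree :: "atree \<Rightarrow> atree" where
  "aux_tree BNil = BNil"
| "aux_tree (BNode a ks ts) = BNode a ks (map prune ts)"

fun hung :: "atree \<Rightarrow> atree list" where
  "hung BNil = [BNil]"
| "hung (BNode a ks ts) = (if marked a then [BNode a ks ts] else concat (map hung ts))"

definition links :: "atree \<Rightarrow> atree list" where
  "links t = concat (map hung (children t))"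

fun aux_trees :: "atree \<Rightarrow> atree set" where
  "aux_trees BNil = {}"
| "aux_trees (BNode a ks ts) =
    (if marked a then {aux_tree (BNode a ks ts)} else {}) \<union> (\<Union>t\<in>set ts. aux_trees t)"

text \<open>\<open>classic B m h t\<close>: the auxiliary tree at the root of \<open>t\<close> is a classic B-tree of height \<open>h\<close>
  with all leaves at the same depth, at least \<open>m\<close> keys in the root and at least \<open>B div 2\<close> children
  (and one key) in every other node.\<close>

inductive classic :: "nat \<Rightarrow> nat \<Rightarrow> nat \<Rightarrow> atree \<Rightarrow> bool" for B :: nat where
  "\<lbrakk>m \<le> length ks; length ks \<le> B - 1; length ts = length ks + 1; \<forall>t\<in>set ts. is_link t\<rbrakk>
   \<Longrightarrow> classic B m 0 (BNode a ks ts)"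
| "\<lbrakk>m \<le> length ks; length ks \<le> B - 1; length ts = length ks + 1;
    \<forall>t\<in>set ts. \<not> is_link t \<and> classic B (max 1 (B div 2 - 1)) h t\<rbrakk>
   \<Longrightarrow> classic B m (Suc h) (BNode a ks ts)"

text \<open>Minimum and maximum depths range over the subtree within the auxiliary tree.\<close>

fun labelled :: "nat tree \<Rightarrow> atree \<Rightarrow> bool" where
  "labelled P BNil = True"
| "labelled P (BNode a ks ts) =
    (key_depths a = map (depth P) ks \<and>
     min_depth a = Min (depth P ` keys (aux_tree (BNode a ks ts))) \<and>
     max_depth a = Max (depth P ` keys (aux_tree (BNode a ks ts))) \<and>
     (\<forall>t\<in>set ts. labelled P t))"

inductive linked :: "nat \<Rightarrow> preference \<Rightarrow> nat tree \<Rightarrow> atree \<Rightarrow> bool"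
  for B :: nat and pref :: preference where
  "linked B pref \<langle>\<rangle> BNil"
| "\<lbrakk>P \<noteq> \<langle>\<rangle>; marked (label T); classic B 1 h T;
    keys_inorder (aux_tree T) = preferred_path pref P;
    list_all2 (linked B pref) (hanging pref P) (links T)\<rbrakk>
   \<Longrightarrow> linked B pref P T"

definition belga_tree :: "nat \<Rightarrow> nat tree \<Rightarrow> preference \<Rightarrow> atree \<Rightarrow> bool" where
  "belga_tree B P pref T \<longleftrightarrow> linked B pref P T \<and> labelled P T"

text \<open>The walk for \<open>x\<close> from the root of \<open>T\<close> stops at the first node \<open>u\<close> that contains \<open>x\<close> or is
  marked (other than the root); \<open>p\<close> is the address of \<open>u\<close>.\<close>

inductive descent :: "nat \<Rightarrow> atree \<Rightarrow> nat list \<Rightarrow> atree \<Rightarrow> bool" for x :: nat where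
  "x \<in> set ks \<Longrightarrow> descent x (BNode a ks ts) [] (BNode a ks ts)"
| "\<lbrakk>x \<notin> set ks; i = length (filter (\<lambda>k. k < x) ks); ts ! i \<noteq> BNil; marked (label (ts ! i))\<rbrakk>
   \<Longrightarrow> descent x (BNode a ks ts) [i] (ts ! i)"
| "\<lbrakk>x \<notin> set ks; i = length (filter (\<lambda>k. k < x) ks); ts ! i \<noteq> BNil; \<not> marked (label (ts ! i));
    descent x (ts ! i) p u\<rbrakk>
   \<Longrightarrow> descent x (BNode a ks ts) (i # p) u"

text \<open>The topmost auxiliary tree \<open>Q\<close> of \<open>T\<close> is cut at depth \<open>e\<close>; the part of depth at most \<open>e\<close> is
  merged with the auxiliary tree \<open>S\<close>, the other part (if any) becomes an auxiliary tree of its own,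
  and all other auxiliary trees stay as they are.\<close>

definition cut_merge :: "nat tree \<Rightarrow> atree \<Rightarrow> nat \<Rightarrow> atree \<Rightarrow> atree \<Rightarrow> bool" where
  "cut_merge P T e S T' \<longleftrightarrow>
     (let Q = aux_tree T;
          low = {k \<in> keys Q. depth P k \<le> e};
          high = {k \<in> keys Q. depth P k > e};
          rest = insert (aux_tree T') (aux_trees T - {Q, S})
      in keys (aux_tree T') = low \<union> keys S \<and>
         (if high = {} then aux_trees T' = rest
          else \<exists>D. keys D = high \<and> aux_trees T' = insert D rest))"

text \<open>A cut and merge performed by \<open>j\<close> operations of the B-tree model, starting with the pointer
  at \<open>p\<close> and ending with it at the root. The constant \<open>K\<close> is the one in the
  $O(1 + \log_B k)$ cost of cutting and merging classic B-trees with \<open>k\<close> keys in total.\<close>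

definition cut_merge_run ::
  "real \<Rightarrow> nat \<Rightarrow> nat tree \<Rightarrow> atree \<Rightarrow> nat list \<Rightarrow> nat \<Rightarrow> atree \<Rightarrow> atree \<Rightarrow> nat \<Rightarrow> bool" where
  "cut_merge_run K B P T p e S T' j \<longleftrightarrow>
     cut_merge P T e S T' \<and>
     (step B ^^ j) (erase T, p) (erase T', []) \<and>
     real j \<le> K * (1 + log (real B) (real (card (keys (aux_tree T)) + card (keys S))))"

text \<open>\<open>belga_search K B P x pref T n T'\<close>: the search for \<open>x\<close> in \<open>T\<close> uses \<open>n\<close> operations and leaves
  \<open>T'\<close>; a walk to address \<open>p\<close> amounts to \<open>length p\<close> moves to a child. In \<open>switch\<close>, \<open>w\<close> is the
  last key of the part of the topmost path that is kept, whose preferred child changes. Since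
  searching for \<open>x\<close> makes the left child of \<open>x\<close> preferred, a search that finds \<open>x\<close> with its right
  child preferred closes with a cut below \<open>x\<close> and a merge with the path \<open>S\<close> of the left child of
  \<open>x\<close>, which is empty if there is no such child.\<close>

inductive belga_search ::
  "real \<Rightarrow> nat \<Rightarrow> nat tree \<Rightarrow> nat \<Rightarrow> preference \<Rightarrow> atree \<Rightarrow> nat \<Rightarrow> atree \<Rightarrow> bool"
  for K :: real and B :: nat and P :: "nat tree" and x :: nat where
  switch:
    "\<lbrakk>descent x T p u; p \<noteq> []; marked (label u); d = min_depth (label u);
      w \<in> keys (aux_tree T); depth P w = d - 1; pref' = pref(w := side_of x w);
      cut_merge_run K B P T p (d - 1) (aux_tree u) T' j; belga_tree B P pref' T';
      belga_search K B P x pref' T' n T''\<rbrakk>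
     \<Longrightarrow> belga_search K B P x pref T (length p + j + n) T''"
| found_left:
    "\<lbrakk>descent x T p u; p = [] \<or> \<not> marked (label u); pref x = L\<rbrakk>
     \<Longrightarrow> belga_search K B P x pref T (length p) T"
| found_right:
    "\<lbrakk>descent x T p u; p = [] \<or> \<not> marked (label u); pref x = R;
      S \<in> insert BNil (aux_trees T);
      keys_inorder S = preferred_path pref (left (subtree_of P x));
      cut_merge_run K B P T p (depth P x) S T' j; belga_tree B P (pref(x := L)) T'\<rbrakk>
     \<Longrightarrow> belga_search K B P x pref T (length p + j) T'"

text \<open>Total cost of a search sequence, starting from a Belga B-tree; each search pays one more unit
  for placing the pointer at the root.\<close>

inductive belga_run ::
  "real \<Rightarrow> nat \<Rightarrow> nat tree \<Rightarrow> preference \<Rightarrow> atree \<Rightarrow> nat list \<Rightarrow> nat \<Rightarrow> bool"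
  for K :: real and B :: nat and P :: "nat tree" where
  "belga_run K B P pref T [] 0"
| "\<lbrakk>belga_search K B P x pref T n T'; belga_tree B P (after_search P x pref) T';
    belga_run K B P (after_search P x pref) T' X m\<rbrakk>
   \<Longrightarrow> belga_run K B P pref T (x # X) (1 + n + m)"

end

theory Submission
  imports Defs
begin

text \<open>
  Existence of runs. Two B-trees on the same keys with at most \<open>n\<close> nodes are transformed into each
  other with \<open>O(n)\<close> operations, because both can be straightened into the same vine. This remains true
  with arbitrary trees hanging from the null pointers, so every cut or merge that opens \<open>n\<close> nodes of
  an auxiliary tree and regroups what is in them costs \<open>O(n)\<close>. Cutting and gluing classic B-trees opens
  nodes only along a root path, and an auxiliary tree has height \<open>O(1 + log\<^sub>B log N)\<close>.

  Competitiveness. A Belga search pays \<open>O(1 + log\<^sub>B log N)\<close> for every preferred child that changes. The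
  number of changes is at most \<open>N + O(log B) \<cdot> OPT\<close>: call a side of a node \<open>v\<close> of the reference tree
  light or heavy according to how deep the keys of that side lie in the current B-tree of the
  optimal algorithm, and take as potential the number of nodes whose preferred side is light. A
  search that touches \<open>j\<close> nodes takes the light side at \<open>O(j log B)\<close> nodes of the reference tree, and an
  operation changes the light side of \<open>O(log B)\<close> nodes. Finally \<open>(1 + log\<^sub>B log N) log B = log B + log log N\<close>
  is \<open>O(log log N)\<close> for \<open>B = (log N)\<^sup>O\<^sup>(\<^sup>1\<^sup>)\<close>.
\<close>


section \<open>Addresses and reversible moves\<close>

text \<open>A bound on runs says nothing unless runs exist, hence the constructive half. There, keys
  move only along one edge at a time and no node may become empty, so a textbook cut or
  concatenation is not a short list of operations. The way out is reversibility: rotations invert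
  rotations, splits and joins invert each other up to pointer moves, so it is enough to bring both
  the given and the desired tree into a normal form. Tightly packed vines resist this, since merging
  two nodes needs spare room nearby; a chunk of two keys supplies it. Marks and depth labels cost
  nothing in the model, so cutting a path off and merging one are the same problem: isolate a
  segment, change the mark of its root, glue it back. In the lower bound the obstacle is ties. In a
  binary tree each node lies on one side of \<open>v\<close>; a B-tree node may hold keys of both
  sides, so depth alone does not tell which side is light. Counting the keys in the common topmost
  node breaks the tie, and the halving of that count is where the factor log B comes from.\<close>

fun valid_address :: "'a btree \<Rightarrow> nat list \<Rightarrow> bool" where
  "valid_address t [] = True"
| "valid_address (BNode a ks ts) (i # p) = (i < length ts \<and> valid_address (ts ! i) p)"
| "valid_address BNil (i # p) = False"

lemma sub_at_put_at_append:
  "valid_address T q \<Longrightarrow> sub_at (put_at T q t) (q @ r) = sub_at t r"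
  by (induction T q rule: valid_address.induct) auto

lemma sub_at_put_at: "valid_address T q \<Longrightarrow> sub_at (put_at T q t) q = t"
  using sub_at_put_at_append[of T q t "[]"] by simp

lemma put_at_put_at_append:
  "valid_address T q \<Longrightarrow> put_at (put_at T q t) (q @ r) s = put_at T q (put_at t r s)"
  by (induction T q rule: valid_address.induct) auto

lemma put_at_put_at: "valid_address T q \<Longrightarrow> put_at (put_at T q t) q s = put_at T q s"
  using put_at_put_at_append[of T q t "[]" s] by simp

lemma valid_address_put_at: "valid_address T q \<Longrightarrow> valid_address (put_at T q t) q"
  by (induction T q rule: valid_address.induct) auto

lemma valid_address_append:
  "valid_address T (q @ r) \<longleftrightarrow> valid_address T q \<and> valid_address (sub_at T q) r"
  by (induction T q rule: valid_address.induct) auto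

lemma sub_at_append: "valid_address T q \<Longrightarrow> sub_at T (q @ r) = sub_at (sub_at T q) r"
  by (induction T q rule: valid_address.induct) auto

section \<open>Reachability with a bound on the cost\<close>

definition reach :: "nat \<Rightarrow> nat \<Rightarrow> config \<Rightarrow> config \<Rightarrow> bool" where
  "reach B j c c' \<longleftrightarrow> (\<exists>i\<le>j. (step B ^^ i) c c')"

lemma reach_refl: "reach B j c c"
  unfolding reach_def by (intro exI[of _ 0]) auto

lemma reach_trans: "reach B i a b \<Longrightarrow> reach B j b c \<Longrightarrow> reach B (i + j) a c"
  unfolding reach_def
proof (elim exE conjE)
  fix k l assume *: "k \<le> i" "l \<le> j" "(step B ^^ k) a b" "(step B ^^ l) b c"
  then have "(step B ^^ (k + l)) a c" unfolding relpowp_add by auto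
  with * show "\<exists>k\<le>i + j. (step B ^^ k) a c" by (intro exI[of _ "k + l"]) auto
qed

lemma reach_mono: "reach B i a b \<Longrightarrow> i \<le> j \<Longrightarrow> reach B j a b"
  unfolding reach_def by (meson le_trans)

lemma reach_step: "step B a b \<Longrightarrow> reach B 1 a b"
  unfolding reach_def by (intro exI[of _ 1]) auto

lemma reach_to_root: "reach B (length p) (t, p) (t, [])"
proof (induction p rule: rev_induct)
  case (snoc x xs)
  have "reach B 1 (t, xs @ [x]) (t, xs)" by (intro reach_step step.move_parent)
  from reach_trans[OF this snoc] show ?case by simp
qed (simp add: reach_refl)

text \<open>Root splits are the only operations that this relation cannot express.\<close>

definition local_equiv ::
  "nat \<Rightarrow> nat \<Rightarrow> unit btree \<Rightarrow> nat list \<Rightarrow> unit btree \<Rightarrow> nat list \<Rightarrow> bool" where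
  "local_equiv B j t p t' p' \<longleftrightarrow> (\<forall>T q. valid_address T q \<longrightarrow>
     reach B j (put_at T q t, q @ p) (put_at T q t', q @ p') \<and>
     reach B j (put_at T q t', q @ p') (put_at T q t, q @ p))"

lemma local_equiv_refl: "local_equiv B j t p t p"
  unfolding local_equiv_def by (simp add: reach_refl)

lemma local_equiv_sym: "local_equiv B j t p t' p' \<Longrightarrow> local_equiv B j t' p' t p"
  unfolding local_equiv_def by blast

lemma local_equiv_trans:
  "local_equiv B i t p t' p' \<Longrightarrow> local_equiv B j t' p' t'' p'' \<Longrightarrow>
   local_equiv B (i + j) t p t'' p''"
  unfolding local_equiv_def
  by (intro allI impI conjI)
     (blast intro: reach_trans, subst add.commute, blast intro: reach_trans)

lemma local_equiv_mono: "local_equiv B i t p t' p' \<Longrightarrow> i \<le> j \<Longrightarrow> local_equiv B j t p t' p'"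
  unfolding local_equiv_def by (meson reach_mono)

text \<open>The definition quantifies over all contexts, so the parent simply becomes part of the
  context: the address \<open>q\<close> is extended by \<open>i\<close>, and no operation has to be
  inspected again.\<close>

lemma local_equiv_child:
  assumes "local_equiv B j s p s' p'" and "i < length ts"
  shows "local_equiv B j (node ks (ts[i := s])) (i # p) (node ks (ts[i := s'])) (i # p')"
  unfolding local_equiv_def
proof (intro allI impI)
  fix T :: "unit btree" and q assume q: "valid_address T q"
  define T' where "T' = put_at T q (node ks ts)"
  have v: "valid_address T' (q @ [i])"
    unfolding T'_def valid_address_append using q assms(2)
    by (simp add: valid_address_put_at sub_at_put_at)
  have e: "put_at T' (q @ [i]) r = put_at T q (node ks (ts[i := r]))" for r
    unfolding T'_def using q by (simp add: put_at_put_at_append)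
  show "reach B j (put_at T q (node ks (ts[i := s])), q @ i # p)
          (put_at T q (node ks (ts[i := s'])), q @ i # p') \<and>
        reach B j (put_at T q (node ks (ts[i := s'])), q @ i # p')
          (put_at T q (node ks (ts[i := s])), q @ i # p)"
    using assms(1)[unfolded local_equiv_def, rule_format, OF v] by (simp add: e)
qed

lemma local_equiv_move:
  assumes "i < length ts" "ts ! i \<noteq> BNil"
  shows "local_equiv B 1 (node ks ts) [] (node ks ts) [i]"
  unfolding local_equiv_def
proof (intro allI impI)
  fix T :: "unit btree" and q assume q: "valid_address T q"
  have "step B (put_at T q (node ks ts), q) (put_at T q (node ks ts), q @ [i])"
    using assms q by (intro step.move_child) (auto simp: sub_at_put_at)
  moreover have "step B (put_at T q (node ks ts), q @ [i]) (put_at T q (node ks ts), q)"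
    by (rule step.move_parent)
  ultimately show "reach B 1 (put_at T q (node ks ts), q @ []) (put_at T q (node ks ts), q @ [i]) \<and>
        reach B 1 (put_at T q (node ks ts), q @ [i]) (put_at T q (node ks ts), q @ [])"
    by (auto intro: reach_step simp del: One_nat_def)
qed

lemma local_equiv_in_child:
  assumes "local_equiv B j s [] s' []" "i < length ts" "ts ! i = s" "s \<noteq> BNil" "s' \<noteq> BNil"
  shows "local_equiv B (j + 2) (node ks ts) [] (node ks (ts[i := s'])) []"
proof -
  have 1: "local_equiv B 1 (node ks ts) [] (node ks ts) [i]"
    using assms by (intro local_equiv_move) auto
  have 2: "local_equiv B j (node ks ts) [i] (node ks (ts[i := s'])) [i]"
    using local_equiv_child[OF assms(1,2), of ks] assms(3) by (metis list_update_id)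
  have 3: "local_equiv B 1 (node ks (ts[i := s'])) [i] (node ks (ts[i := s'])) []"
    using assms by (intro local_equiv_sym[OF local_equiv_move]) auto
  from local_equiv_trans[OF local_equiv_trans[OF 1 2] 3] show ?thesis
    by (simp add: add.commute)
qed

section \<open>Rotations, splits and joins with their inverses\<close>

lemma reach_rotate:
  assumes "valid_address T q" "length ts1 = length as"
    "as @ us @ cs = as' @ us' @ cs'" "distinct (as @ us @ cs)"
    "ts1 @ vs @ ts2 = ts1' @ vs' @ ts2'" "length vs = length us + 1"
    "length ts1' = length as'" "length vs' = length us' + 1" "length ts2' = length cs'"
    "us' \<noteq> []" "as' @ cs' \<noteq> []" "length us' \<le> B - 1" "length (as' @ cs') \<le> B - 1"
  shows "reach B 1 (put_at T q (node (as @ cs) (ts1 @ node us vs # ts2)), q @ [length as])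
           (put_at T q (node (as' @ cs') (ts1' @ node us' vs' # ts2')), q @ [length as'])"
\<comment> \<open>A rotation that changes nothing is not an operation of the model. As the keys are
  distinct, an unchanged interval has an unchanged position, so both configurations are equal and no
  operation is used.\<close>
proof (cases "us' = us")
  case True
  then have "hd us \<in> set us" using assms by auto
  then obtain zs where us: "us = hd us # zs" using True assms(10) by (cases us) auto
  have "as = as'"
  proof -
    have d: "distinct (as @ hd us # zs @ cs)" "as @ hd us # zs @ cs = as' @ hd us # zs @ cs'"
      using assms(3,4) True us by (metis append_Cons)+
    from d(1) have "hd us \<notin> set as" "hd us \<notin> set (zs @ cs)" by simp_all
    from append_Cons_eq_iff[OF this] d(2) show ?thesis by blast
  qed
  with True assms have "cs = cs'" "ts1 = ts1'" "vs = vs'" "ts2 = ts2'" by auto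
  with \<open>as = as'\<close> True show ?thesis by (simp add: reach_refl)
next
  case False
  let ?T = "put_at T q (node (as @ cs) (ts1 @ node us vs # ts2))"
  have "step B (?T, q @ [length ts1])
          (put_at ?T q (node (as' @ cs') (ts1' @ node us' vs' # ts2')), q @ [length ts1'])"
    by (rule step.rotate[where as = as and cs = cs and us = us and vs = vs and ?ts2.0 = ts2])
       (use assms False in \<open>auto simp: sub_at_put_at\<close>)
  then show ?thesis
    using assms by (auto simp: put_at_put_at intro: reach_step simp del: One_nat_def)
qed

lemma local_equiv_rotate:
  assumes "as @ us @ cs = as' @ us' @ cs'" "distinct (as @ us @ cs)"
    "ts1 @ vs @ ts2 = ts1' @ vs' @ ts2'"
    "length ts1 = length as" "length vs = length us + 1" "length ts2 = length cs"
    "us \<noteq> []" "as @ cs \<noteq> []" "length us \<le> B - 1" "length (as @ cs) \<le> B - 1"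
    "length ts1' = length as'" "length vs' = length us' + 1" "length ts2' = length cs'"
    "us' \<noteq> []" "as' @ cs' \<noteq> []" "length us' \<le> B - 1" "length (as' @ cs') \<le> B - 1"
  shows "local_equiv B 1 (node (as @ cs) (ts1 @ node us vs # ts2)) [length as]
           (node (as' @ cs') (ts1' @ node us' vs' # ts2')) [length as']"
  unfolding local_equiv_def
  by (intro allI impI conjI; rule reach_rotate) (use assms in \<open>simp_all\<close>)

text \<open>The inverse is a join, but a split ends with the pointer at the parent while a join
  starts at a child; a move down before the join and one after it make three operations. The parent
  must have a key besides \<open>k\<close>, for otherwise the join would remove it.\<close>

lemma local_equiv_split:
  assumes "length ts1 = length ks1" "length vs1 = length us1 + 1"
    "us1 \<noteq> []" "us2 \<noteq> []" "ks1 @ ks2 \<noteq> []" "length (ks1 @ ks2) < B - 1"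
    "length (us1 @ k # us2) \<le> B - 1"
  shows "local_equiv B 3
           (node (ks1 @ ks2) (ts1 @ node (us1 @ k # us2) (vs1 @ vs2) # ts2)) [length ts1]
           (node (ks1 @ k # ks2) (ts1 @ node us1 vs1 # node us2 vs2 # ts2)) []"
    (is "local_equiv B 3 ?t [?i] ?t' []")
  unfolding local_equiv_def
proof (intro allI impI)
  fix T :: "unit btree" and q assume q: "valid_address T q"
  have "step B (put_at T q ?t, q @ [?i]) (put_at (put_at T q ?t) q ?t', q)"
    by (rule step.split) (use assms q in \<open>auto simp: sub_at_put_at\<close>)
  then have 1: "reach B 1 (put_at T q ?t, q @ [?i]) (put_at T q ?t', q)"
    using q by (simp add: put_at_put_at reach_step del: One_nat_def)
  have "step B (put_at T q ?t', q) (put_at T q ?t', q @ [?i])"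
    using q by (intro step.move_child) (auto simp: sub_at_put_at)
  then have 2: "reach B 1 (put_at T q ?t', q) (put_at T q ?t', q @ [?i])" by (rule reach_step)
  have "step B (put_at T q ?t', q @ [?i]) (put_at (put_at T q ?t') q
          (if ks1 @ ks2 = [] then node (us1 @ k # us2) (vs1 @ vs2) else ?t), q)"
    by (rule step.join[where ?us1.0 = us1 and ?us2.0 = us2])
       (use assms q in \<open>auto simp: sub_at_put_at\<close>)
  then have 3: "reach B 1 (put_at T q ?t', q @ [?i]) (put_at T q ?t, q)"
    using q by (simp only: if_not_P[OF assms(5)] put_at_put_at) (rule reach_step)
  have "step B (put_at T q ?t, q) (put_at T q ?t, q @ [?i])"
    using q by (intro step.move_child) (auto simp: sub_at_put_at)
  then have 4: "reach B 1 (put_at T q ?t, q) (put_at T q ?t, q @ [?i])" by (rule reach_step)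
  show "reach B 3 (put_at T q ?t, q @ [?i]) (put_at T q ?t', q @ []) \<and>
        reach B 3 (put_at T q ?t', q @ []) (put_at T q ?t, q @ [?i])"
    using reach_mono[OF 1, of 3] reach_trans[OF reach_trans[OF 2 3] 4]
    by (simp add: numeral_3_eq_3)
qed

section \<open>Equivalence of whole trees\<close>

definition root_equiv :: "nat \<Rightarrow> nat \<Rightarrow> unit btree \<Rightarrow> unit btree \<Rightarrow> bool" where
  "root_equiv B j t t' \<longleftrightarrow> reach B j (t, []) (t', []) \<and> reach B j (t', []) (t, [])"

lemma local_imp_root_equiv: "local_equiv B j t [] t' [] \<Longrightarrow> root_equiv B j t t'"
  unfolding local_equiv_def root_equiv_def
  by (metis append_Nil put_at.simps(1) valid_address.simps(1))

lemma root_equiv_refl: "root_equiv B j t t"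
  unfolding root_equiv_def by (simp add: reach_refl)

lemma root_equiv_sym: "root_equiv B j t t' \<Longrightarrow> root_equiv B j t' t"
  unfolding root_equiv_def by blast

lemma root_equiv_trans:
  "root_equiv B i t t' \<Longrightarrow> root_equiv B j t' t'' \<Longrightarrow> root_equiv B (i + j) t t''"
  unfolding root_equiv_def using reach_trans[of B i _ _ j] reach_trans[of B j _ _ i]
  by (auto simp: add.commute)

lemma root_equiv_mono: "root_equiv B i t t' \<Longrightarrow> i \<le> j \<Longrightarrow> root_equiv B j t t'"
  unfolding root_equiv_def by (meson reach_mono)

text \<open>The inverse is the join that empties the parent, preceded by a move to the left
  child.\<close>

lemma root_equiv_split:
  assumes "length vs1 = length us1 + 1" "us1 \<noteq> []" "us2 \<noteq> []" "length (us1 @ k # us2) \<le> B - 1"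
  shows "root_equiv B 2 (node (us1 @ k # us2) (vs1 @ vs2)) (node [k] [node us1 vs1, node us2 vs2])"
    (is "root_equiv B 2 ?t ?t'")
proof -
  have "step B (?t, []) (?t', [])" by (rule step.split_root) (use assms in auto)
  then have 1: "reach B 1 (?t, []) (?t', [])" by (rule reach_step)
  have "step B (?t', []) (?t', [] @ [0])" by (rule step.move_child) auto
  then have 2: "reach B 1 (?t', []) (?t', [] @ [0])" by (rule reach_step)
  have "step B (?t', [] @ [0]) (put_at ?t' [] (if [] @ [] = ([]::nat list) then ?t
        else node ([] @ []) ([] @ ?t # [])), [])"
    by (rule step.join[where ?us1.0 = us1 and ?us2.0 = us2 and ?ts1.0 = "[]" and ?ks1.0 = "[]"])
       (use assms in auto)
  then have 3: "reach B 1 (?t', [] @ [0]) (?t, [])" by (auto intro: reach_step simp del: One_nat_def)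
  show ?thesis unfolding root_equiv_def using reach_mono[OF 1, of 2] reach_trans[OF 2 3]
    by (simp add: numeral_2_eq_2)
qed


section \<open>Straightening a tree into a vine\<close>

text \<open>Rotation, split and join can each be seen as dissolving children into the parent and
  regrouping, so every claim that the key order is preserved comes down to this identity.\<close>

lemma weave_flatten:
  assumes "length xs1 = length as" "length vs = length us + 1" "length xs2 = length cs"
  shows "weave (xs1 @ weave vs us # xs2) (as @ cs) = weave (xs1 @ vs @ xs2) (as @ us @ cs)"
  using assms
proof (induction xs1 as rule: list_induct2)
  case Nil
  then show ?case
  proof (induction us arbitrary: vs)
    case Nil
    then show ?case by (cases vs; cases cs; cases xs2) auto
  next
    case (Cons u us)
    then obtain v vs' where vs: "vs = v # vs'" "length vs' = length us + 1" by (cases vs) auto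
    from Cons.IH[OF vs(2) Cons.prems(2)] show ?case
      by (cases cs; cases xs2) (auto simp: vs(1))
  qed
qed auto

lemma weave_replicate_Nil:
  "weave (replicate (length ks) [] @ [x]) ks = ks @ x"
  by (induction ks) auto

lemma keys_inorder_flatten:
  assumes "length ts1 = length as" "length vs = length us + 1" "length ts2 = length cs"
  shows "keys_inorder (BNode a (as @ cs) (ts1 @ BNode b us vs # ts2)) =
    weave (map keys_inorder (ts1 @ vs @ ts2)) (as @ us @ cs)"
  using weave_flatten[of "map keys_inorder ts1" as "map keys_inorder vs" us
      "map keys_inorder ts2" cs] assms
  by simp

fun nnodes :: "'a btree \<Rightarrow> nat" where
  "nnodes BNil = 0"
| "nnodes (BNode a ks ts) = Suc (sum_list (map nnodes ts))"

text \<open>The length of the rightmost path; straightening is complete when this path contains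
  every node.\<close>

fun spine :: "'a btree \<Rightarrow> nat" where
  "spine BNil = 0"
| "spine (BNode a ks ts) = Suc (last (0 # map spine ts))"

lemma spine_le_nnodes: "spine t \<le> nnodes t"
proof (induction t)
  case (BNode a ks ts)
  show ?case
  proof (cases "ts = []")
    case False
    then have "last (map spine ts) \<le> nnodes (last ts)" using BNode by (simp add: last_map)
    also have "nnodes (last ts) \<le> sum_list (map nnodes ts)"
      using False by (intro member_le_sum_list) auto
    finally show ?thesis using False by (simp add: last_map)
  qed simp
qed simp

fun vine :: "nat list list \<Rightarrow> unit btree" where
  "vine [] = BNil"
| "vine (ks # kss) = node ks (replicate (length ks) BNil @ [vine kss])"

definition chunks_ok :: "nat \<Rightarrow> nat list list \<Rightarrow> bool" where
  "chunks_ok B kss \<longleftrightarrow> (\<forall>ks\<in>set kss. ks \<noteq> [] \<and> length ks \<le> B - 1)"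

lemma chunks_ok_simps [simp]:
  "chunks_ok B []"
  "chunks_ok B (ks # kss) \<longleftrightarrow> ks \<noteq> [] \<and> length ks \<le> B - 1 \<and> chunks_ok B kss"
  by (auto simp: chunks_ok_def)

lemma node_sizes_okE:
  assumes "node_sizes_ok B t" "t \<noteq> BNil"
  obtains a ks ts where "t = BNode a ks ts" "ks \<noteq> []" "length ks \<le> B - 1" "length ts = length ks + 1"
    "\<And>t. t \<in> set ts \<Longrightarrow> node_sizes_ok B t"
  using assms by (cases t) (auto simp: Suc_le_length_iff)

lemma vine_move:
  assumes "kss \<noteq> []"
  shows "local_equiv B 1 (vine (ks # kss)) [] (vine (ks # kss)) [length ks]"
  unfolding vine.simps
  by (rule local_equiv_move) (use assms in \<open>auto simp: nth_append neq_Nil_conv\<close>)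

lemma vine_in_child:
  assumes "local_equiv B j (vine kss) [] (vine kss') []" "kss \<noteq> []" "kss' \<noteq> []"
  shows "local_equiv B (j + 2) (vine (ks # kss)) [] (vine (ks # kss')) []"
proof -
  have "local_equiv B (j + 2) (node ks (replicate (length ks) BNil @ [vine kss])) []
          (node ks ((replicate (length ks) BNil @ [vine kss])[length ks := vine kss'])) []"
    by (rule local_equiv_in_child[OF assms(1)])
       (use assms(2,3) in \<open>auto simp: nth_append neq_Nil_conv\<close>)
  then show ?thesis by (simp add: list_update_append)
qed

text \<open>A rotation on the edge to a non-null child that is not the last can hand the smallest
  keys of the union to the parent and make the child the last one, so the rightmost path gains a
  node. Such a rotation costs 3 with its moves, and passing a finished node costs 2. The bound
  charges 5 for a node off the spine (3 to bring it there, 2 to pass it) and 2 for one on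
  it.\<close>

lemma local_equiv_vine:
  fixes t :: "unit btree"
  assumes "node_sizes_ok B t" "distinct (keys_inorder t)" "t \<noteq> BNil"
  shows "\<exists>kss. local_equiv B (5 * (nnodes t - spine t) + 2 * spine t) t [] (vine kss) [] \<and>
    concat kss = keys_inorder t \<and> length kss = nnodes t \<and> chunks_ok B kss"
  using assms
\<comment> \<open>This measure drops by one in both cases: a rotation lengthens the spine by a node,
  and passing to the last child removes one node, which lies on the spine.\<close>
proof (induction "2 * nnodes t - spine t" arbitrary: t rule: less_induct)
  case less
  obtain ks ts where t: "t = node ks ts" and ks: "ks \<noteq> []" "length ks \<le> B - 1"
    and len: "length ts = length ks + 1" and ok: "\<And>t. t \<in> set ts \<Longrightarrow> node_sizes_ok B t"
    using node_sizes_okE[OF less.prems(1,3)] by (metis (full_types) old.unit.exhaust)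
  have last_ts: "ts \<noteq> []" using len by auto
  have spine_t: "spine t = Suc (spine (last ts))"
    using last_ts by (simp add: t last_map)
  show ?case
  proof (cases "\<exists>i<length ks. ts ! i \<noteq> BNil")
    case True
    then obtain i where i: "i < length ks" "ts ! i \<noteq> BNil" by blast
    have "node_sizes_ok B (ts ! i)" using ok i len by auto
    then obtain us vs where u: "ts ! i = node us vs" and us: "us \<noteq> []" "length us \<le> B - 1"
      and vs: "length vs = length us + 1" and okv: "\<And>t. t \<in> set vs \<Longrightarrow> node_sizes_ok B t"
      using node_sizes_okE[OF _ i(2)] by (metis (full_types) old.unit.exhaust)
    define ts1 ts2 where "ts1 = take i ts" and "ts2 = drop (Suc i) ts"
    define as cs where "as = take i ks" and "cs = drop i ks"
    have ts: "ts = ts1 @ node us vs # ts2"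
      unfolding ts1_def ts2_def using i len u by (metis id_take_nth_drop less_SucI Suc_eq_plus1)
    have ks_eq: "ks = as @ cs" unfolding as_def cs_def by simp
    have lens: "length ts1 = length as" "length ts2 = length cs" "cs \<noteq> []" "length as = i"
      unfolding ts1_def ts2_def as_def cs_def using i len by auto
    define W where "W = as @ us @ cs"
    define C where "C = ts1 @ vs @ ts2"
    have lW: "length W = length ks + length us" unfolding W_def ks_eq by simp
    have lC: "length C = length ks + length us + 1" unfolding C_def ks_eq using lens vs by simp
    \<comment> \<open>Parent and child keep their numbers of keys, so neither can overflow; the
      child takes the largest keys and becomes the last child.\<close>
    define t1 where "t1 = node (take (length ks) W) (take (length ks) C @
      [node (drop (length ks) W) (drop (length ks) C)])"
    have inorder: "keys_inorder t = weave (map keys_inorder C) W"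
      unfolding t ts ks_eq C_def W_def by (rule keys_inorder_flatten) (use lens vs in auto)
    have inorder1: "keys_inorder t1 = weave (map keys_inorder C) W"
      unfolding t1_def
      using keys_inorder_flatten[of "take (length ks) C" "take (length ks) W"
          "drop (length ks) C" "drop (length ks) W" "[]" "[]"] lW lC
      by simp
    have dist: "distinct W"
    proof -
      have "distinct ys" if "distinct (weave xss ys)" "length xss = length ys + 1"
        for ys :: "nat list" and xss
        using that
      proof (induction xss ys rule: weave.induct)
        case (1 xs xss k ks)
        moreover have "set ks \<subseteq> set (weave xss ks)" if "length xss = length ks + 1"
          for ks :: "nat list" and xss
          using that by (induction xss ks rule: weave.induct) auto
        ultimately show ?case by auto
      qed auto
      then show ?thesis using less.prems(2) inorder lW lC by simp
    qed
    have "W \<noteq> []" unfolding W_def using us by simp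
    have eq: "local_equiv B 1 (node (as @ cs) (ts1 @ node us vs # ts2)) [length as]
       (node (take (length ks) W @ []) (take (length ks) C @
          node (drop (length ks) W) (drop (length ks) C) # [])) [length (take (length ks) W)]"
      by (rule local_equiv_rotate) (use lens dist lW lC us ks vs ks_eq \<open>W \<noteq> []\<close> in \<open>simp_all flip: W_def C_def\<close>)
    have mv: "local_equiv B 1 t [] t [length as]"
      unfolding t using i lens len by (intro local_equiv_move) auto
    have mv1: "local_equiv B 1 t1 [length (take (length ks) W)] t1 []"
      unfolding t1_def using lW lC
      by (intro local_equiv_sym[OF local_equiv_move]) (auto simp: nth_append)
    have step: "local_equiv B 3 t [] t1 []"
      using local_equiv_trans[OF local_equiv_trans[OF mv, of 1] mv1] eq
      unfolding t1_def t ts ks_eq by (simp add: numeral_3_eq_3)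
    have nn: "nnodes t1 = nnodes t"
    proof -
      have "sum_list (map nnodes C) =
        sum_list (map nnodes (take (length ks) C)) + sum_list (map nnodes (drop (length ks) C))"
        by (metis append_take_drop_id map_append sum_list_append)
      then show ?thesis unfolding t1_def t ts by (simp add: C_def)
    qed
    have "last C = last ts" using lens unfolding C_def ts by (auto simp: last_append)
    then have sp: "spine t1 = Suc (spine t)"
      unfolding t1_def spine_t using lC by (simp add: last_map)
    have le: "spine t1 \<le> nnodes t1" by (rule spine_le_nnodes)
    have ok1: "node_sizes_ok B t1"
    proof -
      have "\<forall>x\<in>set C. node_sizes_ok B x" unfolding C_def using ok okv ts by auto
      then show ?thesis unfolding t1_def using lW lC ks us
        by (auto dest: in_set_takeD in_set_dropD simp: Suc_le_length_iff Suc_le_eq)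
    qed
    have lt: "2 * nnodes t1 - spine t1 < 2 * nnodes t - spine t" using nn sp le by linarith
    have "distinct (keys_inorder t1)" "t1 \<noteq> BNil"
      using less.prems(2) inorder inorder1 by (auto simp: t1_def)
    from less.hyps[OF lt ok1 this]
    obtain kss where kss: "local_equiv B (5 * (nnodes t1 - spine t1) + 2 * spine t1) t1 [] (vine kss) []"
      "concat kss = keys_inorder t1" "length kss = nnodes t1" "chunks_ok B kss"
      by blast
    have "local_equiv B (5 * (nnodes t - spine t) + 2 * spine t) t [] (vine kss) []"
      by (rule local_equiv_mono[OF local_equiv_trans[OF step kss(1)]]) (use nn sp le in linarith)
    then show ?thesis using kss nn inorder inorder1 by auto
  next
    case False
    \<comment> \<open>This node already has the form of a vine node; what remains to be done lies in
      its last child.\<close>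
    have ts: "ts = replicate (length ks) BNil @ [last ts]"
    proof (rule nth_equalityI)
      show "length ts = length (replicate (length ks) BNil @ [last ts])" using len by simp
      fix i assume "i < length ts"
      then show "ts ! i = (replicate (length ks) BNil @ [last ts]) ! i"
        using False len last_ts by (cases "i < length ks") (auto simp: nth_append last_conv_nth less_Suc_eq)
    qed
    have sum0: "sum_list (map nnodes (replicate n BNil)) = 0" for n by (induction n) auto
    have nn: "nnodes t = Suc (nnodes (last ts))"
      unfolding t by (subst ts) (simp add: sum0 del: map_replicate)
    have inorder: "keys_inorder t = ks @ keys_inorder (last ts)"
      unfolding t by (subst ts) (simp add: weave_replicate_Nil)
    show ?thesis
    proof (cases "last ts = BNil")
      case True
      then have "t = vine [ks]" unfolding t using ts by simp
      moreover have "chunks_ok B [ks]" using ks by simp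
      moreover have "concat [ks] = keys_inorder t" "length [ks] = nnodes t"
        using inorder nn True by auto
      ultimately show ?thesis using local_equiv_refl by metis
    next
      case False
      have okl: "node_sizes_ok B (last ts)" using ok last_ts by simp
      have le: "spine (last ts) \<le> nnodes (last ts)" by (rule spine_le_nnodes)
      have lt: "2 * nnodes (last ts) - spine (last ts) < 2 * nnodes t - spine t"
        using nn spine_t le by linarith
      have "distinct (keys_inorder (last ts))" using less.prems(2) inorder by simp
      from less.hyps[OF lt okl this False]
      obtain kss where kss: "local_equiv B (5 * (nnodes (last ts) - spine (last ts)) + 2 * spine (last ts))
           (last ts) [] (vine kss) []"
        "concat kss = keys_inorder (last ts)" "length kss = nnodes (last ts)" "chunks_ok B kss"
        by blast
      have "kss \<noteq> []" using kss(3) False by (cases "last ts") auto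
      then have nv: "vine kss \<noteq> BNil" by (cases kss) auto
      have "local_equiv B (5 * (nnodes (last ts) - spine (last ts)) + 2 * spine (last ts) + 2)
         (node ks ts) [] (node ks (ts[length ks := vine kss])) []"
        by (rule local_equiv_in_child[OF kss(1)])
           (use False nv len last_ts in \<open>auto simp: last_conv_nth\<close>)
      moreover have "node ks (ts[length ks := vine kss]) = vine (ks # kss)"
        by (subst ts) (simp add: list_update_append)
      ultimately have "local_equiv B (5 * (nnodes t - spine t) + 2 * spine t) t [] (vine (ks # kss)) []"
        using nn spine_t t by simp
      moreover have "chunks_ok B (ks # kss)" using kss ks by simp
      moreover have "concat (ks # kss) = keys_inorder t" "length (ks # kss) = nnodes t"
        using kss inorder nn by auto
      ultimately show ?thesis by blast
    qed
  qed
qed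

section \<open>Regrouping the keys of a vine\<close>

text \<open>Three operations: a move down, one rotation, a move up. The number of nodes is
  unchanged, so this alone can never shorten a vine.\<close>

lemma vine_redistribute:
  assumes "xs @ ys = xs' @ ys'" "distinct (xs @ ys)"
    "chunks_ok B [xs, ys]" "chunks_ok B [xs', ys']"
  shows "local_equiv B 3 (vine (xs # ys # r)) [] (vine (xs' # ys' # r)) []"
proof -
  have l: "length xs + length ys = length xs' + length ys'"
    using assms(1) by (metis length_append)
  note mv = vine_move[of "ys # r" B xs] local_equiv_sym[OF vine_move[of "ys' # r" B xs']]
  have "local_equiv B 1
    (node (xs @ []) (replicate (length xs) BNil @ node ys (replicate (length ys) BNil @ [vine r]) # []))
      [length xs]
    (node (xs' @ []) (replicate (length xs') BNil @ node ys' (replicate (length ys') BNil @ [vine r]) # []))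
      [length xs']"
    by (rule local_equiv_rotate) (use assms l in \<open>auto simp: replicate_add[symmetric]
        simp flip: append_assoc\<close>)
  then have "local_equiv B 1 (vine (xs # ys # r)) [length xs] (vine (xs' # ys' # r)) [length xs']"
    by simp
  from local_equiv_trans[OF local_equiv_trans[OF mv(1)[OF list.distinct(2)] this] mv(2)[OF list.distinct(2)]] show ?thesis
    by (simp add: numeral_3_eq_3)
qed

text \<open>Read backwards, this is how a vine loses a node. A split sends \<open>y\<close> up and
  leaves \<open>z\<close> in a left child, off the vine; a rotation of the parent with that child
  puts it back in line. The count is 3 for the reversible split, 1 for the rotation and 3 for
  moves.\<close>

lemma vine_split_chunk:
  assumes "us \<noteq> []" "rest \<noteq> []" "length us + 2 \<le> B" "length rest + 3 \<le> B" "z \<notin> set us" "y \<noteq> z"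
    "distinct us" "y \<notin> set us"
  shows "local_equiv B 7 (vine (us # (z # y # rest) # r)) [] (vine ((us @ [z]) # [y] # rest # r)) []"
proof -
  let ?R = "replicate"
  let ?Z = "node (z # y # rest) (?R (length (z # y # rest)) BNil @ [vine r])"
  let ?t1 = "node (us @ [y]) (?R (length us) BNil @ node [z] [BNil, BNil] #
     node rest (?R (length rest) BNil @ [vine r]) # [])"
  have 1: "local_equiv B 1 (vine (us # (z # y # rest) # r)) [] (vine (us # (z # y # rest) # r)) [length us]"
    by (rule vine_move) simp
  have "local_equiv B 3 (node (us @ []) (?R (length us) BNil @ node ([z] @ y # rest)
      ([BNil, BNil] @ (?R (length rest) BNil @ [vine r])) # [])) [length (?R (length us) (BNil :: unit btree))]
      (node (us @ y # []) (?R (length us) BNil @ node [z] [BNil, BNil] #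
        node rest (?R (length rest) BNil @ [vine r]) # [])) []"
    by (rule local_equiv_split) (use assms in auto)
  then have 2: "local_equiv B 3 (vine (us # (z # y # rest) # r)) [length us] ?t1 []"
    by simp
  have 3: "local_equiv B 1 ?t1 [] ?t1 [length us]"
    by (intro local_equiv_move) (auto simp: nth_append)
  have "local_equiv B 1 (node (us @ [y]) (?R (length us) BNil @ node [z] [BNil, BNil] #
     [node rest (?R (length rest) BNil @ [vine r])])) [length us]
     (node ((us @ [z]) @ []) (?R (length (us @ [z])) BNil @ node [y]
       [BNil, node rest (?R (length rest) BNil @ [vine r])] # [])) [length (us @ [z])]"
    by (rule local_equiv_rotate) (use assms in \<open>auto simp: replicate_append_same[symmetric]\<close>)
  then have 4: "local_equiv B 1 ?t1 [length us] (vine ((us @ [z]) # [y] # rest # r)) [length (us @ [z])]"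
    by simp
  have 5: "local_equiv B 1 (vine ((us @ [z]) # [y] # rest # r)) [length (us @ [z])]
     (vine ((us @ [z]) # [y] # rest # r)) []"
    by (rule local_equiv_sym[OF vine_move]) simp
  from local_equiv_trans[OF local_equiv_trans[OF local_equiv_trans[OF local_equiv_trans[OF 1 2] 3] 4] 5]
  show ?thesis by simp
qed

text \<open>The topmost chunk has no parent to take its middle key: the split creates a root, at
  reversible cost 2, and a rotation with its left child straightens the result, at cost 3.\<close>

lemma vine_split_root:
  assumes "as \<noteq> []" "cs \<noteq> []" "length as + length cs + 2 \<le> B" "distinct (as @ [k])"
  shows "root_equiv B 5 (vine ((as @ k # cs) # r)) (vine (as # [k] # cs # r))"
proof -
  let ?R = "replicate"
  let ?C = "node cs (?R (length cs) BNil @ [vine r])"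
  let ?t1 = "node [k] [node as (?R (length as + 1) BNil), ?C]"
  have "root_equiv B 2 (node (as @ k # cs) (?R (length as + 1) BNil @ (?R (length cs) BNil @ [vine r]))) ?t1"
    by (rule root_equiv_split) (use assms in auto)
  moreover have "?R (length (as @ k # cs)) (BNil :: unit btree) = ?R (length as + 1) BNil @ ?R (length cs) BNil"
    by (simp flip: replicate_add)
  ultimately have 1: "root_equiv B 2 (vine ((as @ k # cs) # r)) ?t1"
    by (simp only: vine.simps append_assoc)
  have 2: "local_equiv B 1 ?t1 [] ?t1 [0]"
    by (intro local_equiv_move) auto
  have "local_equiv B 1 (node ([] @ [k]) ([] @ node as (?R (length as + 1) BNil) # [?C])) [length ([] :: nat list)]
     (node (as @ []) (?R (length as) BNil @ node [k] [BNil, ?C] # [])) [length as]"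
    by (rule local_equiv_rotate) (use assms in \<open>auto simp flip: replicate_append_same\<close>)
  then have 3: "local_equiv B 1 ?t1 [0] (vine (as # [k] # cs # r)) [length as]" by simp
  have 4: "local_equiv B 1 (vine (as # [k] # cs # r)) [length as] (vine (as # [k] # cs # r)) []"
    by (rule local_equiv_sym[OF vine_move]) simp
  from root_equiv_trans[OF 1 local_imp_root_equiv[OF local_equiv_trans[OF local_equiv_trans[OF 2 3] 4]]]
  show ?thesis by simp
qed


text \<open>A normal form that depends only on the keys and on \<open>f\<close>, so that all trees
  with the same keys meet in it. Its last part, with fewer than \<open>f + 2\<close> keys, is the
  two-key buffer of \<open>vine_canon\<close> and whatever remains behind it. The case
  \<open>f = 0\<close> is caught for the sake of termination.\<close>

function canon :: "nat \<Rightarrow> nat list \<Rightarrow> nat list list" where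
  "canon f ks = (if f = 0 \<or> length ks < f + 2
     then (if length ks \<le> 2 then [ks] else [take 2 ks, drop 2 ks])
     else take f ks # canon f (drop f ks))"
  by auto
termination by (relation "measure (length \<circ> snd)") auto

declare canon.simps [simp del]

lemma canon_step: "f > 0 \<Longrightarrow> length xs = f \<Longrightarrow> length ys \<ge> 2 \<Longrightarrow> canon f (xs @ ys) = xs # canon f ys"
  by (subst canon.simps) simp

lemma canon_not_Nil: "canon f ks \<noteq> []"
  by (subst canon.simps) simp

lemma split_list_at: "n \<le> length xs \<Longrightarrow> \<exists>ys zs. xs = ys @ zs \<and> length ys = n \<and> length zs = length xs - n"
  by (intro exI[of _ "take n xs"] exI[of _ "drop n xs"]) auto

text \<open>A chunk of two keys is kept just above the part of the vine that is still to be processed: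
  it is the slack that makes every merge of two small chunks possible.\<close>

lemma vine_canon:
  assumes "4 \<le> B" "chunks_ok B (b # r)" "length b = 2" "distinct (concat (b # r))"
  shows "local_equiv B (20 * length r) (vine (b # r)) [] (vine (canon (B - 1) (concat (b # r)))) []"
  using assms(2-4)
proof (induction "length r" arbitrary: b r rule: less_induct)
  case less
  define f where "f = B - 1"
  have f: "f \<ge> 3" using assms(1) by (simp add: f_def)
  note chunks = less.prems(1)[folded f_def]
  \<comment> \<open>A full chunk behind the buffer lets the buffer slide past it: the first
    \<open>f\<close> keys of the two form a finished chunk, the last two the new buffer.\<close>
  have full: "local_equiv B (20 * length r' + 5) (vine (b # x # r')) []
      (vine (canon f (concat (b # x # r')))) []"
    if len: "length r' < length r" and x: "length x = f" and ok: "chunks_ok B (b # x # r')"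
      and d: "distinct (concat (b # x # r'))" and b: "length b = 2" for b x r'
  proof -
    obtain x' b' where xb: "b @ x = x' @ b'" "length x' = f" "length b' = 2"
      using split_list_at[of f "b @ x"] x b by auto
    from d have "distinct ((b @ x) @ concat r')" by simp
    then have dxb: "distinct (b @ x)" by (simp only: distinct_append)
    have 1: "local_equiv B 3 (vine (b # x # r')) [] (vine (x' # b' # r')) []"
    proof (rule vine_redistribute[OF xb(1) dxb])
      show "chunks_ok B [b, x]" using ok by simp
      show "chunks_ok B [x', b']" using xb f by (auto simp: f_def)
    qed
    have d': "distinct (concat (b' # r'))" using d xb(1)
      by (metis append_assoc concat.simps(2) distinct_append)
    have 2: "local_equiv B (20 * length r') (vine (b' # r')) [] (vine (canon f (concat (b' # r')))) []"
      unfolding f_def by (rule less.hyps) (use len xb ok d' f in \<open>auto simp: f_def\<close>)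
    have 3: "canon f (concat (b # x # r')) = x' # canon f (concat (b' # r'))"
      using canon_step[of f x' "b' @ concat r'"] xb f
      by (metis append_assoc concat.simps(2) length_append le_add1 less_le_trans zero_less_numeral)
    have 4: "local_equiv B (20 * length r' + 2) (vine (x' # b' # r')) []
       (vine (x' # canon f (concat (b' # r')))) []"
      by (rule vine_in_child[OF 2]) (auto simp: canon_not_Nil)
    show ?thesis using local_equiv_trans[OF 1 4] unfolding 3 by (simp add: add.commute)
  qed
  show ?case
  proof (cases r)
    case Nil
    have "canon (B - 1) b = [b]"
      by (subst canon.simps) (use assms(1) less.prems in auto)
    with Nil show ?thesis by (simp add: local_equiv_refl del: vine.simps)
  next
    case (Cons x r1)
    show ?thesis
    proof (cases "length x = f")
      case True
      have "local_equiv B (20 * length r1 + 5) (vine (b # x # r1)) []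
          (vine (canon f (concat (b # x # r1)))) []"
        by (rule full) (use True Cons less.prems in auto)
      then show ?thesis unfolding f_def Cons by (rule local_equiv_mono) simp
    next
      case False
      then have xf: "length x < f" using less.prems Cons by (auto simp: f_def)
      show ?thesis
      proof (cases r1)
        case Nil
        have "canon f (b @ x) = [b, x]"
          using less.prems xf Cons by (subst canon.simps) (auto simp: Suc_le_eq)
        then show ?thesis unfolding f_def[symmetric] by (simp add: Cons Nil local_equiv_refl)
      next
        case (Cons y r2)
        note r = \<open>r = x # r1\<close>[unfolded Cons]
        have ne: "x \<noteq> []" "y \<noteq> []" "length x \<le> f" "length y \<le> f" "b \<noteq> []" "chunks_ok B r2"
          using less.prems r by (auto simp: f_def)
        have d: "distinct (b @ x @ y)" "distinct (x @ y)" using less.prems r by auto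
        show ?thesis
        proof (cases "length x + length y > f")
          case True
          \<comment> \<open>The keys do not fit into one node. Filling the first of the two chunks
            reduces this to the case of a full chunk.\<close>
          obtain x' y' where xy: "x @ y = x' @ y'" "length x' = f"
            using split_list_at[of f "x @ y"] True by auto
          then have y': "length y' = length x + length y - f"
            by (metis add_diff_cancel_left' length_append)
          have "local_equiv B 3 (vine (x # y # r2)) [] (vine (x' # y' # r2)) []"
            by (rule vine_redistribute)
               (use xy y' d ne f True in \<open>auto simp: f_def simp del: diff_is_0_eq\<close>)
          from vine_in_child[OF this, of b]
          have 1: "local_equiv B 5 (vine (b # r)) [] (vine (b # x' # y' # r2)) []"
            by (simp add: r)
          have c: "concat (b # x' # y' # r2) = concat (b # r)"
            using xy by (simp add: r)
          have 2: "local_equiv B (20 * length (y' # r2) + 5) (vine (b # x' # y' # r2)) []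
            (vine (canon f (concat (b # x' # y' # r2)))) []"
          proof (rule full)
            show "chunks_ok B (b # x' # y' # r2)"
              using xy y' ne f True less.prems by (auto simp: f_def)
            show "distinct (concat (b # x' # y' # r2))" unfolding c using less.prems by simp
          qed (use xy less.prems r in auto)
          show ?thesis unfolding f_def[symmetric]
            by (rule local_equiv_mono[OF local_equiv_trans[OF 1 2[unfolded c]]]) (simp add: r)
        next
          case False
          \<comment> \<open>The two chunks fit into one node. Fusing them is
            \<open>vine_split_chunk\<close> backwards, for which the buffer takes in one key for a
            moment and then returns to its size.\<close>
          have "local_equiv B 15 (vine (b # x # y # r2)) [] (vine (b # (x @ y) # r2)) []"
          proof (cases "length x + length y = 2")
            case True
            \<comment> \<open>With only two keys there is nothing left for a third part; instead the
              buffer itself is taken apart, into one key and a chunk of three.\<close>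
            then have "length x = 1" "length y = 1" using ne by (cases x; cases y; auto)+
            then obtain p q where pq: "x = [p]" "y = [q]" by (auto simp: length_Suc_conv)
            obtain b1 b2 where b: "b = [b1, b2]"
              using less.prems(2) by (auto simp: length_Suc_conv numeral_2_eq_2)
            have 1: "local_equiv B 7 (vine ([b1] # (b2 # p # [q]) # r2)) []
              (vine (([b1] @ [b2]) # [p] # [q] # r2)) []"
              by (rule vine_split_chunk) (use assms(1) d b pq in auto)
            have 2: "local_equiv B 3 (vine ([b1] # [b2, p, q] # r2)) []
              (vine ([b1, b2] # [p, q] # r2)) []"
              by (rule vine_redistribute) (use assms(1) d b pq in auto)
            from local_equiv_trans[OF local_equiv_sym[OF 1] 2]
            have "local_equiv B 10 (vine (b # x # y # r2)) [] (vine (b # (x @ y) # r2)) []"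
              by (simp add: b pq)
            then show ?thesis by (rule local_equiv_mono) simp
          next
            case F: False
            have "length x + length y \<noteq> 0" "length x + length y \<noteq> 1"
              using ne by (cases x; cases y; auto)+
            with F have ge: "length x + length y \<ge> 3" by linarith
            obtain xa c where xy: "x @ y = xa @ c" "length xa = 2"
              using split_list_at[of 2 "x @ y"] ge by auto
            then have c: "length c = length x + length y - 2"
              by (metis add_diff_cancel_left' length_append)
            obtain p q where pq: "xa = [p, q]"
              using xy(2) by (auto simp: length_Suc_conv numeral_2_eq_2)
            have cne: "c \<noteq> []" using c ge by auto
            have dd: "distinct (b @ [p, q] @ c)" using d(1) xy(1) pq by simp
            have "local_equiv B 3 (vine (x # y # r2)) [] (vine ([p, q] # c # r2)) []"
              by (rule vine_redistribute)
                 (use xy pq d ne c ge f False cne in \<open>auto simp: f_def\<close>)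
            from vine_in_child[OF this, of b]
            have 1: "local_equiv B 5 (vine (b # x # y # r2)) [] (vine (b # [p, q] # c # r2)) []"
              by simp
            have 2: "local_equiv B 3 (vine (b # [p, q] # c # r2)) [] (vine ((b @ [p]) # [q] # c # r2)) []"
              by (rule vine_redistribute) (use dd ne less.prems assms(1) in auto)
            have 3: "local_equiv B 7 (vine (b # (p # q # c) # r2)) [] (vine ((b @ [p]) # [q] # c # r2)) []"
              by (rule vine_split_chunk) (use dd ne less.prems assms(1) c False cne ge in \<open>auto simp: f_def\<close>)
            from local_equiv_trans[OF local_equiv_trans[OF 1 2] local_equiv_sym[OF 3]]
            show ?thesis by (simp add: xy pq)
          qed
          note 1 = this
          have 2: "local_equiv B (20 * length ((x @ y) # r2)) (vine (b # (x @ y) # r2)) []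
            (vine (canon f (concat (b # (x @ y) # r2)))) []"
            unfolding f_def
            by (rule less.hyps) (use less.prems r ne False in \<open>auto simp: f_def\<close>)
          show ?thesis unfolding f_def[symmetric]
            using local_equiv_mono[OF local_equiv_trans[OF 1 2], of "20 * length r"]
            by (simp add: r)
        qed
      qed
    qed
  qed
qed

section \<open>Creating the two-key buffer at the top\<close>

text \<open>If the second chunk has room, it takes the third key. If it is full, the root is split
  into three chunks and keys are shifted up from the full chunk until the first chunk has two; the
  cost is 5 + 7 + 5 + 3.\<close>

lemma vine_buffer_three:
  assumes "4 \<le> B" "chunks_ok B ([p, q, s] # r)" "distinct (concat ([p, q, s] # r))" "r \<noteq> []"
  shows "\<exists>b r'. root_equiv B 20 (vine ([p, q, s] # r)) (vine (b # r')) \<and> length b = 2 \<and>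
    chunks_ok B (b # r') \<and> concat (b # r') = concat ([p, q, s] # r) \<and> length r' \<le> length r + 2"
proof -
  obtain y r1 where r: "r = y # r1" using assms(4) by (cases r) auto
  show ?thesis
  proof (cases "length y < B - 1")
    case True
    have "local_equiv B 3 (vine ([p, q, s] # y # r1)) [] (vine ([p, q] # (s # y) # r1)) []"
      by (rule vine_redistribute) (use assms True r in auto)
    then have "root_equiv B 20 (vine ([p, q, s] # r)) (vine ([p, q] # (s # y) # r1))"
      unfolding r by (intro local_imp_root_equiv) (rule local_equiv_mono, auto)
    then show ?thesis using assms True r
      by (intro exI[of _ "[p, q]"] exI[of _ "(s # y) # r1"]) auto
  next
    case False
    then have ly: "length y = B - 1" using assms r by auto
    then obtain y1 y2 where y: "y = y1 # y2" "y2 \<noteq> []"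
      using assms(1) by (cases y; cases "tl y") auto
    have 1: "root_equiv B 5 (vine (([p] @ q # [s]) # y # r1)) (vine ([p] # [q] # [s] # y # r1))"
      by (rule vine_split_root) (use assms in auto)
    have "local_equiv B 3 (vine ([s] # y # r1)) [] (vine ([s, y1] # y2 # r1)) []"
      by (rule vine_redistribute) (use assms r y ly in auto)
    from vine_in_child[OF vine_in_child[OF this, of "[q]"], of "[p]"]
    have 2: "local_equiv B 7 (vine ([p] # [q] # [s] # y # r1)) [] (vine ([p] # [q] # [s, y1] # y2 # r1)) []"
      by simp
    have "local_equiv B 3 (vine ([q] # [s, y1] # y2 # r1)) [] (vine ([q, s] # [y1] # y2 # r1)) []"
      by (rule vine_redistribute) (use assms r y ly in auto)
    from vine_in_child[OF this, of "[p]"]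
    have 3: "local_equiv B 5 (vine ([p] # [q] # [s, y1] # y2 # r1)) [] (vine ([p] # [q, s] # [y1] # y2 # r1)) []"
      by simp
    have 4: "local_equiv B 3 (vine ([p] # [q, s] # [y1] # y2 # r1)) [] (vine ([p, q] # [s] # [y1] # y2 # r1)) []"
      by (rule vine_redistribute) (use assms r y ly in auto)
    have "root_equiv B 20 (vine ([p, q, s] # r)) (vine ([p, q] # [s] # [y1] # y2 # r1))"
      using root_equiv_trans[OF 1 local_imp_root_equiv[OF local_equiv_trans[OF local_equiv_trans[OF 2 3] 4]]]
      by (simp add: r)
    moreover have "chunks_ok B ([p, q] # [s] # [y1] # y2 # r1)"
      using assms y ly r by auto
    ultimately show ?thesis using y r
      by (intro exI[of _ "[p, q]"] exI[of _ "[s] # [y1] # y2 # r1"]) auto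
  qed
qed

text \<open>The buffer must stand at the top, so the length of the first chunk decides. A single key
  is completed from the next chunks; if these are single too, three of them are joined by a root
  split read backwards. Five keys ensure that the chunks drawn upon exist.\<close>

lemma vine_buffer:
  assumes "4 \<le> B" "chunks_ok B kss" "distinct (concat kss)" "length (concat kss) \<ge> 5"
  shows "\<exists>b r. root_equiv B 25 (vine kss) (vine (b # r)) \<and> length b = 2 \<and>
    chunks_ok B (b # r) \<and> concat (b # r) = concat kss \<and> length r \<le> length kss + 2"
proof -
  obtain x r where kss: "kss = x # r" using assms(4) by (cases kss) auto
  have x: "x \<noteq> []" "length x \<le> B - 1" using assms kss by auto
  consider "length x = 1" | "length x = 2" | "length x = 3" | "length x \<ge> 4"
    using length_0_conv[of x] x(1) by linarith
  then show ?thesis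
  proof cases
    case 1
    then obtain a where xa: "x = [a]" by (auto simp: length_Suc_conv)
    obtain y r1 where r: "r = y # r1" using assms(4) kss xa by (cases r) auto
    have y: "y \<noteq> []" "length y \<le> B - 1" using assms kss r by auto
    show ?thesis
    proof (cases "length y = 1")
      case False
      obtain y1 y2 where yy: "y = y1 # y2" "y2 \<noteq> []" using y False by (cases y; cases "tl y") auto
      have "local_equiv B 3 (vine ([a] # y # r1)) [] (vine ([a, y1] # y2 # r1)) []"
        by (rule vine_redistribute) (use assms kss r xa yy in auto)
      then have "root_equiv B 25 (vine kss) (vine ([a, y1] # y2 # r1))"
        unfolding kss r xa by (intro local_imp_root_equiv) (rule local_equiv_mono, auto)
      moreover have "chunks_ok B ([a, y1] # y2 # r1)" using assms kss r yy by auto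
      ultimately show ?thesis using kss r xa yy
        by (intro exI[of _ "[a, y1]"] exI[of _ "y2 # r1"]) auto
    next
      case True
      then obtain b where yb: "y = [b]" by (auto simp: length_Suc_conv)
      obtain z r2 where r1: "r1 = z # r2" using assms(4) kss xa r yb by (cases r1) auto
      have z: "z \<noteq> []" "length z \<le> B - 1" using assms kss r r1 by auto
      show ?thesis
      proof (cases "length z = 1")
        case False
        obtain z1 z2 where zz: "z = z1 # z2" "z2 \<noteq> []" using z False by (cases z; cases "tl z") auto
        have "local_equiv B 3 (vine ([b] # z # r2)) [] (vine ([b, z1] # z2 # r2)) []"
          by (rule vine_redistribute) (use assms kss r xa yb r1 zz in auto)
        from vine_in_child[OF this, of "[a]"]
        have 1: "local_equiv B 5 (vine ([a] # [b] # z # r2)) [] (vine ([a] # [b, z1] # z2 # r2)) []"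
          by simp
        have 2: "local_equiv B 3 (vine ([a] # [b, z1] # z2 # r2)) [] (vine ([a, b] # [z1] # z2 # r2)) []"
          by (rule vine_redistribute) (use assms kss r xa yb r1 zz in auto)
        have "root_equiv B 25 (vine kss) (vine ([a, b] # [z1] # z2 # r2))"
          unfolding kss r xa yb r1
          using local_imp_root_equiv[OF local_equiv_mono[OF local_equiv_trans[OF 1 2], of 25]] by simp
        moreover have "chunks_ok B ([a, b] # [z1] # z2 # r2)" using assms kss r r1 zz by auto
        ultimately show ?thesis using kss r xa yb r1 zz
          by (intro exI[of _ "[a, b]"] exI[of _ "[z1] # z2 # r2"]) auto
      next
        case True
        then obtain c where zc: "z = [c]" by (auto simp: length_Suc_conv)
        have 1: "root_equiv B 5 (vine (([a] @ b # [c]) # r2)) (vine ([a] # [b] # [c] # r2))"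
          by (rule vine_split_root) (use assms kss r xa yb in auto)
        have "r2 \<noteq> []" using assms(4) kss xa r yb r1 zc by auto
        then have "\<exists>b' r'. root_equiv B 20 (vine ([a, b, c] # r2)) (vine (b' # r')) \<and> length b' = 2 \<and>
          chunks_ok B (b' # r') \<and> concat (b' # r') = concat ([a, b, c] # r2) \<and> length r' \<le> length r2 + 2"
          by (intro vine_buffer_three) (use assms kss r xa yb r1 zc in auto)
        then obtain b' r' where 2: "root_equiv B 20 (vine ([a, b, c] # r2)) (vine (b' # r'))"
          "length b' = 2" "chunks_ok B (b' # r')" "concat (b' # r') = concat ([a, b, c] # r2)"
          "length r' \<le> length r2 + 2" by blast
        from 1 2(1) have "root_equiv B 25 (vine kss) (vine (b' # r'))"
          unfolding kss r xa yb r1 zc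
          using root_equiv_trans[OF root_equiv_sym[OF 1], of 20] by simp
        then show ?thesis using 2 by (intro exI[of _ b'] exI[of _ r']) (auto simp: kss r xa yb r1 zc)
      qed
    qed
  next
    case 2
    then show ?thesis using assms kss root_equiv_refl by (intro exI[of _ x] exI[of _ r]) auto
  next
    case 3
    then obtain p q s where xp: "x = [p, q, s]" by (auto simp: length_Suc_conv numeral_3_eq_3)
    have "r \<noteq> []" using assms(4) kss xp by auto
    then have "\<exists>b r'. root_equiv B 20 (vine ([p, q, s] # r)) (vine (b # r')) \<and> length b = 2 \<and>
      chunks_ok B (b # r') \<and> concat (b # r') = concat ([p, q, s] # r) \<and> length r' \<le> length r + 2"
      by (intro vine_buffer_three) (use assms kss xp in auto)
    then obtain b r' where "root_equiv B 20 (vine ([p, q, s] # r)) (vine (b # r'))" "length b = 2"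
      "chunks_ok B (b # r')" "concat (b # r') = concat ([p, q, s] # r)" "length r' \<le> length r + 2"
      by blast
    then show ?thesis unfolding kss xp
      by (intro exI[of _ b] exI[of _ r'] conjI root_equiv_mono[of B 20 _ _ 25]) auto
  next
    case 4
    then obtain b c where bc: "x = b @ c" "length b = 2" using split_list_at[of 2 x] by auto
    then have "length c \<ge> 2" using 4 by auto
    then obtain k cs where c: "c = k # cs" "cs \<noteq> []" by (cases c; cases "tl c") auto
    have "root_equiv B 5 (vine ((b @ k # cs) # r)) (vine (b # [k] # cs # r))"
      by (rule vine_split_root) (use assms kss bc c in auto)
    then have "root_equiv B 25 (vine kss) (vine (b # [k] # cs # r))"
      unfolding kss bc c by (rule root_equiv_mono) simp
    moreover have "chunks_ok B (b # [k] # cs # r)" using assms kss bc c by auto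
    ultimately show ?thesis using bc c kss by (intro exI[of _ b] exI[of _ "[k] # cs # r"]) auto
  qed
qed

lemma root_equiv_canon:
  fixes t :: "unit btree"
  assumes "4 \<le> B" "node_sizes_ok B t" "distinct (keys_inorder t)" "length (keys_inorder t) \<ge> 5"
  shows "root_equiv B (25 * nnodes t + 65) t (vine (canon (B - 1) (keys_inorder t)))"
proof -
  have "t \<noteq> BNil" using assms(4) by auto
  then obtain kss where 1: "local_equiv B (5 * (nnodes t - spine t) + 2 * spine t) t [] (vine kss) []"
    "concat kss = keys_inorder t" "length kss = nnodes t" "chunks_ok B kss"
    using local_equiv_vine[OF assms(2,3)] by blast
  then obtain b r where 2: "root_equiv B 25 (vine kss) (vine (b # r))" "length b = 2"
    "chunks_ok B (b # r)" "concat (b # r) = concat kss" "length r \<le> length kss + 2"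
    using vine_buffer[OF assms(1) 1(4)] assms(3,4) by auto
  have 3: "local_equiv B (20 * length r) (vine (b # r)) [] (vine (canon (B - 1) (concat (b # r)))) []"
    by (rule vine_canon) (use 2 1 assms in auto)
  \<comment> \<open>At most 5 per node for straightening, 25 for the buffer, and 20 for each of at
    most \<open>nnodes t + 2\<close> chunks behind it.\<close>
  show ?thesis
    using root_equiv_trans[OF root_equiv_trans[OF local_imp_root_equiv[OF 1(1)] 2(1)] local_imp_root_equiv[OF 3]]
    unfolding 2(4) 1(2) by (rule root_equiv_mono) (use 2(5) 1(3) spine_le_nnodes[of t] in linarith)
qed

text \<open>With three keys this fails: two nodes cannot be merged into one.\<close>

theorem transform_cost:
  fixes t t' :: "unit btree"
  assumes "4 \<le> B" "node_sizes_ok B t" "node_sizes_ok B t'" "keys_inorder t = keys_inorder t'"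
    "distinct (keys_inorder t)" "length (keys_inorder t) \<ge> 5"
  shows "reach B (25 * (nnodes t + nnodes t') + 130) (t, []) (t', [])"
proof -
  have "root_equiv B (25 * nnodes t + 65) t (vine (canon (B - 1) (keys_inorder t)))"
    by (rule root_equiv_canon) (use assms in auto)
  moreover have "root_equiv B (25 * nnodes t' + 65) t' (vine (canon (B - 1) (keys_inorder t)))"
    unfolding assms(4) by (rule root_equiv_canon) (use assms in auto)
  ultimately have "root_equiv B (25 * nnodes t + 65 + (25 * nnodes t' + 65)) t t'"
    by (metis root_equiv_trans root_equiv_sym)
  then show ?thesis unfolding root_equiv_def by (auto intro: reach_mono)
qed


section \<open>Invariants of the operations\<close>

lemma node_sizes_ok_sub_at:
  "node_sizes_ok B t \<Longrightarrow> valid_address t p \<Longrightarrow> node_sizes_ok B (sub_at t p)"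
  by (induction t p rule: valid_address.induct) auto

lemma node_sizes_ok_put_at:
  "node_sizes_ok B t \<Longrightarrow> valid_address t p \<Longrightarrow> node_sizes_ok B s \<Longrightarrow> node_sizes_ok B (put_at t p s)"
proof (induction t p rule: valid_address.induct)
  case (2 a ks ts i p)
  then show ?case by (auto dest!: subsetD[OF set_update_subset_insert])
qed auto

lemma keys_inorder_put_at:
  "valid_address t p \<Longrightarrow> keys_inorder s = keys_inorder (sub_at t p) \<Longrightarrow>
   keys_inorder (put_at t p s) = keys_inorder t"
proof (induction t p rule: valid_address.induct)
  case (2 a ks ts i p)
  then show ?case by (simp add: map_update) (metis list_update_id nth_map)
qed auto

lemma keys_inorder_split:
  assumes "length ts1 = length ks1" "length ts2 = length ks2"
    "length vs1 = length us1 + 1" "length vs2 = length us2 + 1"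
  shows "keys_inorder (BNode a (ks1 @ ks2) (ts1 @ BNode b (us1 @ k # us2) (vs1 @ vs2) # ts2)) =
    keys_inorder (BNode c (ks1 @ k # ks2) (ts1 @ BNode d us1 vs1 # BNode e us2 vs2 # ts2))"
  using keys_inorder_flatten[of ts1 ks1 "vs1 @ vs2" "us1 @ k # us2" ts2 ks2 a b]
    keys_inorder_flatten[of "ts1" "ks1" vs1 us1 "BNode e us2 vs2 # ts2" "k # ks2" c d]
    keys_inorder_flatten[of "ts1 @ vs1" "ks1 @ us1 @ [k]" vs2 us2 ts2 ks2 c d] assms
  by simp

lemma keys_inorder_split_single:
  assumes "length vs1 = length us1 + 1" "length vs2 = length us2 + 1"
  shows "keys_inorder (BNode b (us1 @ k # us2) (vs1 @ vs2)) =
    keys_inorder (BNode c [k] [BNode d us1 vs1, BNode e us2 vs2])"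
  using keys_inorder_flatten[of "[]" "[]" vs1 us1 "[BNode e us2 vs2]" "[k]" c d]
    keys_inorder_flatten[of vs1 "us1 @ [k]" vs2 us2 "[]" "[]" c d] assms
  by simp

definition config_ok :: "nat \<Rightarrow> config \<Rightarrow> bool" where
  "config_ok B c \<longleftrightarrow> node_sizes_ok B (fst c) \<and> valid_address (fst c) (snd c)"

lemma config_ok_parent:
  assumes "config_ok B (t, q @ [i])"
  shows "node_sizes_ok B t" "valid_address t q" "node_sizes_ok B (sub_at t q)"
  using assms by (auto simp: config_ok_def valid_address_append node_sizes_ok_sub_at)

text \<open>The rules of \<open>step\<close> impose local conditions only; flattening the nodes
  concerned shows that no rule leaves the class of valid trees or reorders keys.\<close>

lemma step_preserves:
  assumes "step B c c'" "config_ok B c"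
  shows "config_ok B c' \<and> keys_inorder (fst c') = keys_inorder (fst c)"
  using assms
proof (induction rule: step.induct)
  case (move_child i t p)
  then show ?case by (cases "sub_at t p") (auto simp: config_ok_def valid_address_append)
next
  case (move_parent t p i)
  then show ?case by (auto simp: config_ok_def valid_address_append)
next
  case (split t q ks1 ks2 ts1 us1 k us2 vs1 vs2 ts2)
  note q = config_ok_parent[OF split.prems]
  have sz: "length ts2 = length ks2" "length vs2 = length us2 + 1"
    using q(3) split.hyps by auto
  let ?s = "node (ks1 @ k # ks2) (ts1 @ node us1 vs1 # node us2 vs2 # ts2)"
  have ok: "node_sizes_ok B ?s" using q(3) split.hyps sz by (auto simp: Suc_le_length_iff neq_Nil_conv)
  have "keys_inorder ?s = keys_inorder (sub_at t q)"
    using keys_inorder_split[of ts1 ks1 ts2 ks2 vs1 us1 vs2 us2] split.hyps sz by simp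
  then show ?case using q ok
    by (simp add: config_ok_def node_sizes_ok_put_at valid_address_put_at keys_inorder_put_at)
next
  case (split_root vs1 us1 us2 k vs2)
  then have sz: "length vs2 = length us2 + 1" by (simp add: config_ok_def)
  have "node_sizes_ok B (node [k] [node us1 vs1, node us2 vs2])"
    using split_root sz by (auto simp: config_ok_def Suc_le_length_iff neq_Nil_conv)
  then show ?case
    using keys_inorder_split_single[of vs1 us1 vs2 us2] split_root sz by (simp add: config_ok_def)
next
  case (join t q ks1 k ks2 ts1 us1 vs1 us2 vs2 ts2 i u)
  note q = config_ok_parent[OF join.prems]
  have sz: "length ts2 = length ks2" "length vs2 = length us2 + 1" "length vs1 = length us1 + 1"
    "us1 \<noteq> []" "us2 \<noteq> []"
    using q(3) join.hyps by auto
  \<comment> \<open>Natural subtraction could make \<open>B - 2\<close> zero. Two non-empty nodes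
    exclude this, so the joined node, with the key that comes down, stays within
    \<open>B - 1\<close>.\<close>
  have "B > 2" using join.hyps sz by (cases us1; cases us2) auto
  then have oku: "node_sizes_ok B u" using q(3) join.hyps sz by auto
  let ?s = "if ks1 @ ks2 = [] then u else node (ks1 @ ks2) (ts1 @ u # ts2)"
  have ok: "node_sizes_ok B ?s" using q(3) join.hyps sz oku by (auto simp: Suc_le_eq)
  have "keys_inorder ?s = keys_inorder (sub_at t q)"
  proof (cases "ks1 @ ks2 = []")
    case True
    then have "ts1 = []" "ts2 = []" using join.hyps sz by auto
    with True show ?thesis
      using keys_inorder_split_single[of vs1 us1 vs2 us2] join.hyps sz by simp
  next
    case False
    then show ?thesis unfolding if_not_P[OF False]
      using keys_inorder_split[of ts1 ks1 ts2 ks2 vs1 us1 vs2 us2] join.hyps sz by simp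
  qed
  then show ?case using q ok
    by (simp add: config_ok_def node_sizes_ok_put_at valid_address_put_at keys_inorder_put_at del: if_split
       keys_inorder.simps node_sizes_ok.simps)
next
  case (rotate t q as cs ts1 us vs ts2 as' us' cs' ts1' vs' ts2')
  note q = config_ok_parent[OF rotate.prems]
  have sz: "length ts2 = length cs" "length vs = length us + 1" using q(3) rotate.hyps by auto
  let ?s = "node (as' @ cs') (ts1' @ node us' vs' # ts2')"
  have "\<forall>x\<in>set (ts1 @ vs @ ts2). node_sizes_ok B x" using q(3) rotate.hyps(1) by auto
  then have *: "\<forall>x\<in>set (ts1' @ vs' @ ts2'). node_sizes_ok B x" unfolding rotate.hyps(5) .
  have ok: "node_sizes_ok B ?s" using * rotate.hyps(6-12) by (auto simp: Suc_le_eq)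
  have "keys_inorder ?s = keys_inorder (sub_at t q)"
    using keys_inorder_flatten[of ts1 as vs us ts2 cs "()" "()"]
      keys_inorder_flatten[of ts1' as' vs' us' ts2' cs' "()" "()"] rotate.hyps sz by simp
  then show ?case using q ok
    by (simp add: config_ok_def node_sizes_ok_put_at valid_address_put_at keys_inorder_put_at
        valid_address_append sub_at_put_at)
qed

section \<open>Operations commute with filling the null pointers\<close>

text \<open>\<open>inst f t lo\<close> replaces the null pointer following the key \<open>k\<close> in \<open>t\<close> by \<open>f k\<close>, and the
  first one by \<open>f lo\<close>.\<close>

primrec inst :: "(nat \<Rightarrow> unit btree) \<Rightarrow> unit btree \<Rightarrow> nat \<Rightarrow> unit btree" where
  "inst f BNil = f"
| "inst f (BNode a ks ts) = (\<lambda>lo. BNode a ks (map2 (\<lambda>g l. g l) (map (inst f) ts) (lo # ks)))"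

abbreviation insts :: "(nat \<Rightarrow> unit btree) \<Rightarrow> unit btree list \<Rightarrow> nat list \<Rightarrow> unit btree list" where
  "insts f ts ls \<equiv> map2 (inst f) ts ls"

lemma inst_node: "inst f (BNode a ks ts) lo = BNode a ks (insts f ts (lo # ks))"
  by (simp add: map_zip_map)

declare inst.simps(2) [simp del] inst_node [simp]

lemma insts_append:
  "length ts1 = length ls1 \<Longrightarrow> insts f (ts1 @ ts2) (ls1 @ ls2) = insts f ts1 ls1 @ insts f ts2 ls2"
  by simp

text \<open>Taking the last element of \<open>lo # ks1\<close> as the key before \<open>s\<close>
  covers a first child as well, whose predecessor is \<open>lo\<close>.\<close>

lemma insts_split:
  assumes "length ts1 = length ks1"
  shows "insts f (ts1 @ s # ts2) (lo # ks1 @ ks2) =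
    insts f ts1 (butlast (lo # ks1)) @ inst f s (last (lo # ks1)) # insts f ts2 ks2"
proof -
  have e: "lo # ks1 @ ks2 = butlast (lo # ks1) @ last (lo # ks1) # ks2"
    by (metis append_butlast_last_id append_Cons append_assoc append_Nil list.distinct(1))
  show ?thesis unfolding e using assms by (simp del: butlast.simps last.simps)
qed

lemma insts_flatten:
  assumes "length ts1 = length as" "length vs = length us + 1"
  shows "insts f (ts1 @ vs @ ts2) (lo # as @ us @ cs) =
    insts f ts1 (butlast (lo # as)) @ insts f vs (last (lo # as) # us) @ insts f ts2 cs"
proof -
  have e: "lo # as @ us @ cs = butlast (lo # as) @ (last (lo # as) # us) @ cs"
    by (metis append_butlast_last_id append_Cons append_assoc append_Nil list.distinct(1))
  show ?thesis unfolding e using assms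
      insts_append[of vs "last (lo # as) # us" f ts2 cs]
    by (simp del: butlast.simps last.simps)
qed

text \<open>The value that \<open>lo\<close> has taken when \<open>inst\<close> arrives at the node
  at \<open>p\<close>: the key just before that subtree.\<close>

fun gap_key :: "'a btree \<Rightarrow> nat \<Rightarrow> nat list \<Rightarrow> nat" where
  "gap_key t lo [] = lo"
| "gap_key (BNode a ks ts) lo (i # p) = gap_key (ts ! i) ((lo # ks) ! i) p"
| "gap_key BNil lo (i # p) = lo"

lemma sub_at_inst:
  "node_sizes_ok B t \<Longrightarrow> valid_address t p \<Longrightarrow> sub_at (inst f t lo) p = inst f (sub_at t p) (gap_key t lo p)"
  by (induction t lo p rule: gap_key.induct) auto

lemma put_at_inst:
  "node_sizes_ok B t \<Longrightarrow> valid_address t p \<Longrightarrow>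
   put_at (inst f t lo) p (inst f s (gap_key t lo p)) = inst f (put_at t p s) lo"
proof (induction t lo p rule: gap_key.induct)
  case (2 a ks ts lo i p)
  then have l: "i < length ts" "length ts = length (lo # ks)" by auto
  have "put_at (inst f (BNode a ks ts) lo) (i # p) (inst f s (gap_key (BNode a ks ts) lo (i # p))) =
    BNode a ks ((insts f ts (lo # ks))[i := inst f (put_at (ts ! i) p s) ((lo # ks) ! i)])"
    using 2 l by simp
  also have "(insts f ts (lo # ks))[i := inst f (put_at (ts ! i) p s) ((lo # ks) ! i)] =
     insts f (ts[i := put_at (ts ! i) p s]) (lo # ks)"
    using l by (auto intro!: nth_equalityI simp: nth_list_update)
  finally show ?case by simp
qed auto

text \<open>A null pointer is named by the key before it, and no operation changes which keys are
  neighbours, so afterwards every null pointer still asks for the same filling. The operation on the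
  skeleton is thus the same operation on the filled tree.\<close>

lemma step_inst:
  assumes "step B c c'" "config_ok B c"
  shows "step B (inst f (fst c) lo, snd c) (inst f (fst c') lo, snd c')"
  using assms
proof (induction rule: step.induct)
  case (move_child i t p)
  then obtain a ks ts where s: "sub_at t p = BNode a ks ts" by (cases "sub_at t p") auto
  have v: "valid_address t p" "node_sizes_ok B t" using move_child by (auto simp: config_ok_def)
  have "length ts = length ks + 1" using node_sizes_ok_sub_at[OF v(2,1)] s by simp
  then show ?case using move_child s v
    by (cases "ts ! i") (auto intro!: step.move_child simp: sub_at_inst)
next
  case (move_parent t p i)
  then show ?case by (auto intro: step.move_parent)
next
  case (split t q ks1 ks2 ts1 us1 k us2 vs1 vs2 ts2)
  note q = config_ok_parent[OF split.prems]
  have sz: "length ts2 = length ks2" "length vs2 = length us2 + 1"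
    using q(3) split.hyps by auto
  let ?g = "gap_key t lo q"
  let ?g' = "last (?g # ks1)"
  let ?L = "insts f ts1 (butlast (?g # ks1))" and ?R = "insts f ts2 ks2"
  let ?V1 = "insts f vs1 (?g' # us1)" and ?V2 = "insts f vs2 (k # us2)"
  have V: "insts f (vs1 @ vs2) (?g' # us1 @ k # us2) = ?V1 @ ?V2"
    using insts_append[of vs1 "?g' # us1" f vs2 "k # us2"] split.hyps by simp
  have 1: "sub_at (inst f t lo) q = node (ks1 @ ks2) (?L @ node (us1 @ k # us2) (?V1 @ ?V2) # ?R)"
    using sub_at_inst[OF q(1,2)] split.hyps(1,2) V
    by (simp add: insts_split del: butlast.simps last.simps)
  have 2: "inst f (put_at t q (node (ks1 @ k # ks2) (ts1 @ node us1 vs1 # node us2 vs2 # ts2))) lo =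
     put_at (inst f t lo) q (node (ks1 @ k # ks2) (?L @ node us1 ?V1 # node us2 ?V2 # ?R))"
    using put_at_inst[OF q(1,2)] split.hyps(2)
    by (simp add: insts_split del: butlast.simps last.simps flip: put_at_inst[OF q(1,2)])
  have l: "length ?L = length ts1" using split.hyps(2) by simp
  have "step B (inst f t lo, q @ [length ?L]) (put_at (inst f t lo) q
     (node (ks1 @ k # ks2) (?L @ node us1 ?V1 # node us2 ?V2 # ?R)), q)"
    by (rule step.split[OF 1]) (use split.hyps in auto)
  then show ?case unfolding fst_conv snd_conv 2 l .
next
  case (split_root vs1 us1 us2 k vs2)
  then have sz: "length vs2 = length us2 + 1" by (simp add: config_ok_def)
  have V: "insts f (vs1 @ vs2) (lo # us1 @ k # us2) = insts f vs1 (lo # us1) @ insts f vs2 (k # us2)"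
    using insts_append[of vs1 "lo # us1" f vs2 "k # us2"] split_root by simp
  show ?case using split_root by (auto simp: V intro!: step.split_root)
next
  case (join t q ks1 k ks2 ts1 us1 vs1 us2 vs2 ts2 i u)
  note q = config_ok_parent[OF join.prems]
  have sz: "length ts2 = length ks2" "length vs2 = length us2 + 1" "length vs1 = length us1 + 1"
    using q(3) join.hyps by auto
  let ?g = "gap_key t lo q"
  let ?g' = "last (?g # ks1)"
  let ?L = "insts f ts1 (butlast (?g # ks1))" and ?R = "insts f ts2 ks2"
  let ?V1 = "insts f vs1 (?g' # us1)" and ?V2 = "insts f vs2 (k # us2)"
  let ?u = "node (us1 @ k # us2) (?V1 @ ?V2)"
  have V: "insts f (vs1 @ vs2) (?g' # us1 @ k # us2) = ?V1 @ ?V2"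
    using insts_append[of vs1 "?g' # us1" f vs2 "k # us2"] sz by simp
  then have u: "inst f u ?g' = ?u" using join.hyps by simp
  have 1: "sub_at (inst f t lo) q = node (ks1 @ k # ks2) (?L @ node us1 ?V1 # node us2 ?V2 # ?R)"
    using sub_at_inst[OF q(1,2)] join.hyps(1,2)
    by (simp add: insts_split del: butlast.simps last.simps)
  have e: "inst f (if ks1 @ ks2 = [] then u else node (ks1 @ ks2) (ts1 @ u # ts2)) ?g =
     (if ks1 @ ks2 = [] then ?u else node (ks1 @ ks2) (?L @ ?u # ?R))"
  proof (cases "ks1 @ ks2 = []")
    case True
    then show ?thesis using u by simp
  next
    case False
    then show ?thesis using u join.hyps(2)
      by (simp only: if_False inst_node insts_split)
  qed
  have 2: "inst f (put_at t q (if ks1 @ ks2 = [] then u else node (ks1 @ ks2) (ts1 @ u # ts2))) lo =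
     put_at (inst f t lo) q (if ks1 @ ks2 = [] then ?u else node (ks1 @ ks2) (?L @ ?u # ?R))"
    unfolding e[symmetric] by (rule put_at_inst[OF q(1,2), symmetric])
  have l: "length ?L = length ts1" using join.hyps(2) by simp
  have "step B (inst f t lo, q @ [i]) (put_at (inst f t lo) q
     (if ks1 @ ks2 = [] then ?u else node (ks1 @ ks2) (?L @ ?u # ?R)), q)"
    by (rule step.join[OF 1]) (use join.hyps l in auto)
  then show ?case unfolding fst_conv snd_conv 2 .
next
  case (rotate t q as cs ts1 us vs ts2 as' us' cs' ts1' vs' ts2')
  note q = config_ok_parent[OF rotate.prems]
  have sz: "length ts2 = length cs" "length vs = length us + 1" using q(3) rotate.hyps by auto
  let ?g = "gap_key t lo q"
  let ?L = "insts f ts1 (butlast (?g # as))" and ?R = "insts f ts2 cs"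
  let ?L' = "insts f ts1' (butlast (?g # as'))" and ?R' = "insts f ts2' cs'"
  let ?V = "insts f vs (last (?g # as) # us)" and ?V' = "insts f vs' (last (?g # as') # us')"
  have 1: "sub_at (inst f t lo) q = node (as @ cs) (?L @ node us ?V # ?R)"
    using sub_at_inst[OF q(1,2)] rotate.hyps(1,2)
    by (simp add: insts_split del: butlast.simps last.simps)
  have 2: "inst f (put_at t q (node (as' @ cs') (ts1' @ node us' vs' # ts2'))) lo =
     put_at (inst f t lo) q (node (as' @ cs') (?L' @ node us' ?V' # ?R'))"
    using put_at_inst[OF q(1,2), symmetric] rotate.hyps(6)
    by (simp add: insts_split del: butlast.simps last.simps)
  \<comment> \<open>Both sides are the filling of one flattened list of children, in which every gap
    has the same preceding key before and after the rotation.\<close>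
  have 3: "?L @ ?V @ ?R = ?L' @ ?V' @ ?R'"
    using insts_flatten[of ts1 as vs us f ts2 ?g cs] insts_flatten[of ts1' as' vs' us' f ts2' ?g cs']
      rotate.hyps sz by simp
  have l: "length ?L = length ts1" "length ?L' = length ts1'" using rotate.hyps(2,6) by simp_all
  have "step B (inst f t lo, q @ [length ?L]) (put_at (inst f t lo) q
     (node (as' @ cs') (?L' @ node us' ?V' # ?R')), q @ [length ?L'])"
    by (rule step.rotate[OF 1 _ rotate.hyps(3) rotate.hyps(4) 3])
       (use rotate.hyps l in auto)
  then show ?case unfolding fst_conv snd_conv 2 l .
qed

lemma reach_inst:
  assumes "reach B j (t, []) (t', [])" "node_sizes_ok B t"
  shows "reach B j (inst f t lo, []) (inst f t' lo, [])"
proof -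
  have "config_ok B c' \<and> (step B ^^ i) (inst f (fst c) lo, snd c) (inst f (fst c') lo, snd c')"
    if "(step B ^^ i) c c'" "config_ok B c" for i c c'
    using that
  proof (induction i arbitrary: c')
    case (Suc i)
    then obtain d where d: "(step B ^^ i) c d" "step B d c'" by auto
    with Suc have "config_ok B d" "(step B ^^ i) (inst f (fst c) lo, snd c) (inst f (fst d) lo, snd d)"
      by auto
    moreover from this d have "step B (inst f (fst d) lo, snd d) (inst f (fst c') lo, snd c')"
      by (intro step_inst)
    ultimately show ?case using step_preserves[OF d(2)] by auto
  qed auto
  from this[where c = "(t, [])" and c' = "(t', [])"] show ?thesis
    using assms by (auto simp: reach_def config_ok_def)
qed


section \<open>Sequences of keys and trees\<close>

datatype 't item = Key nat | Tree 't

fun item_key :: "'t item \<Rightarrow> nat list" where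
  "item_key (Key k) = [k]" | "item_key (Tree t) = []"

fun item_tree :: "'t item \<Rightarrow> 't list" where
  "item_tree (Key k) = []" | "item_tree (Tree t) = [t]"

definition item_keys :: "'t item list \<Rightarrow> nat list" where
  "item_keys s = concat (map item_key s)"

definition item_trees :: "'t item list \<Rightarrow> 't list" where
  "item_trees s = concat (map item_tree s)"

lemma item_keys_simps [simp]:
  "item_keys [] = []" "item_keys (Key k # s) = k # item_keys s" "item_keys (Tree t # s) = item_keys s"
  "item_keys (s @ s') = item_keys s @ item_keys s'"
  by (auto simp: item_keys_def)

lemma item_trees_simps [simp]:
  "item_trees [] = []" "item_trees (Key k # s) = item_trees s" "item_trees (Tree t # s) = t # item_trees s"
  "item_trees (s @ s') = item_trees s @ item_trees s'"
  by (auto simp: item_trees_def)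

definition interleave :: "'t list \<Rightarrow> nat list \<Rightarrow> 't item list" where
  "interleave ts ks = weave (map (\<lambda>t. [Tree t]) ts) (map Key ks)"

lemma interleave_simps [simp]:
  "interleave [t] [] = [Tree t]"
  "interleave (t # ts) (k # ks) = Tree t # Key k # interleave ts ks"
  by (simp_all add: interleave_def)

lemma interleave_Cons:
  "length ts = length ks \<Longrightarrow> interleave (t # ts) ks = Tree t # concat (map2 (\<lambda>k t. [Key k, Tree t]) ks ts)"
  by (induction ts ks arbitrary: t rule: list_induct2) auto

lemma interleave_induct [consumes 1, case_names single cons]:
  assumes "length ts = length ks + 1" "\<And>t. Q [t] []"
    "\<And>t ts k ks. length ts = length ks + 1 \<Longrightarrow> Q ts ks \<Longrightarrow> Q (t # ts) (k # ks)"
  shows "Q ts ks"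
  using assms(1)
proof (induction ks arbitrary: ts)
  case Nil
  then show ?case using assms(2) by (auto simp: length_Suc_conv)
next
  case (Cons k ks)
  then show ?case using assms(3) by (cases ts) auto
qed

lemma item_keys_interleave [simp]: "length ts = length ks + 1 \<Longrightarrow> item_keys (interleave ts ks) = ks"
  by (induction ts ks rule: interleave_induct) auto

lemma item_trees_interleave [simp]: "length ts = length ks + 1 \<Longrightarrow> item_trees (interleave ts ks) = ts"
  by (induction ts ks rule: interleave_induct) auto

section \<open>Opening nodes, and confluence of openings\<close>

text \<open>Trees are compared through sequences: two trees that open to the same sequence differ
  only in how the opened nodes group the keys.\<close>

inductive open_node :: "nat \<Rightarrow> unit btree item list \<Rightarrow> unit btree item list \<Rightarrow> bool" for B where
  "\<lbrakk>ks \<noteq> []; length ks \<le> B - 1; length ts = length ks + 1\<rbrakk> \<Longrightarrow>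
   open_node B (s1 @ Tree (node ks ts) # s2) (s1 @ interleave ts ks @ s2)"

lemma open_node_context: "open_node B s t \<Longrightarrow> open_node B (u @ s @ v) (u @ t @ v)"
proof (induction rule: open_node.induct)
  case (1 ks ts s1 s2)
  then show ?case using open_node.intros[of ks B ts "u @ s1" "s2 @ v"] by simp
qed

lemma open_nodes_context: "(open_node B ^^ n) s t \<Longrightarrow> (open_node B ^^ n) (u @ s @ v) (u @ t @ v)"
  by (induction n arbitrary: t) (auto intro: open_node_context)

text \<open>Different occurrences do not overlap, and opening one neither copies nor removes the
  other. One step on each side therefore closes the diagram, which keeps the numbers of openings
  additive.\<close>

lemma open_node_diamond:
  assumes "open_node B s t" "open_node B s u"
  shows "t = u \<or> (\<exists>v. open_node B t v \<and> open_node B u v)"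
  using assms(1)
proof cases
  case (1 ks ts s1 s2)
  note t = this
  from assms(2) show ?thesis
  proof cases
    case (1 ks' ts' s1' s2')
    note u = this
    have eq: "s1 @ Tree (node ks ts) # s2 = s1' @ Tree (node ks' ts') # s2'" using t u by simp
    consider "s1 = s1'"
      | w where "s1' = s1 @ Tree (node ks ts) # w" "s2 = w @ Tree (node ks' ts') # s2'"
      | w where "s1 = s1' @ Tree (node ks' ts') # w" "s2' = w @ Tree (node ks ts) # s2"
    proof -
      from eq obtain us where "s1 = s1' @ us \<and> us @ Tree (node ks ts) # s2 = Tree (node ks' ts') # s2' \<or>
        s1 @ us = s1' \<and> Tree (node ks ts) # s2 = us @ Tree (node ks' ts') # s2'"
        by (auto simp: append_eq_append_conv2)
      then show ?thesis using that by (cases us) auto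
    qed
    then show ?thesis
    proof cases
      case 1
      then show ?thesis using t u eq by auto
    next
      case (2 w)
      have "open_node B t (s1 @ interleave ts ks @ w @ interleave ts' ks' @ s2')"
        using open_node.intros[of ks' B ts' "s1 @ interleave ts ks @ w" s2'] t u 2 by simp
      moreover have "open_node B u (s1 @ interleave ts ks @ w @ interleave ts' ks' @ s2')"
        using open_node.intros[of ks B ts s1 "w @ interleave ts' ks' @ s2'"] t u 2 by simp
      ultimately show ?thesis by blast
    next
      case (3 w)
      have "open_node B t (s1' @ interleave ts' ks' @ w @ interleave ts ks @ s2)"
        using open_node.intros[of ks' B ts' s1' "w @ interleave ts ks @ s2"] t u 3 by simp
      moreover have "open_node B u (s1' @ interleave ts' ks' @ w @ interleave ts ks @ s2)"
        using open_node.intros[of ks B ts "s1' @ interleave ts' ks' @ w" s2] t u 3 by simp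
      ultimately show ?thesis by blast
    qed
  qed
qed

lemma open_node_strip:
  assumes "open_node B s t" "(open_node B ^^ n) s u"
  shows "\<exists>v i j. i \<le> n \<and> j \<le> 1 \<and> (open_node B ^^ i) t v \<and> (open_node B ^^ j) u v"
  using assms
proof (induction n arbitrary: s t)
  case 0
  then show ?case by (intro exI[of _ t] exI[of _ 0] exI[of _ "1::nat"]) auto
next
  case (Suc n)
  then obtain s' where s': "open_node B s s'" "(open_node B ^^ n) s' u"
    using relpowp_Suc_D2[of n "open_node B" s u] by auto
  from open_node_diamond[OF Suc.prems(1) s'(1)] show ?case
  proof
    assume "t = s'"
    then show ?thesis using s' by (intro exI[of _ u] exI[of _ n] exI[of _ "0::nat"]) auto
  next
    assume "\<exists>v. open_node B t v \<and> open_node B s' v"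
    then obtain v where v: "open_node B t v" "open_node B s' v" by blast
    from Suc.IH[OF v(2) s'(2)] obtain w i j where w: "i \<le> n" "j \<le> 1"
      "(open_node B ^^ i) v w" "(open_node B ^^ j) u w" by blast
    have "(open_node B ^^ Suc i) t w" using relpowp_Suc_I2[of "open_node B", OF v(1) w(3)] .
    then show ?thesis using w by (intro exI[of _ w] exI[of _ "Suc i"] exI[of _ j]) auto
  qed
qed

lemma open_nodes_confluent:
  assumes "(open_node B ^^ m) s t" "(open_node B ^^ n) s u"
  shows "\<exists>v i j. i \<le> n \<and> j \<le> m \<and> (open_node B ^^ i) t v \<and> (open_node B ^^ j) u v"
  using assms
proof (induction m arbitrary: t)
  case 0
  then show ?case by (intro exI[of _ u] exI[of _ n] exI[of _ "0::nat"]) auto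
next
  case (Suc m)
  then obtain t' where t': "(open_node B ^^ m) s t'" "open_node B t' t" by auto
  from Suc.IH[OF t'(1) Suc.prems(2)] obtain v i j where v: "i \<le> n" "j \<le> m"
    "(open_node B ^^ i) t' v" "(open_node B ^^ j) u v" by blast
  from open_node_strip[OF t'(2) v(3)] obtain w i' j' where w: "i' \<le> i" "j' \<le> 1"
    "(open_node B ^^ i') t w" "(open_node B ^^ j') v w" by blast
  have "(open_node B ^^ (j + j')) u w" unfolding relpowp_add using v(4) w(4) by auto
  then show ?case using v w by (intro exI[of _ w] exI[of _ i'] exI[of _ "j + j'"]) auto
qed

text \<open>The intermediate trees of a chain of cuts and gluings are never produced by operations;
  only the numbers of opened nodes are carried along. Confluence makes the relation transitive with
  additive cost, and operations are spent once, at the end of the chain.\<close>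

definition refold_equiv :: "nat \<Rightarrow> nat \<Rightarrow> unit btree item list \<Rightarrow> unit btree item list \<Rightarrow> bool" where
  "refold_equiv B n s t \<longleftrightarrow>
     (\<exists>u i j. i \<le> n \<and> j \<le> n \<and> (open_node B ^^ i) s u \<and> (open_node B ^^ j) t u)"

lemma refold_equiv_refl: "refold_equiv B n s s"
  unfolding refold_equiv_def by (intro exI[of _ s] exI[of _ "0::nat"]) auto

lemma refold_equiv_sym: "refold_equiv B n s t \<Longrightarrow> refold_equiv B n t s"
  unfolding refold_equiv_def by blast

lemma refold_equiv_mono: "refold_equiv B n s t \<Longrightarrow> n \<le> m \<Longrightarrow> refold_equiv B m s t"
  unfolding refold_equiv_def by (meson le_trans)

lemma refold_equiv_trans:
  assumes "refold_equiv B m s t" "refold_equiv B n t u"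
  shows "refold_equiv B (m + n) s u"
proof -
  from assms obtain v i j w k l where v: "i \<le> m" "j \<le> m" "(open_node B ^^ i) s v" "(open_node B ^^ j) t v"
    and w: "k \<le> n" "l \<le> n" "(open_node B ^^ k) t w" "(open_node B ^^ l) u w"
    unfolding refold_equiv_def by blast
  from open_nodes_confluent[OF v(4) w(3)] obtain x a b where x: "a \<le> k" "b \<le> j"
    "(open_node B ^^ a) v x" "(open_node B ^^ b) w x" by blast
  have "(open_node B ^^ (i + a)) s x" "(open_node B ^^ (l + b)) u x"
    unfolding relpowp_add using v w x by auto
  then show ?thesis unfolding refold_equiv_def
    using v w x by (intro exI[of _ x] exI[of _ "i + a"] exI[of _ "l + b"]) auto
qed

lemma refold_equiv_context:
  "refold_equiv B n s t \<Longrightarrow> refold_equiv B n (u @ s @ v) (u @ t @ v)"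
  unfolding refold_equiv_def by (meson open_nodes_context)

lemma refold_equiv_open:
  assumes "ks \<noteq> []" "length ks \<le> B - 1" "length ts = length ks + 1"
  shows "refold_equiv B 1 [Tree (node ks ts)] (interleave ts ks)"
  unfolding refold_equiv_def
  using open_node.intros[OF assms, of "[]" "[]"]
  by (intro exI[of _ "interleave ts ks"] exI[of _ 1] exI[of _ 0]) auto

lemma open_nodes_append:
  assumes "(open_node B ^^ n) (s1 @ s2) t"
  shows "\<exists>n1 n2 t1 t2. n = n1 + n2 \<and> t = t1 @ t2 \<and> (open_node B ^^ n1) s1 t1 \<and> (open_node B ^^ n2) s2 t2"
  using assms
proof (induction n arbitrary: t)
  case 0
  then show ?case by (intro exI[of _ 0] exI[of _ s1] exI[of _ s2]) auto
next
  case (Suc n)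
  then obtain u where u: "(open_node B ^^ n) (s1 @ s2) u" "open_node B u t" by auto
  from Suc.IH[OF u(1)] obtain n1 n2 t1 t2 where IH: "n = n1 + n2" "u = t1 @ t2"
    "(open_node B ^^ n1) s1 t1" "(open_node B ^^ n2) s2 t2" by blast
  from u(2) have "(\<exists>t1'. t = t1' @ t2 \<and> open_node B t1 t1') \<or> (\<exists>t2'. t = t1 @ t2' \<and> open_node B t2 t2')"
  proof cases
    case (1 ks ts r1 r2)
    from 1(1) IH(2) obtain us where "t1 = r1 @ us \<and> us @ t2 = Tree (node ks ts) # r2 \<or>
      t1 @ us = r1 \<and> t2 = us @ Tree (node ks ts) # r2"
      by (auto simp: append_eq_append_conv2)
    then show ?thesis
    proof (elim disjE conjE)
      assume a: "t1 = r1 @ us" "us @ t2 = Tree (node ks ts) # r2"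
      show ?thesis
      proof (cases us)
        case Nil
        then show ?thesis using a 1 open_node.intros[of ks B ts "[]" r2] by auto
      next
        case (Cons x us')
        then show ?thesis using a 1 open_node.intros[of ks B ts r1 us'] by auto
      qed
    next
      assume "t1 @ us = r1" "t2 = us @ Tree (node ks ts) # r2"
      then show ?thesis using 1 open_node.intros[of ks B ts us r2] by auto
    qed
  qed
  then show ?case
  proof (elim disjE exE conjE)
    fix t1' assume "t = t1' @ t2" "open_node B t1 t1'"
    then show ?thesis using IH by (intro exI[of _ "Suc n1"] exI[of _ n2] exI[of _ t1'] exI[of _ t2]) auto
  next
    fix t2' assume "t = t1 @ t2'" "open_node B t2 t2'"
    then show ?thesis using IH by (intro exI[of _ n1] exI[of _ "Suc n2"] exI[of _ t1] exI[of _ t2']) auto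
  qed
qed

lemma open_node_Key: "\<not> open_node B [Key k] t"
proof
  assume "open_node B [Key k] t"
  then show False by cases (auto simp: Cons_eq_append_conv)
qed

lemma open_nodes_Key: "(open_node B ^^ n) [Key k] t \<Longrightarrow> n = 0 \<and> t = [Key k]"
  using relpowp_Suc_D2[of _ "open_node B" "[Key k]" t] by (cases n) (auto simp: open_node_Key)

section \<open>From opened sequences back to trees\<close>

lemma open_nodes_lengths:
  "(open_node B ^^ n) s t \<Longrightarrow> length (item_trees t) + length (item_keys s) = length (item_keys t) + length (item_trees s)"
proof (induction n arbitrary: t)
  case (Suc n)
  then obtain u where u: "(open_node B ^^ n) s u" "open_node B u t" by auto
  from u(2) show ?case using Suc.IH[OF u(1)] by cases auto
qed auto

lemma open_nodes_interleave:
  assumes "(open_node B ^^ n) (interleave ts ks) t" "length ts = length ks + 1"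
  shows "\<exists>ns us. length ns = length ts \<and> length us = length ts \<and> n = sum_list ns \<and>
    t = weave us (map Key ks) \<and> (\<forall>i<length ts. (open_node B ^^ (ns ! i)) [Tree (ts ! i)] (us ! i))"
  using assms
proof (induction ks arbitrary: ts n t)
  case Nil
  then obtain t0 where "ts = [t0]" by (auto simp: length_Suc_conv)
  with Nil show ?case by (intro exI[of _ "[n]"] exI[of _ "[t]"]) auto
next
  case (Cons k ks)
  then obtain t0 ts' where ts: "ts = t0 # ts'" "length ts' = length ks + 1" by (cases ts) auto
  with Cons.prems have "(open_node B ^^ n) ([Tree t0] @ [Key k] @ interleave ts' ks) t" by simp
  from open_nodes_append[OF this] obtain n1 n2 t1 t2 where 1: "n = n1 + n2" "t = t1 @ t2"
    "(open_node B ^^ n1) [Tree t0] t1" "(open_node B ^^ n2) ([Key k] @ interleave ts' ks) t2" by blast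
  from open_nodes_append[OF 1(4)] obtain n3 n4 t3 t4 where 2: "n2 = n3 + n4" "t2 = t3 @ t4"
    "(open_node B ^^ n3) [Key k] t3" "(open_node B ^^ n4) (interleave ts' ks) t4" by blast
  from Cons.IH[OF 2(4) ts(2)] obtain ns us where IH: "length ns = length ts'" "length us = length ts'"
    "n4 = sum_list ns" "t4 = weave us (map Key ks)"
    "\<forall>i<length ts'. (open_node B ^^ (ns ! i)) [Tree (ts' ! i)] (us ! i)" by blast
  show ?case
    by (intro exI[of _ "n1 # ns"] exI[of _ "t1 # us"])
       (use IH 1 2 open_nodes_Key[OF 2(3)] ts in \<open>auto simp: nth_Cons split: nat.splits\<close>)
qed

lemma weave_item_keys:
  "length us = length ks + 1 \<Longrightarrow> item_keys (weave us (map Key ks)) = weave (map item_keys us) ks"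
  by (induction us ks rule: interleave_induct) auto

text \<open>The opened nodes form a tree of their own, whose null pointers stand for the unopened
  trees in \<open>s\<close>; \<open>inst\<close> puts these back. Cost is measured on this skeleton,
  so the size of what hangs below does not enter.\<close>

lemma open_nodes_skeleton:
  assumes "(open_node B ^^ n) [Tree T] s"
  shows "\<exists>t. node_sizes_ok B t \<and> nnodes t = n \<and> keys_inorder t = item_keys s \<and>
    (\<forall>f lo. item_trees s = map f (lo # item_keys s) \<longrightarrow> T = inst f t lo)"
  using assms
proof (induction n arbitrary: T s rule: less_induct)
  case (less n)
  show ?case
  proof (cases n)
    case 0
    then show ?thesis using less.prems by (intro exI[of _ BNil]) auto
  next
    case (Suc m)
    with less.prems obtain s' where s': "open_node B [Tree T] s'" "(open_node B ^^ m) s' s"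
      by (metis relpowp_Suc_D2)
    from s'(1) obtain ks ts where T: "T = node ks ts" "s' = interleave ts ks" and
      sz: "ks \<noteq> []" "length ks \<le> B - 1" "length ts = length ks + 1"
      by cases (auto simp: Cons_eq_append_conv)
    from open_nodes_interleave[OF s'(2)[unfolded T] sz(3)] obtain ns us where
      ns: "length ns = length ts" "length us = length ts" "m = sum_list ns" "s = weave us (map Key ks)"
      and op: "\<forall>i<length ts. (open_node B ^^ (ns ! i)) [Tree (ts ! i)] (us ! i)" by blast
    have "\<exists>t. node_sizes_ok B t \<and> nnodes t = ns ! i \<and> keys_inorder t = item_keys (us ! i) \<and>
       (\<forall>f lo. item_trees (us ! i) = map f (lo # item_keys (us ! i)) \<longrightarrow> ts ! i = inst f t lo)"
      if "i < length ts" for i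
    proof (rule less.IH)
      have "ns ! i \<le> sum_list ns" using that ns by (intro member_le_sum_list) auto
      then show "ns ! i < n" using ns Suc by simp
    qed (use op that in auto)
    then obtain c where c: "\<And>i. i < length ts \<Longrightarrow> node_sizes_ok B (c i) \<and> nnodes (c i) = ns ! i \<and>
      keys_inorder (c i) = item_keys (us ! i) \<and>
      (\<forall>f lo. item_trees (us ! i) = map f (lo # item_keys (us ! i)) \<longrightarrow> ts ! i = inst f (c i) lo)"
      by metis
    define cs where "cs = map c [0..<length ts]"
    have cs: "length cs = length ts" unfolding cs_def by simp
    have "map nnodes cs = ns"
      by (rule nth_equalityI) (use c ns in \<open>auto simp: cs_def\<close>)
    moreover have kcs: "map keys_inorder cs = map item_keys us"
      by (rule nth_equalityI) (use c ns in \<open>auto simp: cs_def\<close>)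
    moreover have "\<forall>t\<in>set cs. node_sizes_ok B t" using c by (auto simp: cs_def)
    moreover have "T = inst f (node ks cs) lo"
      if "item_trees s = map f (lo # item_keys s)" for f lo
    proof -
      \<comment> \<open>Each part has one tree more than keys; these numbers determine how the list
        of hung trees of \<open>s\<close> is distributed over the children.\<close>
      have len: "length (item_trees (us ! i)) = Suc (length (item_keys (us ! i)))" if "i < length ts" for i
        using op that open_nodes_lengths[of "ns ! i" B "[Tree (ts ! i)]" "us ! i"] by simp
      have pt: "ts ! i = inst f (cs ! i) l"
        if "i < length ts" "item_trees (us ! i) = map f (l # item_keys (us ! i))" for i l
        using c that by (simp add: cs_def)
      have "ts = insts f cs (lo # ks)"
        using that[unfolded ns(4)] len pt sz(3) ns(2) cs
      proof (induction ks arbitrary: lo us ts cs)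
        case Nil
        then obtain t0 u0 c0 where "ts = [t0]" "us = [u0]" "cs = [c0]" by (auto simp: length_Suc_conv)
        with Nil(1) Nil(3)[of 0 lo] show ?case by simp
      next
        case (Cons k ks)
        obtain t0 ts' u0 us' c0 cs' where eqs: "ts = t0 # ts'" "us = u0 # us'" "cs = c0 # cs'"
          using Cons.prems by (cases ts; cases us; cases cs) auto
        have "item_trees u0 @ item_trees (weave us' (map Key ks)) =
          map f (lo # item_keys u0) @ map f (k # item_keys (weave us' (map Key ks)))"
          using Cons.prems(1) by (simp add: eqs)
        moreover have "length (item_trees u0) = length (map f (lo # item_keys u0))"
          using Cons.prems(2)[of 0] by (simp add: eqs)
        ultimately have h: "item_trees u0 = map f (lo # item_keys u0)"
          "item_trees (weave us' (map Key ks)) = map f (k # item_keys (weave us' (map Key ks)))"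
          using append_eq_append_conv by blast+
        have "t0 = inst f c0 lo" using Cons.prems(3)[of 0 lo] h by (simp add: eqs)
        moreover have "ts' = insts f cs' (k # ks)"
        proof (rule Cons.IH[OF h(2)])
          fix i l assume "i < length ts'"
          then show "length (item_trees (us' ! i)) = Suc (length (item_keys (us' ! i)))"
            using Cons.prems(2)[of "Suc i"] by (simp add: eqs)
        next
          fix i l assume "i < length ts'" "item_trees (us' ! i) = map f (l # item_keys (us' ! i))"
          then show "ts' ! i = inst f (cs' ! i) l"
            using Cons.prems(3)[of "Suc i" l] by (simp add: eqs)
        qed (use Cons.prems in \<open>auto simp: eqs\<close>)
        ultimately show ?case by (simp add: eqs)
      qed
      then show ?thesis unfolding T by simp
    qed
    ultimately show ?thesis using sz ns Suc cs
      by (intro exI[of _ "node ks cs"]) (auto simp: weave_item_keys Suc_le_eq)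
  qed
qed

fun flat_item :: "unit btree item \<Rightarrow> nat list" where
  "flat_item (Key k) = [k]" | "flat_item (Tree t) = keys_inorder t"

lemma flat_interleave:
  "length ts = length ks + 1 \<Longrightarrow>
   concat (map flat_item (interleave ts ks)) = weave (map keys_inorder ts) ks"
  by (induction ts ks rule: interleave_induct) auto

lemma set_interleave_trees:
  "length ts = length ks + 1 \<Longrightarrow> Tree t \<in> set (interleave ts ks) \<Longrightarrow> t \<in> set ts"
  by (induction ts ks rule: interleave_induct) auto

lemma open_nodes_invariant:
  assumes "(open_node B ^^ n) s t" "\<forall>x. Tree x \<in> set s \<longrightarrow> node_sizes_ok B x"
  shows "concat (map flat_item t) = concat (map flat_item s) \<and> (\<forall>x. Tree x \<in> set t \<longrightarrow> node_sizes_ok B x)"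
  using assms
proof (induction n arbitrary: t)
  case (Suc n)
  then obtain u where u: "(open_node B ^^ n) s u" "open_node B u t" by auto
  note IH = Suc.IH[OF u(1) Suc.prems(2)]
  from u(2) show ?case
  proof cases
    case (1 ks ts s1 s2)
    have "node_sizes_ok B (node ks ts)" using IH 1 by simp
    then have "\<forall>x. Tree x \<in> set (interleave ts ks) \<longrightarrow> node_sizes_ok B x"
      using set_interleave_trees[OF 1(5)] by auto
    then show ?thesis using IH 1 by (auto simp: flat_interleave)
  qed
qed auto

text \<open>Every opening adds a key, so a skeleton that is too small for
  \<open>transform_cost\<close> can be enlarged at bounded expense.\<close>

lemma open_more_keys:
  assumes "\<forall>x. Tree x \<in> set s \<longrightarrow> node_sizes_ok B x" "j \<le> length (concat (map flat_item s))"
  shows "\<exists>m t. m \<le> j \<and> (open_node B ^^ m) s t \<and> j \<le> length (item_keys t)"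
  using assms(2)
proof (induction j)
  case 0
  then show ?case by (intro exI[of _ "0::nat"] exI[of _ s]) auto
next
  case (Suc j)
  then obtain m t where t: "m \<le> j" "(open_node B ^^ m) s t" "j \<le> length (item_keys t)" by auto
  show ?case
  proof (cases "Suc j \<le> length (item_keys t)")
    case True
    then show ?thesis using t by (intro exI[of _ m] exI[of _ t]) auto
  next
    case False
    have inv: "concat (map flat_item t) = concat (map flat_item s)" "\<forall>x. Tree x \<in> set t \<longrightarrow> node_sizes_ok B x"
      using open_nodes_invariant[OF t(2) assms(1)] by auto
    have "\<exists>x. Tree x \<in> set t \<and> x \<noteq> BNil"
    proof (rule ccontr)
      assume "\<not> ?thesis"
      then have "concat (map flat_item t) = item_keys t"
      proof (induction t)
        case (Cons a t)
        have IH: "concat (map flat_item t) = item_keys t"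
          by (rule Cons.IH) (use Cons.prems in auto)
        show ?case
        proof (cases a)
          case (Tree x)
          then have "x = BNil" using Cons.prems by auto
          then show ?thesis using IH Tree by simp
        qed (use IH in simp)
      qed auto
      then show False using inv Suc.prems False by simp
    qed
    then obtain x where x: "Tree x \<in> set t" "x \<noteq> BNil" by blast
    have "node_sizes_ok B x" using inv x by blast
    from node_sizes_okE[OF this x(2)] obtain ks ts where xk: "x = node ks ts" "ks \<noteq> []" "length ks \<le> B - 1"
      "length ts = length ks + 1" by (metis (full_types) old.unit.exhaust)
    from x(1) obtain t1 t2 where t12: "t = t1 @ Tree x # t2" by (auto dest: split_list)
    have op: "open_node B t (t1 @ interleave ts ks @ t2)"
      unfolding t12 xk(1) by (rule open_node.intros) (use xk in auto)
    have "length (item_keys (t1 @ interleave ts ks @ t2)) \<ge> Suc j"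
      using t(3) xk(2,4) by (cases ks) (auto simp: t12)
    then show ?thesis using t op by (intro exI[of _ "Suc m"] exI) auto
  qed
qed

text \<open>With at most five further openings on either side, both skeletons have at most
  \<open>n + 5\<close> nodes and the five keys that \<open>transform_cost\<close> asks for; 25 (2 n
  + 10) + 130 = 50 n + 380.\<close>

theorem refold_cost:
  assumes "4 \<le> B" "refold_equiv B n [Tree T] [Tree T']" "node_sizes_ok B T"
    "distinct (0 # keys_inorder T)" "length (keys_inorder T) \<ge> 5"
  shows "reach B (50 * n + 380) (T, []) (T', [])"
proof -
  from assms(2) obtain u i j where u: "i \<le> n" "j \<le> n" "(open_node B ^^ i) [Tree T] u" "(open_node B ^^ j) [Tree T'] u"
    unfolding refold_equiv_def by blast
  have inv: "concat (map flat_item u) = keys_inorder T" "\<forall>x. Tree x \<in> set u \<longrightarrow> node_sizes_ok B x"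
    using open_nodes_invariant[OF u(3)] assms(3) by auto
  from open_more_keys[OF inv(2), of 5] assms(5) inv(1) obtain m v where
    v: "m \<le> 5" "(open_node B ^^ m) u v" "5 \<le> length (item_keys v)" by auto
  have 1: "(open_node B ^^ (i + m)) [Tree T] v" "(open_node B ^^ (j + m)) [Tree T'] v"
    unfolding relpowp_add using u v by auto
  have inv': "concat (map flat_item v) = keys_inorder T"
    using open_nodes_invariant[OF 1(1)] assms(3) by auto
  from open_nodes_skeleton[OF 1(1)] obtain t where t: "node_sizes_ok B t" "nnodes t = i + m"
    "keys_inorder t = item_keys v" "\<And>f lo. item_trees v = map f (lo # item_keys v) \<Longrightarrow> T = inst f t lo"
    by blast
  from open_nodes_skeleton[OF 1(2)] obtain t' where t': "node_sizes_ok B t'" "nnodes t' = j + m"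
    "keys_inorder t' = item_keys v" "\<And>f lo. item_trees v = map f (lo # item_keys v) \<Longrightarrow> T' = inst f t' lo"
    by blast
  have d: "distinct (0 # item_keys v)"
  proof -
    have sub: "set (item_keys w) \<subseteq> set (concat (map flat_item w))" for w
    proof (induction w)
      case (Cons a w)
      then show ?case by (cases a) auto
    qed auto
    have "distinct (concat (map flat_item w)) \<Longrightarrow> distinct (item_keys w)" for w
    proof (induction w)
      case (Cons a w)
      then show ?case using sub[of w] by (cases a) auto
    qed auto
    then show ?thesis using sub[of v] assms(4) inv' by auto
  qed
  \<comment> \<open>The value 0 stands for the gap before the first key, which is why it must differ
    from every key.\<close>
  define f where "f k = the (map_of (zip (0 # item_keys v) (item_trees v)) k)" for k
  have len: "length (item_trees v) = length (0 # item_keys v)"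
    using open_nodes_lengths[OF 1(1)] by simp
  have f: "item_trees v = map f (0 # item_keys v)"
  proof (rule nth_equalityI)
    fix i assume "i < length (item_trees v)"
    then show "item_trees v ! i = map f (0 # item_keys v) ! i"
      using len d map_of_zip_nth[of "0 # item_keys v" "item_trees v" i]
      by (simp add: f_def del: map_of_zip_nth zip_Cons_Cons nth_Cons_Suc list.map distinct.simps)
  qed (use len in simp)
  have "reach B (25 * (nnodes t + nnodes t') + 130) (t, []) (t', [])"
    by (rule transform_cost) (use assms t t' d v in auto)
  from reach_inst[OF this t(1), of f 0] have "reach B (25 * (nnodes t + nnodes t') + 130) (T, []) (T', [])"
    using t(4)[OF f] t'(4)[OF f] by simp
  then show ?thesis by (rule reach_mono) (use t t' u v in auto)
qed


section \<open>Cutting and gluing classic B-trees\<close>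

abbreviation min_keys :: "nat \<Rightarrow> nat" where
  "min_keys B \<equiv> max 1 (B div 2 - 1)"

text \<open>\<open>shape B m g t\<close>: \<open>t\<close> is a link if \<open>g = 0\<close>; otherwise the auxiliary tree at its root is a classic
  B-tree of height \<open>g - 1\<close> with at least \<open>m\<close> keys in the root, whatever the mark of the root.\<close>

fun shape :: "nat \<Rightarrow> nat \<Rightarrow> nat \<Rightarrow> atree \<Rightarrow> bool" where
  "shape B m 0 t = is_link t"
| "shape B m (Suc g) BNil = False"
| "shape B m (Suc g) (BNode a ks ts) = (m \<le> length ks \<and> ks \<noteq> [] \<and> length ks \<le> B - 1 \<and>
     length ts = length ks + 1 \<and> (\<forall>t\<in>set ts. shape B (min_keys B) g t \<and> (0 < g \<longrightarrow> \<not> marked (label t))))"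

definition inner :: "nat \<Rightarrow> nat \<Rightarrow> nat \<Rightarrow> atree \<Rightarrow> bool" where
  "inner B m g t \<longleftrightarrow> shape B m g t \<and> (0 < g \<longrightarrow> \<not> marked (label t))"

abbreviation proper :: "nat \<Rightarrow> nat \<Rightarrow> atree \<Rightarrow> bool" where
  "proper B g t \<equiv> inner B (min_keys B) g t"

lemma shape_node:
  "shape B m (Suc g) (BNode a ks ts) \<longleftrightarrow> m \<le> length ks \<and> ks \<noteq> [] \<and> length ks \<le> B - 1 \<and>
     length ts = length ks + 1 \<and> (\<forall>t\<in>set ts. proper B g t)"
  by (auto simp: inner_def)

declare shape.simps(3) [simp del]

lemma shapeE:
  assumes "shape B m (Suc g) t"
  obtains a ks ts where "t = BNode a ks ts" "m \<le> length ks" "ks \<noteq> []" "length ks \<le> B - 1"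
    "length ts = length ks + 1" "\<forall>t\<in>set ts. proper B g t"
  using assms by (cases t) (auto simp: shape_node)

lemma shape_mono: "shape B m g t \<Longrightarrow> m' \<le> m \<Longrightarrow> shape B m' g t"
  by (cases g; cases t) (auto simp: shape_node)

lemma proper_imp_shape: "proper B g t \<Longrightarrow> shape B 1 g t"
  by (auto simp: inner_def intro: shape_mono)

text \<open>The sequence obtained by opening every node of the auxiliary tree but no link. The
  recursion stops by height instead of by marks, so that marking or unmarking the root does not
  change it.\<close>

fun cont :: "nat \<Rightarrow> atree \<Rightarrow> atree item list" where
  "cont 0 t = [Tree t]"
| "cont (Suc g) BNil = []"
| "cont (Suc g) (BNode a ks ts) = weave (map (cont g) ts) (map Key ks)"

abbreviation conts :: "nat \<Rightarrow> atree list \<Rightarrow> nat list \<Rightarrow> atree item list" where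
  "conts g ts ks \<equiv> weave (map (cont g) ts) (map Key ks)"

lemma weave_append_last:
  "length xs1 = length as \<Longrightarrow> weave (xs1 @ [x @ y]) as = weave (xs1 @ [x]) as @ y"
  by (induction xs1 as rule: list_induct2) auto

lemma weave_Cons_append:
  "weave ((x @ y) # xs) bs = x @ weave (y # xs) bs"
  by (cases bs) auto

lemma weave_glue:
  "length xs1 = length as + 1 \<Longrightarrow>
   weave (xs1 @ xs2) (as @ k # bs) = weave xs1 as @ k # weave xs2 bs"
  by (induction xs1 as rule: interleave_induct) auto

lemma weave_split_last:
  "length xs1 = length as \<Longrightarrow> weave (xs1 @ [x, y]) (as @ [k]) = weave (xs1 @ [x @ k # y]) as"
  by (induction xs1 as rule: list_induct2) auto

text \<open>Labels are erased first: the model charges nothing for marks and recorded depths. New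
  nodes can therefore carry the dummy label of \<open>fresh\<close> until the tree is
  relabelled.\<close>

definition atree_equiv :: "nat \<Rightarrow> nat \<Rightarrow> atree item list \<Rightarrow> atree item list \<Rightarrow> bool" where
  "atree_equiv B n s t \<longleftrightarrow>
     refold_equiv B n (map (map_item erase) s) (map (map_item erase) t)"

lemma atree_equiv_refl: "atree_equiv B n s s"
  by (simp add: atree_equiv_def refold_equiv_refl)

lemma atree_equiv_sym: "atree_equiv B n s t \<Longrightarrow> atree_equiv B n t s"
  by (simp add: atree_equiv_def refold_equiv_sym)

lemma atree_equiv_mono: "atree_equiv B n s t \<Longrightarrow> n \<le> m \<Longrightarrow> atree_equiv B m s t"
  by (auto simp: atree_equiv_def intro: refold_equiv_mono)

lemma atree_equiv_trans:
  "atree_equiv B m s t \<Longrightarrow> atree_equiv B n t u \<Longrightarrow> m + n \<le> p \<Longrightarrow> atree_equiv B p s u"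
  unfolding atree_equiv_def by (blast intro: refold_equiv_trans refold_equiv_mono)

lemma atree_equiv_context:
  "atree_equiv B n s t \<Longrightarrow> x = u @ s @ v \<Longrightarrow> y = u @ t @ v \<Longrightarrow> atree_equiv B n x y"
  by (simp add: atree_equiv_def refold_equiv_context)

lemma erase_node [simp]: "erase (BNode a ks ts) = node ks (map erase ts)"
  by (simp add: erase_def)

lemma erase_BNil [simp]: "erase BNil = BNil"
  by (simp add: erase_def)

lemma map_interleave: "map (map_item f) (interleave ts ks) = interleave (map f ts) ks"
  if "length ts = length ks + 1"
  using that by (induction ts ks rule: interleave_induct) auto

lemma atree_equiv_open:
  assumes "ks \<noteq> []" "length ks \<le> B - 1" "length ts = length ks + 1"
  shows "atree_equiv B 1 [Tree (BNode a ks ts)] (interleave ts ks)"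
  using refold_equiv_open[of ks B "map erase ts"] assms
  by (simp add: atree_equiv_def map_interleave)

abbreviation fresh :: "nat list \<Rightarrow> atree list \<Rightarrow> atree" where
  "fresh \<equiv> BNode (AuxLabel False [] 0 0)"

lemma interleave_glue:
  "length ts1 = length ks1 + 1 \<Longrightarrow>
   interleave (ts1 @ ts2) (ks1 @ k # ks2) = interleave ts1 ks1 @ Key k # interleave ts2 ks2"
  unfolding interleave_def using weave_glue[of "map (\<lambda>t. [Tree t]) ts1" "map Key ks1"] by simp

section \<open>Gluing two classic B-trees with a key between them\<close>

text \<open>The two outcomes of an insertion into a classic B-tree: the height is kept, or the root
  overflows into two halves with a key to be passed up.\<close>

definition glued :: "nat \<Rightarrow> nat \<Rightarrow> nat \<Rightarrow> nat \<Rightarrow> atree item list \<Rightarrow> atree item list \<Rightarrow> bool" where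
  "glued B m g n s c \<longleftrightarrow>
     (\<exists>t. inner B m g t \<and> cont g t = c \<and> atree_equiv B n s [Tree t]) \<or>
     (\<exists>u k v. proper B g u \<and> proper B g v \<and> cont g u @ Key k # cont g v = c \<and>
        atree_equiv B n s [Tree u, Key k, Tree v])"

lemma glued_trans: "atree_equiv B n s s' \<Longrightarrow> glued B m g n' s' c \<Longrightarrow> n + n' \<le> p \<Longrightarrow> glued B m g p s c"
  unfolding glued_def by (blast intro: atree_equiv_trans)

lemma glued_mono: "glued B m g n s c \<Longrightarrow> n \<le> n' \<Longrightarrow> glued B m g n' s c"
  unfolding glued_def by (blast intro: atree_equiv_mono)

lemma fold_level:
  assumes "4 \<le> B" "\<forall>t\<in>set ts. proper B g t" "length ts = length ks + 1"
    "m \<le> length ks" "ks \<noteq> []" "length ks \<le> 2 * B - 1"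
  shows "glued B m (Suc g) 2 (interleave ts ks) (conts g ts ks)"
proof (cases "length ks \<le> B - 1")
  case True
  then have "inner B m (Suc g) (fresh ks ts)" using assms by (auto simp: inner_def shape_node)
  moreover have "atree_equiv B 2 (interleave ts ks) [Tree (fresh ks ts)]"
    using atree_equiv_mono[OF atree_equiv_sym[OF atree_equiv_open]] True assms by simp
  ultimately show ?thesis unfolding glued_def by (intro disjI1 exI[of _ "fresh ks ts"]) simp
next
  case False
  \<comment> \<open>There are at least \<open>B\<close> and at most \<open>2 * B - 1\<close> keys,
    the latter being two full nodes and a key between them. Removing the middle key leaves halves
    within both bounds, given \<open>B\<close> \<ge> 4.\<close>
  define n where "n = (length ks - 1) div 2"
  define ks1 ks2 k where "ks1 = take n ks" and "ks2 = drop (Suc n) ks" and "k = ks ! n"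
  define ts1 ts2 where "ts1 = take (Suc n) ts" and "ts2 = drop (Suc n) ts"
  have n: "n < length ks" using False assms by (auto simp: n_def)
  have ks: "ks = ks1 @ k # ks2" unfolding ks1_def ks2_def k_def using n by (rule id_take_nth_drop)
  have ts: "ts = ts1 @ ts2" by (simp add: ts1_def ts2_def)
  have len: "length ks1 = n" "length ks2 = length ks - Suc n" "length ts1 = n + 1"
    "length ts2 = length ks - n" using n assms by (auto simp: ks1_def ks2_def ts1_def ts2_def)
  have b: "min_keys B \<le> n" "n \<le> B - 1" "min_keys B \<le> length ks - Suc n" "length ks - Suc n \<le> B - 1" "n \<ge> 1"
    using assms(1,6) False by (auto simp: n_def)
  have pr: "proper B (Suc g) (fresh ks1 ts1)" "proper B (Suc g) (fresh ks2 ts2)"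
    using b len assms(2) n Suc_diff_Suc[OF n] unfolding inner_def shape_node
    by (auto simp: ts1_def ts2_def ks1_def ks2_def dest: in_set_takeD in_set_dropD)
  have ne: "ks1 \<noteq> []" "ks2 \<noteq> []" using pr by (auto simp: inner_def shape_node)
  have il: "interleave ts ks = interleave ts1 ks1 @ Key k # interleave ts2 ks2"
    unfolding ks ts by (rule interleave_glue) (simp add: len)
  have e1: "atree_equiv B 1 (interleave ts1 ks1) [Tree (fresh ks1 ts1)]"
    by (rule atree_equiv_sym[OF atree_equiv_open]) (use b len ne in auto)
  have e2: "atree_equiv B 1 (interleave ts2 ks2) [Tree (fresh ks2 ts2)]"
    by (rule atree_equiv_sym[OF atree_equiv_open]) (use b len ne n in auto)
  have "atree_equiv B 1 (interleave ts ks) (Tree (fresh ks1 ts1) # Key k # interleave ts2 ks2)"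
    by (rule atree_equiv_context[OF e1, where u = "[]" and v = "Key k # interleave ts2 ks2"]) (auto simp: il)
  moreover have "atree_equiv B 1 (Tree (fresh ks1 ts1) # Key k # interleave ts2 ks2)
      [Tree (fresh ks1 ts1), Key k, Tree (fresh ks2 ts2)]"
    by (rule atree_equiv_context[OF e2, where u = "[Tree (fresh ks1 ts1), Key k]" and v = "[]"]) auto
  ultimately have "atree_equiv B 2 (interleave ts ks) [Tree (fresh ks1 ts1), Key k, Tree (fresh ks2 ts2)]"
    by (rule atree_equiv_trans) simp
  moreover have "conts g ts ks = conts g ts1 ks1 @ Key k # conts g ts2 ks2"
    unfolding ks ts using weave_glue[of "map (cont g) ts1" "map Key ks1"] len by simp
  ultimately show ?thesis unfolding glued_def using pr
    by (intro disjI2 exI[of _ "fresh ks1 ts1"] exI[of _ k] exI[of _ "fresh ks2 ts2"]) simp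
qed

text \<open>Both roots are opened, and their children and keys with \<open>k\<close> in between are
  folded as one level: 2 openings and 2 for the folding.\<close>

lemma glue_same_height:
  assumes "4 \<le> B" "shape B m1 g t1" "shape B m2 g t2" "m \<le> max m1 m2"
  shows "glued B m g 4 [Tree t1, Key k, Tree t2] (cont g t1 @ Key k # cont g t2)"
proof (cases g)
  case 0
  then show ?thesis using assms atree_equiv_refl unfolding glued_def
    by (intro disjI2) (auto simp: inner_def)
next
  case (Suc h)
  from assms(2)[unfolded Suc] obtain a ks ts where t1: "t1 = BNode a ks ts" "m1 \<le> length ks" "ks \<noteq> []"
    "length ks \<le> B - 1" "length ts = length ks + 1" "\<forall>t\<in>set ts. proper B h t" by (rule shapeE)
  from assms(3)[unfolded Suc] obtain b ls us where t2: "t2 = BNode b ls us" "m2 \<le> length ls" "ls \<noteq> []"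
    "length ls \<le> B - 1" "length us = length ls + 1" "\<forall>t\<in>set us. proper B h t" by (rule shapeE)
  have o1: "atree_equiv B 1 [Tree t1] (interleave ts ks)" unfolding t1 by (rule atree_equiv_open) (use t1 in auto)
  have o2: "atree_equiv B 1 [Tree t2] (interleave us ls)" unfolding t2 by (rule atree_equiv_open) (use t2 in auto)
  have "atree_equiv B 1 [Tree t1, Key k, Tree t2] (interleave ts ks @ [Key k, Tree t2])"
    by (rule atree_equiv_context[OF o1, where u = "[]" and v = "[Key k, Tree t2]"]) auto
  moreover have "atree_equiv B 1 (interleave ts ks @ [Key k, Tree t2]) (interleave (ts @ us) (ks @ k # ls))"
    by (rule atree_equiv_context[OF o2, where u = "interleave ts ks @ [Key k]" and v = "[]"])
       (use t1(5) in \<open>auto simp: interleave_glue\<close>)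
  ultimately have op: "atree_equiv B 2 [Tree t1, Key k, Tree t2] (interleave (ts @ us) (ks @ k # ls))"
    by (rule atree_equiv_trans) simp
  have "glued B m (Suc h) 2 (interleave (ts @ us) (ks @ k # ls)) (conts h (ts @ us) (ks @ k # ls))"
    by (rule fold_level) (use assms t1 t2 in auto)
  moreover have "conts h (ts @ us) (ks @ k # ls) = cont g t1 @ Key k # cont g t2"
    using weave_glue[of "map (cont h) ts" "map Key ks"] t1 t2 Suc by simp
  ultimately show ?thesis using glued_trans[OF op, of m "Suc h" 2 _ 4] Suc by simp
qed

lemma interleave_snoc: "length ts = length ks \<Longrightarrow>
   interleave (ts @ [t]) ks = concat (map2 (\<lambda>t k. [Tree t, Key k]) ts ks) @ [Tree t]"
  by (induction ts ks rule: list_induct2) auto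

lemma interleave_snoc2: "length ts = length ks \<Longrightarrow>
   interleave (ts @ [u, v]) (ks @ [k]) =
   concat (map2 (\<lambda>t k. [Tree t, Key k]) ts ks) @ [Tree u, Key k, Tree v]"
  by (induction ts ks rule: list_induct2) auto

lemma interleave_Cons2: "length ts = length ks \<Longrightarrow>
   interleave (u # v # ts) (k # ks) =
   [Tree u, Key k, Tree v] @ concat (map2 (\<lambda>k t. [Key k, Tree t]) ks ts)"
  using interleave_Cons[of ts ks v] by simp

text \<open>The lower tree is passed down the right spine to its own height; on the way back each
  level absorbs at most one extra key. One for the opening and two for the folding give the factor 3
  per level.\<close>

lemma glue_right_spine:
  assumes "4 \<le> B" "shape B m g1 t1" "shape B 1 g2 t2" "g2 \<le> g1"
  shows "glued B m g1 (3 * (g1 - g2) + 4) [Tree t1, Key k, Tree t2] (cont g1 t1 @ Key k # cont g2 t2)"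
  using assms(2,4)
proof (induction g1 arbitrary: m t1)
  case 0
  then show ?case using glue_same_height[OF assms(1), of m 0 t1 1 t2 m k] assms(3) by auto
next
  case (Suc h)
  show ?case
  proof (cases "g2 = Suc h")
    case True
    then show ?thesis using glue_same_height[OF assms(1), of m "Suc h" t1 1 t2 m k] assms(3) Suc by auto
  next
    case False
    then have le: "g2 \<le> h" using Suc by simp
    from Suc.prems(1) obtain a ks ts where t1: "t1 = BNode a ks ts" "m \<le> length ks" "ks \<noteq> []"
      "length ks \<le> B - 1" "length ts = length ks + 1" "\<forall>t\<in>set ts. proper B h t" by (rule shapeE)
    then obtain us l where ts: "ts = us @ [l]" by (cases ts rule: rev_cases) auto
    have us: "length us = length ks" using t1 ts by simp
    define pre where "pre = concat (map2 (\<lambda>t k. [Tree t, Key k]) us ks)"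
    have op: "atree_equiv B 1 [Tree t1] (pre @ [Tree l])"
      using atree_equiv_open[of ks B ts a] t1 by (simp add: ts interleave_snoc us pre_def)
    have IH: "glued B (min_keys B) h (3 * (h - g2) + 4) [Tree l, Key k, Tree t2] (cont h l @ Key k # cont g2 t2)"
      by (rule Suc.IH) (use t1 ts le in \<open>auto simp: inner_def\<close>)
    have e0: "atree_equiv B 1 [Tree t1, Key k, Tree t2] (pre @ [Tree l, Key k, Tree t2])"
      by (rule atree_equiv_context[OF op, where u = "[]" and v = "[Key k, Tree t2]"]) auto
    have c1: "cont (Suc h) t1 @ Key k # cont g2 t2 =
       weave (map (cont h) us @ [cont h l @ Key k # cont g2 t2]) (map Key ks)"
      unfolding t1 ts using weave_append_last[of "map (cont h) us" "map Key ks"] us by simp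
    have tail: "glued B m (Suc h) (3 * (h - g2) + 6) (pre @ [Tree l, Key k, Tree t2])
       (cont (Suc h) t1 @ Key k # cont g2 t2)"
      using IH unfolding glued_def[of B "min_keys B"]
    proof (elim disjE exE conjE)
      fix t assume t: "inner B (min_keys B) h t" "cont h t = cont h l @ Key k # cont g2 t2"
        "atree_equiv B (3 * (h - g2) + 4) [Tree l, Key k, Tree t2] [Tree t]"
      have "glued B m (Suc h) 2 (interleave (us @ [t]) ks) (conts h (us @ [t]) ks)"
        by (rule fold_level) (use assms t t1 ts in auto)
      moreover have "conts h (us @ [t]) ks = cont (Suc h) t1 @ Key k # cont g2 t2"
        unfolding c1 by (simp add: t)
      moreover have "atree_equiv B (3 * (h - g2) + 4) (pre @ [Tree l, Key k, Tree t2]) (interleave (us @ [t]) ks)"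
        by (rule atree_equiv_context[OF t(3), where u = pre and v = "[]"]) (auto simp: interleave_snoc us pre_def)
      ultimately show ?thesis using glued_trans[where n' = 2 and p = "3 * (h - g2) + 6"] by fastforce
    next
      fix u k' v assume t: "proper B h u" "proper B h v" "cont h u @ Key k' # cont h v = cont h l @ Key k # cont g2 t2"
        "atree_equiv B (3 * (h - g2) + 4) [Tree l, Key k, Tree t2] [Tree u, Key k', Tree v]"
      have "glued B m (Suc h) 2 (interleave (us @ [u, v]) (ks @ [k'])) (conts h (us @ [u, v]) (ks @ [k']))"
        by (rule fold_level) (use assms t t1 ts in auto)
      moreover have "conts h (us @ [u, v]) (ks @ [k']) = cont (Suc h) t1 @ Key k # cont g2 t2"
        unfolding c1 t(3)[symmetric] using weave_split_last[of "map (cont h) us" "map Key ks"] us by simp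
      moreover have "atree_equiv B (3 * (h - g2) + 4) (pre @ [Tree l, Key k, Tree t2]) (interleave (us @ [u, v]) (ks @ [k']))"
        by (rule atree_equiv_context[OF t(4), where u = pre and v = "[]"]) (auto simp: interleave_snoc2 us pre_def)
      ultimately show ?thesis using glued_trans[where n' = 2 and p = "3 * (h - g2) + 6"] by fastforce
    qed
    show ?thesis by (rule glued_trans[OF e0 tail]) (use le in auto)
  qed
qed

lemma glue_left_spine:
  assumes "4 \<le> B" "shape B 1 g1 t1" "shape B m g2 t2" "g1 \<le> g2"
  shows "glued B m g2 (3 * (g2 - g1) + 4) [Tree t1, Key k, Tree t2] (cont g1 t1 @ Key k # cont g2 t2)"
  using assms(3,4)
proof (induction g2 arbitrary: m t2)
  case 0
  then show ?case using glue_same_height[OF assms(1), of 1 0 t1 m t2 m k] assms(2) by auto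
next
  case (Suc h)
  show ?case
  proof (cases "g1 = Suc h")
    case True
    then show ?thesis using glue_same_height[OF assms(1), of 1 "Suc h" t1 m t2 m k] assms(2) Suc by auto
  next
    case False
    then have le: "g1 \<le> h" using Suc by simp
    from Suc.prems(1) obtain a ks ts where t2: "t2 = BNode a ks ts" "m \<le> length ks" "ks \<noteq> []"
      "length ks \<le> B - 1" "length ts = length ks + 1" "\<forall>t\<in>set ts. proper B h t" by (rule shapeE)
    then obtain l us where ts: "ts = l # us" by (cases ts) auto
    have us: "length us = length ks" using t2 ts by simp
    define post where "post = concat (map2 (\<lambda>k t. [Key k, Tree t]) ks us)"
    have op: "atree_equiv B 1 [Tree t2] (Tree l # post)"
      using atree_equiv_open[of ks B ts a] t2 by (simp add: ts interleave_Cons us post_def)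
    have IH: "glued B (min_keys B) h (3 * (h - g1) + 4) [Tree t1, Key k, Tree l] (cont g1 t1 @ Key k # cont h l)"
      by (rule Suc.IH) (use t2 ts le in \<open>auto simp: inner_def\<close>)
    have e0: "atree_equiv B 1 [Tree t1, Key k, Tree t2] ([Tree t1, Key k, Tree l] @ post)"
      by (rule atree_equiv_context[OF op, where u = "[Tree t1, Key k]" and v = "[]"]) auto
    have c1: "cont g1 t1 @ Key k # cont (Suc h) t2 =
       weave ((cont g1 t1 @ Key k # cont h l) # map (cont h) us) (map Key ks)"
      unfolding t2 ts using weave_Cons_append[of "cont g1 t1 @ [Key k]"] by simp
    have tail: "glued B m (Suc h) (3 * (h - g1) + 6) ([Tree t1, Key k, Tree l] @ post)
       (cont g1 t1 @ Key k # cont (Suc h) t2)"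
      using IH unfolding glued_def[of B "min_keys B"]
    proof (elim disjE exE conjE)
      fix t assume t: "inner B (min_keys B) h t" "cont h t = cont g1 t1 @ Key k # cont h l"
        "atree_equiv B (3 * (h - g1) + 4) [Tree t1, Key k, Tree l] [Tree t]"
      have "glued B m (Suc h) 2 (interleave (t # us) ks) (conts h (t # us) ks)"
        by (rule fold_level) (use assms t t2 ts in auto)
      moreover have "conts h (t # us) ks = cont g1 t1 @ Key k # cont (Suc h) t2"
        unfolding c1 by (simp add: t)
      moreover have "atree_equiv B (3 * (h - g1) + 4) ([Tree t1, Key k, Tree l] @ post) (interleave (t # us) ks)"
        by (rule atree_equiv_context[OF t(3), where u = "[]" and v = post]) (auto simp: interleave_Cons us post_def)
      ultimately show ?thesis using glued_trans[where n' = 2 and p = "3 * (h - g1) + 6"] by fastforce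
    next
      fix u k' v assume t: "proper B h u" "proper B h v" "cont h u @ Key k' # cont h v = cont g1 t1 @ Key k # cont h l"
        "atree_equiv B (3 * (h - g1) + 4) [Tree t1, Key k, Tree l] [Tree u, Key k', Tree v]"
      have "glued B m (Suc h) 2 (interleave (u # v # us) (k' # ks)) (conts h (u # v # us) (k' # ks))"
        by (rule fold_level) (use assms t t2 ts in auto)
      moreover have "conts h (u # v # us) (k' # ks) = cont g1 t1 @ Key k # cont (Suc h) t2"
        unfolding c1 t(3)[symmetric] using weave_Cons_append[of "cont h u @ [Key k']" "cont h v"] by simp
      moreover have "atree_equiv B (3 * (h - g1) + 4) ([Tree t1, Key k, Tree l] @ post) (interleave (u # v # us) (k' # ks))"
        by (rule atree_equiv_context[OF t(4), where u = "[]" and v = post]) (auto simp: interleave_Cons us post_def)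
      ultimately show ?thesis using glued_trans[where n' = 2 and p = "3 * (h - g1) + 6"] by fastforce
    qed
    show ?thesis by (rule glued_trans[OF e0 tail]) (use le in auto)
  qed
qed

text \<open>Only an overflow at the top makes a new root, so the height exceeds the larger one by at
  most one.\<close>

lemma glue:
  assumes "4 \<le> B" "shape B 1 g1 t1" "shape B 1 g2 t2"
  shows "\<exists>t g. 0 < g \<and> g \<le> Suc (max g1 g2) \<and> inner B 1 g t \<and> cont g t = cont g1 t1 @ Key k # cont g2 t2 \<and>
    atree_equiv B (3 * (g1 + g2) + 5) [Tree t1, Key k, Tree t2] [Tree t]"
proof -
  let ?g = "max g1 g2"
  have "glued B 1 ?g (3 * (g1 + g2) + 4) [Tree t1, Key k, Tree t2] (cont g1 t1 @ Key k # cont g2 t2)"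
  proof (cases "g2 \<le> g1")
    case True
    then show ?thesis
      using glued_mono[OF glue_right_spine[OF assms True, of k], of "3 * (g1 + g2) + 4"] by (simp add: max_absorb1)
  next
    case False
    then have le: "g1 \<le> g2" by simp
    then show ?thesis
      using glued_mono[OF glue_left_spine[OF assms le, of k], of "3 * (g1 + g2) + 4"] by (simp add: max_absorb2)
  qed
  then show ?thesis unfolding glued_def
  proof (elim disjE exE conjE)
    fix t assume t: "inner B 1 ?g t" "cont ?g t = cont g1 t1 @ Key k # cont g2 t2"
      "atree_equiv B (3 * (g1 + g2) + 4) [Tree t1, Key k, Tree t2] [Tree t]"
    have "0 < ?g"
    proof (rule ccontr)
      assume "\<not> 0 < ?g"
      then have "g1 = 0" "g2 = 0" by auto
      then show False using t(2) by simp
    qed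
    then show ?thesis using t atree_equiv_mono[OF t(3), of "3 * (g1 + g2) + 5"]
      by (intro exI[of _ t] exI[of _ ?g]) auto
  next
    fix u k' v assume t: "proper B ?g u" "proper B ?g v"
      "cont ?g u @ Key k' # cont ?g v = cont g1 t1 @ Key k # cont g2 t2"
      "atree_equiv B (3 * (g1 + g2) + 4) [Tree t1, Key k, Tree t2] [Tree u, Key k', Tree v]"
    have e: "atree_equiv B 1 [Tree u, Key k', Tree v] [Tree (fresh [k'] [u, v])]"
      using atree_equiv_sym[OF atree_equiv_open[of "[k']" B "[u, v]"]] assms(1) by simp
    have "inner B 1 (Suc ?g) (fresh [k'] [u, v])" using t assms(1) by (auto simp: inner_def shape_node)
    then show ?thesis using t atree_equiv_trans[OF t(4) e, of "3 * (g1 + g2) + 5"]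
      by (intro exI[of _ "fresh [k'] [u, v]"] exI[of _ "Suc ?g"]) auto
  qed
qed

section \<open>Splitting a classic B-tree at a key\<close>

text \<open>The two cases are those of a search in a node: \<open>k\<close> is one of its own keys,
  or it lies inside a child.\<close>

lemma weave_locate:
  assumes "length xss = length ks + 1" "weave xss (map Key ks) = al @ Key k # be"
  shows "(\<exists>ks1 ks2 xs1 xs2. ks = ks1 @ k # ks2 \<and> xss = xs1 @ xs2 \<and> length xs1 = length ks1 + 1 \<and>
      length xs2 = length ks2 + 1 \<and> al = weave xs1 (map Key ks1) \<and> be = weave xs2 (map Key ks2)) \<or>
    (\<exists>ks1 ks2 xs1 xs2 al' be'. ks = ks1 @ ks2 \<and> xss = xs1 @ (al' @ Key k # be') # xs2 \<and>
      length xs1 = length ks1 \<and> length xs2 = length ks2 \<and>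
      al = weave (xs1 @ [al']) (map Key ks1) \<and> be = weave (be' # xs2) (map Key ks2))"
    (is "?A ks xss al be \<or> ?B ks xss al be")
  using assms
proof (induction xss ks arbitrary: al rule: interleave_induct)
  case (single x)
  then have "?B [] [x] al be"
    by (intro exI[of _ "[]"] exI[of _ al] exI[of _ be]) auto
  then show ?case ..
next
  case (cons x xss l ks)
  from cons.prems have eq: "x @ Key l # weave xss (map Key ks) = al @ Key k # be" by simp
  then obtain us where "x = al @ us \<and> us @ Key l # weave xss (map Key ks) = Key k # be \<or>
     x @ us = al \<and> Key l # weave xss (map Key ks) = us @ Key k # be"
    by (auto simp: append_eq_append_conv2)
  then show ?case
  proof (elim disjE conjE)
    assume us: "x = al @ us" "us @ Key l # weave xss (map Key ks) = Key k # be"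
    show ?thesis
    proof (cases us)
      case Nil
      then have "?A (l # ks) (x # xss) al be" using us cons.hyps
        by (intro exI[of _ "[]"] exI[of _ ks] exI[of _ "[x]"] exI[of _ xss]) auto
      then show ?thesis ..
    next
      case (Cons y us')
      then have "?B (l # ks) (x # xss) al be" using us cons.hyps
        by (intro exI[of _ "[]"] exI[of _ "l # ks"] exI[of _ "[]"] exI[of _ xss] exI[of _ al] exI[of _ us']) auto
      then show ?thesis ..
    qed
  next
    assume us: "x @ us = al" "Key l # weave xss (map Key ks) = us @ Key k # be"
    show ?thesis
    proof (cases us)
      case Nil
      then have "?A (l # ks) (x # xss) al be" using us cons.hyps
        by (intro exI[of _ "[]"] exI[of _ ks] exI[of _ "[x]"] exI[of _ xss]) auto
      then show ?thesis ..
    next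
      case (Cons y al2)
      then have y: "y = Key l" "weave xss (map Key ks) = al2 @ Key k # be" using us by auto
      from cons.IH[OF y(2)] show ?thesis
      proof
        assume "?A ks xss al2 be"
        then obtain ks1 ks2 xs1 xs2 where a: "ks = ks1 @ k # ks2" "xss = xs1 @ xs2" "length xs1 = length ks1 + 1"
          "length xs2 = length ks2 + 1" "al2 = weave xs1 (map Key ks1)" "be = weave xs2 (map Key ks2)" by blast
        have "?A (l # ks) (x # xss) al be"
          by (intro exI[of _ "l # ks1"] exI[of _ ks2] exI[of _ "x # xs1"] exI[of _ xs2]) (use a us Cons y in auto)
        then show ?thesis ..
      next
        assume "?B ks xss al2 be"
        then obtain ks1 ks2 xs1 xs2 al' be' where a: "ks = ks1 @ ks2" "xss = xs1 @ (al' @ Key k # be') # xs2"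
          "length xs1 = length ks1" "length xs2 = length ks2"
          "al2 = weave (xs1 @ [al']) (map Key ks1)" "be = weave (be' # xs2) (map Key ks2)" by blast
        have "?B (l # ks) (x # xss) al be"
          by (intro exI[of _ "l # ks1"] exI[of _ ks2] exI[of _ "x # xs1"] exI[of _ xs2] exI[of _ al'] exI[of _ be'])
             (use a us Cons y in auto)
        then show ?thesis ..
      qed
    qed
  qed
qed


text \<open>A cut can leave a level without keys; then its only child is the result and the level
  disappears.\<close>

lemma pack_level:
  assumes "\<forall>t\<in>set ts. proper B g t" "length ts = length ks + 1" "length ks \<le> B - 1"
  shows "\<exists>t g'. g \<le> g' \<and> g' \<le> Suc g \<and> shape B 1 g' t \<and> cont g' t = conts g ts ks \<and>
    atree_equiv B 1 (interleave ts ks) [Tree t]"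
proof (cases "ks = []")
  case True
  then obtain t where "ts = [t]" using assms by (auto simp: length_Suc_conv)
  then show ?thesis using assms True proper_imp_shape[of B g t] atree_equiv_refl
    by (intro exI[of _ t] exI[of _ g]) auto
next
  case False
  then show ?thesis using assms atree_equiv_sym[OF atree_equiv_open[of ks B ts]]
    by (intro exI[of _ "fresh ks ts"] exI[of _ "Suc g"]) (auto simp: shape_node Suc_le_eq)
qed

text \<open>The height of the result enters the cost bound with a positive sign: in a recursive split,
  the costs of the successive gluings telescope.\<close>

lemma glue_left_part:
  assumes "4 \<le> B" "\<forall>t\<in>set ts. proper B g t" "length ts = length ks" "length ks \<le> B - 1"
    "shape B 1 g1 c" "g1 \<le> g"
  shows "\<exists>t g' n. g' \<le> Suc g \<and> shape B 1 g' t \<and>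
    cont g' t = weave (map (cont g) ts @ [cont g1 c]) (map Key ks) \<and>
    atree_equiv B n (interleave (ts @ [c]) ks) [Tree t] \<and> n + 3 * g1 \<le> 3 * g' + 5"
proof (cases ks rule: rev_cases)
  case Nil
  then show ?thesis using assms atree_equiv_refl
    by (intro exI[of _ c] exI[of _ g1] exI[of _ 0]) auto
next
  case (snoc ls k)
  then obtain us l where ts: "ts = us @ [l]" "length us = length ls"
    using assms(3) by (cases ts rule: rev_cases) auto
  define pre where "pre = concat (map2 (\<lambda>t k. [Tree t, Key k]) us ls)"
  have il: "interleave (ts @ [c]) ks = pre @ [Tree l, Key k, Tree c]"
    using interleave_snoc2[OF ts(2), of l c k] by (simp add: ts snoc pre_def)
  have ct: "weave (map (cont g) ts @ [cont g1 c]) (map Key ks) =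
     weave (map (cont g) us @ [cont g l @ Key k # cont g1 c]) (map Key ls)"
    using weave_split_last[of "map (cont g) us" "map Key ls" "cont g l" "cont g1 c" "Key k"] ts snoc by simp
  have l: "shape B (min_keys B) g l" using assms(2) ts by (simp add: inner_def)
  have pus: "\<forall>t\<in>set us. proper B g t" using assms(2) ts by simp
  have "glued B (min_keys B) g (3 * (g - g1) + 4) [Tree l, Key k, Tree c] (cont g l @ Key k # cont g1 c)"
    by (rule glue_right_spine[OF assms(1) l assms(5,6)])
  then obtain us' ls' where us': "\<forall>t\<in>set us'. proper B g t" "length us' = length ls' + 1" "length ls' \<le> B - 1"
    "conts g us' ls' = weave (map (cont g) us @ [cont g l @ Key k # cont g1 c]) (map Key ls)"
    "atree_equiv B (3 * (g - g1) + 4) (pre @ [Tree l, Key k, Tree c]) (interleave us' ls')"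
    unfolding glued_def
  proof (elim disjE exE conjE)
    fix t assume t: "proper B g t" "cont g t = cont g l @ Key k # cont g1 c"
      "atree_equiv B (3 * (g - g1) + 4) [Tree l, Key k, Tree c] [Tree t]"
    have "atree_equiv B (3 * (g - g1) + 4) (pre @ [Tree l, Key k, Tree c]) (interleave (us @ [t]) ls)"
      by (rule atree_equiv_context[OF t(3), where u = pre and v = "[]"])
         (auto simp: interleave_snoc ts pre_def)
    then show ?thesis using t pus assms(4) snoc ts by (intro that[of "us @ [t]" ls]) auto
  next
    fix u k' v assume t: "proper B g u" "proper B g v" "cont g u @ Key k' # cont g v = cont g l @ Key k # cont g1 c"
      "atree_equiv B (3 * (g - g1) + 4) [Tree l, Key k, Tree c] [Tree u, Key k', Tree v]"
    have "atree_equiv B (3 * (g - g1) + 4) (pre @ [Tree l, Key k, Tree c]) (interleave (us @ [u, v]) (ls @ [k']))"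
      by (rule atree_equiv_context[OF t(4), where u = pre and v = "[]"])
         (auto simp: interleave_snoc2 ts pre_def)
    moreover have "conts g (us @ [u, v]) (ls @ [k']) = weave (map (cont g) us @ [cont g l @ Key k # cont g1 c]) (map Key ls)"
      using weave_split_last[of "map (cont g) us" "map Key ls" "cont g u" "cont g v" "Key k'"] ts t(3) by simp
    ultimately show ?thesis using t pus assms(4) snoc ts
      by (intro that[of "us @ [u, v]" "ls @ [k']"]) auto
  qed
  from pack_level[OF us'(1-3)] obtain t g' where t: "g \<le> g'" "g' \<le> Suc g" "shape B 1 g' t"
    "cont g' t = conts g us' ls'" "atree_equiv B 1 (interleave us' ls') [Tree t]" by blast
  have "atree_equiv B (3 * (g - g1) + 5) (interleave (ts @ [c]) ks) [Tree t]"
    unfolding il by (rule atree_equiv_trans[OF us'(5) t(5)]) simp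
  then show ?thesis using t us'(4) ct assms(6)
    by (intro exI[of _ t] exI[of _ g'] exI[of _ "3 * (g - g1) + 5"]) auto
qed

lemma glue_right_part:
  assumes "4 \<le> B" "\<forall>t\<in>set ts. proper B g t" "length ts = length ks" "length ks \<le> B - 1"
    "shape B 1 g1 c" "g1 \<le> g"
  shows "\<exists>t g' n. g' \<le> Suc g \<and> shape B 1 g' t \<and>
    cont g' t = weave (cont g1 c # map (cont g) ts) (map Key ks) \<and>
    atree_equiv B n (interleave (c # ts) ks) [Tree t] \<and> n + 3 * g1 \<le> 3 * g' + 5"
proof (cases ks)
  case Nil
  then show ?thesis using assms atree_equiv_refl
    by (intro exI[of _ c] exI[of _ g1] exI[of _ 0]) auto
next
  case (Cons k ls)
  then obtain l us where ts: "ts = l # us" "length us = length ls"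
    using assms(3) by (cases ts) auto
  define post where "post = concat (map2 (\<lambda>k t. [Key k, Tree t]) ls us)"
  have il: "interleave (c # ts) ks = [Tree c, Key k, Tree l] @ post"
    using interleave_Cons2[OF ts(2), of c l k] by (simp add: ts Cons post_def)
  have ct: "weave (cont g1 c # map (cont g) ts) (map Key ks) =
     weave ((cont g1 c @ Key k # cont g l) # map (cont g) us) (map Key ls)"
    using weave_Cons_append[of "cont g1 c @ [Key k]" "cont g l"] ts Cons by simp
  have l: "shape B (min_keys B) g l" using assms(2) ts by (simp add: inner_def)
  have pus: "\<forall>t\<in>set us. proper B g t" using assms(2) ts by simp
  have "glued B (min_keys B) g (3 * (g - g1) + 4) [Tree c, Key k, Tree l] (cont g1 c @ Key k # cont g l)"
    by (rule glue_left_spine[OF assms(1,5) l assms(6)])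
  then obtain us' ls' where us': "\<forall>t\<in>set us'. proper B g t" "length us' = length ls' + 1" "length ls' \<le> B - 1"
    "conts g us' ls' = weave ((cont g1 c @ Key k # cont g l) # map (cont g) us) (map Key ls)"
    "atree_equiv B (3 * (g - g1) + 4) ([Tree c, Key k, Tree l] @ post) (interleave us' ls')"
    unfolding glued_def
  proof (elim disjE exE conjE)
    fix t assume t: "proper B g t" "cont g t = cont g1 c @ Key k # cont g l"
      "atree_equiv B (3 * (g - g1) + 4) [Tree c, Key k, Tree l] [Tree t]"
    have "atree_equiv B (3 * (g - g1) + 4) ([Tree c, Key k, Tree l] @ post) (interleave (t # us) ls)"
      by (rule atree_equiv_context[OF t(3), where u = "[]" and v = post])
         (auto simp: interleave_Cons ts post_def)
    then show ?thesis using t pus assms(4) Cons ts by (intro that[of "t # us" ls]) auto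
  next
    fix u k' v assume t: "proper B g u" "proper B g v" "cont g u @ Key k' # cont g v = cont g1 c @ Key k # cont g l"
      "atree_equiv B (3 * (g - g1) + 4) [Tree c, Key k, Tree l] [Tree u, Key k', Tree v]"
    have "atree_equiv B (3 * (g - g1) + 4) ([Tree c, Key k, Tree l] @ post) (interleave (u # v # us) (k' # ls))"
      by (rule atree_equiv_context[OF t(4), where u = "[]" and v = post])
         (auto simp: interleave_Cons ts post_def)
    moreover have "conts g (u # v # us) (k' # ls) = weave ((cont g1 c @ Key k # cont g l) # map (cont g) us) (map Key ls)"
      using weave_Cons_append[of "cont g u @ [Key k']" "cont g v"] t(3)[symmetric] by simp
    ultimately show ?thesis using t pus assms(4) Cons ts
      by (intro that[of "u # v # us" "k' # ls"]) auto
  qed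
  from pack_level[OF us'(1-3)] obtain t g' where t: "g \<le> g'" "g' \<le> Suc g" "shape B 1 g' t"
    "cont g' t = conts g us' ls'" "atree_equiv B 1 (interleave us' ls') [Tree t]" by blast
  have "atree_equiv B (3 * (g - g1) + 5) (interleave (c # ts) ks) [Tree t]"
    unfolding il by (rule atree_equiv_trans[OF us'(5) t(5)]) simp
  then show ?thesis using t us'(4) ct assms(6)
    by (intro exI[of _ t] exI[of _ g'] exI[of _ "3 * (g - g1) + 5"]) auto
qed

text \<open>Cutting along the search path leaves, on either side of \<open>k\<close>, pieces of
  levels that are glued from the bottom up. One opening and 5 for each of the two gluings make 11
  per level; \<open>3 * (g1 + g2)\<close> is the part that telescopes.\<close>

lemma split_at_key:
  assumes "4 \<le> B" "shape B m g t" "cont g t = al @ Key k # be"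
  shows "\<exists>t1 t2 g1 g2. g1 \<le> g \<and> g2 \<le> g \<and> shape B 1 g1 t1 \<and> shape B 1 g2 t2 \<and>
    cont g1 t1 = al \<and> cont g2 t2 = be \<and>
    atree_equiv B (11 * g + 3 * (g1 + g2)) [Tree t] [Tree t1, Key k, Tree t2]"
  using assms(2,3)
proof (induction g arbitrary: m t al be)
  case 0
  then show ?case by (auto simp: Cons_eq_append_conv)
next
  case (Suc h)
  from Suc.prems(1) obtain a ks ts where t: "t = BNode a ks ts" "m \<le> length ks" "ks \<noteq> []"
    "length ks \<le> B - 1" "length ts = length ks + 1" "\<forall>t\<in>set ts. proper B h t" by (rule shapeE)
  have op: "atree_equiv B 1 [Tree t] (interleave ts ks)"
    unfolding t by (rule atree_equiv_open) (use t in auto)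
  have "weave (map (cont h) ts) (map Key ks) = al @ Key k # be" using Suc.prems t by simp
  note eq = this
  have "length (map (cont h) ts) = length ks + 1" using t by simp
  from weave_locate[OF this eq] show ?case
  proof (elim disjE exE conjE)
    fix ks1 ks2 xs1 xs2
    assume ks: "ks = ks1 @ k # ks2" and xs: "map (cont h) ts = xs1 @ xs2" "length xs1 = length ks1 + 1"
      "length xs2 = length ks2 + 1"
      and ab: "al = weave xs1 (map Key ks1)" "be = weave xs2 (map Key ks2)"
    from xs(1) obtain ts1 ts2 where ts: "ts = ts1 @ ts2" "xs1 = map (cont h) ts1" "xs2 = map (cont h) ts2"
      by (auto simp: map_eq_append_conv)
    have len: "length ts1 = length ks1 + 1" "length ts2 = length ks2 + 1" "length ks1 \<le> B - 1" "length ks2 \<le> B - 1"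
      using xs ts ks t by auto
    have pr: "\<forall>t\<in>set ts1. proper B h t" "\<forall>t\<in>set ts2. proper B h t" using t ts by auto
    from pack_level[OF pr(1) len(1,3)] obtain t1 g1 where 1: "g1 \<le> Suc h" "shape B 1 g1 t1"
      "cont g1 t1 = conts h ts1 ks1" "atree_equiv B 1 (interleave ts1 ks1) [Tree t1]" by blast
    from pack_level[OF pr(2) len(2,4)] obtain t2 g2 where 2: "g2 \<le> Suc h" "shape B 1 g2 t2"
      "cont g2 t2 = conts h ts2 ks2" "atree_equiv B 1 (interleave ts2 ks2) [Tree t2]" by blast
    have il: "interleave ts ks = interleave ts1 ks1 @ Key k # interleave ts2 ks2"
      unfolding ks ts by (rule interleave_glue) (rule len)
    have "atree_equiv B 1 (interleave ts ks) (Tree t1 # Key k # interleave ts2 ks2)"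
      by (rule atree_equiv_context[OF 1(4), where u = "[]" and v = "Key k # interleave ts2 ks2"]) (auto simp: il)
    then have e1: "atree_equiv B 2 [Tree t] (Tree t1 # Key k # interleave ts2 ks2)"
      using atree_equiv_trans[OF op] by simp
    have "atree_equiv B 1 (Tree t1 # Key k # interleave ts2 ks2) [Tree t1, Key k, Tree t2]"
      by (rule atree_equiv_context[OF 2(4), where u = "[Tree t1, Key k]" and v = "[]"]) auto
    then have "atree_equiv B (11 * Suc h + 3 * (g1 + g2)) [Tree t] [Tree t1, Key k, Tree t2]"
      using atree_equiv_trans[OF e1] by simp
    then show ?thesis using 1 2 ab ts
      by (intro exI[of _ t1] exI[of _ t2] exI[of _ g1] conjI exI[of _ g2]) auto
  next
    fix ks1 ks2 xs1 xs2 al' be'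
    assume ks: "ks = ks1 @ ks2" and xs: "map (cont h) ts = xs1 @ (al' @ Key k # be') # xs2"
      "length xs1 = length ks1" "length xs2 = length ks2"
      and ab: "al = weave (xs1 @ [al']) (map Key ks1)" "be = weave (be' # xs2) (map Key ks2)"
    from xs(1) obtain ts1 c ts2 where ts: "ts = ts1 @ c # ts2" "xs1 = map (cont h) ts1"
      "xs2 = map (cont h) ts2" "cont h c = al' @ Key k # be'"
      by (auto simp: map_eq_append_conv map_eq_Cons_conv)
    have len: "length ts1 = length ks1" "length ts2 = length ks2" "length ks1 \<le> B - 1" "length ks2 \<le> B - 1"
      using xs ts ks t by auto
    have pr: "\<forall>t\<in>set ts1. proper B h t" "\<forall>t\<in>set ts2. proper B h t" using t ts by auto
    have "shape B (min_keys B) h c" using t ts by (auto simp: inner_def)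
    from Suc.IH[OF this ts(4)] obtain c1 c2 g1 g2 where c: "g1 \<le> h" "g2 \<le> h" "shape B 1 g1 c1" "shape B 1 g2 c2"
      "cont g1 c1 = al'" "cont g2 c2 = be'"
      "atree_equiv B (11 * h + 3 * (g1 + g2)) [Tree c] [Tree c1, Key k, Tree c2]" by blast
    from glue_left_part[OF assms(1) pr(1) len(1,3) c(3,1)] obtain t1 g1' n1 where 1: "g1' \<le> Suc h"
      "shape B 1 g1' t1" "cont g1' t1 = weave (map (cont h) ts1 @ [cont g1 c1]) (map Key ks1)"
      "atree_equiv B n1 (interleave (ts1 @ [c1]) ks1) [Tree t1]" "n1 + 3 * g1 \<le> 3 * g1' + 5" by blast
    from glue_right_part[OF assms(1) pr(2) len(2,4) c(4,2)] obtain t2 g2' n2 where 2: "g2' \<le> Suc h"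
      "shape B 1 g2' t2" "cont g2' t2 = weave (cont g2 c2 # map (cont h) ts2) (map Key ks2)"
      "atree_equiv B n2 (interleave (c2 # ts2) ks2) [Tree t2]" "n2 + 3 * g2 \<le> 3 * g2' + 5" by blast
    define pre where "pre = concat (map2 (\<lambda>t k. [Tree t, Key k]) ts1 ks1)"
    define post where "post = concat (map2 (\<lambda>k t. [Key k, Tree t]) ks2 ts2)"
    have il: "interleave ts ks = pre @ Tree c # post"
    proof -
      have "length ts1 = length ks1 \<Longrightarrow> interleave (ts1 @ c # ts2) (ks1 @ ks2) =
          concat (map2 (\<lambda>t k. [Tree t, Key k]) ts1 ks1) @ interleave (c # ts2) ks2"
        by (induction ts1 ks1 rule: list_induct2) auto
      then show ?thesis using len ts ks by (simp add: pre_def post_def interleave_Cons)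
    qed
    have il1: "interleave (ts1 @ [c1]) ks1 = pre @ [Tree c1]" by (simp add: interleave_snoc len pre_def)
    have il2: "interleave (c2 # ts2) ks2 = Tree c2 # post" by (simp add: interleave_Cons len post_def)
    have "atree_equiv B (11 * h + 3 * (g1 + g2)) (interleave ts ks) (pre @ [Tree c1, Key k, Tree c2] @ post)"
      by (rule atree_equiv_context[OF c(7), where u = pre and v = post]) (auto simp: il)
    then have e1: "atree_equiv B (11 * h + 3 * (g1 + g2) + 1) [Tree t] (pre @ [Tree c1, Key k, Tree c2] @ post)"
      using atree_equiv_trans[OF op] by simp
    have "atree_equiv B n1 (pre @ [Tree c1, Key k, Tree c2] @ post) (Tree t1 # Key k # Tree c2 # post)"
      by (rule atree_equiv_context[OF 1(4), where u = "[]" and v = "Key k # Tree c2 # post"]) (auto simp: il1)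
    then have e2: "atree_equiv B (11 * h + 3 * (g1 + g2) + 1 + n1) [Tree t] (Tree t1 # Key k # Tree c2 # post)"
      using atree_equiv_trans[OF e1] by simp
    have "atree_equiv B n2 (Tree t1 # Key k # Tree c2 # post) [Tree t1, Key k, Tree t2]"
      by (rule atree_equiv_context[OF 2(4), where u = "[Tree t1, Key k]" and v = "[]"]) (auto simp: il2)
    then have "atree_equiv B (11 * Suc h + 3 * (g1' + g2')) [Tree t] [Tree t1, Key k, Tree t2]"
      by (rule atree_equiv_trans[OF e2]) (use 1(5) 2(5) in simp)
    then show ?thesis using 1 2 ab ts c
      by (intro exI[of _ t1] exI[of _ t2] exI[of _ g1'] conjI exI[of _ g2']) auto
  qed
qed

section \<open>Exchanging a segment of the content\<close>

text \<open>Trees are cut at keys, so a segment can be isolated only if the context borders on it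
  with a key or is empty.\<close>

definition left_ctx :: "'t item list \<Rightarrow> bool" where
  "left_ctx al \<longleftrightarrow> al = [] \<or> (\<exists>s k. al = s @ [Key k])"

definition right_ctx :: "'t item list \<Rightarrow> bool" where
  "right_ctx be \<longleftrightarrow> be = [] \<or> (\<exists>k s. be = Key k # s)"

text \<open>This serves cutting as well as merging. A segment is isolated by two splits and glued
  back after its root has been reinterpreted, which is free: marked as a link it has height 0, and a
  link read as a tree of height \<open>h\<close> contributes its content. The splits cost at most
  \<open>34 * g\<close>, the gluings the rest.\<close>

lemma replace_segment:
  assumes "4 \<le> B" "shape B m g t" "cont g t = al @ mid @ be" "left_ctx al" "right_ctx be"
  shows "\<exists>r g'. g' \<le> g \<and> shape B 1 g' r \<and> cont g' r = mid \<and>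
    (\<forall>r' h. shape B 1 h r' \<longrightarrow> erase r' = erase r \<longrightarrow> al \<noteq> [] \<or> be \<noteq> [] \<longrightarrow>
      (\<exists>t' g''. 0 < g'' \<and> g'' \<le> max g h + 2 \<and> inner B 1 g'' t' \<and> cont g'' t' = al @ cont h r' @ be \<and>
         atree_equiv B (46 * g + 6 * h + 13) [Tree t] [Tree t']))"
proof -
  obtain ts ga t2 where A: "atree_equiv B (17 * g) [Tree t] (ts @ [Tree t2])" "ga \<le> g" "shape B (min m 1) ga t2"
    "cont ga t2 = mid @ be"
    "(al = [] \<and> ts = []) \<or> (\<exists>t1 a g1. ts = [Tree t1, Key a] \<and> g1 \<le> g \<and> shape B 1 g1 t1 \<and> al = cont g1 t1 @ [Key a])"
  proof (cases "al = []")
    case True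
    then show ?thesis using that[of "[]" t g] assms atree_equiv_refl shape_mono[of B m g t "min m 1"] by auto
  next
    case False
    then obtain s a where al: "al = s @ [Key a]" using assms(4) by (auto simp: left_ctx_def)
    have "cont g t = s @ Key a # (mid @ be)" using assms(3) al by simp
    from split_at_key[OF assms(1,2) this] obtain t1 t2 g1 g2 where s: "g1 \<le> g" "g2 \<le> g" "shape B 1 g1 t1"
      "shape B 1 g2 t2" "cont g1 t1 = s" "cont g2 t2 = mid @ be"
      "atree_equiv B (11 * g + 3 * (g1 + g2)) [Tree t] [Tree t1, Key a, Tree t2]" by blast
    have "shape B (min m 1) g2 t2" using s(4) shape_mono by force
    then show ?thesis using that[of "[Tree t1, Key a]" t2 g2] s al atree_equiv_mono[OF s(7), of "17 * g"] by auto
  qed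
  obtain us r gb where C: "atree_equiv B (17 * g) [Tree t2] (Tree r # us)" "gb \<le> g" "shape B 1 gb r" "cont gb r = mid"
    "(be = [] \<and> us = []) \<or> (\<exists>t3 c g3. us = [Key c, Tree t3] \<and> g3 \<le> g \<and> shape B 1 g3 t3 \<and> be = Key c # cont g3 t3)"
  proof (cases "be = []")
    case True
    have "shape B 1 ga t2"
    proof (cases ga)
      case (Suc h)
      with A(3) have "shape B (min m 1) (Suc h) t2" by simp
      then show ?thesis unfolding Suc by (cases t2) (auto simp: shape_node Suc_le_eq)
    qed (use A(3) in auto)
    then show ?thesis using that[of t2 "[]" ga] True A atree_equiv_refl by auto
  next
    case False
    then obtain s c where be: "be = Key c # s" using assms(5) by (auto simp: right_ctx_def)
    have "cont ga t2 = mid @ Key c # s" using A(4) be by simp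
    from split_at_key[OF assms(1) A(3) this] obtain r t3 g1 g2 where s: "g1 \<le> ga" "g2 \<le> ga" "shape B 1 g1 r"
      "shape B 1 g2 t3" "cont g1 r = mid" "cont g2 t3 = s"
      "atree_equiv B (11 * ga + 3 * (g1 + g2)) [Tree t2] [Tree r, Key c, Tree t3]" by blast
    moreover have "g2 \<le> g" "11 * ga + 3 * (g1 + g2) \<le> 17 * g" using s A(2) by auto
    moreover have "atree_equiv B (17 * g) [Tree t2] (Tree r # [Key c, Tree t3])"
      by (rule atree_equiv_mono[OF s(7)]) fact
    ultimately show ?thesis using that[of r "[Key c, Tree t3]" g1] be A(2) by (metis le_trans)
  qed
  have e1: "atree_equiv B (34 * g) [Tree t] (ts @ Tree r # us)"
    by (rule atree_equiv_trans[OF A(1) atree_equiv_context[OF C(1), where u = ts and v = "[]"]]) auto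
  have main: "\<exists>t' g''. 0 < g'' \<and> g'' \<le> max g h + 2 \<and> inner B 1 g'' t' \<and> cont g'' t' = al @ cont h r' @ be \<and>
         atree_equiv B (46 * g + 6 * h + 13) [Tree t] [Tree t']"
    if r': "shape B 1 h r'" "erase r' = erase r" and ne: "al \<noteq> [] \<or> be \<noteq> []" for r' h
  proof -
    have "atree_equiv B (34 * g) (ts @ Tree r # us) (ts @ Tree r' # us) \<and> True"
      using r'(2) by (simp add: atree_equiv_def refold_equiv_refl)
    \<comment> \<open>Equal erasures: exchanging \<open>r\<close> for \<open>r'\<close> takes no
      opening.\<close>
    then have e2: "atree_equiv B (34 * g) [Tree t] (ts @ Tree r' # us)"
      using e1 r'(2) by (simp add: atree_equiv_def)
    obtain u gu where U: "gu \<le> max g h + 1" "inner B 1 gu u \<and> 0 < gu \<or> (u = r' \<and> gu = h \<and> us = [])" "shape B 1 gu u"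
      "cont gu u = cont h r' @ be"
      "atree_equiv B (3 * (g + h) + 5) (Tree r' # us) [Tree u]"
    proof (cases "us = []")
      case True
      then show ?thesis using that[of h r'] C(5) r' atree_equiv_refl by auto
    next
      case False
      then obtain t3 c g3 where t3: "us = [Key c, Tree t3]" "g3 \<le> g" "shape B 1 g3 t3" "be = Key c # cont g3 t3"
        using C(5) by auto
      from glue[OF assms(1) r'(1) t3(3), of c] obtain u gu where u: "0 < gu" "gu \<le> Suc (max h g3)" "inner B 1 gu u"
        "cont gu u = cont h r' @ Key c # cont g3 t3"
        "atree_equiv B (3 * (h + g3) + 5) [Tree r', Key c, Tree t3] [Tree u]" by blast
      show ?thesis
        by (rule that[of gu u]) (use u t3 atree_equiv_mono[OF u(5), of "3 * (g + h) + 5"] in \<open>auto simp: inner_def\<close>)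
    qed
    have e3: "atree_equiv B (37 * g + 3 * h + 5) [Tree t] (ts @ [Tree u])"
      by (rule atree_equiv_trans[OF e2 atree_equiv_context[OF U(5), where u = ts and v = "[]"]]) auto
    show ?thesis
    proof (cases "ts = []")
      case True
      then have "al = []" using A(5) by auto
      then have "us \<noteq> []" using ne C(5) by auto
      then show ?thesis using U e3 True \<open>al = []\<close> atree_equiv_mono[OF e3, of "46 * g + 6 * h + 13"]
        by (intro exI[of _ u] exI[of _ gu]) auto
    next
      case False
      then obtain t1 a g1 where t1: "ts = [Tree t1, Key a]" "g1 \<le> g" "shape B 1 g1 t1" "al = cont g1 t1 @ [Key a]"
        using A(5) by auto
      from glue[OF assms(1) t1(3) U(3), of a] obtain v gv where v: "0 < gv" "gv \<le> Suc (max g1 gu)" "inner B 1 gv v"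
        "cont gv v = cont g1 t1 @ Key a # cont gu u"
        "atree_equiv B (3 * (g1 + gu) + 5) [Tree t1, Key a, Tree u] [Tree v]" by blast
      have "atree_equiv B (46 * g + 6 * h + 13) [Tree t] [Tree v]"
        by (rule atree_equiv_trans[OF e3]) (use v(5) t1 U(1) in auto)
      then show ?thesis using v t1 U by (intro exI[of _ v] exI[of _ gv]) auto
    qed
  qed
  show ?thesis by (intro exI[of _ r] exI[of _ gb]) (use C main in blast)
qed

text \<open>Gluing one link and one key at a time in front yields a classic B-tree for any sequence.
  Cost is not tracked, since the initial tree is not charged.\<close>

lemma grow:
  assumes "4 \<le> B" "\<forall>t\<in>set ts. is_link t" "length ts = length ks + 1"
  shows "\<exists>t g. shape B 1 g t \<and> cont g t = interleave ts ks \<and> (ks \<noteq> [] \<longrightarrow> 0 < g)"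
  using assms(3,2)
proof (induction ts ks rule: interleave_induct)
  case (single t)
  then show ?case by (intro exI[of _ t] exI[of _ 0]) auto
next
  case (cons t ts k ks)
  then obtain u g where u: "shape B 1 g u" "cont g u = interleave ts ks" by auto
  have "shape B 1 0 t" using cons.prems by simp
  from glue[OF assms(1) this u(1), of k] obtain v gv where "0 < gv" "inner B 1 gv v"
    "cont gv v = cont 0 t @ Key k # cont g u" by blast
  then show ?case using u by (intro exI[of _ v] exI[of _ gv]) (auto simp: inner_def)
qed


section \<open>Preferred paths and Belga B-trees as sequences\<close>

lemma classic_iff_shape: "1 \<le> m \<Longrightarrow> classic B m h t \<longleftrightarrow> shape B m (Suc h) t"
proof (induction h arbitrary: m t)
  case 0
  show ?case using 0 by (subst classic.simps, cases t) (auto simp: shape_node inner_def Suc_le_eq)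
next
  case (Suc h)
  have "(\<not> is_link t \<and> classic B (min_keys B) h t) \<longleftrightarrow> proper B (Suc h) t" for t
    using Suc.IH[of "min_keys B" t] by (cases t) (auto simp: is_link_def inner_def)
  then show ?case using Suc.prems
    by (subst classic.simps, cases t) (auto simp: shape_node Suc_le_eq)
qed

section \<open>Alternating sequences of trees and keys\<close>

text \<open>Such a sequence is determined by the list of its keys and the list of its trees, which
  reconciles \<open>linked\<close>, stated with two lists, with the view by sequences.\<close>

definition alternating :: "'t item list \<Rightarrow> bool" where
  "alternating s \<longleftrightarrow> (\<exists>ts ks. length ts = length ks + 1 \<and> s = interleave ts ks)"

lemma alternating_single: "alternating [Tree t]"
  unfolding alternating_def by (intro exI[of _ "[t]"] exI[of _ "[]"]) auto

lemma alternating_append: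
  assumes "alternating s" "alternating s'"
  shows "alternating (s @ Key k # s')"
proof -
  from assms obtain ts ks ts' ks' where "length ts = length ks + 1" "s = interleave ts ks"
    "length ts' = length ks' + 1" "s' = interleave ts' ks'" by (auto simp: alternating_def)
  then show ?thesis unfolding alternating_def
    by (intro exI[of _ "ts @ ts'"] exI[of _ "ks @ k # ks'"]) (auto simp: interleave_glue)
qed

lemma alternating_weave:
  assumes "length xss = length ks + 1" "\<forall>x\<in>set xss. alternating x"
  shows "alternating (weave xss (map Key ks))"
  using assms by (induction xss ks rule: interleave_induct) (auto intro: alternating_append)

lemma alternating_eq:
  assumes "alternating s"
  shows "s = interleave (item_trees s) (item_keys s)" "length (item_trees s) = length (item_keys s) + 1"
  using assms by (auto simp: alternating_def)

lemma alternating_cont: "shape B m g t \<Longrightarrow> alternating (cont g t)"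
proof (induction g arbitrary: m t)
  case 0
  then show ?case by (simp add: alternating_single)
next
  case (Suc g)
  then obtain a ks ts where t: "t = BNode a ks ts" "length ts = length ks + 1"
    "\<forall>t\<in>set ts. proper B g t" by (auto elim!: shapeE)
  have "\<forall>u\<in>set ts. alternating (cont g u)" using t(3) Suc.IH by (auto simp: inner_def)
  then show ?case using t alternating_weave[of "map (cont g) ts" ks] by simp
qed

lemma item_trees_weave: "length us = length ks + 1 \<Longrightarrow> item_trees (weave us (map Key ks)) = concat (map item_trees us)"
  by (induction us ks rule: interleave_induct) auto

text \<open>The bridge from definitions by marks (\<open>prune\<close>, \<open>hung\<close>) to
  \<open>cont\<close>, which goes by height: below a proper node, links sit exactly at height
  0.\<close>

lemma prune_cont:
  "proper B g t \<Longrightarrow> keys_inorder (prune t) = item_keys (cont g t) \<and> hung t = item_trees (cont g t)"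
proof (induction g arbitrary: t)
  case 0
  then show ?case by (cases t) (auto simp: inner_def is_link_def)
next
  case (Suc g)
  then have "shape B (min_keys B) (Suc g) t" "\<not> marked (label t)" by (auto simp: inner_def)
  then obtain a ks ts where t: "t = BNode a ks ts" "length ts = length ks + 1"
    "\<forall>t\<in>set ts. proper B g t" "\<not> marked a" by (auto elim!: shapeE)
  have 1: "map (keys_inorder \<circ> prune) ts = map (item_keys \<circ> cont g) ts"
    and 2: "map hung ts = map (item_trees \<circ> cont g) ts"
    using Suc.IH t(3) by auto
  show ?case using t 1 2 by (simp add: weave_item_keys item_trees_weave del: map_eq_conv)
qed

lemma aux_tree_cont:
  assumes "shape B m (Suc g) t"
  shows "keys_inorder (aux_tree t) = item_keys (cont (Suc g) t)" "links t = item_trees (cont (Suc g) t)"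
proof -
  from assms obtain a ks ts where t: "t = BNode a ks ts" "length ts = length ks + 1"
    "\<forall>t\<in>set ts. proper B g t" by (auto elim!: shapeE)
  have 1: "map (keys_inorder \<circ> prune) ts = map (item_keys \<circ> cont g) ts"
    and 2: "map hung ts = map (item_trees \<circ> cont g) ts"
    using prune_cont t(3) by auto
  show "keys_inorder (aux_tree t) = item_keys (cont (Suc g) t)" "links t = item_trees (cont (Suc g) t)"
    using t 1 2 by (simp_all add: weave_item_keys item_trees_weave links_def del: map_eq_conv)
qed

lemma cont_has_key: "shape B m (Suc g) t \<Longrightarrow> item_keys (cont (Suc g) t) \<noteq> []"
proof (elim shapeE)
  fix a ks ts assume t: "t = BNode a ks ts" "ks \<noteq> []" "length ts = length ks + 1"
  have "item_keys (cont (Suc g) t) = weave (map (item_keys \<circ> cont g) ts) ks"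
    using t by (simp add: weave_item_keys)
  then show ?thesis using t by (cases ks; cases ts) auto
qed

lemma cont_single_link: "shape B m g t \<Longrightarrow> cont g t = [Tree s] \<Longrightarrow> g = 0 \<and> t = s"
  using cont_has_key[of B m "g - 1" t] by (cases g) auto

fun flat_with :: "('t \<Rightarrow> nat list) \<Rightarrow> 't item \<Rightarrow> nat list" where
  "flat_with f (Key k) = [k]" | "flat_with f (Tree t) = f t"

abbreviation flats :: "('t \<Rightarrow> nat list) \<Rightarrow> 't item list \<Rightarrow> nat list" where
  "flats f s \<equiv> concat (map (flat_with f) s)"

lemma flats_weave: "length us = length ks + 1 \<Longrightarrow> flats f (weave us (map Key ks)) = weave (map (flats f) us) ks"
  by (induction us ks rule: interleave_induct) auto

lemma flats_cont: "shape B m g t \<Longrightarrow> flats keys_inorder (cont g t) = keys_inorder t"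
proof (induction g arbitrary: m t)
  case (Suc g)
  then obtain a ks ts where t: "t = BNode a ks ts" "length ts = length ks + 1"
    "\<forall>t\<in>set ts. proper B g t" by (auto elim!: shapeE)
  have "map (flats keys_inorder \<circ> cont g) ts = map keys_inorder ts"
    using Suc.IH t(3) by (auto simp: inner_def)
  then show ?case using t by (simp add: flats_weave del: map_eq_conv)
qed simp

lemma node_sizes_ok_cont:
  "shape B m g t \<Longrightarrow> (\<forall>s\<in>set (item_trees (cont g t)). node_sizes_ok B s) \<Longrightarrow> node_sizes_ok B t"
proof (induction g arbitrary: m t)
  case (Suc g)
  then obtain a ks ts where t: "t = BNode a ks ts" "ks \<noteq> []" "length ks \<le> B - 1" "length ts = length ks + 1"
    "\<forall>t\<in>set ts. proper B g t" by (auto elim!: shapeE)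
  have "\<forall>u\<in>set ts. node_sizes_ok B u"
    using Suc.IH Suc.prems(2) t by (auto simp: inner_def item_trees_weave)
  then show ?case using t by (auto simp: Suc_le_eq)
qed simp

text \<open>One more than the number of keys is the number of links, and this number multiplies at
  least by the fan-out at every level.\<close>

lemma cont_height_keys:
  "proper B g t \<Longrightarrow> (min_keys B + 1) ^ g \<le> length (item_keys (cont g t)) + 1"
proof (induction g arbitrary: t)
  case (Suc g)
  then have "shape B (min_keys B) (Suc g) t" by (auto simp: inner_def)
  then obtain a ks ts where t: "t = BNode a ks ts" "min_keys B \<le> length ks" "length ts = length ks + 1"
    "\<forall>t\<in>set ts. proper B g t" by (auto elim!: shapeE)
  let ?q = "min_keys B + 1"
  have "(length ks + 1) * ?q ^ g \<le> length (item_keys (cont (Suc g) t)) + 1"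
    using t(3,4) unfolding t(1)
  proof (induction ts ks rule: interleave_induct)
    case (single u)
    then show ?case using Suc.IH[of u] by simp
  next
    case (cons u ts k ks)
    have "?q ^ g \<le> length (item_keys (cont g u)) + 1" using Suc.IH[of u] cons.prems by simp
    then show ?case using cons by (simp add: add_mult_distrib)
  qed
  moreover have "?q ^ Suc g \<le> (length ks + 1) * ?q ^ g" using t(2) by (simp add: mult_le_mono1)
  ultimately show ?case by linarith
qed simp

lemma root_height_keys:
  assumes "shape B 1 (Suc h) t"
  shows "(min_keys B + 1) ^ h \<le> length (item_keys (cont (Suc h) t)) + 1"
proof -
  from assms obtain a ks ts where t: "t = BNode a ks ts" "length ts = length ks + 1"
    "\<forall>t\<in>set ts. proper B h t" by (auto elim!: shapeE)
  then obtain s where s: "s \<in> set ts" by (cases ts) auto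
  have "length (item_keys (cont h s)) \<le> length (item_keys (cont (Suc h) t))"
    using t(2) s unfolding t(1) by (induction ts ks rule: interleave_induct) auto
  then show ?thesis using cont_height_keys[of B h s] t s by fastforce
qed

text \<open>The minimal fan-out \<open>?q\<close> below the root is at least 2 and satisfies
  \<open>B\<close> \<le> 2 q + 1 \<le> q^3, so the factor 3 pays for the change of base. Passing
  from n + 1 to 2 n adds log 2 to base B, which is at most 1.\<close>

lemma height_le_log:
  assumes "2 \<le> B" "shape B 1 (Suc h) t" "n = length (item_keys (cont (Suc h) t))"
  shows "real h \<le> 3 * (1 + log (real B) (real n))"
proof -
  let ?q = "min_keys B + 1"
  have n: "n \<ge> 1" using cont_has_key[OF assms(2)] assms(3) by (simp add: Suc_le_eq)
  have "B \<le> 2 * ?q + 1" by auto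
  also have "\<dots> \<le> ?q * ?q * ?q"
  proof -
    have *: "2 * q + 1 \<le> q * q * q" if q: "2 \<le> q" for q :: nat
    proof -
      have "4 \<le> q * q" using mult_le_mono[OF q q] by simp
      then have "4 * q \<le> q * q * q" by (rule mult_le_mono1)
      then show ?thesis using q by linarith
    qed
    show ?thesis by (rule *) simp
  qed
  finally have "B \<le> ?q ^ 3" by (simp add: power3_eq_cube)
  then have "B ^ h \<le> (?q ^ 3) ^ h" by (rule power_mono) simp
  also have "\<dots> = (?q ^ h) ^ 3" by (simp add: power_mult[symmetric] mult.commute)
  also have "\<dots> \<le> (n + 1) ^ 3"
    using root_height_keys[OF assms(2)] assms(3) by (intro power_mono) auto
  also have "\<dots> \<le> (2 * n) ^ 3" using n by (intro power_mono) auto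
  finally have "real (B ^ h) \<le> real ((2 * n) ^ 3)" by (simp only: of_nat_le_iff)
  then have "real B ^ h \<le> (2 * real n) ^ 3" by (simp only: of_nat_mult of_nat_numeral of_nat_power)
  then have "log B (real B ^ h) \<le> log B ((2 * real n) ^ 3)" using assms(1) n by (subst log_le_cancel_iff) auto
  moreover have "log B (real B ^ h) = h" using assms(1) by (simp add: log_nat_power)
  moreover have "log B ((2 * real n) ^ 3) = 3 * log B (2 * real n)"
    using assms(1) n by (subst log_nat_power) auto
  ultimately have "real h \<le> 3 * log B (2 * real n)" by linarith
  also have "log B (2 * real n) = log B 2 + log B (real n)" using assms(1) n by (simp add: log_mult)
  also have "log B 2 \<le> log B B" using assms(1) by (subst log_le_cancel_iff) auto
  finally show ?thesis using assms(1) by simp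
qed

section \<open>Preferred paths as sequences\<close>

fun path_seq :: "preference \<Rightarrow> nat tree \<Rightarrow> nat tree item list" where
  "path_seq pref \<langle>\<rangle> = [Tree \<langle>\<rangle>]"
| "path_seq pref \<langle>l, v, r\<rangle> =
    (case pref v of L \<Rightarrow> path_seq pref l @ [Key v, Tree r] | R \<Rightarrow> Tree l # Key v # path_seq pref r)"

lemma path_seq_parts:
  "item_keys (path_seq pref P) = preferred_path pref P" "item_trees (path_seq pref P) = hanging pref P"
  by (induction P) (auto split: side.splits)

lemma alternating_path_seq: "alternating (path_seq pref P)"
proof (induction P)
  case (Node l v r)
  then show ?case
    using alternating_append[OF _ alternating_single, of "path_seq pref l" v r]
      alternating_append[OF alternating_single, of "path_seq pref r" l v]
    by (auto split: side.splits)
qed (simp add: alternating_single)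

lemma flats_path_seq: "flats inorder (path_seq pref P) = inorder P"
  by (induction P) (auto split: side.splits)

lemma rel_interleave:
  assumes "length ps = length ks + 1" "length ts = length ks' + 1"
  shows "list_all2 (rel_item Q) (interleave ps ks) (interleave ts ks') \<longleftrightarrow> ks = ks' \<and> list_all2 Q ps ts"
  using assms
proof (induction ps ks arbitrary: ts ks' rule: interleave_induct)
  case (single p)
  then show ?case by (cases ks'; cases ts) auto
next
  case (cons p ps k ks)
  show ?case
  proof (cases ks')
    case Nil
    then show ?thesis using cons.prems by (auto simp: length_Suc_conv)
  next
    case (Cons k' ls)
    then show ?thesis using cons by (cases ts) auto
  qed
qed

lemma linked_Leaf_iff: "linked B pref \<langle>\<rangle> T \<longleftrightarrow> T = BNil"
  by (subst linked.simps) auto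

text \<open>Being linked becomes a pointwise relation between two sequences, so a segment taken out
  on one side can be followed on the other.\<close>

lemma linked_iff:
  assumes "P \<noteq> \<langle>\<rangle>"
  shows "linked B pref P T \<longleftrightarrow> marked (label T) \<and> (\<exists>h. shape B 1 (Suc h) T \<and>
    list_all2 (rel_item (linked B pref)) (path_seq pref P) (cont (Suc h) T))"
proof -
  have "(keys_inorder (aux_tree T) = preferred_path pref P \<and> list_all2 (linked B pref) (hanging pref P) (links T)) \<longleftrightarrow>
     list_all2 (rel_item (linked B pref)) (path_seq pref P) (cont (Suc h) T)" if "shape B 1 (Suc h) T" for h
  proof -
    note a = alternating_eq[OF alternating_path_seq[of pref P]] alternating_eq[OF alternating_cont[OF that]]
    show ?thesis
      using rel_interleave[OF a(2) a(4), of "linked B pref"] a(1,3)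
      unfolding aux_tree_cont[OF that] path_seq_parts by auto
  qed
  then show ?thesis using assms
    by (subst linked.simps) (auto simp: classic_iff_shape)
qed

lemma linked_induct [consumes 1, case_names Leaf Node]:
  assumes "linked B pref P T"
    "Q \<langle>\<rangle> BNil"
    "\<And>P T h. P \<noteq> \<langle>\<rangle> \<Longrightarrow> marked (label T) \<Longrightarrow> shape B 1 (Suc h) T \<Longrightarrow>
      list_all2 (rel_item (\<lambda>p t. linked B pref p t \<and> Q p t)) (path_seq pref P) (cont (Suc h) T) \<Longrightarrow> Q P T"
  shows "Q P T"
  using assms(1)
proof (induction rule: linked.induct)
  case 1
  then show ?case by (rule assms(2))
next
  case (2 P T h)
  have s: "shape B 1 (Suc h) T" using 2 by (simp add: classic_iff_shape)
  note a = alternating_eq[OF alternating_path_seq[of pref P]] alternating_eq[OF alternating_cont[OF s]]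
  have "list_all2 (\<lambda>p t. linked B pref p t \<and> Q p t) (hanging pref P) (links T)"
    using 2 by (auto elim: list_all2_mono)
  then have "list_all2 (rel_item (\<lambda>p t. linked B pref p t \<and> Q p t)) (path_seq pref P) (cont (Suc h) T)"
    using rel_interleave[OF a(2) a(4), of "\<lambda>p t. linked B pref p t \<and> Q p t"] a(1,3) 2(4)
    unfolding aux_tree_cont[OF s] path_seq_parts by auto
  then show ?case using 2 s by (intro assms(3)) auto
qed

lemma flats_rel:
  "list_all2 (rel_item (\<lambda>p t. f p = f' t)) s s' \<Longrightarrow> flats f s = flats f' s'"
proof (induction rule: list_all2_induct)
  case (Cons x xs y ys)
  then show ?case by (cases x; cases y) auto
qed simp

lemma linked_inorder: "linked B pref P T \<Longrightarrow> keys_inorder T = inorder P"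
proof (induction rule: linked_induct)
  case (Node P T h)
  have "flats inorder (path_seq pref P) = flats keys_inorder (cont (Suc h) T)"
    by (rule flats_rel, rule list_all2_mono[OF Node(4)]) (auto elim!: item.rel_mono_strong)
  then show ?case using flats_cont[OF Node(3)] flats_path_seq by metis
qed simp

lemma rel_item_trees:
  assumes "list_all2 (rel_item Q) s s'" "t \<in> set (item_trees s')"
  shows "\<exists>p\<in>set (item_trees s). Q p t"
  using assms
proof (induction rule: list_all2_induct)
  case (Cons x xs y ys)
  then show ?case by (cases x; cases y) auto
qed simp

lemma linked_node_sizes_ok: "linked B pref P T \<Longrightarrow> node_sizes_ok B T"
proof (induction rule: linked_induct)
  case (Node P T h)
  then show ?case by (intro node_sizes_ok_cont[OF Node(3)]) (auto dest: rel_item_trees)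
qed simp

lemma set_tree_path_seq:
  "p \<in> set (item_trees (path_seq pref P)) \<Longrightarrow> set_tree p \<subseteq> set_tree P"
  by (induction P) (auto split: side.splits)

lemma path_seq_cong: "(\<And>v. v \<in> set_tree P \<Longrightarrow> pref v = pref' v) \<Longrightarrow> path_seq pref P = path_seq pref' P"
  by (induction P) (auto split: side.splits)

lemma list_all2_rel_item_mono:
  assumes "list_all2 (rel_item Q) s s'"
    "\<And>p t. p \<in> set (item_trees s) \<Longrightarrow> t \<in> set (item_trees s') \<Longrightarrow> Q p t \<Longrightarrow> Q' p t"
  shows "list_all2 (rel_item Q') s s'"
  using assms
proof (induction rule: list_all2_induct)
  case (Cons x xs y ys)
  then show ?case by (cases x; cases y) auto
qed simp

text \<open>Preferences outside \<open>P\<close> are never consulted; links that do not contain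
  \<open>w\<close> therefore survive a change at \<open>w\<close>.\<close>

lemma linked_cong:
  "linked B pref P T \<Longrightarrow> (\<And>v. v \<in> set_tree P \<Longrightarrow> pref v = pref' v) \<Longrightarrow> linked B pref' P T"
proof (induction rule: linked_induct)
  case Leaf
  then show ?case by (simp add: linked_Leaf_iff)
next
  case (Node P T h)
  have "list_all2 (rel_item (linked B pref')) (path_seq pref P) (cont (Suc h) T)"
    by (rule list_all2_rel_item_mono[OF Node(4)]) (use Node.prems set_tree_path_seq in blast)
  then show ?case using Node path_seq_cong[of P pref pref'] by (auto simp: linked_iff)
qed

section \<open>Restoring labels and marks\<close>

text \<open>Cutting and gluing leave labels stale. Recomputing them does not change the erased tree,
  so it is free, and it fixes trees that are labelled already, so untouched links stay the
  same.\<close>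

fun relabel :: "nat tree \<Rightarrow> atree \<Rightarrow> atree" where
  "relabel P BNil = BNil"
| "relabel P (BNode a ks ts) =
    BNode (AuxLabel (marked a) (map (depth P) ks)
        (Min (depth P ` keys (aux_tree (BNode a ks ts))))
        (Max (depth P ` keys (aux_tree (BNode a ks ts))))) ks (map (relabel P) ts)"

lemma keys_inorder_prune_relabel: "keys_inorder (prune (relabel P t)) = keys_inorder (prune t)"
  by (induction t) (auto intro!: arg_cong[where f = "\<lambda>x. weave x _"])

lemma keys_inorder_aux_relabel: "keys_inorder (aux_tree (relabel P t)) = keys_inorder (aux_tree t)"
  by (cases t) (auto simp: keys_inorder_prune_relabel comp_def)

lemma labelled_relabel: "labelled P (relabel P t)"
proof (induction t)
  case (BNode a ks ts)
  have "keys (aux_tree (relabel P (BNode a ks ts))) = keys (aux_tree (BNode a ks ts))"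
    unfolding keys_def keys_inorder_aux_relabel ..
  then show ?case using BNode by (simp del: aux_tree.simps)
qed simp

lemma relabel_labelled: "labelled P t \<Longrightarrow> relabel P t = t"
proof (induction t)
  case (BNode a ks ts)
  then show ?case by (cases a) (auto simp del: aux_tree.simps intro: map_idI)
qed simp

lemma erase_relabel [simp]: "erase (relabel P t) = erase t"
  by (induction t) auto

lemma is_link_relabel [simp]: "is_link (relabel P t) = is_link t"
  by (cases t) (auto simp: is_link_def)

lemma marked_relabel: "t \<noteq> BNil \<Longrightarrow> marked (label (relabel P t)) = marked (label t)"
  by (cases t) auto

lemma shape_relabel: "shape B m g t \<Longrightarrow> shape B m g (relabel P t)"
proof (induction g arbitrary: m t)
  case (Suc g)
  then obtain a ks ts where t: "t = BNode a ks ts" "m \<le> length ks" "ks \<noteq> []" "length ks \<le> B - 1"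
    "length ts = length ks + 1" "\<forall>t\<in>set ts. proper B g t" by (auto elim!: shapeE)
  have "proper B g (relabel P u)" if "u \<in> set ts" for u
  proof -
    have u: "shape B (min_keys B) g u" "0 < g \<longrightarrow> \<not> marked (label u)" using t(6) that by (auto simp: inner_def)
    have "u \<noteq> BNil" if "0 < g" using u(1) that by (cases g) auto
    then show ?thesis using Suc.IH[OF u(1)] u(2) marked_relabel[of u P] by (auto simp: inner_def)
  qed
  then show ?case using t by (auto simp: shape_node)
qed simp

lemma cont_relabel: "cont g (relabel P t) = map (map_item (relabel P)) (cont g t)"
proof (induction g arbitrary: t)
  case (Suc g)
  have m: "map h (weave xss ks) = weave (map (map h) xss) (map h ks)" for h :: "atree item \<Rightarrow> atree item" and xss ks
    by (induction xss ks rule: weave.induct) (auto simp: map_concat)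
  show ?case by (cases t) (auto simp: Suc m comp_def)
qed simp

lemma list_all2_map_item: "list_all2 (rel_item Q) s (map (map_item f) s') \<longleftrightarrow> list_all2 (rel_item (\<lambda>p t. Q p (f t))) s s'"
  by (simp add: list_all2_map2 item.rel_map)

lemma linked_relabel: "linked B pref P T \<Longrightarrow> linked B pref P (relabel P' T)"
proof (induction rule: linked_induct)
  case Leaf
  then show ?case by (simp add: linked_Leaf_iff)
next
  case (Node P T h)
  have "list_all2 (rel_item (linked B pref)) (path_seq pref P) (cont (Suc h) (relabel P' T))"
    unfolding cont_relabel list_all2_map_item
    by (rule list_all2_rel_item_mono[OF Node(4)]) auto
  moreover have "T \<noteq> BNil" using Node(3) by auto
  ultimately show ?case using Node shape_relabel[OF Node(3), of P'] by (auto simp: linked_iff marked_relabel)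
qed

lemma labelled_cont:
  "shape B m g T \<Longrightarrow> labelled P T \<Longrightarrow> t \<in> set (item_trees (cont g T)) \<Longrightarrow> labelled P t"
proof (induction g arbitrary: m T)
  case (Suc g)
  then obtain a ks ts where t: "T = BNode a ks ts" "length ts = length ks + 1"
    "\<forall>t\<in>set ts. proper B g t" by (auto elim!: shapeE)
  then show ?case using Suc.IH Suc.prems by (auto simp: item_trees_weave inner_def)
qed simp

fun set_mark :: "atree \<Rightarrow> atree" where
  "set_mark BNil = BNil"
| "set_mark (BNode a ks ts) = BNode (AuxLabel True [] 0 0) ks ts"

lemma set_mark_simps [simp]:
  "erase (set_mark t) = erase t" "is_link (set_mark t)"
  "t \<noteq> BNil \<Longrightarrow> marked (label (set_mark t))"
  "shape B m (Suc g) (set_mark t) = shape B m (Suc g) t"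
  "cont (Suc g) (set_mark t) = cont (Suc g) t"
  by (cases t; auto simp: is_link_def shape_node)+

theorem belga_tree_exists:
  assumes "4 \<le> B"
  shows "\<exists>T. belga_tree B P pref T"
proof -
  have "\<exists>T. linked B pref P T"
  proof (induction P rule: measure_induct_rule[where f = size])
    case (less P)
    show ?case
    proof (cases "P = \<langle>\<rangle>")
      case True
      then show ?thesis by (auto simp: linked_Leaf_iff)
    next
      case False
      have "\<exists>t. linked B pref p t" if "p \<in> set (hanging pref P)" for p
      proof (rule less.IH)
        have "p \<in> set (hanging pref P) \<Longrightarrow> P \<noteq> \<langle>\<rangle> \<Longrightarrow> size p < size P" for P
        proof (induction P)
          case (Node l v r)
          then show ?case by (cases "l = \<langle>\<rangle>"; cases "r = \<langle>\<rangle>") (auto split: side.splits)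
        qed simp
        then show "size p < size P" using that False by blast
      qed
      then obtain f where f: "\<And>p. p \<in> set (hanging pref P) \<Longrightarrow> linked B pref p (f p)" by metis
      let ?ts = "map f (hanging pref P)"
      have lk: "is_link (f p)" if "p \<in> set (hanging pref P)" for p
        using f[OF that] by (cases "p = \<langle>\<rangle>") (auto simp: linked_Leaf_iff linked_iff is_link_def)
      have len: "length ?ts = length (preferred_path pref P) + 1"
        using alternating_eq(2)[OF alternating_path_seq[of pref P]] by (simp add: path_seq_parts)
      have "preferred_path pref P \<noteq> []" using False by (cases P) (auto split: side.splits)
      with grow[OF assms _ len] lk obtain t g where t: "shape B 1 g t" "cont g t = interleave ?ts (preferred_path pref P)" "0 < g"
        by auto
      then obtain h where g: "g = Suc h" by (cases g) auto
      have "list_all2 (rel_item (linked B pref)) (path_seq pref P) (cont (Suc h) (set_mark t))"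
        using rel_interleave[of "hanging pref P" "preferred_path pref P" ?ts "preferred_path pref P" "linked B pref"]
          len f t g alternating_eq(1)[OF alternating_path_seq[of pref P]]
        by (simp add: path_seq_parts list_all2_conv_all_nth)
      moreover have "t \<noteq> BNil" using t g by auto
      ultimately show ?thesis using t g False by (auto simp: linked_iff intro!: exI[of _ "set_mark t"])
    qed
  qed
  then show ?thesis unfolding belga_tree_def using linked_relabel labelled_relabel by blast
qed


section \<open>Changing a preferred child\<close>

lemma preferred_path_subset: "set (preferred_path pref P) \<subseteq> set_tree P"
  by (induction P) (auto split: side.splits)

text \<open>From \<open>w\<close> on, the path stays in the subtree of \<open>w\<close>, an interval
  of keys, so this part is contiguous in the sequence. What surrounds it are shallower keys and
  their hanging subtrees, unaffected by a change of preference at \<open>w\<close>.\<close>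

lemma path_seq_split:
  assumes "bst P" "w \<in> set (preferred_path pref P)"
  shows "\<exists>al be l r. path_seq pref P = al @ path_seq pref \<langle>l, w, r\<rangle> @ be \<and> left_ctx al \<and> right_ctx be \<and>
    subtree_of P w = \<langle>l, w, r\<rangle> \<and> bst \<langle>l, w, r\<rangle> \<and> set_tree \<langle>l, w, r\<rangle> \<subseteq> set_tree P \<and>
    (\<forall>k\<in>set (item_keys (al @ be)). depth P k < depth P w) \<and>
    (\<forall>k\<in>set_tree \<langle>l, w, r\<rangle>. depth P k = depth P w + depth \<langle>l, w, r\<rangle> k) \<and>
    (\<forall>pref'. (\<forall>v\<in>set (item_keys (al @ be)). pref' v = pref v) \<longrightarrow>
      path_seq pref' P = al @ path_seq pref' \<langle>l, w, r\<rangle> @ be)"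
  using assms
proof (induction P)
  case (Node l' v r')
  show ?case
  proof (cases "w = v")
    case True
    then show ?thesis using Node.prems
      by (intro exI[of _ "[]"] exI[of _ l'] exI[of _ r']) (auto simp: left_ctx_def right_ctx_def)
  next
    case neq: False
    show ?thesis
    proof (cases "pref v")
      case L
      then have w: "w \<in> set (preferred_path pref l')" using Node.prems neq by auto
      then have wl: "w \<in> set_tree l'" using preferred_path_subset by blast
      have b: "bst l'" using Node.prems by simp
      from Node.IH(1)[OF b w] obtain al be l r where IH: "path_seq pref l' = al @ path_seq pref \<langle>l, w, r\<rangle> @ be"
        "left_ctx al" "right_ctx be" "subtree_of l' w = \<langle>l, w, r\<rangle>" "bst \<langle>l, w, r\<rangle>" "set_tree \<langle>l, w, r\<rangle> \<subseteq> set_tree l'"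
        "\<forall>k\<in>set (item_keys (al @ be)). depth l' k < depth l' w"
        "\<forall>k\<in>set_tree \<langle>l, w, r\<rangle>. depth l' k = depth l' w + depth \<langle>l, w, r\<rangle> k"
        "\<forall>pref'. (\<forall>v\<in>set (item_keys (al @ be)). pref' v = pref v) \<longrightarrow> path_seq pref' l' = al @ path_seq pref' \<langle>l, w, r\<rangle> @ be"
        by blast
      have "set (item_keys (path_seq pref l')) \<subseteq> set_tree l'"
        unfolding path_seq_parts by (rule preferred_path_subset)
      then have sub: "set (item_keys (al @ be)) \<subseteq> set_tree l'" unfolding IH(1) by auto
      have lt: "\<forall>k\<in>set_tree l'. k < v" using Node.prems by simp
      show ?thesis
      proof (rule exI[of _ al], rule exI[of _ "be @ [Key v, Tree r']"], rule exI[of _ l], rule exI[of _ r], intro conjI)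
        show "path_seq pref \<langle>l', v, r'\<rangle> = al @ path_seq pref \<langle>l, w, r\<rangle> @ be @ [Key v, Tree r']"
          using L IH(1) by simp
        show "right_ctx (be @ [Key v, Tree r'])" using IH(3) by (cases be) (simp_all add: right_ctx_def)
        show "subtree_of \<langle>l', v, r'\<rangle> w = \<langle>l, w, r\<rangle>" using IH(4) lt wl neq by auto
        show "\<forall>k\<in>set (item_keys (al @ be @ [Key v, Tree r'])). depth \<langle>l', v, r'\<rangle> k < depth \<langle>l', v, r'\<rangle> w"
        proof
          fix k assume "k \<in> set (item_keys (al @ be @ [Key v, Tree r']))"
          then have "k \<in> set (item_keys (al @ be)) \<or> k = v" by auto
          then show "depth \<langle>l', v, r'\<rangle> k < depth \<langle>l', v, r'\<rangle> w"
            using IH(7) sub lt wl neq by (auto dest: less_imp_not_eq)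
        qed
        show "\<forall>k\<in>set_tree \<langle>l, w, r\<rangle>. depth \<langle>l', v, r'\<rangle> k = depth \<langle>l', v, r'\<rangle> w + depth \<langle>l, w, r\<rangle> k"
        proof
          fix k assume k: "k \<in> set_tree \<langle>l, w, r\<rangle>"
          then have "k < v" "w < v" using IH(6) lt wl by auto
          then show "depth \<langle>l', v, r'\<rangle> k = depth \<langle>l', v, r'\<rangle> w + depth \<langle>l, w, r\<rangle> k"
            using bspec[OF IH(8) k] by (simp del: depth.simps add: depth.simps(2)[of l'])
        qed
        show "\<forall>pref'. (\<forall>va\<in>set (item_keys (al @ be @ [Key v, Tree r'])). pref' va = pref va) \<longrightarrow>
          path_seq pref' \<langle>l', v, r'\<rangle> = al @ path_seq pref' \<langle>l, w, r\<rangle> @ be @ [Key v, Tree r']"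
          using IH(9) L by auto
      qed (use IH(2,5,6) in auto)
    next
      case R
      then have w: "w \<in> set (preferred_path pref r')" using Node.prems neq by auto
      then have wl: "w \<in> set_tree r'" using preferred_path_subset by blast
      have b: "bst r'" using Node.prems by simp
      from Node.IH(2)[OF b w] obtain al be l r where IH: "path_seq pref r' = al @ path_seq pref \<langle>l, w, r\<rangle> @ be"
        "left_ctx al" "right_ctx be" "subtree_of r' w = \<langle>l, w, r\<rangle>" "bst \<langle>l, w, r\<rangle>" "set_tree \<langle>l, w, r\<rangle> \<subseteq> set_tree r'"
        "\<forall>k\<in>set (item_keys (al @ be)). depth r' k < depth r' w"
        "\<forall>k\<in>set_tree \<langle>l, w, r\<rangle>. depth r' k = depth r' w + depth \<langle>l, w, r\<rangle> k"
        "\<forall>pref'. (\<forall>v\<in>set (item_keys (al @ be)). pref' v = pref v) \<longrightarrow> path_seq pref' r' = al @ path_seq pref' \<langle>l, w, r\<rangle> @ be"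
        by blast
      have "set (item_keys (path_seq pref r')) \<subseteq> set_tree r'"
        unfolding path_seq_parts by (rule preferred_path_subset)
      then have sub: "set (item_keys (al @ be)) \<subseteq> set_tree r'" unfolding IH(1) by auto
      have lt: "\<forall>k\<in>set_tree r'. v < k" using Node.prems by simp
      show ?thesis
      proof (rule exI[of _ "Tree l' # Key v # al"], rule exI[of _ be], rule exI[of _ l], rule exI[of _ r], intro conjI)
        show "path_seq pref \<langle>l', v, r'\<rangle> = (Tree l' # Key v # al) @ path_seq pref \<langle>l, w, r\<rangle> @ be"
          using R IH(1) by simp
        show "left_ctx (Tree l' # Key v # al)" using IH(2) by (cases al rule: rev_cases) (simp_all add: left_ctx_def)
        show "subtree_of \<langle>l', v, r'\<rangle> w = \<langle>l, w, r\<rangle>" using IH(4) lt wl neq by auto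
        show "\<forall>k\<in>set (item_keys ((Tree l' # Key v # al) @ be)). depth \<langle>l', v, r'\<rangle> k < depth \<langle>l', v, r'\<rangle> w"
        proof
          fix k assume "k \<in> set (item_keys ((Tree l' # Key v # al) @ be))"
          then have "k \<in> set (item_keys (al @ be)) \<or> k = v" by auto
          then show "depth \<langle>l', v, r'\<rangle> k < depth \<langle>l', v, r'\<rangle> w"
          proof
            assume "k \<in> set (item_keys (al @ be))"
            then have "v < k" "depth r' k < depth r' w" using sub lt IH(7) by blast+
            then show ?thesis using lt wl by auto
          qed (use lt wl in auto)
        qed
        show "\<forall>k\<in>set_tree \<langle>l, w, r\<rangle>. depth \<langle>l', v, r'\<rangle> k = depth \<langle>l', v, r'\<rangle> w + depth \<langle>l, w, r\<rangle> k"
        proof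
          fix k assume k: "k \<in> set_tree \<langle>l, w, r\<rangle>"
          then have "v < k" "v < w" using IH(6) lt wl by auto
          then show "depth \<langle>l', v, r'\<rangle> k = depth \<langle>l', v, r'\<rangle> w + depth \<langle>l, w, r\<rangle> k"
            using bspec[OF IH(8) k] by (simp del: depth.simps add: depth.simps(2)[of l'])
        qed
        show "\<forall>pref'. (\<forall>va\<in>set (item_keys ((Tree l' # Key v # al) @ be)). pref' va = pref va) \<longrightarrow>
          path_seq pref' \<langle>l', v, r'\<rangle> = (Tree l' # Key v # al) @ path_seq pref' \<langle>l, w, r\<rangle> @ be"
          using IH(9) R by auto
      qed (use IH(3,5,6) in auto)
    qed
  qed
qed simp

section \<open>Cutting and merging on the level of sequences\<close>

text \<open>The isolated segment is glued back as a link: by marking its root if it contains keys,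
  and unchanged if it is a single link already.\<close>

lemma cut_step:
  assumes "4 \<le> B" "shape B m g T" "cont g T = x @ H @ y" "left_ctx x" "right_ctx y" "x \<noteq> [] \<or> y \<noteq> []"
  shows "\<exists>D T' g'. (H = [Tree D] \<and> is_link D \<or> (\<exists>h. marked (label D) \<and> shape B 1 (Suc h) D \<and> cont (Suc h) D = H)) \<and>
    g' \<le> g + 2 \<and> shape B 1 g' T' \<and> cont g' T' = x @ Tree D # y \<and> atree_equiv B (46 * g + 13) [Tree T] [Tree T']"
proof -
  from replace_segment[OF assms(1-5)] obtain r g0 where r: "shape B 1 g0 r" "cont g0 r = H"
    and rep: "\<And>r' h. shape B 1 h r' \<Longrightarrow> erase r' = erase r \<Longrightarrow>
      \<exists>t' g''. 0 < g'' \<and> g'' \<le> max g h + 2 \<and> inner B 1 g'' t' \<and> cont g'' t' = x @ cont h r' @ y \<and>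
         atree_equiv B (46 * g + 6 * h + 13) [Tree T] [Tree t']" using assms(6) by blast
  define D where "D = (if g0 = 0 then r else set_mark r)"
  have D: "shape B 1 0 D" "erase D = erase r" using r by (auto simp: D_def)
  have "H = [Tree D] \<and> is_link D \<or> (\<exists>h. marked (label D) \<and> shape B 1 (Suc h) D \<and> cont (Suc h) D = H)"
  proof (cases g0)
    case 0
    then show ?thesis using r by (auto simp: D_def)
  next
    case (Suc h)
    then have "r \<noteq> BNil" using r by auto
    then show ?thesis using r Suc by (intro disjI2 exI[of _ h]) (auto simp: D_def)
  qed
  moreover from rep[OF D] obtain T' g' where "g' \<le> max g 0 + 2" "inner B 1 g' T'" "cont g' T' = x @ cont 0 D @ y"
    "atree_equiv B (46 * g + 6 * 0 + 13) [Tree T] [Tree T']" by blast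
  ultimately show ?thesis by (intro exI[of _ D] exI[of _ T'] exI[of _ g']) (auto simp: inner_def)
qed

text \<open>The isolated segment is the link itself, now read as a tree of height
  \<open>h\<close>.\<close>

lemma merge_step:
  assumes "4 \<le> B" "shape B m g T" "cont g T = x @ Tree s # y" "left_ctx x" "right_ctx y" "x \<noteq> [] \<or> y \<noteq> []"
    "shape B 1 h s"
  shows "\<exists>T' g'. 0 < g' \<and> shape B 1 g' T' \<and> cont g' T' = x @ cont h s @ y \<and>
    atree_equiv B (46 * g + 6 * h + 13) [Tree T] [Tree T']"
proof -
  have c: "cont g T = x @ [Tree s] @ y" using assms(3) by simp
  from replace_segment[OF assms(1,2) c assms(4,5)] obtain r g0 where r: "shape B 1 g0 r" "cont g0 r = [Tree s]"
    and rep: "\<And>r' h. shape B 1 h r' \<Longrightarrow> erase r' = erase r \<Longrightarrow>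
      \<exists>t' g''. 0 < g'' \<and> g'' \<le> max g h + 2 \<and> inner B 1 g'' t' \<and> cont g'' t' = x @ cont h r' @ y \<and>
         atree_equiv B (46 * g + 6 * h + 13) [Tree T] [Tree t']" using assms(6) by blast
  have "r = s" using cont_single_link[OF r] by simp
  with rep[OF assms(7)] show ?thesis by (auto simp: inner_def)
qed

text \<open>Here the left child of \<open>w\<close> was preferred: its path \<open>H\<close> is cut
  off, and the path of the right child is merged. The cut may raise the height by 2, hence the
  constant 13 + 46 * 2 + 13 = 118.\<close>

lemma exchange_left:
  assumes "4 \<le> B" "shape B m g T" "cont g T = x @ H @ [Key w, Tree s] @ y" "left_ctx x" "right_ctx y" "shape B 1 h s"
  shows "\<exists>D T' g'. (H = [Tree D] \<and> is_link D \<or> (\<exists>h. marked (label D) \<and> shape B 1 (Suc h) D \<and> cont (Suc h) D = H)) \<and>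
    shape B 1 (Suc g') T' \<and> cont (Suc g') T' = x @ [Tree D, Key w] @ cont h s @ y \<and>
    atree_equiv B (92 * g + 6 * h + 118) [Tree T] [Tree T']"
proof -
  have "right_ctx ([Key w, Tree s] @ y)" by (simp add: right_ctx_def)
  from cut_step[OF assms(1-4) this] obtain D T1 g1 where 1:
    "H = [Tree D] \<and> is_link D \<or> (\<exists>h. marked (label D) \<and> shape B 1 (Suc h) D \<and> cont (Suc h) D = H)"
    "g1 \<le> g + 2" "shape B 1 g1 T1" "cont g1 T1 = x @ Tree D # [Key w, Tree s] @ y"
    "atree_equiv B (46 * g + 13) [Tree T] [Tree T1]" by auto
  have c: "cont g1 T1 = (x @ [Tree D, Key w]) @ Tree s # y" using 1(4) by simp
  have "left_ctx (x @ [Tree D, Key w])" by (auto simp: left_ctx_def)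
  from merge_step[OF assms(1) 1(3) c this assms(5) _ assms(6)] obtain T2 g2 where 2: "0 < g2" "shape B 1 g2 T2"
    "cont g2 T2 = (x @ [Tree D, Key w]) @ cont h s @ y" "atree_equiv B (46 * g1 + 6 * h + 13) [Tree T1] [Tree T2]" by auto
  have "atree_equiv B (92 * g + 6 * h + 118) [Tree T] [Tree T2]"
    by (rule atree_equiv_trans[OF 1(5) 2(4)]) (use 1(2) in simp)
  then show ?thesis using 1(1) 2 by (intro exI[of _ D] exI[of _ T2] exI[of _ "g2 - 1"]) auto
qed

lemma exchange_right:
  assumes "4 \<le> B" "shape B m g T" "cont g T = x @ [Tree s, Key w] @ H @ y" "left_ctx x" "right_ctx y" "shape B 1 h s"
  shows "\<exists>D T' g'. (H = [Tree D] \<and> is_link D \<or> (\<exists>h. marked (label D) \<and> shape B 1 (Suc h) D \<and> cont (Suc h) D = H)) \<and>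
    shape B 1 (Suc g') T' \<and> cont (Suc g') T' = x @ cont h s @ [Key w, Tree D] @ y \<and>
    atree_equiv B (92 * g + 6 * h + 118) [Tree T] [Tree T']"
proof -
  have l: "left_ctx (x @ [Tree s, Key w])" by (auto simp: left_ctx_def)
  have c0: "cont g T = (x @ [Tree s, Key w]) @ H @ y" using assms(3) by simp
  from cut_step[OF assms(1,2) c0 l assms(5)] obtain D T1 g1 where 1:
    "H = [Tree D] \<and> is_link D \<or> (\<exists>h. marked (label D) \<and> shape B 1 (Suc h) D \<and> cont (Suc h) D = H)"
    "g1 \<le> g + 2" "shape B 1 g1 T1" "cont g1 T1 = (x @ [Tree s, Key w]) @ Tree D # y"
    "atree_equiv B (46 * g + 13) [Tree T] [Tree T1]" by auto
  have c: "cont g1 T1 = x @ Tree s # [Key w, Tree D] @ y" using 1(4) by simp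
  have "right_ctx ([Key w, Tree D] @ y)" by (auto simp: right_ctx_def)
  from merge_step[OF assms(1) 1(3) c assms(4) this _ assms(6)] obtain T2 g2 where 2: "0 < g2" "shape B 1 g2 T2"
    "cont g2 T2 = x @ cont h s @ [Key w, Tree D] @ y" "atree_equiv B (46 * g1 + 6 * h + 13) [Tree T1] [Tree T2]" by auto
  have "atree_equiv B (92 * g + 6 * h + 118) [Tree T] [Tree T2]"
    by (rule atree_equiv_trans[OF 1(5) 2(4)]) (use 1(2) in simp)
  then show ?thesis using 1(1) 2 by (intro exI[of _ D] exI[of _ T2] exI[of _ "g2 - 1"]) auto
qed

lemma set_item_keys: "k \<in> set (item_keys s) \<longleftrightarrow> Key k \<in> set s"
proof (induction s)
  case (Cons a s)
  then show ?case by (cases a) auto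
qed simp

lemma set_item_trees: "t \<in> set (item_trees s) \<longleftrightarrow> Tree t \<in> set s"
proof (induction s)
  case (Cons a s)
  then show ?case by (cases a) auto
qed simp

section \<open>Bookkeeping of auxiliary trees\<close>

lemma aux_trees_hung: "proper B g t \<Longrightarrow> aux_trees t = (\<Union>s\<in>set (hung t). aux_trees s)"
proof (induction g arbitrary: t)
  case 0
  then show ?case by (cases t) (auto simp: inner_def is_link_def)
next
  case (Suc g)
  then have "shape B (min_keys B) (Suc g) t" "\<not> marked (label t)" by (auto simp: inner_def)
  then obtain a ks ts where t: "t = BNode a ks ts" "\<forall>t\<in>set ts. proper B g t" "\<not> marked a" by (auto elim!: shapeE)
  then show ?case using Suc.IH by auto
qed

lemma aux_trees_cont:
  assumes "shape B m (Suc g) T" "marked (label T)"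
  shows "aux_trees T = insert (aux_tree T) (\<Union>s\<in>{s. Tree s \<in> set (cont (Suc g) T)}. aux_trees s)"
proof -
  from assms obtain a ks ts where t: "T = BNode a ks ts" "\<forall>t\<in>set ts. proper B g t" "marked a" by (auto elim!: shapeE)
  have "{s. Tree s \<in> set (cont (Suc g) T)} = set (links T)"
    using aux_tree_cont(2)[OF assms(1)] by (auto simp: set_item_trees)
  also have "\<dots> = (\<Union>u\<in>set ts. set (hung u))" by (simp add: t links_def)
  finally have s: "{s. Tree s \<in> set (cont (Suc g) T)} = (\<Union>u\<in>set ts. set (hung u))" .
  have "aux_trees T = insert (aux_tree T) (\<Union>u\<in>set ts. aux_trees u)" using t by simp
  also have "(\<Union>u\<in>set ts. aux_trees u) = (\<Union>u\<in>set ts. \<Union>s\<in>set (hung u). aux_trees s)"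
    using t(2) aux_trees_hung by (intro SUP_cong refl) blast
  also have "\<dots> = (\<Union>s\<in>(\<Union>u\<in>set ts. set (hung u)). aux_trees s)" by (simp only: UN_UN_flatten)
  finally show ?thesis unfolding s .
qed

lemma keys_aux_tree: "shape B m (Suc g) T \<Longrightarrow> keys (aux_tree T) = {k. Key k \<in> set (cont (Suc g) T)}"
  using aux_tree_cont(1)[of B m g T] by (auto simp: keys_def set_item_keys)

text \<open>\<open>cut_merge\<close> compares sets of trees, so removing \<open>Q\<close> and
  \<open>S\<close> must not also remove an equal tree elsewhere. Non-empty disjoint key sets exclude
  this; \<open>Z\<close> below is the set of auxiliary trees that are not involved.\<close>

lemma cut_mergeI:
  assumes T: "shape B m (Suc g) T" "marked (label T)" "set (cont (Suc g) T) = E \<union> set H \<union> {Key w, Tree s}"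
    and T': "shape B m' (Suc g') T'" "marked (label T')" "set (cont (Suc g') T') = E \<union> {Tree D, Key w} \<union> set F"
    and s: "s = BNil \<and> F = [Tree BNil] \<or> marked (label s) \<and> shape B 1 (Suc h) s \<and> F = cont (Suc h) s"
    and D: "D = BNil \<and> H = [Tree BNil] \<or> marked (label D) \<and> shape B 1 (Suc h') D \<and> H = cont (Suc h') D"
    and depths: "\<And>k. Key k \<in> E \<Longrightarrow> depth P k < depth P w" "\<And>k. Key k \<in> set H \<Longrightarrow> depth P w < depth P k"
    and disj: "\<And>t k. Tree t \<in> E \<union> set H \<union> set F \<Longrightarrow> Key k \<in> insert (Key w) (set F) \<Longrightarrow> k \<notin> keys t"
    and ne: "\<And>t X. Tree t \<in> E \<union> set H \<union> set F \<Longrightarrow> X \<in> aux_trees t \<Longrightarrow> keys X \<noteq> {} \<and> keys X \<subseteq> keys t"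
  shows "cut_merge P T (depth P w) (aux_tree s) T'"
proof -
  define Z where "Z = (\<Union>t\<in>{t. Tree t \<in> E \<union> set H \<union> set F}. aux_trees t)"
  have kT: "keys (aux_tree T) = {k. Key k \<in> E \<union> set H} \<union> {w}" using keys_aux_tree[OF T(1)] T(3) by auto
  have kT': "keys (aux_tree T') = {k. Key k \<in> E \<union> set F} \<union> {w}" using keys_aux_tree[OF T'(1)] T'(3) by auto
  have ks: "keys (aux_tree s) = {k. Key k \<in> set F}" using s keys_aux_tree[of B 1 h s] by (auto simp: keys_def)
  have low: "{k \<in> keys (aux_tree T). depth P k \<le> depth P w} = {k. Key k \<in> E} \<union> {w}"
  proof -
    have "depth P k \<le> depth P w" if "Key k \<in> E" for k using depths(1)[OF that] by simp
    moreover have "\<not> depth P k \<le> depth P w" if "Key k \<in> set H" for k using depths(2)[OF that] by simp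
    ultimately show ?thesis unfolding kT by blast
  qed
  have high: "{k \<in> keys (aux_tree T). depth P w < depth P k} = {k. Key k \<in> set H}"
  proof -
    have "\<not> depth P w < depth P k" if "Key k \<in> E" for k using depths(1)[OF that] by simp
    then show ?thesis unfolding kT using depths(2) by blast
  qed
  have Z1: "X \<notin> Z" if "k \<in> keys X" "Key k \<in> insert (Key w) (set F)" for X k
  proof
    assume "X \<in> Z"
    then obtain t where t: "Tree t \<in> E \<union> set H \<union> set F" "X \<in> aux_trees t" by (auto simp: Z_def)
    then show False using ne[OF t] disj[OF t(1) that(2)] that(1) by blast
  qed
  have T_Z: "aux_tree T \<notin> Z" by (rule Z1[of w]) (auto simp: kT)
  have s_Z: "aux_tree s \<notin> Z"
  proof (cases "s = BNil")
    case True
    then show ?thesis using ne[of _ BNil] by (auto simp: Z_def keys_def)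
  next
    case False
    then have "item_keys F \<noteq> []" using s cont_has_key[of B 1 h s] by auto
    then have "Key (hd (item_keys F)) \<in> set F" by (simp flip: set_item_keys)
    then show ?thesis by (intro Z1[of "hd (item_keys F)"]) (auto simp: ks)
  qed
  have aT: "aux_trees T - {aux_tree T, aux_tree s} = Z"
  proof -
    have "aux_trees T = insert (aux_tree T) ((\<Union>t\<in>{t. Tree t \<in> E \<union> set H}. aux_trees t) \<union> aux_trees s)"
      using aux_trees_cont[OF T(1,2)] T(3) by auto
    moreover have "aux_trees s \<union> {aux_tree s} = insert (aux_tree s) (\<Union>t\<in>{t. Tree t \<in> set F}. aux_trees t)"
      using s aux_trees_cont[of B 1 h s] by auto
    ultimately have "aux_trees T \<union> {aux_tree T, aux_tree s} = {aux_tree T, aux_tree s} \<union> Z"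
      unfolding Z_def by auto
    then show ?thesis using T_Z s_Z by blast
  qed
  have aT': "aux_trees T' = insert (aux_tree T') ((if D = BNil then {} else {aux_tree D}) \<union> Z)"
  proof -
    have "aux_trees T' = insert (aux_tree T') ((\<Union>t\<in>{t. Tree t \<in> E \<union> set F}. aux_trees t) \<union> aux_trees D)"
      using aux_trees_cont[OF T'(1,2)] T'(3) by auto
    moreover have "aux_trees D = (if D = BNil then {} else {aux_tree D}) \<union> (\<Union>t\<in>{t. Tree t \<in> set H}. aux_trees t)"
      using D aux_trees_cont[of B 1 h' D] by auto
    ultimately show ?thesis unfolding Z_def by auto
  qed
  have Dnil: "{k. Key k \<in> set H} = {} \<longleftrightarrow> D = BNil"
  proof (cases "D = BNil")
    case True
    then show ?thesis using D by auto
  next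
    case False
    then have "item_keys H \<noteq> []" using D cont_has_key[of B 1 h' D] by auto
    then have "hd (item_keys H) \<in> {k. Key k \<in> set H}" by (simp flip: set_item_keys)
    then show ?thesis using False by blast
  qed
  have kD: "D \<noteq> BNil \<Longrightarrow> keys (aux_tree D) = {k. Key k \<in> set H}" using D keys_aux_tree[of B 1 h' D] by auto
  show ?thesis unfolding cut_merge_def Let_def low high aT
    using Dnil kD aT' kT' ks by auto
qed


lemma erase_simps [simp]:
  "node_sizes_ok B (erase t) = node_sizes_ok B t" "keys_inorder (erase t) = keys_inorder t"
proof -
  show "node_sizes_ok B (erase t) = node_sizes_ok B t" by (induction t) auto
  show "keys_inorder (erase t) = keys_inorder t"
    by (induction t) (auto intro!: arg_cong[where f = "\<lambda>x. weave x _"])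
qed

lemma linked_aux_trees:
  "linked B pref P T \<Longrightarrow> X \<in> aux_trees T \<Longrightarrow> keys X \<noteq> {} \<and> keys X \<subseteq> keys T"
proof (induction arbitrary: X rule: linked_induct)
  case (Node P T h)
  have kT: "keys T = set (flats keys_inorder (cont (Suc h) T))" by (simp only: flats_cont[OF Node(3)] keys_def)
  have key: "flat_with keys_inorder i \<noteq> [] \<Longrightarrow> i \<in> set s \<Longrightarrow> set (flat_with keys_inorder i) \<subseteq> set (flats keys_inorder s)"
    for i :: "atree item" and s by auto
  from Node.prems aux_trees_cont[OF Node(3,2)]
  consider "X = aux_tree T" | t where "Tree t \<in> set (cont (Suc h) T)" "X \<in> aux_trees t" by blast
  then show ?case
  proof cases
    case 1
    have "item_keys (cont (Suc h) T) \<noteq> []" by (rule cont_has_key[OF Node(3)])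
    then have "keys X \<noteq> {}" unfolding 1 keys_def aux_tree_cont(1)[OF Node(3)] by simp
    moreover have "keys X \<subseteq> keys T" unfolding 1 keys_aux_tree[OF Node(3)] kT
      using key[of "Key _" "cont (Suc h) T"] by auto
    ultimately show ?thesis ..
  next
    case (2 t)
    then have "t \<in> set (item_trees (cont (Suc h) T))" by (simp add: set_item_trees)
    from rel_item_trees[OF Node(4) this] have k: "keys X \<noteq> {} \<and> keys X \<subseteq> keys t" using 2(2) by blast
    have "keys t \<subseteq> keys T" unfolding kT using 2(1) by (auto simp: keys_def intro!: bexI[of _ "Tree t"])
    then show ?thesis using k by blast
  qed
qed simp

lemma flats_disjoint:
  assumes "distinct (flats f s)" "Tree t \<in> set s" "Key k \<in> set s"
  shows "k \<notin> set (f t)"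
  using assms
proof (induction s)
  case (Cons a s)
  then show ?case
  proof (cases a)
    case (Key l)
    then show ?thesis using Cons by (auto intro!: bexI[of _ "Tree t"])
  next
    case (Tree u)
    have "Key k \<in> set s \<Longrightarrow> k \<in> set (flats f s)" by (auto intro!: bexI[of _ "Key k"])
    then show ?thesis using Cons Tree by auto
  qed
qed simp

text \<open>Serves to recognise the link at which a walk stops as the one that hangs at
  \<open>w\<close>.\<close>

lemma flats_unique_tree:
  assumes "distinct (flats f s)" "Tree t \<in> set s" "Tree u \<in> set s" "f t = f u" "f t \<noteq> []"
  shows "t = u"
  using assms
proof (induction s)
  case (Cons a s)
  have *: "set (f x) \<subseteq> set (flats f s)" if "Tree x \<in> set s" for x
    using that by (auto intro!: bexI[of _ "Tree x"])
  show ?case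
  proof (cases "a = Tree t \<or> a = Tree u")
    case True
    show ?thesis
    proof (rule ccontr)
      assume neq: "t \<noteq> u"
      with True Cons.prems have "Tree t \<in> set s \<or> Tree u \<in> set s" by auto
      then have "set (f t) \<subseteq> set (flats f s)" using *[of t] *[of u] Cons.prems(4) by auto
      moreover have "set (flat_with f a) = set (f t)" using True Cons.prems(4) by auto
      ultimately show False using Cons.prems(1,5) by (cases "f t") auto
    qed
  next
    case False
    then show ?thesis using Cons by auto
  qed
qed simp

section \<open>Flipping one preference\<close>

definition flip_side :: "side \<Rightarrow> side" where
  "flip_side s = (case s of L \<Rightarrow> R | R \<Rightarrow> L)"

definition other_child :: "preference \<Rightarrow> nat tree \<Rightarrow> nat \<Rightarrow> nat tree" where
  "other_child pref P w = (case pref w of L \<Rightarrow> right (subtree_of P w) | R \<Rightarrow> left (subtree_of P w))"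

lemma linked_height:
  assumes "linked B pref q s"
  shows "(q = \<langle>\<rangle> \<and> s = BNil) \<or> (\<exists>h. marked (label s) \<and> shape B 1 (Suc h) s \<and>
     list_all2 (rel_item (linked B pref)) (path_seq pref q) (cont (Suc h) s))"
  using assms by (cases "q = \<langle>\<rangle>") (auto simp: linked_iff linked_Leaf_iff)

text \<open>The sequence of a path has length 1 exactly for the empty subtree, and then the link is
  a null pointer; in every other case the cut creates a marked auxiliary tree.\<close>

lemma linked_cut_part:
  assumes "list_all2 (rel_item (linked B pref)) (path_seq pref p) H"
    "H = [Tree D] \<and> is_link D \<or> (\<exists>h. marked (label D) \<and> shape B 1 (Suc h) D \<and> cont (Suc h) D = H)"
  shows "linked B pref p D"
    "D = BNil \<and> H = [Tree BNil] \<or> (\<exists>h. marked (label D) \<and> shape B 1 (Suc h) D \<and> H = cont (Suc h) D)"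
proof -
  have "linked B pref p D \<and> (D = BNil \<and> H = [Tree BNil] \<or> (\<exists>h. marked (label D) \<and> shape B 1 (Suc h) D \<and> H = cont (Suc h) D))"
  proof (cases "p = \<langle>\<rangle>")
    case True
    then have H: "H = [Tree BNil]"
      using assms(1) by (auto simp: list_all2_Cons1 linked_Leaf_iff elim!: item.rel_cases)
    have "\<not> (shape B 1 (Suc h) D \<and> cont (Suc h) D = H)" for h
      using cont_single_link[of B 1 "Suc h" D BNil] H by auto
    then show ?thesis using assms(2) H True by (auto simp: linked_Leaf_iff)
  next
    case False
    have "length H \<noteq> 1"
    proof -
      obtain l v r where p: "p = \<langle>l, v, r\<rangle>" using False by (cases p) auto
      have "length (path_seq pref p) \<noteq> 1" by (cases "pref v"; cases l; cases r) (auto simp: p split: side.splits)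
      then show ?thesis using list_all2_lengthD[OF assms(1)] by simp
    qed
    then obtain h where h: "marked (label D)" "shape B 1 (Suc h) D" "cont (Suc h) D = H" using assms(2) by auto
    then show ?thesis using assms(1) False by (auto simp: linked_iff)
  qed
  then show "linked B pref p D"
    "D = BNil \<and> H = [Tree BNil] \<or> (\<exists>h. marked (label D) \<and> shape B 1 (Suc h) D \<and> H = cont (Suc h) D)" by auto
qed

lemma map_relabel_id:
  assumes "\<And>t. Tree t \<in> set s \<Longrightarrow> labelled P t"
  shows "map (map_item (relabel P)) s = s"
proof (rule map_idI)
  fix i assume "i \<in> set s"
  then show "map_item (relabel P) i = i"
    using assms relabel_labelled item.exhaust[of i "map_item (relabel P) i = i"] by fastforce
qed

text \<open>In key order the flip exchanges the roles of two neighbours of \<open>w\<close>: the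
  part of the path below \<open>w\<close> turns from a segment into a link, and the path of the
  other child from a link into a segment. All other links are literally kept, labels included, as
  \<open>cut_merge\<close> demands.\<close>

theorem flip_preference:
  assumes B: "4 \<le> B" and P: "bst P" "0 \<notin> set_tree P" "5 \<le> size P" and T: "belga_tree B P pref T"
    and w: "w \<in> set (preferred_path pref P)"
  shows "\<exists>s T' c. s \<in> set (links T) \<and> linked B pref (other_child pref P w) s \<and>
    belga_tree B P (pref(w := flip_side (pref w))) T' \<and> cut_merge P T (depth P w) (aux_tree s) T' \<and>
    reach B c (erase T, []) (erase T', []) \<and>
    real c \<le> 30000 * (1 + log (real B) (real (card (keys (aux_tree T)) + card (keys (aux_tree s)))))"
proof -
  define pref' where "pref' = pref(w := flip_side (pref w))"
  have lT: "linked B pref P T" and lab: "labelled P T" using T by (auto simp: belga_tree_def)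
  have "P \<noteq> \<langle>\<rangle>" using w by auto
  with lT obtain g where mT: "marked (label T)" and sT: "shape B 1 (Suc g) T"
    and rT: "list_all2 (rel_item (linked B pref)) (path_seq pref P) (cont (Suc g) T)" by (auto simp: linked_iff)
  from path_seq_split[OF P(1) w] obtain al be l r where sp: "path_seq pref P = al @ path_seq pref \<langle>l, w, r\<rangle> @ be"
    "left_ctx al" "right_ctx be" "subtree_of P w = \<langle>l, w, r\<rangle>" "bst \<langle>l, w, r\<rangle>" "set_tree \<langle>l, w, r\<rangle> \<subseteq> set_tree P"
    and dep: "\<forall>k\<in>set (item_keys (al @ be)). depth P k < depth P w"
    "\<forall>k\<in>set_tree \<langle>l, w, r\<rangle>. depth P k = depth P w + depth \<langle>l, w, r\<rangle> k"
    and sp': "\<forall>pref'. (\<forall>v\<in>set (item_keys (al @ be)). pref' v = pref v) \<longrightarrow>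
      path_seq pref' P = al @ path_seq pref' \<langle>l, w, r\<rangle> @ be" by blast
  have "w \<notin> set (item_keys (al @ be))" using dep(1) by blast
  then have "\<forall>v\<in>set (item_keys (al @ be)). pref' v = pref v" by (auto simp: pref'_def)
  then have seq': "path_seq pref' P = al @ path_seq pref' \<langle>l, w, r\<rangle> @ be" using sp' by blast
  have wl: "w \<notin> set_tree l" "w \<notin> set_tree r" using sp(5) by auto
  have same: "path_seq pref' l = path_seq pref l" "path_seq pref' r = path_seq pref r"
    by (rule path_seq_cong; use wl in \<open>auto simp: pref'_def\<close>)+
  have order: "distinct (inorder P)" using P(1) by (simp add: bst_iff_sorted_wrt_less strict_sorted_iff)
  \<comment> \<open>\<open>p\<close> is cut off and \<open>q\<close> is merged\<close>
  define p q where "p = (case pref w of L \<Rightarrow> l | R \<Rightarrow> r)" and "q = (case pref w of L \<Rightarrow> r | R \<Rightarrow> l)"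
  have q: "q = other_child pref P w" by (cases "pref w") (simp_all add: q_def other_child_def sp(4))
  have pq: "set_tree p \<subseteq> set_tree \<langle>l, w, r\<rangle>" "w \<notin> set_tree p" "w \<notin> set_tree q"
    using wl by (auto simp: p_def q_def split: side.splits)
  \<comment> \<open>The decomposition of \<open>path_seq pref P\<close>, transferred to the content
    of \<open>T\<close>: \<open>H\<close> realises the path to be cut off, \<open>s\<close> is the
    link to be merged.\<close>
  obtain x H s y where parts: "list_all2 (rel_item (linked B pref)) al x" "list_all2 (rel_item (linked B pref)) be y"
      "list_all2 (rel_item (linked B pref)) (path_seq pref p) H" "linked B pref q s"
    and cT: "cont (Suc g) T = (case pref w of L \<Rightarrow> x @ H @ [Key w, Tree s] @ y | R \<Rightarrow> x @ [Tree s, Key w] @ H @ y)"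
  proof (cases "pref w")
    case L
    then have "list_all2 (rel_item (linked B pref)) (al @ path_seq pref l @ Key w # Tree r # be) (cont (Suc g) T)"
      using rT sp(1) by simp
    then obtain x H i j y where "list_all2 (rel_item (linked B pref)) al x" "list_all2 (rel_item (linked B pref)) (path_seq pref l) H"
      "rel_item (linked B pref) (Key w) i" "rel_item (linked B pref) (Tree r) j" "list_all2 (rel_item (linked B pref)) be y"
      "cont (Suc g) T = x @ H @ i # j # y"
      by (force simp: list_all2_append1 list_all2_Cons1)
    then show ?thesis using L by (cases i; cases j) (auto intro!: that simp: p_def q_def)
  next
    case R
    then have "list_all2 (rel_item (linked B pref)) (al @ Tree l # Key w # path_seq pref r @ be) (cont (Suc g) T)"
      using rT sp(1) by simp
    then obtain x H i j y where "list_all2 (rel_item (linked B pref)) al x" "list_all2 (rel_item (linked B pref)) (path_seq pref r) H"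
      "rel_item (linked B pref) (Tree l) j" "rel_item (linked B pref) (Key w) i" "list_all2 (rel_item (linked B pref)) be y"
      "cont (Suc g) T = x @ j # i # H @ y"
      by (force simp: list_all2_append1 list_all2_Cons1)
    then show ?thesis using R by (cases i; cases j) (auto intro!: that simp: p_def q_def)
  qed
  have keys_rel: "item_keys s' = item_keys s" if "list_all2 (rel_item Q) s s'" for Q s and s' :: "atree item list"
    using that
  proof (induction rule: list_all2_induct)
    case (Cons a as b bs)
    then show ?case by (cases a; cases b) auto
  qed simp
  have ctx: "left_ctx x" "right_ctx y"
  proof -
    show "left_ctx x" using sp(2) parts(1)
      by (auto simp: left_ctx_def list_all2_append1 list_all2_Cons1 elim!: item.rel_cases)
    show "right_ctx y" using sp(3) parts(2)
      by (auto simp: right_ctx_def list_all2_Cons1 elim!: item.rel_cases)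
  qed
  obtain h F where sF: "shape B 1 h s" "cont h s = F" "list_all2 (rel_item (linked B pref)) (path_seq pref q) F"
    and sF': "s = BNil \<and> F = [Tree BNil] \<and> h = 0 \<or> marked (label s) \<and> (\<exists>h'. h = Suc h')"
    using linked_height[OF parts(4)]
  proof (elim disjE exE conjE)
    assume "q = \<langle>\<rangle>" "s = BNil"
    then show ?thesis by (intro that[of 0 "[Tree BNil]"]) (auto simp: is_link_def linked_Leaf_iff)
  qed (blast intro: that)
  obtain D T2 g2 where D: "H = [Tree D] \<and> is_link D \<or> (\<exists>h. marked (label D) \<and> shape B 1 (Suc h) D \<and> cont (Suc h) D = H)"
    and T2: "shape B 1 (Suc g2) T2"
      "cont (Suc g2) T2 = (case pref w of L \<Rightarrow> x @ [Tree D, Key w] @ F @ y | R \<Rightarrow> x @ F @ [Key w, Tree D] @ y)"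
      "atree_equiv B (92 * Suc g + 6 * h + 118) [Tree T] [Tree T2]"
  proof (cases "pref w")
    case L
    then show ?thesis using exchange_left[OF B sT _ ctx sF(1), of H w] cT sF(2) that by auto
  next
    case R
    then show ?thesis using exchange_right[OF B sT _ ctx sF(1), of w H] cT sF(2) that by auto
  qed
  note Dl = linked_cut_part[OF parts(3) D]
  have labT: "labelled P t" if "Tree t \<in> set (x @ y @ H @ [Tree s])" for t
    by (rule labelled_cont[OF sT lab]) (use that cT in \<open>auto simp: set_item_trees split: side.splits\<close>)
  have labF: "labelled P t" if "Tree t \<in> set F" for t
    by (rule labelled_cont[OF sF(1) labT]) (use that sF(2) in \<open>auto simp: set_item_trees\<close>)
  \<comment> \<open>Only the two new auxiliary trees have stale labels; on the other links
    \<open>relabel P\<close> is the identity.\<close>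
  define D' where "D' = relabel P D"
  define T' where "T' = relabel P (set_mark T2)"
  have "T2 \<noteq> BNil" using T2(1) by auto
  then have mT': "marked (label T')" unfolding T'_def by (cases T2) auto
  have sT': "shape B 1 (Suc g2) T'" unfolding T'_def by (rule shape_relabel) (use T2(1) in simp)
  have cT': "cont (Suc g2) T' = (case pref w of L \<Rightarrow> x @ [Tree D', Key w] @ F @ y | R \<Rightarrow> x @ F @ [Key w, Tree D'] @ y)"
  proof -
    have "map (map_item (relabel P)) x = x" "map (map_item (relabel P)) y = y" "map (map_item (relabel P)) F = F"
      by (rule map_relabel_id; use labT labF in auto)+
    then show ?thesis unfolding T'_def cont_relabel using T2(2)
      by (cases "pref w") (simp_all add: D'_def del: map_append add: map_append)
  qed
  have lD: "linked B pref p D'" unfolding D'_def by (rule linked_relabel[OF Dl(1)])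
  have D'H: "D' = BNil \<and> H = [Tree BNil] \<or> (\<exists>h. marked (label D') \<and> shape B 1 (Suc h) D' \<and> H = cont (Suc h) D')"
    using Dl(2)
  proof (elim disjE exE conjE)
    fix h assume h: "marked (label D)" "shape B 1 (Suc h) D" "H = cont (Suc h) D"
    have "D \<noteq> BNil" using h by auto
    moreover have "cont (Suc h) D' = H" unfolding D'_def cont_relabel h(3)[symmetric]
      by (rule map_relabel_id) (use labT in auto)
    ultimately show ?thesis using h(1) shape_relabel[OF h(2), of P]
      by (intro disjI2 exI[of _ h]) (simp add: D'_def marked_relabel)
  qed (simp add: D'_def)
  \<comment> \<open>Subtrees that hang outside the subtree of \<open>w\<close> do not contain
    \<open>w\<close>, so the new preference does not affect them.\<close>
  have w_out: "w \<notin> set_tree t" if "t \<in> set (item_trees (al @ be))" for t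
  proof -
    have "distinct (flats inorder (path_seq pref P))" using order by (simp only: flats_path_seq)
    moreover have "Tree t \<in> set (path_seq pref P)" using that by (auto simp: sp(1) set_item_trees)
    moreover have "Key w \<in> set (path_seq pref P)" using w by (simp flip: set_item_keys add: path_seq_parts)
    ultimately show ?thesis using flats_disjoint by fastforce
  qed
  have lcong: "linked B pref' t u" if "linked B pref t u" "w \<notin> set_tree t" for t u
    by (rule linked_cong[OF that(1)]) (use that(2) in \<open>auto simp: pref'_def\<close>)
  have r': "list_all2 (rel_item (linked B pref')) al x" "list_all2 (rel_item (linked B pref')) be y"
    by (rule list_all2_rel_item_mono[OF parts(1)] list_all2_rel_item_mono[OF parts(2)]; use lcong w_out in auto)+
  have rF: "list_all2 (rel_item (linked B pref')) (path_seq pref q) F"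
    by (rule list_all2_rel_item_mono[OF sF(3)]) (use lcong pq(3) set_tree_path_seq in blast)
  have "list_all2 (rel_item (linked B pref')) (path_seq pref' P) (cont (Suc g2) T')"
    unfolding seq' cT' using r' rF lcong[OF lD pq(2)] same
    by (cases "pref w") (auto simp: pref'_def[THEN fun_cong] flip_side_def p_def q_def
        intro!: list_all2_appendI)
  then have lT': "linked B pref' P T'" using mT' sT' \<open>P \<noteq> \<langle>\<rangle>\<close> by (auto simp: linked_iff)
  have bT': "belga_tree B P pref' T'" using lT' by (simp add: belga_tree_def T'_def labelled_relabel)
  have full: "distinct (flats keys_inorder (x @ H @ [Key w] @ F @ y)) \<and> distinct (flats keys_inorder (cont (Suc g) T))"
  proof -
    have d: "distinct (flats keys_inorder (cont (Suc g) T))"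
      using order linked_inorder[OF lT] by (simp only: flats_cont[OF sT])
    have "flats keys_inorder F = keys_inorder s" unfolding sF(2)[symmetric] by (rule flats_cont[OF sF(1)])
    then have "distinct (flats keys_inorder (x @ H @ [Key w] @ F @ y))"
      using d cT by (cases "pref w") (simp_all del: set_concat, blast+)
    then show ?thesis using d by blast
  qed
  have lk: "\<exists>u. linked B pref u t" if "Tree t \<in> set (x @ H @ F @ y)" for t
  proof -
    have "t \<in> set (item_trees x) \<or> t \<in> set (item_trees H) \<or> t \<in> set (item_trees F) \<or> t \<in> set (item_trees y)"
      using that by (auto simp: set_item_trees)
    then show ?thesis using rel_item_trees[OF parts(1)] rel_item_trees[OF parts(2)] rel_item_trees[OF parts(3)]
        rel_item_trees[OF sF(3)] by blast
  qed
  have cm: "cut_merge P T (depth P w) (aux_tree s) T'"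
  proof -
    obtain h0 where h0: "D' = BNil \<and> H = [Tree BNil] \<or> marked (label D') \<and> shape B 1 (Suc h0) D' \<and> H = cont (Suc h0) D'"
      using D'H by blast
    show ?thesis
    proof (rule cut_mergeI[where E = "set x \<union> set y" and H = H and F = F and h = "h - 1" and h' = h0 and D = D'])
      show "shape B 1 (Suc g) T" "marked (label T)" "shape B 1 (Suc g2) T'" "marked (label T')" by fact+
      show "set (cont (Suc g) T) = set x \<union> set y \<union> set H \<union> {Key w, Tree s}" using cT by (cases "pref w") auto
      show "set (cont (Suc g2) T') = set x \<union> set y \<union> {Tree D', Key w} \<union> set F" using cT' by (cases "pref w") auto
      show "s = BNil \<and> F = [Tree BNil] \<or> marked (label s) \<and> shape B 1 (Suc (h - 1)) s \<and> F = cont (Suc (h - 1)) s"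
        using sF sF' by auto
      show "D' = BNil \<and> H = [Tree BNil] \<or> marked (label D') \<and> shape B 1 (Suc h0) D' \<and> H = cont (Suc h0) D'" by (rule h0)
    next
      fix k assume "Key k \<in> set x \<union> set y"
      then have "k \<in> set (item_keys (al @ be))" using keys_rel[OF parts(1)] keys_rel[OF parts(2)]
        by (auto simp flip: set_item_keys)
      then show "depth P k < depth P w" using dep(1) by blast
    next
      fix k assume "Key k \<in> set H"
      then have "k \<in> set (preferred_path pref p)" using keys_rel[OF parts(3)] by (simp flip: set_item_keys add: path_seq_parts)
      then have "k \<in> set_tree p" using preferred_path_subset by blast
      then have "k \<in> set_tree \<langle>l, w, r\<rangle>" "k \<noteq> w" using pq by auto
      then show "depth P w < depth P k" using bspec[OF dep(2), of k] by simp
    next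
      fix t k assume "Tree t \<in> set x \<union> set y \<union> set H \<union> set F" "Key k \<in> insert (Key w) (set F)"
      then show "k \<notin> keys t" using full
        by (intro flats_disjoint[of keys_inorder "x @ H @ [Key w] @ F @ y", folded keys_def]) auto
    next
      fix t X assume "Tree t \<in> set x \<union> set y \<union> set H \<union> set F" "X \<in> aux_trees t"
      then show "keys X \<noteq> {} \<and> keys X \<subseteq> keys t" using lk linked_aux_trees by (metis Un_iff set_append)
    qed
  qed
  define n where "n = 92 * Suc g + 6 * h + 118"
  have "refold_equiv B n [Tree (erase T)] [Tree (erase T')]"
    using T2(3) by (simp add: atree_equiv_def n_def T'_def)
  then have rc: "reach B (50 * n + 380) (erase T, []) (erase T', [])"
    by (rule refold_cost[OF B])
       (use linked_node_sizes_ok[OF lT] linked_inorder[OF lT] order P(2,3) in auto)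
  have kd: "card (keys (aux_tree T)) = length (item_keys (cont (Suc g) T))"
    and kd': "0 < h \<Longrightarrow> card (keys (aux_tree s)) = length (item_keys (cont h s))"
  proof -
    have di: "distinct (item_keys c)" if "distinct (flats f c)" for c and f :: "atree \<Rightarrow> nat list"
      using that
    proof (induction c)
      case (Cons a c)
      then show ?case by (cases a) (auto simp: set_item_keys)
    qed simp
    show "card (keys (aux_tree T)) = length (item_keys (cont (Suc g) T))"
      unfolding keys_def aux_tree_cont(1)[OF sT] using full by (intro distinct_card di) blast
    have "distinct (item_keys F)" using full di by (metis concat_append distinct_append map_append)
    moreover assume "0 < h"
    ultimately show "card (keys (aux_tree s)) = length (item_keys (cont h s))"
      using aux_tree_cont(1)[of B 1 "h - 1" s] sF(1,2) by (simp add: keys_def distinct_card)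
  qed
  define X where "X = 1 + log (real B) (real (card (keys (aux_tree T)) + card (keys (aux_tree s))))"
  have c1: "card (keys (aux_tree T)) \<ge> 1" unfolding kd using cont_has_key[OF sT] by (simp add: Suc_le_eq)
  have lm: "log (real B) (real a) \<le> X - 1"
    if "1 \<le> a" "a \<le> card (keys (aux_tree T)) + card (keys (aux_tree s))" for a
    unfolding X_def using that B by (simp add: log_le_cancel_iff)
  have X1: "1 \<le> X" using lm[of 1] c1 by simp
  have g: "real g \<le> 3 * X" using height_le_log[OF _ sT refl] B lm[OF c1] kd by (simp add: X_def)
  \<comment> \<open>An empty path has \<open>h = 0\<close>; otherwise \<open>h\<close> is one more
    than the height that the logarithm bounds.\<close>
  have hh: "real h \<le> 3 * X + 1"
  proof (cases h)
    case (Suc h0)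
    have s0: "shape B 1 (Suc h0) s" using sF(1) Suc by simp
    have "1 \<le> card (keys (aux_tree s))" using kd' Suc cont_has_key[OF s0] by (simp add: Suc_le_eq)
    from height_le_log[OF _ s0 refl] lm[OF this] kd' Suc B show ?thesis by simp
  qed (use X1 in simp)
  \<comment> \<open>With g \<le> 3 X, h \<le> 3 X + 1 and X \<ge> 1 this is at most 25880 X; the
    constant 30000 is that number rounded up.\<close>
  have "real (50 * n + 380) = 4600 * real g + 300 * real h + 10880" by (simp add: n_def)
  also have "\<dots> \<le> 30000 * X" using g hh X1 by linarith
  finally have "real (50 * n + 380) \<le> 30000 * X" .
  moreover have "s \<in> set (links T)" unfolding aux_tree_cont(2)[OF sT]
    using cT by (cases "pref w") (auto simp: set_item_trees)
  ultimately show ?thesis using parts(4) bT' cm rc unfolding q pref'_def X_def by blast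
qed


section \<open>Searching\<close>

lemma weave_filter_position:
  fixes xss :: "nat list list"
  assumes "length xss = length ks + 1" "sorted_wrt (<) (weave xss ks)" "x \<in> set (weave xss ks)" "x \<notin> set ks"
  shows "x \<in> set (xss ! length (filter (\<lambda>k. k < x) ks))"
  using assms
proof (induction xss ks rule: interleave_induct)
  case (cons xs xss k ks)
  have sub: "set ks \<subseteq> set (weave xss ks)" using cons.hyps by (induction xss ks rule: interleave_induct) auto
  have s: "sorted_wrt (<) (weave xss ks)" "\<forall>y\<in>set (weave xss ks). k < y" "\<forall>y\<in>set xs. y < k"
    using cons.prems(1) by (auto simp: sorted_wrt_append)
  show ?case
  proof (cases "k < x")
    case True
    have "x \<notin> set xs" using bspec[OF s(3), of x] True by auto
    then have "x \<in> set (weave xss ks)" using cons.prems by auto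
    then show ?thesis using cons True s by simp
  next
    case False
    then have "\<forall>y\<in>set ks. \<not> y < x" using s(2) sub by (meson less_trans subsetD)
    then have "filter (\<lambda>k. k < x) ks = []" by (simp add: filter_empty_conv)
    moreover have "x \<in> set xs" using cons.prems False s by auto
    ultimately show ?thesis using False by simp
  qed
qed simp

lemma sorted_wrt_weave: 
  assumes "length xss = length ks + 1" "sorted_wrt (<) (weave xss ks)" "xs \<in> set xss"
  shows "sorted_wrt (<) (xs :: nat list)"
  using assms by (induction xss ks rule: interleave_induct) (auto simp: sorted_wrt_append)

text \<open>The walk follows the search-tree order and so keeps the key in its subtree. It takes at
  most \<open>g\<close> moves inside the auxiliary tree and one more to enter a link.\<close>

lemma descent_exists:
  assumes "shape B m (Suc g) T" "sorted_wrt (<) (keys_inorder T)" "x \<in> keys T"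
  shows "\<exists>p u. descent x T p u \<and> length p \<le> Suc g \<and>
    (x \<in> set (item_keys (cont (Suc g) T)) \<and> (p = [] \<and> u = T \<or> p \<noteq> [] \<and> \<not> marked (label u)) \<or>
     p \<noteq> [] \<and> marked (label u) \<and> Tree u \<in> set (cont (Suc g) T) \<and> x \<in> keys u)"
  using assms
proof (induction g arbitrary: m T)
  case 0
  from 0(1) obtain a ks ts where T: "T = BNode a ks ts" "length ts = length ks + 1"
    "\<forall>t\<in>set ts. proper B 0 t" by (auto elim!: shapeE)
  have c: "cont (Suc 0) T = interleave ts ks"
  proof -
    have "cont 0 = (\<lambda>t. [Tree t])" by (rule ext) simp
    then show ?thesis by (simp add: T(1) interleave_def)
  qed
  show ?case
  proof (cases "x \<in> set ks")
    case True
    then show ?thesis using T c by (intro exI[of _ "[]"] exI[of _ T]) (auto intro: descent.intros)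
  next
    case False
    let ?i = "length (filter (\<lambda>k. k < x) ks)"
    have i: "?i < length ts" using T(2) by (simp add: le_imp_less_Suc)
    have x: "x \<in> keys (ts ! ?i)"
      using weave_filter_position[of "map keys_inorder ts" ks x] 0 T False i by (simp add: keys_def)
    then have "ts ! ?i \<noteq> BNil" by (auto simp: keys_def)
    moreover have "proper B 0 (ts ! ?i)" using T(3) i by simp
    ultimately have "marked (label (ts ! ?i))" by (auto simp: inner_def is_link_def)
    moreover have "Tree (ts ! ?i) \<in> set (cont (Suc 0) T)"
      using T(2) i by (simp flip: set_item_trees add: c)
    moreover have "descent x T [?i] (ts ! ?i)"
      unfolding T(1) by (rule descent.intros(2)) (use False \<open>ts ! ?i \<noteq> BNil\<close> calculation in auto)
    ultimately show ?thesis using x by (intro exI[of _ "[?i]"] exI[of _ "ts ! ?i"]) auto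
  qed
next
  case (Suc g)
  from Suc.prems(1) obtain a ks ts where T: "T = BNode a ks ts" "length ts = length ks + 1"
    "\<forall>t\<in>set ts. proper B (Suc g) t" by (auto elim!: shapeE)
  show ?case
  proof (cases "x \<in> set ks")
    case True
    have "set ks \<subseteq> set (item_keys (cont (Suc (Suc g)) T))"
      using T(2) unfolding T(1) by (induction ts ks rule: interleave_induct) auto
    then show ?thesis using True T by (intro exI[of _ "[]"] exI[of _ T]) (auto intro: descent.intros)
  next
    case False
    let ?i = "length (filter (\<lambda>k. k < x) ks)"
    let ?t = "ts ! ?i"
    have i: "?i < length ts" using T(2) by (simp add: le_imp_less_Suc)
    have x: "x \<in> keys ?t"
      using weave_filter_position[of "map keys_inorder ts" ks x] Suc.prems T False i by (simp add: keys_def)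
    have t: "shape B (min_keys B) (Suc g) ?t" "\<not> marked (label ?t)" using T(3) i by (auto simp: inner_def)
    have nt: "?t \<noteq> BNil" using t by auto
    have "sorted_wrt (<) (keys_inorder ?t)"
      using sorted_wrt_weave[of "map keys_inorder ts" ks] Suc.prems(2) T i by auto
    from Suc.IH[OF t(1) this x] obtain p u where p: "descent x ?t p u" "length p \<le> Suc g"
      "x \<in> set (item_keys (cont (Suc g) ?t)) \<and> (p = [] \<and> u = ?t \<or> p \<noteq> [] \<and> \<not> marked (label u)) \<or>
       p \<noteq> [] \<and> marked (label u) \<and> Tree u \<in> set (cont (Suc g) ?t) \<and> x \<in> keys u" by blast
    have d: "descent x T (?i # p) u"
      unfolding T(1) by (rule descent.intros(3)) (use False nt t p in auto)
    have "set (cont (Suc g) ?t) \<subseteq> set (cont (Suc (Suc g)) T)"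
    proof -
      have "xs \<in> set xss \<Longrightarrow> set xs \<subseteq> set (weave xss ks)" for xs xss and ks :: "atree item list"
        by (induction xss ks rule: weave.induct) auto
      then show ?thesis using i by (simp add: T(1))
    qed
    then show ?thesis using d p t by (intro exI[of _ "?i # p"] exI[of _ u]) (auto simp: set_item_keys)
  qed
qed

text \<open>Lets facts about the walk known to exist be applied to the walk of a given run.\<close>

lemma descent_deterministic:
  "descent x T p u \<Longrightarrow> descent x T p' u' \<Longrightarrow> p = p' \<and> u = u'"
proof (induction arbitrary: p' u' rule: descent.induct)
  case (1 ks a ts)
  from 1(2) show ?case by cases (use 1 in auto)
next
  case (2 ks i ts a)
  from 2(5) show ?case by cases (use 2 in auto)
next
  case (3 ks i ts p u a)
  note IH = 3(6) and hyps = 3(1,2,4)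
  from 3(7) show ?case
  proof cases
    case (3 j p'')
    then show ?thesis using IH hyps(2) by simp
  qed (use hyps in auto)
qed

section \<open>Where a walk leaves the preferred path\<close>

text \<open>The subtree that holds \<open>x\<close> hangs off a path key \<open>w\<close> at which
  the search and the preference disagree, and its root lies one level below \<open>w\<close>. So the
  depth \<open>d - 1\<close> which the algorithm obtains from a label is the depth of
  \<open>w\<close>.\<close>

lemma hanging_gap:
  assumes "bst P" "q \<in> set (hanging pref P)" "x \<in> set_tree q"
  shows "\<exists>w\<in>set (preferred_path pref P). q = other_child pref P w \<and> side_of x w \<noteq> pref w \<and>
    x \<in> set_tree (subtree_of P w) \<and> (\<forall>k\<in>set_tree q. depth P w + 1 \<le> depth P k) \<and>
    (\<exists>k\<in>set (preferred_path pref q). depth P k = depth P w + 1)"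
  using assms(1,2)
proof (induction P)
  case Leaf
  then show ?case using assms(3) by simp
next
  case (Node l v r)
  have b: "\<forall>k\<in>set_tree l. k < v" "\<forall>k\<in>set_tree r. v < k" using Node.prems(1) by auto
  have root: "\<exists>k\<in>set (preferred_path pref q). depth q k = 0 \<and> k \<in> set_tree q"
    using assms(3) by (cases q) (auto split: side.splits)
  have sub: "q \<in> set (hanging pref t) \<Longrightarrow> set_tree q \<subseteq> set_tree t" for t
    using set_tree_path_seq by (simp flip: path_seq_parts)
  show ?case
  proof (cases "pref v")
    case L
    consider "q = r" | "q \<in> set (hanging pref l)" using Node.prems(2) L by auto
    then show ?thesis
    proof cases
      case 1
      have lt: "v < k" if "k \<in> set_tree q" for k using b 1 that by blast
      obtain k where k: "k \<in> set (preferred_path pref q)" "depth q k = 0" "k \<in> set_tree q" using root by blast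
      have d: "depth \<langle>l, v, r\<rangle> k = Suc (depth q k)" if "k \<in> set_tree q" for k using lt[OF that] 1 by auto
      show ?thesis
      proof (rule bexI[of _ v], intro conjI)
        show "side_of x v \<noteq> pref v" using lt[OF assms(3)] L by (auto simp: side_of_def)
        show "\<forall>k\<in>set_tree q. depth \<langle>l, v, r\<rangle> v + 1 \<le> depth \<langle>l, v, r\<rangle> k" using d by simp
        show "\<exists>k\<in>set (preferred_path pref q). depth \<langle>l, v, r\<rangle> k = depth \<langle>l, v, r\<rangle> v + 1"
          using k d[OF k(3)] by (intro bexI[of _ k]) auto
      qed (use 1 L assms(3) in \<open>auto simp: other_child_def\<close>)
    next
      case 2
      obtain w where w: "w \<in> set (preferred_path pref l)" "q = other_child pref l w" "side_of x w \<noteq> pref w"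
        "x \<in> set_tree (subtree_of l w)" "\<forall>k\<in>set_tree q. depth l w + 1 \<le> depth l k"
        "\<exists>k\<in>set (preferred_path pref q). depth l k = depth l w + 1"
        using Node.IH(1) Node.prems 2 by auto
      have wl: "w < v" "\<And>k. k \<in> set_tree q \<Longrightarrow> k < v" using b w(1) preferred_path_subset sub[OF 2] by blast+
      obtain k where k: "k \<in> set (preferred_path pref q)" "depth l k = depth l w + 1" using w(6) by blast
      have kq: "k \<in> set_tree q" using k(1) preferred_path_subset by blast
      have d: "depth \<langle>l, v, r\<rangle> k = Suc (depth l k)" if "k \<in> set_tree q \<or> k = w" for k using wl(1) wl(2)[of k] that by auto
      show ?thesis
      proof (rule bexI[of _ w], intro conjI)
        show "\<forall>k\<in>set_tree q. depth \<langle>l, v, r\<rangle> w + 1 \<le> depth \<langle>l, v, r\<rangle> k" using w(5) d by simp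
        show "\<exists>k\<in>set (preferred_path pref q). depth \<langle>l, v, r\<rangle> k = depth \<langle>l, v, r\<rangle> w + 1"
          using k(2) d[of k] d[of w] kq by (intro bexI[OF _ k(1)]) auto
        show "q = other_child pref \<langle>l, v, r\<rangle> w" "x \<in> set_tree (subtree_of \<langle>l, v, r\<rangle> w)"
          using w(2,4) wl(1) by (cases "pref w"; auto simp: other_child_def)+
      qed (use w(1,3) L in auto)
    qed
  next
    case R
    consider "q = l" | "q \<in> set (hanging pref r)" using Node.prems(2) R by auto
    then show ?thesis
    proof cases
      case 1
      have lt: "k < v" if "k \<in> set_tree q" for k using b 1 that by blast
      obtain k where k: "k \<in> set (preferred_path pref q)" "depth q k = 0" "k \<in> set_tree q" using root by blast
      have d: "depth \<langle>l, v, r\<rangle> k = Suc (depth q k)" if "k \<in> set_tree q" for k using lt[OF that] 1 by auto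
      show ?thesis
      proof (rule bexI[of _ v], intro conjI)
        show "side_of x v \<noteq> pref v" using lt[OF assms(3)] R by (auto simp: side_of_def)
        show "\<forall>k\<in>set_tree q. depth \<langle>l, v, r\<rangle> v + 1 \<le> depth \<langle>l, v, r\<rangle> k" using d by simp
        show "\<exists>k\<in>set (preferred_path pref q). depth \<langle>l, v, r\<rangle> k = depth \<langle>l, v, r\<rangle> v + 1"
          using k d[OF k(3)] by (intro bexI[of _ k]) auto
      qed (use 1 R assms(3) in \<open>auto simp: other_child_def\<close>)
    next
      case 2
      obtain w where w: "w \<in> set (preferred_path pref r)" "q = other_child pref r w" "side_of x w \<noteq> pref w"
        "x \<in> set_tree (subtree_of r w)" "\<forall>k\<in>set_tree q. depth r w + 1 \<le> depth r k"
        "\<exists>k\<in>set (preferred_path pref q). depth r k = depth r w + 1"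
        using Node.IH(2) Node.prems 2 by auto
      have wl: "v < w" "\<And>k. k \<in> set_tree q \<Longrightarrow> v < k" using b w(1) preferred_path_subset sub[OF 2] by blast+
      obtain k where k: "k \<in> set (preferred_path pref q)" "depth r k = depth r w + 1" using w(6) by blast
      have kq: "k \<in> set_tree q" using k(1) preferred_path_subset by blast
      have d: "depth \<langle>l, v, r\<rangle> k = Suc (depth r k)" if "k \<in> set_tree q \<or> k = w" for k using wl(1) wl(2)[of k] that by auto
      show ?thesis
      proof (rule bexI[of _ w], intro conjI)
        show "\<forall>k\<in>set_tree q. depth \<langle>l, v, r\<rangle> w + 1 \<le> depth \<langle>l, v, r\<rangle> k" using w(5) d by simp
        show "\<exists>k\<in>set (preferred_path pref q). depth \<langle>l, v, r\<rangle> k = depth \<langle>l, v, r\<rangle> w + 1"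
          using k(2) d[of k] d[of w] kq by (intro bexI[OF _ k(1)]) auto
        show "q = other_child pref \<langle>l, v, r\<rangle> w" "x \<in> set_tree (subtree_of \<langle>l, v, r\<rangle> w)"
          using w(2,4) wl(1) by (cases "pref w"; auto simp: other_child_def)+
      qed (use w(1,3) R in auto)
    qed
  qed
qed

text \<open>A path has one key per level, so a depth determines the key at which the path is
  cut.\<close>

lemma preferred_path_depth_inj:
  assumes "bst P" shows "inj_on (depth P) (set (preferred_path pref P))"
  using assms
proof (induction P)
  case (Node l v r)
  have b: "\<forall>k\<in>set_tree l. k < v" "\<forall>k\<in>set_tree r. v < k" using Node.prems by auto
  have "\<forall>k\<in>set (preferred_path pref l). k < v" "\<forall>k\<in>set (preferred_path pref r). v < k"
    using b preferred_path_subset by blast+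
  then show ?case using Node
    by (auto split: side.splits simp: inj_on_def)
qed simp

text \<open>A key on the path is reached by following preferences. The key \<open>x\<close> itself
  is excluded because its own preference may still point to the right.\<close>

lemma on_path_sides:
  assumes "bst P" "x \<in> set (preferred_path pref P)" "x \<in> set_tree (subtree_of P v)" "v \<noteq> x"
  shows "side_of x v = pref v"
  using assms
proof (induction P)
  case (Node l u r)
  have sub: "set_tree (subtree_of t v) \<subseteq> set_tree t" for t by (induction t) auto
  have b: "\<forall>k\<in>set_tree l. k < u" "\<forall>k\<in>set_tree r. u < k" using Node.prems by auto
  consider "x = u" | "x \<in> set (preferred_path pref l)" "pref u = L" | "x \<in> set (preferred_path pref r)" "pref u = R"
    using Node.prems(2) by (auto split: side.splits)
  then show ?case
  proof cases
    case 1
    then show ?thesis using Node.prems sub b by (auto split: if_splits)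
  next
    case 2
    then have x: "x < u" "x \<in> set_tree l" using b preferred_path_subset by blast+
    then have "x \<notin> set_tree (subtree_of r v)" using sub[of r] b(2) less_asym by blast
    then show ?thesis using Node.IH(1) Node.prems 2 x
      by (cases "v = u") (auto simp: side_of_def split: if_splits)
  next
    case 3
    then have x: "u < x" "x \<in> set_tree r" using b preferred_path_subset by blast+
    then have "x \<notin> set_tree (subtree_of l v)" using sub[of l] b(1) less_asym by blast
    then show ?thesis using Node.IH(2) Node.prems 3 x
      by (cases "v = u") (auto simp: side_of_def split: if_splits)
  qed
qed simp

lemma set_tree_linked: "linked B pref P T \<Longrightarrow> keys T = set_tree P"
  using linked_inorder by (fastforce simp: keys_def)

text \<open>Joins the walk in the B-tree with the picture in \<open>P\<close>: it ends at
  \<open>x\<close> on the topmost path or at the link of a disagreement. At most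
  \<open>g + 1\<close> moves with g \<le> 3 (1 + log) give the factor 5.\<close>

lemma belga_descent:
  assumes "2 \<le> B" "bst P" "belga_tree B P pref T" "x \<in> set_tree P"
  shows "keys (aux_tree T) = set (preferred_path pref P) \<and> (\<exists>p u. descent x T p u \<and>
    real (length p) \<le> 5 * (1 + log (real B) (real (card (keys (aux_tree T))))) \<and>
    (x \<in> set (preferred_path pref P) \<and> (p = [] \<or> \<not> marked (label u)) \<or>
     p \<noteq> [] \<and> marked (label u) \<and> u \<in> set (links T) \<and> x \<in> keys u \<and>
     (\<exists>w\<in>set (preferred_path pref P). linked B pref (other_child pref P w) u \<and> side_of x w \<noteq> pref w \<and>
        x \<in> set_tree (subtree_of P w) \<and> min_depth (label u) = depth P w + 1)))"
proof -
  have lT: "linked B pref P T" and lab: "labelled P T" using assms(3) by (auto simp: belga_tree_def)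
  have "P \<noteq> \<langle>\<rangle>" using assms(4) by auto
  with lT obtain g where mT: "marked (label T)" and sT: "shape B 1 (Suc g) T"
    and rT: "list_all2 (rel_item (linked B pref)) (path_seq pref P) (cont (Suc g) T)" by (auto simp: linked_iff)
  have kT: "keys_inorder (aux_tree T) = preferred_path pref P"
    using lT \<open>P \<noteq> \<langle>\<rangle>\<close> by (auto elim: linked.cases)
  have so: "sorted_wrt (<) (inorder P)" using assms(2) by (simp add: bst_iff_sorted_wrt_less)
  have di: "distinct (flats keys_inorder (cont (Suc g) T))"
    unfolding flats_cont[OF sT] linked_inorder[OF lT] using so by (simp add: strict_sorted_iff)
  have ik: "item_keys (cont (Suc g) T) = preferred_path pref P" using kT aux_tree_cont(1)[OF sT] by simp
  have dp: "distinct (preferred_path pref P)"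
  proof -
    have "distinct (item_keys c)" if "distinct (flats f c)" for c and f :: "atree \<Rightarrow> nat list"
      using that
    proof (induction c)
      case (Cons a c)
      then show ?case by (cases a) (auto simp: set_item_keys)
    qed simp
    then show ?thesis using di ik by metis
  qed
  have K: "keys (aux_tree T) = set (preferred_path pref P)" by (simp add: keys_def kT)
  have cn: "card (keys (aux_tree T)) = length (item_keys (cont (Suc g) T))"
    unfolding K ik using dp by (rule distinct_card)
  have ne: "1 \<le> length (item_keys (cont (Suc g) T))" using cont_has_key[OF sT] by (simp add: Suc_le_eq)
  obtain p u where p: "descent x T p u" "length p \<le> Suc g"
    "x \<in> set (item_keys (cont (Suc g) T)) \<and> (p = [] \<and> u = T \<or> p \<noteq> [] \<and> \<not> marked (label u)) \<or>
     p \<noteq> [] \<and> marked (label u) \<and> Tree u \<in> set (cont (Suc g) T) \<and> x \<in> keys u"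
    using descent_exists[OF sT, of x] so linked_inorder[OF lT] set_tree_linked[OF lT] assms(4) by auto
  have "log (real B) (real (card (keys (aux_tree T)))) \<ge> 0" using ne assms(1) unfolding cn by (subst zero_le_log_cancel_iff) auto
  then have len: "real (length p) \<le> 5 * (1 + log (real B) (real (card (keys (aux_tree T)))))"
    using of_nat_mono[OF p(2), where ?'a = real] height_le_log[OF assms(1) sT refl] unfolding cn of_nat_Suc by argo
  have gap: "\<exists>w\<in>set (preferred_path pref P). linked B pref (other_child pref P w) u \<and> side_of x w \<noteq> pref w \<and>
        x \<in> set_tree (subtree_of P w) \<and> min_depth (label u) = depth P w + 1"
    if u: "Tree u \<in> set (cont (Suc g) T)" "x \<in> keys u" "marked (label u)"
  proof -
    have "u \<in> set (item_trees (cont (Suc g) T))" using u by (simp add: set_item_trees)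
    from rel_item_trees[OF rT this] obtain q where q: "q \<in> set (hanging pref P)" "linked B pref q u"
      by (auto simp: path_seq_parts)
    have xq: "x \<in> set_tree q" using set_tree_linked[OF q(2)] u(2) by simp
    from hanging_gap[OF assms(2) q(1) xq] obtain w where w: "w \<in> set (preferred_path pref P)"
      "q = other_child pref P w" "side_of x w \<noteq> pref w" "x \<in> set_tree (subtree_of P w)"
      "\<forall>k\<in>set_tree q. depth P w + 1 \<le> depth P k" "\<exists>k\<in>set (preferred_path pref q). depth P k = depth P w + 1" by blast
    have "q \<noteq> \<langle>\<rangle>" using xq by auto
    then have ku: "keys (aux_tree u) = set (preferred_path pref q)"
      using q(2) by (auto elim: linked.cases simp: keys_def)
    have "labelled P u" by (rule labelled_cont[OF sT lab]) (use u in \<open>simp add: set_item_trees\<close>)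
    then have "min_depth (label u) = Min (depth P ` set (preferred_path pref q))"
      using u(2) ku by (cases u) (auto simp: keys_def)
    also have "\<dots> = depth P w + 1"
      using w(5,6) preferred_path_subset[of pref q] by (intro Min_eqI) (auto, metis imageI)
    finally show ?thesis using w q by auto
  qed
  show ?thesis
    using K p(1) len p(3) gap unfolding ik
    by (intro conjI exI[of _ p] exI[of _ u]) (auto simp: aux_tree_cont(2)[OF sT] set_item_trees)
qed

section \<open>Existence of searches and runs\<close>

text \<open>Each round only anticipates one of the changes that the search makes anyway, so the
  final preferences are the same.\<close>

lemma after_search_step:
  assumes "x \<in> set_tree (subtree_of P w)"
  shows "after_search P x (pref(w := side_of x w)) = after_search P x pref"
  using assms by (auto simp: after_search_def)

text \<open>All proper ancestors agree with the search already; only \<open>x\<close> can still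
  change, and \<open>side_of x x\<close> is \<open>L\<close>.\<close>

lemma after_search_found:
  assumes "bst P" "x \<in> set (preferred_path pref P)"
  shows "after_search P x pref = pref(x := L)"
proof
  fix v
  have "bst t \<Longrightarrow> x \<in> set_tree t \<Longrightarrow> x \<in> set_tree (subtree_of t x)" for t by (induction t) auto
  then have "x \<in> set_tree (subtree_of P x)" using assms preferred_path_subset by blast
  then show "after_search P x pref v = (pref(x := L)) v"
    using on_path_sides[OF assms, of v] by (auto simp: after_search_def side_of_def)
qed

lemma side_flip: "s \<noteq> t \<Longrightarrow> s = flip_side t"
  by (cases s; cases t) (auto simp: flip_side_def)

text \<open>Every cut and merge makes one more ancestor of \<open>x\<close> agree with the search,
  so the number of disagreeing ancestors bounds the rounds.\<close>

lemma belga_search_exists: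
  assumes B: "4 \<le> B" and P: "bst P" "0 \<notin> set_tree P" "5 \<le> size P" and x: "x \<in> set_tree P"
    and T: "belga_tree B P pref T"
  shows "\<exists>n T'. belga_search 40000 B P x pref T n T' \<and> belga_tree B P (after_search P x pref) T'"
  using T
proof (induction "card {v \<in> set_tree P. x \<in> set_tree (subtree_of P v) \<and> pref v \<noteq> side_of x v}"
    arbitrary: pref T rule: less_induct)
  case less
  have B2: "2 \<le> B" using B by simp
  from belga_descent[OF B2 P(1) less.prems x] obtain p u where K: "keys (aux_tree T) = set (preferred_path pref P)"
    and p: "descent x T p u" "real (length p) \<le> 5 * (1 + log (real B) (real (card (keys (aux_tree T)))))"
    and cases: "x \<in> set (preferred_path pref P) \<and> (p = [] \<or> \<not> marked (label u)) \<or>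
     p \<noteq> [] \<and> marked (label u) \<and> u \<in> set (links T) \<and> x \<in> keys u \<and>
     (\<exists>w\<in>set (preferred_path pref P). linked B pref (other_child pref P w) u \<and> side_of x w \<noteq> pref w \<and>
        x \<in> set_tree (subtree_of P w) \<and> min_depth (label u) = depth P w + 1)" by blast
  have lT: "linked B pref P T" using less.prems by (simp add: belga_tree_def)
  \<comment> \<open>\<open>flip_preference\<close> starts at the root, whereas the walk has left the
    pointer at \<open>p\<close>. The way back adds at most 5 times the same logarithmic term to the
    30000, within 40000.\<close>
  have run: "\<exists>j. cut_merge_run 40000 B P T p (depth P w) S T' j"
    if "cut_merge P T (depth P w) S T'" "reach B c (erase T, []) (erase T', [])"
      "real c \<le> 30000 * (1 + log (real B) (real (card (keys (aux_tree T)) + card (keys S))))" for w S T' c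
  proof -
    let ?X = "1 + log (real B) (real (card (keys (aux_tree T)) + card (keys S)))"
    have "reach B (length p + c) (erase T, p) (erase T', [])" by (rule reach_trans[OF reach_to_root that(2)])
    then obtain j where j: "j \<le> length p + c" "(step B ^^ j) (erase T, p) (erase T', [])" unfolding reach_def by blast
    have c0: "card (keys (aux_tree T)) > 0"
    proof -
      have "preferred_path pref P \<noteq> []" using x by (cases P) (auto split: side.splits)
      then show ?thesis unfolding K by (simp add: card_gt_0_iff)
    qed
    define Y Z where "Y = log (real B) (real (card (keys (aux_tree T)) + card (keys S)))"
      and "Z = log (real B) (real (card (keys (aux_tree T))))"
    have "Z \<le> Y" unfolding Y_def Z_def using c0 B by (subst log_le_cancel_iff) auto
    moreover have "0 \<le> Z" unfolding Z_def using c0 B by simp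
    moreover have "real j \<le> real (length p) + real c" using j(1) by linarith
    moreover note p(2)[folded Z_def] that(3)[folded Y_def]
    ultimately have "real j \<le> 40000 * ?X" unfolding Y_def[symmetric] by argo
    then show ?thesis using that(1) j(2) unfolding cut_merge_run_def by blast
  qed
  from cases show ?case
  proof
    assume "p \<noteq> [] \<and> marked (label u) \<and> u \<in> set (links T) \<and> x \<in> keys u \<and>
     (\<exists>w\<in>set (preferred_path pref P). linked B pref (other_child pref P w) u \<and> side_of x w \<noteq> pref w \<and>
        x \<in> set_tree (subtree_of P w) \<and> min_depth (label u) = depth P w + 1)"
    then obtain w where u: "p \<noteq> []" "marked (label u)" "u \<in> set (links T)" "x \<in> keys u"
      and w: "w \<in> set (preferred_path pref P)" "linked B pref (other_child pref P w) u" "side_of x w \<noteq> pref w"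
        "x \<in> set_tree (subtree_of P w)" "min_depth (label u) = depth P w + 1" by blast
    from flip_preference[OF B P less.prems w(1)] obtain s T' c where s: "s \<in> set (links T)"
      "linked B pref (other_child pref P w) s" "belga_tree B P (pref(w := flip_side (pref w))) T'"
      "cut_merge P T (depth P w) (aux_tree s) T'" "reach B c (erase T, []) (erase T', [])"
      "real c \<le> 30000 * (1 + log (real B) (real (card (keys (aux_tree T)) + card (keys (aux_tree s)))))" by blast
    \<comment> \<open>\<open>flip_preference\<close> supplies a link for the other child of
      \<open>w\<close>. It has the same keys as the link that was met, and keys identify a
      link.\<close>
    have "s = u"
    proof -
      have "P \<noteq> \<langle>\<rangle>" using x by auto
      with lT obtain g where sT: "shape B 1 (Suc g) T" by (auto simp: linked_iff)
      have so: "sorted_wrt (<) (inorder P)" using P(1) by (simp add: bst_iff_sorted_wrt_less)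
      have "distinct (flats keys_inorder (cont (Suc g) T))"
        unfolding flats_cont[OF sT] linked_inorder[OF lT] using so by (simp add: strict_sorted_iff)
      moreover have "Tree s \<in> set (cont (Suc g) T)" "Tree u \<in> set (cont (Suc g) T)"
        using s(1) u(3) unfolding aux_tree_cont(2)[OF sT] by (simp_all add: set_item_trees)
      moreover have "keys_inorder s = keys_inorder u" using linked_inorder[OF s(2)] linked_inorder[OF w(2)] by simp
      moreover have "keys_inorder u \<noteq> []" using u(4) by (auto simp: keys_def)
      ultimately show ?thesis using flats_unique_tree by metis
    qed
    define pref' where "pref' = pref(w := side_of x w)"
    have fl: "pref(w := flip_side (pref w)) = pref'" unfolding pref'_def using side_flip[OF w(3)] by simp
    from run[OF s(4-6)] obtain j where j: "cut_merge_run 40000 B P T p (depth P w) (aux_tree u) T' j"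
      using \<open>s = u\<close> by blast
    have wP: "w \<in> set_tree P" using w(1) preferred_path_subset by blast
    let ?S = "{v \<in> set_tree P. x \<in> set_tree (subtree_of P v) \<and> pref v \<noteq> side_of x v}"
    have "{v \<in> set_tree P. x \<in> set_tree (subtree_of P v) \<and> pref' v \<noteq> side_of x v} = ?S - {w}"
      unfolding pref'_def by auto
    moreover have "w \<in> ?S" using w(3,4) wP by auto
    ultimately have "card {v \<in> set_tree P. x \<in> set_tree (subtree_of P v) \<and> pref' v \<noteq> side_of x v} < card ?S"
      using card_Diff1_less[of ?S w] by simp
    from less.hyps[OF this] s(3) obtain n T'' where n: "belga_search 40000 B P x pref' T' n T''"
      "belga_tree B P (after_search P x pref') T''" unfolding fl by blast
    have "belga_search 40000 B P x pref T (length p + j + n) T''"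
      by (rule belga_search.switch[OF p(1) u(1,2) refl, of w P pref' pref 40000 B T'])
         (use w j s(3) n K fl in \<open>auto simp: pref'_def\<close>)
    then show ?thesis using n(2) after_search_step[OF w(4), of pref] unfolding pref'_def by auto
  next
    assume "x \<in> set (preferred_path pref P) \<and> (p = [] \<or> \<not> marked (label u))"
    then have xp: "x \<in> set (preferred_path pref P)" and pu: "p = [] \<or> \<not> marked (label u)" by auto
    have af: "after_search P x pref = pref(x := L)" by (rule after_search_found[OF P(1) xp])
    show ?thesis
    proof (cases "pref x")
      case L
      then have "pref(x := L) = pref" by auto
      then show ?thesis using belga_search.found_left[where pref = pref, OF p(1) pu L] less.prems unfolding af by (intro exI conjI) auto
    next
      case R
      from flip_preference[OF B P less.prems xp] obtain s T' c where s: "s \<in> set (links T)"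
        "linked B pref (other_child pref P x) s" "belga_tree B P (pref(x := flip_side (pref x))) T'"
        "cut_merge P T (depth P x) (aux_tree s) T'" "reach B c (erase T, []) (erase T', [])"
        "real c \<le> 30000 * (1 + log (real B) (real (card (keys (aux_tree T)) + card (keys (aux_tree s)))))" by blast
      from run[OF s(4-6)] obtain j where j: "cut_merge_run 40000 B P T p (depth P x) (aux_tree s) T' j" by blast
      have q: "other_child pref P x = left (subtree_of P x)" using R by (simp add: other_child_def)
      have S1: "keys_inorder (aux_tree s) = preferred_path pref (left (subtree_of P x))"
        using s(2) unfolding q by (cases rule: linked.cases) auto
      have S2: "aux_tree s \<in> insert BNil (aux_trees T)"
      proof (cases "s = BNil")
        case False
        have "P \<noteq> \<langle>\<rangle>" using x by auto
        with lT obtain g where sT: "shape B 1 (Suc g) T" "marked (label T)" by (auto simp: linked_iff)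
        have "marked (label s)" using s(2) False by (cases rule: linked.cases) auto
        then have "aux_tree s \<in> aux_trees s" using False by (cases s) auto
        moreover have "Tree s \<in> set (cont (Suc g) T)"
          using s(1) unfolding aux_tree_cont(2)[OF sT(1)] by (simp add: set_item_trees)
        ultimately show ?thesis using aux_trees_cont[OF sT] by auto
      qed simp
      have bt: "belga_tree B P (pref(x := L)) T'" using s(3) R by (simp add: flip_side_def)
      show ?thesis using belga_search.found_right[where pref = pref, OF p(1) pu R S2 S1 j bt] bt unfolding af by blast
    qed
  qed
qed

lemma reference_tree_facts:
  assumes "reference_tree N P"
  shows "bst P" "set_tree P = {1..N}" "0 \<notin> set_tree P" "size P = N"
proof -
  have i: "inorder P = [1..<N + 1]" using assms by (simp add: reference_tree_def)
  show "bst P" by (simp add: bst_iff_sorted_wrt_less i del: upt_Suc)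
  have "set_tree P = set [1..<N + 1]" unfolding i[symmetric] by simp
  also have "\<dots> = {1..N}" by (simp add: atLeastLessThanSuc_atLeastAtMost del: upt_Suc)
  finally show "set_tree P = {1..N}" .
  then show "0 \<notin> set_tree P" by simp
  show "size P = N" using arg_cong[OF i, of length] by simp
qed

theorem belga_run_exists:
  assumes "4 \<le> B" "5 \<le> N" "reference_tree N P" "belga_tree B P pref T" "set X \<subseteq> {1..N}"
  shows "\<exists>n. belga_run 40000 B P pref T X n"
  using assms(4,5)
proof (induction X arbitrary: pref T)
  case Nil
  then show ?case using belga_run.intros(1) by blast
next
  case (Cons x X)
  note P = reference_tree_facts[OF assms(3)]
  have "x \<in> set_tree P" "5 \<le> size P" using Cons.prems P(2,4) assms(2) by auto
  from belga_search_exists[OF assms(1) P(1,3) this(2,1) Cons.prems(1)] obtain n T' where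
    n: "belga_search 40000 B P x pref T n T'" "belga_tree B P (after_search P x pref) T'" by blast
  from Cons.IH[OF n(2)] Cons.prems obtain m where "belga_run 40000 B P (after_search P x pref) T' X m" by auto
  then show ?case using belga_run.intros(2)[OF n] by blast
qed


section \<open>The interleave lower bound\<close>

definition region :: "nat tree \<Rightarrow> nat \<Rightarrow> side \<Rightarrow> nat set" where
  "region P v s = {k \<in> set_tree (subtree_of P v). side_of k v = s}"

abbreviation top_depth :: "(nat \<Rightarrow> nat) \<Rightarrow> nat set \<Rightarrow> nat" where
  "top_depth D A \<equiv> Min (D ` A)"

definition level_count :: "(nat \<Rightarrow> nat) \<Rightarrow> nat \<Rightarrow> nat set \<Rightarrow> nat" where
  "level_count D d A = card {k \<in> A. D k = d}"

text \<open>\<open>D k\<close> is the depth of the node that holds \<open>k\<close>. The keys of least depth in an interval of keys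
  all lie in one node. The light side of \<open>v\<close> is the one whose topmost node is deeper or, if both
  sides have the same topmost node, the one with fewer keys in it.\<close>

definition light :: "(nat \<Rightarrow> nat) \<Rightarrow> nat tree \<Rightarrow> nat \<Rightarrow> side \<Rightarrow> bool" where
  "light D P v s \<longleftrightarrow> (let A = region P v s; A' = region P v (flip_side s) in
     A = {} \<or> A' \<noteq> {} \<and> (top_depth D A' < top_depth D A \<or> top_depth D A' = top_depth D A \<and>
       level_count D (top_depth D A) A \<le> level_count D (top_depth D A) A'))"

lemma flip_flip [simp]: "flip_side (flip_side s) = s"
  by (cases s) (auto simp: flip_side_def)

lemma finite_region [simp]: "finite (region P v s)"
  by (simp add: region_def)

text \<open>In a tie both sides may be light. That some side always is makes a switch to a side that
  is not light release potential, because the abandoned side must have been light.\<close>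

lemma light_total: "light D P v s \<or> light D P v (flip_side s)"
  unfolding light_def Let_def flip_flip by (cases "top_depth D (region P v s)" "top_depth D (region P v (flip_side s))" rule: linorder_cases) auto

definition ancestors :: "nat tree \<Rightarrow> nat \<Rightarrow> nat set" where
  "ancestors P x = {v \<in> set_tree P. x \<in> set_tree (subtree_of P v)}"

text \<open>The places where a search for \<open>x\<close> takes a light side, sorted by the level
  of the topmost node of that side. The bound for a search is obtained level by level.\<close>

definition light_at :: "(nat \<Rightarrow> nat) \<Rightarrow> nat tree \<Rightarrow> nat \<Rightarrow> nat \<Rightarrow> nat set" where
  "light_at D P x d = {v \<in> ancestors P x. light D P v (side_of x v) \<and> top_depth D (region P v (side_of x v)) = d}"

lemma set_subtree_of: "set_tree (subtree_of P v) \<subseteq> set_tree P"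
  by (induction P) auto

lemma region_child:
  assumes "bst \<langle>l, u, r\<rangle>"
  shows "v \<in> set_tree l \<Longrightarrow> region \<langle>l, u, r\<rangle> v = region l v" "v \<in> set_tree r \<Longrightarrow> region \<langle>l, u, r\<rangle> v = region r v"
  using assms by (auto simp: region_def fun_eq_iff dest: bspec)

lemma light_child:
  assumes "bst \<langle>l, u, r\<rangle>"
  shows "v \<in> set_tree l \<Longrightarrow> light D \<langle>l, u, r\<rangle> v = light D l v" "v \<in> set_tree r \<Longrightarrow> light D \<langle>l, u, r\<rangle> v = light D r v"
  by (auto simp: light_def fun_eq_iff region_child[OF assms])

lemma ancestors_Node:
  assumes "bst \<langle>l, u, r\<rangle>"
  shows "x \<in> set_tree l \<Longrightarrow> ancestors \<langle>l, u, r\<rangle> x = insert u (ancestors l x)"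
    "x \<in> set_tree r \<Longrightarrow> ancestors \<langle>l, u, r\<rangle> x = insert u (ancestors r x)"
    "ancestors \<langle>l, u, r\<rangle> u = {u}"
proof -
  have b: "\<forall>k\<in>set_tree l. k < u" "\<forall>k\<in>set_tree r. u < k" using assms by auto
  have sl: "v \<in> set_tree l \<Longrightarrow> subtree_of \<langle>l, u, r\<rangle> v = subtree_of l v"
    and sr: "v \<in> set_tree r \<Longrightarrow> subtree_of \<langle>l, u, r\<rangle> v = subtree_of r v" for v
    using b by auto
  have dj: "x \<in> set_tree l \<Longrightarrow> x \<notin> set_tree r" "u \<notin> set_tree l" "u \<notin> set_tree r" using b by force+
  show "x \<in> set_tree l \<Longrightarrow> ancestors \<langle>l, u, r\<rangle> x = insert u (ancestors l x)"
    using sl sr dj set_subtree_of[of r] by (auto simp: ancestors_def simp del: subtree_of.simps) (auto)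
  show "x \<in> set_tree r \<Longrightarrow> ancestors \<langle>l, u, r\<rangle> x = insert u (ancestors r x)"
    using sl sr dj set_subtree_of[of l] by (auto simp: ancestors_def simp del: subtree_of.simps) (auto)
  show "ancestors \<langle>l, u, r\<rangle> u = {u}"
  proof -
    have "v = u" if "v \<in> ancestors \<langle>l, u, r\<rangle> u" for v
    proof (rule ccontr)
      assume "v \<noteq> u"
      then have "v \<in> set_tree l \<or> v \<in> set_tree r" using that by (auto simp: ancestors_def)
      moreover have "u \<in> set_tree (subtree_of \<langle>l, u, r\<rangle> v)" using that by (simp add: ancestors_def)
      ultimately show False using sl[of v] sr[of v] dj(2,3) set_subtree_of[of l v] set_subtree_of[of r v]
        by (auto simp del: subtree_of.simps)
    qed
    moreover have "u \<in> ancestors \<langle>l, u, r\<rangle> u" by (simp add: ancestors_def)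
    ultimately show ?thesis by blast
  qed
qed

lemma light_at_Node:
  assumes "bst \<langle>l, u, r\<rangle>"
  shows "x \<in> set_tree l \<Longrightarrow> light_at D \<langle>l, u, r\<rangle> x d \<subseteq> insert u (light_at D l x d)"
    "x \<in> set_tree r \<Longrightarrow> light_at D \<langle>l, u, r\<rangle> x d \<subseteq> insert u (light_at D r x d)"
    "light_at D \<langle>l, u, r\<rangle> u d \<subseteq> {u}"
proof -
  have "v \<in> ancestors t x \<Longrightarrow> v \<in> set_tree t" for t v x by (simp add: ancestors_def)
  then show "x \<in> set_tree l \<Longrightarrow> light_at D \<langle>l, u, r\<rangle> x d \<subseteq> insert u (light_at D l x d)"
    "x \<in> set_tree r \<Longrightarrow> light_at D \<langle>l, u, r\<rangle> x d \<subseteq> insert u (light_at D r x d)"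
    "light_at D \<langle>l, u, r\<rangle> u d \<subseteq> {u}"
    using region_child[OF assms] light_child[OF assms]
    by (auto simp: light_at_def ancestors_Node[OF assms])
qed

lemma finite_light_at [simp]: "finite (light_at D P x d)"
  by (auto simp: light_at_def ancestors_def)

lemma level_count_mono: "finite A' \<Longrightarrow> A \<subseteq> A' \<Longrightarrow> level_count D d A \<le> level_count D d A'"
  unfolding level_count_def by (intro card_mono) auto

lemma level_count_pos:
  assumes "finite A" "A \<noteq> {}" shows "level_count D (top_depth D A) A \<ge> 1"
proof -
  have "top_depth D A \<in> D ` A" using assms by (intro Min_in) auto
  then obtain k where "k \<in> A" "D k = top_depth D A" by auto
  then have "{k \<in> A. D k = top_depth D A} \<noteq> {}" by auto
  then show ?thesis unfolding level_count_def using assms(1) by (simp add: Suc_le_eq card_gt_0_iff)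
qed

text \<open>Below a light side at level \<open>d\<close>, every further light side at level \<open>d\<close> halves the number of
  keys of that level.\<close>

lemma light_at_high:
  assumes "bst P" "x \<in> set_tree P" "\<forall>k\<in>set_tree P. d \<le> D k"
  shows "2 ^ card (light_at D P x d) \<le> max 1 (level_count D d (set_tree P))"
  using assms
proof (induction P)
  case (Node l u r)
  let ?P = "\<langle>l, u, r\<rangle>"
  have top: "d \<le> top_depth D A" if "A \<subseteq> set_tree ?P" "A \<noteq> {}" for A
    using that Node.prems(3) finite_subset[OF that(1)] by (subst Min_ge_iff) auto
  define A where "A = region ?P u (side_of x u)"
  define A' where "A' = region ?P u (flip_side (side_of x u))"
  have AA: "A \<union> A' = set_tree ?P" "A \<inter> A' = {}" "x \<in> A"
  proof -
    show "A \<union> A' = set_tree ?P" using side_flip by (auto simp: A_def A'_def region_def)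
    have "flip_side s \<noteq> s" for s by (cases s) (auto simp: flip_side_def)
    then show "A \<inter> A' = {}" by (auto simp: A_def A'_def region_def)
    show "x \<in> A" using Node.prems(2) by (simp add: A_def region_def)
  qed
  have step: "2 ^ card (light_at D ?P x d) \<le> max 1 (level_count D d (set_tree ?P))"
    if sub: "light_at D ?P x d \<subseteq> insert u E" "finite E" "2 ^ card E \<le> max 1 (level_count D d A)" for E
  proof (cases "u \<in> light_at D ?P x d")
    case False
    then have "card (light_at D ?P x d) \<le> card E" using sub by (intro card_mono) auto
    then have "(2::nat) ^ card (light_at D ?P x d) \<le> 2 ^ card E" by (intro power_increasing) auto
    moreover have "level_count D d A \<le> level_count D d (set_tree ?P)" using AA by (intro level_count_mono) auto
    ultimately show ?thesis using sub(3) by linarith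
  next
    case True
    then have lt: "light D ?P u (side_of x u)" "top_depth D A = d" by (auto simp: light_at_def A_def)
    have "A \<noteq> {}" using AA by auto
    \<comment> \<open>No key lies above level \<open>d\<close>, so the opposite side starts at level
      \<open>d\<close> as well and has at least as many keys there as \<open>A\<close>.\<close>
    then have A': "A' \<noteq> {}" "top_depth D A' \<le> d" "top_depth D A' = d \<longrightarrow> level_count D d A \<le> level_count D d A'"
      using lt unfolding light_def Let_def A_def[symmetric] A'_def[symmetric] by auto
    have "A' \<subseteq> set_tree ?P" using AA by auto
    from top[OF this A'(1)] A'(2) have "top_depth D A' = d" by (rule order_antisym[rotated])
    then have le: "level_count D d A \<le> level_count D d A'" using A'(3) by blast
    have fin: "finite A" "finite A'" by (simp_all add: A_def A'_def)
    have "level_count D d (set_tree ?P) = level_count D d A + level_count D d A'"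
    proof -
      have "{k \<in> set_tree ?P. D k = d} = {k \<in> A. D k = d} \<union> {k \<in> A'. D k = d}" using AA by auto
      moreover have "card ({k \<in> A. D k = d} \<union> {k \<in> A'. D k = d}) = card {k \<in> A. D k = d} + card {k \<in> A'. D k = d}"
        using AA(2) fin by (intro card_Un_disjoint) auto
      ultimately show ?thesis unfolding level_count_def by simp
    qed
    moreover have "1 \<le> level_count D d A" using level_count_pos[OF fin(1) \<open>A \<noteq> {}\<close>, of D] lt(2) by simp
    moreover have "card (light_at D ?P x d) \<le> Suc (card E)"
    proof -
      have "card (light_at D ?P x d) \<le> card (insert u E)" using sub by (intro card_mono) auto
      also have "\<dots> \<le> Suc (card E)" using sub(2) by (simp add: card_insert_if)
      finally show ?thesis .
    qed
    then have "(2::nat) ^ card (light_at D ?P x d) \<le> 2 ^ Suc (card E)" by (intro power_increasing) auto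
    ultimately show ?thesis using sub(3) le by simp
  qed
  have b: "bst l" "bst r" using Node.prems by auto
  consider "x = u" | "x \<in> set_tree l" | "x \<in> set_tree r" using Node.prems by auto
  then show ?case
  proof cases
    case 1
    show ?thesis using light_at_Node(3)[OF Node.prems(1), of D d] 1 by (intro step[of "{}"]) auto
  next
    case 2
    have "set_tree l \<subseteq> A"
      using 2 Node.prems(1) by (auto simp: A_def region_def side_of_def dest: bspec)
    then have "level_count D d (set_tree l) \<le> level_count D d A" by (intro level_count_mono) (auto simp: A_def)
    then show ?thesis using Node.IH(1)[OF b(1) 2] Node.prems(3) light_at_Node(1)[OF Node.prems(1) 2, of D d]
      by (intro step[of "light_at D l x d"]) auto
  next
    case 3
    have "set_tree r \<subseteq> A"
      using 3 Node.prems(1) by (auto simp: A_def region_def side_of_def dest: bspec)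
    then have "level_count D d (set_tree r) \<le> level_count D d A" by (intro level_count_mono) (auto simp: A_def)
    then show ?thesis using Node.IH(2)[OF b(2) 3] Node.prems(3) light_at_Node(2)[OF Node.prems(1) 3, of D d]
      by (intro step[of "light_at D r x d"]) auto
  qed
qed simp

definition bounded_levels :: "nat \<Rightarrow> (nat \<Rightarrow> nat) \<Rightarrow> nat tree \<Rightarrow> bool" where
  "bounded_levels b D P \<longleftrightarrow> (\<forall>v\<in>set_tree P. \<forall>s. region P v s \<noteq> {} \<longrightarrow>
     level_count D (top_depth D (region P v s)) (region P v s) \<le> b)"

text \<open>From the topmost such node on, all keys on the side of \<open>x\<close> have depth at
  least \<open>d\<close>, and at most \<open>b\<close> of them have depth \<open>d\<close>. The
  halving then allows at most \<open>c\<close> further nodes.\<close>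

lemma card_light_at:
  assumes "bst P" "x \<in> set_tree P" "bounded_levels b D P" "b < 2 ^ Suc c"
  shows "card (light_at D P x d) \<le> Suc c"
  using assms(1-3)
proof (induction P)
  case (Node l u r)
  let ?P = "\<langle>l, u, r\<rangle>"
  have b: "bst l" "bst r" using Node.prems by auto
  have bl: "bounded_levels b D l" "bounded_levels b D r"
  proof -
    have "v \<in> set_tree l \<or> v \<in> set_tree r \<Longrightarrow> \<forall>s. region ?P v s \<noteq> {} \<longrightarrow>
      level_count D (top_depth D (region ?P v s)) (region ?P v s) \<le> b" for v
      using Node.prems(3) by (auto simp: bounded_levels_def)
    then show "bounded_levels b D l" "bounded_levels b D r"
      unfolding bounded_levels_def by (metis region_child[OF Node.prems(1)])+
  qed
  have main: "card (light_at D ?P x d) \<le> Suc c"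
    if t: "bst t" "x \<in> set_tree t" "set_tree t \<subseteq> region ?P u (side_of x u)"
      "card (light_at D t x d) \<le> Suc c" "light_at D ?P x d \<subseteq> insert u (light_at D t x d)" for t
  proof (cases "u \<in> light_at D ?P x d")
    case False
    then have "light_at D ?P x d \<subseteq> light_at D t x d" using t by auto
    then have "card (light_at D ?P x d) \<le> card (light_at D t x d)" by (intro card_mono) auto
    then show ?thesis using t by simp
  next
    case True
    define A where "A = region ?P u (side_of x u)"
    have d: "top_depth D A = d" using True by (simp add: light_at_def A_def)
    have ne: "A \<noteq> {}" using t by (auto simp: A_def)
    have "\<forall>k\<in>set_tree t. d \<le> D k"
    proof
      fix k assume "k \<in> set_tree t"
      then have "k \<in> A" using t(3) by (auto simp: A_def)
      then have "top_depth D A \<le> D k" by (intro Min_le) (auto simp: A_def)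
      then show "d \<le> D k" using d by simp
    qed
    then have "2 ^ card (light_at D t x d) \<le> max 1 (level_count D d (set_tree t))"
      by (rule light_at_high[OF t(1,2)])
    moreover have "level_count D d (set_tree t) \<le> level_count D d A" using t(3) by (intro level_count_mono) (auto simp: A_def)
    moreover have "level_count D d A \<le> b" using Node.prems(3) ne d unfolding bounded_levels_def A_def by auto
    moreover have "1 \<le> level_count D d A" using level_count_pos[of A D] ne d by (auto simp: A_def)
    ultimately have "2 ^ card (light_at D t x d) < (2::nat) ^ Suc c" using assms(4) by linarith
    then have "card (light_at D t x d) < Suc c" by (subst (asm) power_strict_increasing_iff) simp_all
    moreover have "card (light_at D ?P x d) \<le> Suc (card (light_at D t x d))"
    proof -
      have "card (light_at D ?P x d) \<le> card (insert u (light_at D t x d))" using t(5) by (intro card_mono) auto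
      also have "\<dots> \<le> Suc (card (light_at D t x d))" by (simp add: card_insert_if)
      finally show ?thesis .
    qed
    ultimately show ?thesis by simp
  qed
  consider "x = u" | "x \<in> set_tree l" | "x \<in> set_tree r" using Node.prems by auto
  then show ?case
  proof cases
    case 1
    then show ?thesis using card_mono[OF _ light_at_Node(3)[OF Node.prems(1), of D d]] by simp
  next
    case 2
    have "set_tree l \<subseteq> region ?P u (side_of x u)"
      using 2 Node.prems(1) by (auto simp: region_def side_of_def dest: bspec)
    then show ?thesis using Node.IH(1)[OF b(1) 2 bl(1)] b 2 light_at_Node(1)[OF Node.prems(1) 2]
      by (intro main[of l]) auto
  next
    case 3
    have "set_tree r \<subseteq> region ?P u (side_of x u)"
      using 3 Node.prems(1) by (auto simp: region_def side_of_def dest: bspec)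
    then show ?thesis using Node.IH(2)[OF b(2) 3 bl(2)] b 3 light_at_Node(2)[OF Node.prems(1) 3]
      by (intro main[of r]) auto
  qed
qed simp

section \<open>Potential and switches\<close>

definition potential :: "(nat \<Rightarrow> nat) \<Rightarrow> nat tree \<Rightarrow> preference \<Rightarrow> nat" where
  "potential D P pref = card {v \<in> set_tree P. light D P v (pref v)}"

definition switches :: "nat tree \<Rightarrow> nat \<Rightarrow> preference \<Rightarrow> nat" where
  "switches P x pref = card {v \<in> ancestors P x. pref v \<noteq> side_of x v}"

text \<open>A switch to a heavy side takes its node out of the potential. A switch to a light side
  may add a node and is counted itself, whence the factor 2. A light side that is taken contains
  \<open>x\<close>, so its topmost level is one of \<open>D x + 1\<close> values.\<close>

lemma potential_search:
  assumes "bst P" "x \<in> set_tree P" "bounded_levels b D P" "b < 2 ^ Suc c"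
  shows "switches P x pref + potential D P (after_search P x pref) \<le>
    potential D P pref + 2 * ((D x + 1) * Suc c)"
proof -
  define Lt where "Lt = {v \<in> ancestors P x. light D P v (side_of x v)}"
  define Alt where "Alt = {v \<in> ancestors P x. pref v \<noteq> side_of x v}"
  define Q where "Q = {v \<in> set_tree P. light D P v (pref v)}"
  define Q' where "Q' = {v \<in> set_tree P. light D P v (after_search P x pref v)}"
  have fin: "finite Lt" "finite Alt" "finite Q" "finite Q'"
    by (auto simp: Lt_def Alt_def Q_def Q'_def ancestors_def)
  have "Lt \<subseteq> (\<Union>d\<le>D x. light_at D P x d)"
  proof
    fix v assume v: "v \<in> Lt"
    have "x \<in> region P v (side_of x v)" using v by (auto simp: Lt_def ancestors_def region_def)
    then have "top_depth D (region P v (side_of x v)) \<le> D x" by (intro Min_le) auto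
    then show "v \<in> (\<Union>d\<le>D x. light_at D P x d)" using v by (auto simp: Lt_def light_at_def)
  qed
  then have "card Lt \<le> card (\<Union>d\<le>D x. light_at D P x d)" by (intro card_mono) auto
  also have "\<dots> \<le> (\<Sum>d\<le>D x. card (light_at D P x d))" by (intro card_UN_le) auto
  also have "\<dots> \<le> (\<Sum>d\<le>D x. Suc c)" using card_light_at[OF assms] by (intro sum_mono) auto
  finally have Lt: "card Lt \<le> (D x + 1) * Suc c" by simp
  have e: "after_search P x pref v = (if v \<in> ancestors P x then side_of x v else pref v)" if "v \<in> set_tree P" for v
    using that by (auto simp: after_search_def ancestors_def)
  have "Q' \<subseteq> (Q - (Alt - Lt)) \<union> (Alt \<inter> Lt)"
  proof
    fix v assume v: "v \<in> Q'"
    then have P: "v \<in> set_tree P" by (simp add: Q'_def)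
    show "v \<in> (Q - (Alt - Lt)) \<union> (Alt \<inter> Lt)"
      using v e[OF P] P by (auto simp: Q'_def Q_def Alt_def Lt_def split: if_splits)
  qed
  then have "card Q' \<le> card ((Q - (Alt - Lt)) \<union> (Alt \<inter> Lt))" using fin by (intro card_mono) auto
  also have "\<dots> \<le> card (Q - (Alt - Lt)) + card (Alt \<inter> Lt)" by (rule card_Un_le)
  also have "Alt - Lt \<subseteq> Q"
  proof
    fix v assume v: "v \<in> Alt - Lt"
    then have "\<not> light D P v (side_of x v)" "pref v = flip_side (side_of x v)" "v \<in> set_tree P"
      using side_flip[of "pref v" "side_of x v"] by (auto simp: Alt_def Lt_def ancestors_def)
    then show "v \<in> Q" using light_total[of D P v "side_of x v"] by (simp add: Q_def)
  qed
  then have "card (Q - (Alt - Lt)) = card Q - card (Alt - Lt)" "card (Alt - Lt) \<le> card Q"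
    using fin by (auto intro: card_Diff_subset card_mono)
  moreover have "card Alt = card (Alt - Lt) + card (Alt \<inter> Lt)"
    using card_Diff_subset_Int[of Alt Lt] card_mono[of Alt "Alt \<inter> Lt"] fin by auto
  moreover have "card (Alt \<inter> Lt) \<le> card Lt" using fin by (intro card_mono) auto
  ultimately have "card Alt + card Q' \<le> card Q + 2 * card Lt" by linarith
  then show ?thesis using Lt unfolding switches_def potential_def Alt_def[symmetric] Q_def[symmetric] Q'_def[symmetric] by linarith
qed


section \<open>How light sides react to a shift of depths\<close>

text \<open>Comparing depths and counting keys per level do not see a common shift.\<close>

lemma light_shift:
  assumes "\<forall>k\<in>set_tree (subtree_of P v). D k = D' k + e"
  shows "light D P v s = light D' P v s"
proof -
  have sub: "region P v s \<subseteq> set_tree (subtree_of P v)" for s by (auto simp: region_def)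
  have m: "top_depth D A = top_depth D' A + e" if "A \<subseteq> set_tree (subtree_of P v)" "A \<noteq> {}" for A
  proof -
    have fin: "finite A" using finite_subset[OF that(1)] by simp
    have "D ` A = (\<lambda>x. x + e) ` D' ` A" using that(1) assms by (force simp: image_iff)
    moreover have "Min ((\<lambda>x. x + e) ` D' ` A) = Min (D' ` A) + e"
      using fin that(2) by (subst mono_Min_commute[symmetric]) (auto simp: mono_def)
    ultimately show ?thesis by simp
  qed
  have c: "level_count D (n + e) A = level_count D' n A" if "A \<subseteq> set_tree (subtree_of P v)" for A n
    unfolding level_count_def using that assms by (intro arg_cong[where f = card]) auto
  show ?thesis
  proof (cases "region P v s = {} \<or> region P v (flip_side s) = {}")
    case False
    then show ?thesis unfolding light_def Let_def using m[OF sub] c[OF sub] by simp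
  qed (auto simp: light_def)
qed

text \<open>The least depth is below \<open>h\<close>, where the two functions agree in both
  directions: no key enters or leaves this range.\<close>

lemma agree_low:
  assumes "\<forall>k\<in>A. D k < h \<or> D' k < h \<longrightarrow> D k = D' k" "finite A" "A \<noteq> {}" "top_depth D A < h"
  shows "top_depth D' A = top_depth D A" "level_count D' (top_depth D A) A = level_count D (top_depth D A) A"
proof -
  let ?m = "top_depth D A"
  have "?m \<in> D ` A" using assms by (intro Min_in) auto
  then obtain k where k: "k \<in> A" "D k = ?m" by auto
  have ge: "?m \<le> D i" if "i \<in> A" for i using that assms(2) by (intro Min_le) auto
  have "?m \<le> D' i" if "i \<in> A" for i
    using ge[OF that] bspec[OF assms(1) that] assms(4) by linarith
  moreover have "D' k = ?m" using bspec[OF assms(1) k(1)] k(2) assms(4) by simp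
  moreover from this have "?m \<in> D' ` A" using k(1) by (metis imageI)
  ultimately show "top_depth D' A = ?m" using assms(2) by (intro Min_eqI) auto
  show "level_count D' ?m A = level_count D ?m A"
  proof -
    have "D' i = ?m \<longleftrightarrow> D i = ?m" if "i \<in> A" for i using bspec[OF assms(1) that] assms(4) by linarith
    then show ?thesis unfolding level_count_def by (intro arg_cong[where f = card]) blast
  qed
qed

lemma convex_subtree:
  assumes "bst P" "k \<in> set_tree P" "a \<in> set_tree (subtree_of P v)" "c \<in> set_tree (subtree_of P v)" "a \<le> k" "k \<le> c"
  shows "k \<in> set_tree (subtree_of P v)"
  using assms
proof (induction P)
  case (Node l u r)
  consider "v = u" | "v < u" | "v > u" by linarith
  then show ?case
  proof cases
    case 1
    then show ?thesis using Node.prems by simp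
  next
    case 2
    then have "a \<in> set_tree l" "c \<in> set_tree l" using Node.prems set_subtree_of[of l v] by auto
    then have "c < u" using Node.prems by auto
    then have "k < u" using Node.prems by simp
    then have "k \<in> set_tree l" using Node.prems by auto
    then show ?thesis using Node 2 by auto
  next
    case 3
    then have "a \<in> set_tree r" "c \<in> set_tree r" using Node.prems set_subtree_of[of r v] by auto
    then have "u < a" using Node.prems by auto
    then have "u < k" using Node.prems by simp
    then have "k \<in> set_tree r" using Node.prems by auto
    then show ?thesis using Node 3 by auto
  qed
qed simp

text \<open>\<open>lo\<close> to \<open>hi\<close> are the keys whose depth drops by one. A subtree
  of \<open>P\<close> inside or outside this interval sees a uniform shift; any other contains one
  of the two border keys, whose depth is at most \<open>h\<close>. A change there forces the side of
  the border key to be light with its top exactly at level \<open>h\<close>, before or after. Two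
  border keys, two depth functions and \<open>Suc c\<close> nodes for each make
  \<open>4 * Suc c\<close>.\<close>

lemma dissolve_light_changes:
  assumes P: "reference_tree N P" and b: "bounded_levels b D P" "bounded_levels b D' P" "b < 2 ^ Suc c"
    and D: "1 \<le> lo" "lo \<le> hi" "hi \<le> N" "\<And>k. lo \<le> k \<Longrightarrow> k \<le> hi \<Longrightarrow> D k = D' k + 1 \<and> h \<le> D' k"
      "\<And>k. k \<in> {1..N} \<Longrightarrow> \<not> (lo \<le> k \<and> k \<le> hi) \<Longrightarrow> D k = D' k"
      "1 < lo \<Longrightarrow> D (lo - 1) \<le> h" "hi < N \<Longrightarrow> D (hi + 1) \<le> h"
  shows "card {v \<in> set_tree P. \<exists>s. light D P v s \<noteq> light D' P v s} \<le> 4 * Suc c"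
proof -
  note PP = reference_tree_facts[OF P]
  define G where "G f = (if f \<in> {1..N} then light_at D P f h \<union> light_at D' P f h else {})" for f
  have cG: "card (G f) \<le> 2 * Suc c" and fG: "finite (G f)" for f
  proof -
    show "finite (G f)" by (simp add: G_def)
    have "card (light_at D P f h \<union> light_at D' P f h) \<le> 2 * Suc c" if "f \<in> {1..N}"
      using card_Un_le[of "light_at D P f h" "light_at D' P f h"] that PP(2)
        card_light_at[OF PP(1) _ b(1,3), of f h] card_light_at[OF PP(1) _ b(2,3), of f h] by simp
    then show "card (G f) \<le> 2 * Suc c" by (simp add: G_def)
  qed
  have key: "v \<in> light_at D P f h \<union> light_at D' P f h"
    if v: "v \<in> set_tree P" "\<exists>s. light D P v s \<noteq> light D' P v s" and f: "f \<in> set_tree (subtree_of P v)" "D f = D' f" "D f \<le> h"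
    for v f
  proof -
    have I: "set_tree (subtree_of P v) \<subseteq> {1..N}" using set_subtree_of[of P v] PP(2) by simp
    have R: "D k < h \<or> D' k < h \<longrightarrow> D k = D' k" if "k \<in> set_tree (subtree_of P v)" for k
      using D(4)[of k] D(5)[of k] that I by (cases "lo \<le> k \<and> k \<le> hi") auto
    define s where "s = side_of f v"
    define A where "A = region P v s"
    define A' where "A' = region P v (flip_side s)"
    have fA: "f \<in> A" using f by (simp add: A_def s_def region_def)
    have RA: "\<forall>k\<in>A. D k < h \<or> D' k < h \<longrightarrow> D k = D' k" "\<forall>k\<in>A'. D k < h \<or> D' k < h \<longrightarrow> D k = D' k"
      unfolding A_def A'_def region_def using R by blast+
    have RB: "\<forall>k\<in>A. D' k < h \<or> D k < h \<longrightarrow> D' k = D k" "\<forall>k\<in>A'. D' k < h \<or> D k < h \<longrightarrow> D' k = D k"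
      using RA by metis+
    have fin: "finite A" "finite A'" "A \<noteq> {}" using fA by (auto simp: A_def A'_def)
    have anc: "v \<in> ancestors P f" using v f by (simp add: ancestors_def)
    \<comment> \<open>If a light side has its top at a depth below \<open>h\<close>, the opposite
      side starts no deeper. Both comparisons are then decided at depths below \<open>h\<close>,
      where nothing has changed.\<close>
    have same: False
      if r: "\<forall>k\<in>A. X k < h \<or> Y k < h \<longrightarrow> X k = Y k" "\<forall>k\<in>A'. X k < h \<or> Y k < h \<longrightarrow> X k = Y k"
        and l: "light X P v s" "top_depth X A < h" and neq: "\<exists>s. light X P v s \<noteq> light Y P v s" for X Y
    proof -
      have A': "A' \<noteq> {}" "top_depth X A' \<le> top_depth X A"
        using l(1) fin(3) unfolding light_def Let_def A_def[symmetric] A'_def[symmetric] by auto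
      then have low: "top_depth X A' < h" using l(2) by simp
      note e = agree_low[OF r(1) fin(1,3) l(2)] agree_low[OF r(2) fin(2) A'(1) low]
      have eq1: "light X P v s = light Y P v s"
        unfolding light_def Let_def A_def[symmetric] A'_def[symmetric] using e by auto
      have eq2: "light X P v (flip_side s) = light Y P v (flip_side s)"
        unfolding light_def Let_def flip_flip A_def[symmetric] A'_def[symmetric] using e by auto
      from neq obtain s' where "light X P v s' \<noteq> light Y P v s'" by blast
      then show False using eq1 eq2 side_flip[of s' s] by metis
    qed
    \<comment> \<open>Otherwise the opposite side would be light both before and after, and no side
      would have changed.\<close>
    have "light D P v s \<or> light D' P v s"
    proof (rule ccontr)
      assume n: "\<not> ?thesis"
      then have "light D P v (flip_side s)" "light D' P v (flip_side s)" using light_total by blast+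
      moreover obtain s' where "light D P v s' \<noteq> light D' P v s'" using v by blast
      ultimately show False using n side_flip[of s' s] by metis
    qed
    moreover have "top_depth D A \<le> h" "top_depth D' A \<le> h"
    proof -
      have "top_depth D A \<le> D f" "top_depth D' A \<le> D' f" using fA fin by auto
      then show "top_depth D A \<le> h" "top_depth D' A \<le> h" using f by simp_all
    qed
    ultimately consider "light D P v s" "top_depth D A = h" | "light D' P v s" "top_depth D' A = h"
      using same[OF RA] same[OF RB] v(2) by (metis order_le_imp_less_or_eq)
    then show ?thesis using anc by cases (auto simp: light_at_def A_def s_def)
  qed
  have "{v \<in> set_tree P. \<exists>s. light D P v s \<noteq> light D' P v s} \<subseteq> G (lo - 1) \<union> G (hi + 1)"
  proof
    fix v assume "v \<in> {v \<in> set_tree P. \<exists>s. light D P v s \<noteq> light D' P v s}"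
    then have v: "v \<in> set_tree P" "\<exists>s. light D P v s \<noteq> light D' P v s" by auto
    let ?I = "set_tree (subtree_of P v)"
    have I: "?I \<subseteq> {1..N}" using set_subtree_of[of P v] PP(2) by simp
    have "\<exists>i\<in>?I. lo \<le> i \<and> i \<le> hi"
    proof (rule ccontr)
      assume "\<not> ?thesis"
      then have "\<forall>k\<in>?I. D k = D' k + 0" using I D(5) by (metis add_0_right subsetD)
      then show False using light_shift v(2) by blast
    qed
    then obtain i where i: "i \<in> ?I" "lo \<le> i" "i \<le> hi" by blast
    obtain j where j: "j \<in> ?I" "\<not> (lo \<le> j \<and> j \<le> hi)"
    proof (rule ccontr)
      assume "\<not> thesis"
      then have "\<forall>k\<in>?I. D k = D' k + 1" using that D(4) by blast
      then show False using light_shift v(2) by blast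
    qed
    have jN: "1 \<le> j" "j \<le> N" using j I by auto
    consider "j < lo" | "hi < j" using j(2) by linarith
    then show "v \<in> G (lo - 1) \<union> G (hi + 1)"
    proof cases
      case 1
      then have k: "1 < lo" "lo - 1 \<in> {1..N}" "j \<le> lo - 1" "lo - 1 \<le> i" using jN i D(2,3) by auto
      then have "lo - 1 \<in> ?I" using convex_subtree[OF PP(1) _ j(1) i(1), of "lo - 1"] PP(2) by simp
      from key[OF v this] k D(5)[of "lo - 1"] D(6) show ?thesis by (auto simp: G_def)
    next
      case 2
      then have k: "hi < N" "hi + 1 \<in> {1..N}" "i \<le> hi + 1" "hi + 1 \<le> j" using jN i D(2,3) by auto
      then have "hi + 1 \<in> ?I" using convex_subtree[OF PP(1) _ i(1) j(1), of "hi + 1"] PP(2) by simp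
      from key[OF v this] k D(5)[of "hi + 1"] D(7) show ?thesis by (auto simp: G_def)
    qed
  qed
  then have "card {v \<in> set_tree P. \<exists>s. light D P v s \<noteq> light D' P v s} \<le> card (G (lo - 1) \<union> G (hi + 1))"
    using fG by (intro card_mono) auto
  also have "\<dots> \<le> card (G (lo - 1)) + card (G (hi + 1))" by (rule card_Un_le)
  finally show ?thesis using cG[of "lo - 1"] cG[of "hi + 1"] by simp
qed

text \<open>Only nodes with a changed side can enter or leave the potential, whatever the
  preferences are.\<close>

lemma potential_changes:
  assumes "card {v \<in> set_tree P. \<exists>s. light D P v s \<noteq> light D' P v s} \<le> n"
  shows "potential D' P pref \<le> potential D P pref + n \<and> potential D P pref \<le> potential D' P pref + n"
proof -
  let ?C = "{v \<in> set_tree P. \<exists>s. light D P v s \<noteq> light D' P v s}"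
  have "card {v \<in> set_tree P. light X P v (pref v)} \<le> card ({v \<in> set_tree P. light Y P v (pref v)} \<union> ?C)"
    if "X = D \<and> Y = D' \<or> X = D' \<and> Y = D" for X Y using that by (intro card_mono) auto
  then have "potential X P pref \<le> potential Y P pref + card ?C" if "X = D \<and> Y = D' \<or> X = D' \<and> Y = D" for X Y
    unfolding potential_def using le_trans[OF _ card_Un_le] that by blast
  from this[of D D'] this[of D' D] assms show ?thesis by auto
qed

section \<open>Depths of the keys in a B-tree\<close>

text \<open>A list in key order, so that an operation on a subtree shows as the replacement of one
  segment. As the keys are 1 to \<open>N\<close>, the key \<open>k\<close> stands at position
  \<open>k - 1\<close>.\<close>

fun key_depths_list :: "nat \<Rightarrow> 'a btree \<Rightarrow> (nat \<times> nat) list" where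
  "key_depths_list d BNil = []"
| "key_depths_list d (BNode a ks ts) = weave (map (key_depths_list (Suc d)) ts) (map (\<lambda>k. (k, d)) ks)"

definition key_depth :: "'a btree \<Rightarrow> nat \<Rightarrow> nat" where
  "key_depth t k = snd (key_depths_list 0 t ! (k - 1))"

lemma map_weave: "map f (weave xss ks) = weave (map (map f) xss) (map f ks)"
  by (induction xss ks rule: weave.induct) (auto simp: map_concat)

lemma fst_key_depths: "map fst (key_depths_list d t) = keys_inorder t"
  by (induction d t rule: key_depths_list.induct)
     (auto simp: map_weave comp_def intro!: arg_cong[where f = "\<lambda>x. weave x _"])

lemma key_depths_Suc: "key_depths_list (Suc d) t = map (apsnd Suc) (key_depths_list d t)"
  by (induction d t rule: key_depths_list.induct)
     (auto simp: map_weave comp_def intro!: arg_cong[where f = "\<lambda>x. weave x _"])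

lemma set_weave: "set (weave xss ks) \<subseteq> (\<Union>xs\<in>set xss. set xs) \<union> set ks"
  by (induction xss ks rule: weave.induct) auto

lemma key_depths_ge: "p \<in> set (key_depths_list d t) \<Longrightarrow> d \<le> snd p"
proof (induction d t rule: key_depths_list.induct)
  case (2 d a ks ts)
  then consider xs where "xs \<in> set ts" "p \<in> set (key_depths_list (Suc d) xs)" | "p \<in> set (map (\<lambda>k. (k, d)) ks)"
    using set_weave[of "map (key_depths_list (Suc d)) ts" "map (\<lambda>k. (k, d)) ks"] by auto
  then show ?case using 2(1) by cases (fastforce dest: Suc_leD)+
qed simp

text \<open>A segment without any key of the node cannot cross one, so it stays inside a single
  child.\<close>

lemma weave_segment:
  assumes "length xss = length ks + 1" "weave xss ks = X @ Y @ Z" "\<forall>y\<in>set Y. \<not> Q y" "\<forall>k\<in>set ks. Q k"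
  shows "Y = [] \<or> (\<exists>xs\<in>set xss. \<exists>X' Z'. xs = X' @ Y @ Z')"
  using assms
proof (induction xss ks arbitrary: X rule: interleave_induct)
  case (single xs)
  then show ?case by auto
next
  case (cons xs xss k ks)
  from cons.prems(1) have "xs @ k # weave xss ks = X @ Y @ Z" by simp
  then obtain us where us: "xs = X @ us \<and> us @ k # weave xss ks = Y @ Z \<or> xs @ us = X \<and> k # weave xss ks = us @ Y @ Z"
    by (auto simp: append_eq_append_conv2)
  have kY: "k \<notin> set Y" using cons.prems by auto
  from us show ?case
  proof (elim disjE conjE)
    assume a: "xs = X @ us" "us @ k # weave xss ks = Y @ Z"
    then obtain vs where "us = Y @ vs \<and> vs @ k # weave xss ks = Z \<or> us @ vs = Y \<and> k # weave xss ks = vs @ Z"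
      by (auto simp: append_eq_append_conv2)
    then show ?thesis
    proof (elim disjE conjE)
      assume "us @ vs = Y" "k # weave xss ks = vs @ Z"
      then have "us = Y" using kY by (cases vs) auto
      then have "xs = X @ Y @ []" using a by simp
      then have "\<exists>X' Z'. xs = X' @ Y @ Z'" by blast
      then show ?thesis by simp
    next
      assume "us = Y @ vs"
      then have "xs = X @ Y @ vs" using a by simp
      then have "\<exists>X' Z'. xs = X' @ Y @ Z'" by blast
      then show ?thesis by simp
    qed
  next
    assume a: "xs @ us = X" "k # weave xss ks = us @ Y @ Z"
    show ?thesis
    proof (cases us)
      case Nil
      then show ?thesis using a kY by (cases Y) auto
    next
      case (Cons u us')
      then have "weave xss ks = us' @ Y @ Z" using a by auto
      then show ?thesis using cons by auto
    qed
  qed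
qed

text \<open>As long as a node has no key in the segment, the segment lies within one child. The
  first node on this descent that has a key in it holds all keys of least depth, at most
  \<open>b\<close>.\<close>

lemma segment_level_count:
  assumes "node_sizes_ok (Suc b) t" "key_depths_list d t = X @ Y @ Z" "Y \<noteq> []"
  shows "length (filter (\<lambda>p. snd p = Min (snd ` set Y)) Y) \<le> b"
  using assms
proof (induction d t arbitrary: X Z rule: key_depths_list.induct)
  case (2 d a ks ts)
  let ?W = "weave (map (key_depths_list (Suc d)) ts) (map (\<lambda>k. (k, d)) ks)"
  have W: "?W = X @ Y @ Z" using 2 by simp
  have len: "length (map (key_depths_list (Suc d)) ts) = length (map (\<lambda>k. (k, d)) ks) + 1" using 2 by simp
  show ?case
  proof (cases "\<exists>p\<in>set Y. snd p = d")
    case True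
    have "Min (snd ` set Y) = d"
    proof (rule Min_eqI)
      fix y assume "y \<in> snd ` set Y"
      then obtain p where "p \<in> set ?W" "y = snd p" using W by auto
      then show "d \<le> y" using key_depths_ge[of p d "BNode a ks ts"] by simp
    qed (use True in auto)
    moreover have "length (filter (\<lambda>p. snd p = d) ?W) = length ks"
    proof -
      have "filter (\<lambda>p. snd p = d) (key_depths_list (Suc d) t) = []" for t
        using key_depths_ge[of _ "Suc d" t] by (force simp: filter_empty_conv)
      note e = this
      have "length ts = length ks + 1" using len by simp
      then show ?thesis by (induction ts ks rule: interleave_induct) (auto simp: e)
    qed
    then have "length (filter (\<lambda>p. snd p = d) Y) \<le> length ks" unfolding W by simp
    ultimately show ?thesis using 2 by simp
  next
    case False
    then obtain u X' Z' where u: "u \<in> set ts" "key_depths_list (Suc d) u = X' @ Y @ Z'"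
      using weave_segment[OF len W, of "\<lambda>p. snd p = d"] 2(4) by auto
    have "node_sizes_ok (Suc b) u" using 2(2) u(1) by simp
    from 2(1)[OF u(1) this u(2) 2(4)] show ?thesis .
  qed
qed simp

text \<open>Subtrees of \<open>P\<close> are intervals and a side cuts them at \<open>v\<close>, so
  every region is an interval of keys, that is, a segment of the depth list.\<close>

lemma bounded_key_depth:
  assumes P: "reference_tree N P" and t: "node_sizes_ok (Suc b) t" "keys_inorder t = [1..<N + 1]"
  shows "bounded_levels b (key_depth t) P"
  unfolding bounded_levels_def
proof (intro ballI allI impI)
  fix v s assume v: "v \<in> set_tree P" and ne: "region P v s \<noteq> {}"
  note PP = reference_tree_facts[OF P]
  let ?A = "region P v s"
  define a c where "a = Min ?A" and "c = Max ?A"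
  have sub: "?A \<subseteq> {1..N}" using set_subtree_of[of P v] PP(2) by (auto simp: region_def)
  have ac: "a \<in> ?A" "c \<in> ?A" using ne by (auto simp: a_def c_def)
  have A: "?A = {a..c}"
  proof
    show "?A \<subseteq> {a..c}" by (auto simp: a_def c_def)
    show "{a..c} \<subseteq> ?A"
    proof
      fix k assume k: "k \<in> {a..c}"
      then have "k \<in> set_tree P" using sub ac PP(2) by auto
      then have "k \<in> set_tree (subtree_of P v)"
        using convex_subtree[OF PP(1), of k a v c] ac k by (auto simp: region_def)
      moreover have "side_of k v = s" using ac k by (auto simp: region_def side_of_def split: if_splits)
      ultimately show "k \<in> ?A" by (simp add: region_def)
    qed
  qed
  have acN: "1 \<le> a" "c \<le> N" "a \<le> c" using ac sub A by auto
  let ?L = "key_depths_list 0 t"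
  have len: "length ?L = N" using arg_cong[OF fst_key_depths[of 0 t], of length] t(2) by simp
  define Y where "Y = take (c - a + 1) (drop (a - 1) ?L)"
  have Y: "map snd Y = map (key_depth t) [a..<Suc c]"
    by (rule nth_equalityI) (use acN len in \<open>auto simp: Y_def key_depth_def simp del: upt_Suc\<close>)
  have split: "?L = take (a - 1) ?L @ Y @ drop (c - a + 1) (drop (a - 1) ?L)" by (metis Y_def append_take_drop_id)
  have "Y \<noteq> []" using acN len by (simp add: Y_def)
  from segment_level_count[OF t(1) split this]
  have le: "length (filter (\<lambda>p. snd p = Min (snd ` set Y)) Y) \<le> b" .
  have m: "snd ` set Y = key_depth t ` ?A" using arg_cong[OF Y, of set] A by (auto simp: atLeastLessThanSuc_atLeastAtMost)
  have "length (filter (\<lambda>p. snd p = m) Y) = card {k \<in> ?A. key_depth t k = m}" for m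
  proof -
    have "length (filter (\<lambda>p. snd p = m) Y) = length (filter (\<lambda>d. d = m) (map snd Y))"
      by (simp add: filter_map comp_def)
    also have "\<dots> = length (filter (\<lambda>k. key_depth t k = m) [a..<Suc c])" unfolding Y by (simp add: filter_map comp_def)
    also have "\<dots> = card (set (filter (\<lambda>k. key_depth t k = m) [a..<Suc c]))" by (rule distinct_card[symmetric]) simp
    also have "set (filter (\<lambda>k. key_depth t k = m) [a..<Suc c]) = {k \<in> ?A. key_depth t k = m}" using A by auto
    finally show ?thesis .
  qed
  then show "level_count (key_depth t) (top_depth (key_depth t) ?A) ?A \<le> b"
    using le unfolding level_count_def m by simp
qed

text \<open>The keys next to a subtree in key order lie in proper ancestors of its root, which gives
  the strict bounds at both borders.\<close>

lemma key_depths_put_at: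
  assumes "valid_address t q" "node_sizes_ok b t"
  shows "\<exists>X Z. (\<forall>s. key_depths_list d (put_at t q s) = X @ key_depths_list (d + length q) s @ Z) \<and>
    (X = [] \<or> snd (last X) < d + length q) \<and> (Z = [] \<or> snd (hd Z) < d + length q)"
  using assms
proof (induction t q arbitrary: d rule: valid_address.induct)
  case (1 t)
  show ?case by (intro exI[of _ "[]"]) auto
next
  case (2 a ks ts i q)
  then have i: "i < length ts" "length ts = length ks + 1" by auto
  have "valid_address (ts ! i) q" "node_sizes_ok b (ts ! i)" using 2(2,3) by auto
  from 2(1)[OF this, of "Suc d"] obtain X Z where IH: "\<forall>s. key_depths_list (Suc d) (put_at (ts ! i) q s) = X @ key_depths_list (Suc d + length q) s @ Z"
    "X = [] \<or> snd (last X) < Suc d + length q" "Z = [] \<or> snd (hd Z) < Suc d + length q" by blast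
  have w: "\<exists>U V. (\<forall>y. weave (xss[i := y]) ks = U @ y @ V) \<and> (U = [] \<or> last U \<in> set ks) \<and> (V = [] \<or> hd V \<in> set ks)"
    if "length xss = length ks + 1" "i < length xss" for xss :: "(nat \<times> nat) list list" and ks
    using that
  proof (induction xss ks arbitrary: i rule: interleave_induct)
    case (single x)
    then show ?case by (intro exI[of _ "[]"]) auto
  next
    case (cons x xss k ks)
    show ?case
    proof (cases i)
      case 0
      then show ?thesis by (intro exI[of _ "[]"] exI[of _ "k # weave xss ks"]) auto
    next
      case (Suc j)
      then have "j < length xss" using cons.prems by simp
      from cons.IH[OF this] obtain U V where UV: "\<forall>y. weave (xss[j := y]) ks = U @ y @ V" "U = [] \<or> last U \<in> set ks"
        "V = [] \<or> hd V \<in> set ks" by blast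
      then show ?thesis using Suc by (intro exI[of _ "x @ k # U"] exI[of _ V]) auto
    qed
  qed
  from w[of "map (key_depths_list (Suc d)) ts" "map (\<lambda>k. (k, d)) ks"] i obtain U V where
    UV: "\<And>y. weave ((map (key_depths_list (Suc d)) ts)[i := y]) (map (\<lambda>k. (k, d)) ks) = U @ y @ V"
    "U = [] \<or> snd (last U) = d" "V = [] \<or> snd (hd V) = d" by fastforce
  show ?case
  proof (rule exI[of _ "U @ X"], rule exI[of _ "Z @ V"], intro conjI allI)
    fix s show "key_depths_list d (put_at (BNode a ks ts) (i # q) s) =
       (U @ X) @ key_depths_list (d + length (i # q)) s @ Z @ V"
      using UV(1) IH(1) by (simp add: map_update)
  qed (use UV IH in \<open>auto simp: last_append hd_append\<close>)
qed simp

text \<open>Merging a node into its parent shifts the depths of the keys in its subtree by one. Every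
  operation is a composition of at most three such mergers and their inverses, through trees
  with somewhat larger nodes.\<close>

lemma dissolve_potential:
  fixes t :: "unit btree"
  assumes P: "reference_tree N P" and t: "valid_address t q" "node_sizes_ok b' t"
    and len: "length ts1 = length as" "length vs = length us + 1" "length ts2 = length cs" "us \<noteq> []"
    and T: "T = put_at t q (node (as @ cs) (ts1 @ node us vs # ts2))" "T' = put_at t q (node (as @ us @ cs) (ts1 @ vs @ ts2))"
    and ok: "node_sizes_ok (Suc b) T" "node_sizes_ok (Suc b) T'" "keys_inorder T = [1..<N + 1]" and c: "b < 2 ^ Suc c"
  shows "potential (key_depth T') P pref \<le> potential (key_depth T) P pref + 4 * Suc c \<and>
    potential (key_depth T) P pref \<le> potential (key_depth T') P pref + 4 * Suc c"
proof -
  let ?h = "length q"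
  from key_depths_put_at[OF t, of 0] obtain X0 Z0 where XZ:
    "\<And>s. key_depths_list 0 (put_at t q s) = X0 @ key_depths_list ?h s @ Z0"
    "X0 = [] \<or> snd (last X0) < ?h" "Z0 = [] \<or> snd (hd Z0) < ?h" by auto
  define X1 where "X1 = concat (map2 (\<lambda>s k. key_depths_list (Suc ?h) s @ [(k, ?h)]) ts1 as)"
  define Z1 where "Z1 = concat (map2 (\<lambda>k s. (k, ?h) # key_depths_list (Suc ?h) s) cs ts2)"
  have w1: "weave (map f ts1 @ W) (map g as @ K) = concat (map2 (\<lambda>s k. f s @ [g k]) ts1 as) @ weave W K"
    for f :: "unit btree \<Rightarrow> (nat \<times> nat) list" and g W K
    using len(1) by (induction ts1 as rule: list_induct2) auto
  have w2: "weave (y # map f ts2) (map g cs) = y @ concat (map2 (\<lambda>k s. g k # f s) cs ts2)"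
    for f :: "unit btree \<Rightarrow> (nat \<times> nat) list" and g y
    using len(3) by (induction ts2 cs arbitrary: y rule: list_induct2) auto
  have w3: "weave (map f vs @ map f ts2) (map g us @ map g cs) = weave (map f vs) (map g us) @ concat (map2 (\<lambda>k s. g k # f s) cs ts2)"
    for f :: "unit btree \<Rightarrow> (nat \<times> nat) list" and g
    using len(2)
  proof (induction vs us rule: interleave_induct)
    case (single v)
    then show ?case using w2[of "f v" f g] by simp
  qed simp
  \<comment> \<open>The segment of the child at the depths it has after the merger; before it, every
    entry is one deeper.\<close>
  define Y where "Y = key_depths_list ?h (node us vs)"
  have L: "key_depths_list 0 T = (X0 @ X1) @ map (apsnd Suc) Y @ (Z1 @ Z0)"
    unfolding T XZ(1) Y_def key_depths_Suc[symmetric] using w1 w2 by (simp add: X1_def Z1_def)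
  have L': "key_depths_list 0 T' = (X0 @ X1) @ Y @ (Z1 @ Z0)"
    unfolding T XZ(1) Y_def using w1 w3 by (simp add: X1_def Z1_def)
  \<comment> \<open>The key before the child belongs to the parent or, for a first child, to a
    proper ancestor; on the right, \<open>Z\<close> is its counterpart.\<close>
  have X: "X0 @ X1 = [] \<or> snd (last (X0 @ X1)) \<le> ?h"
  proof (cases ts1 rule: rev_cases)
    case Nil
    then show ?thesis using XZ(2) by (auto simp: X1_def)
  next
    case (snoc ts s)
    then obtain as' k where "as = as' @ [k]" "length ts = length as'" using len(1) by (cases as rule: rev_cases) auto
    then have "X1 = concat (map2 (\<lambda>s k. key_depths_list (Suc ?h) s @ [(k, ?h)]) ts as') @ key_depths_list (Suc ?h) s @ [(k, ?h)]"
      unfolding X1_def snoc by simp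
    then show ?thesis by simp
  qed
  have Z: "Z1 @ Z0 = [] \<or> snd (hd (Z1 @ Z0)) \<le> ?h"
    using XZ(3) len(3) by (cases cs; cases ts2) (auto simp: Z1_def)
  have Yge: "?h \<le> snd p" if "p \<in> set Y" for p using that key_depths_ge unfolding Y_def by blast
  have "length (keys_inorder T) = N" using ok(3) by simp
  then have lN: "length (X0 @ X1) + length Y + length (Z1 @ Z0) = N"
    unfolding fst_key_depths[of 0 T, symmetric] L by simp
  have Yne: "Y \<noteq> []"
  proof -
    have "weave xss ks \<noteq> []" if "ks \<noteq> []" "xss \<noteq> []" for xss :: "(nat \<times> nat) list list" and ks
      using that by (cases xss; cases ks) auto
    moreover have "map (\<lambda>k. (k, ?h)) us \<noteq> []" "map (key_depths_list (Suc ?h)) vs \<noteq> []" using len by auto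
    ultimately show ?thesis unfolding Y_def key_depths_list.simps by blast
  qed
  have kT': "keys_inorder T' = [1..<N + 1]"
    using ok(3) unfolding fst_key_depths[of 0 T, symmetric] fst_key_depths[of 0 T', symmetric] L L' by (simp add: comp_def)
  let ?x = "length (X0 @ X1)"
  have "card {v \<in> set_tree P. \<exists>s. light (key_depth T) P v s \<noteq> light (key_depth T') P v s} \<le> 4 * Suc c"
  proof (rule dissolve_light_changes[OF P bounded_key_depth[OF P ok(1,3)] bounded_key_depth[OF P ok(2) kT'] c,
        where lo = "?x + 1" and hi = "?x + length Y" and h = ?h])
    show "?x + 1 \<le> ?x + length Y" using Yne by (simp add: Suc_le_eq)
    show "?x + length Y \<le> N" using lN by simp
  next
    fix k assume k: "?x + 1 \<le> k" "k \<le> ?x + length Y"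
    then have "key_depth T k = snd (map (apsnd Suc) Y ! (k - 1 - ?x))" "key_depth T' k = snd (Y ! (k - 1 - ?x))"
      "k - 1 - ?x < length Y"
      unfolding key_depth_def L L' by (auto simp: nth_append)
    then show "key_depth T k = key_depth T' k + 1 \<and> ?h \<le> key_depth T' k" using Yge by simp
  next
    fix k assume "k \<in> {1..N}" "\<not> (?x + 1 \<le> k \<and> k \<le> ?x + length Y)"
    then show "key_depth T k = key_depth T' k" unfolding key_depth_def L L' by (auto simp: nth_append)
  next
    assume "1 < ?x + 1"
    then have "X0 @ X1 \<noteq> []" by auto
    then show "key_depth T (?x + 1 - 1) \<le> ?h" using X unfolding key_depth_def L
      by (subst nth_append) (auto simp: last_conv_nth simp del: length_append append_assoc)
  next
    assume "?x + length Y < N"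
    then have "Z1 @ Z0 \<noteq> []" using lN by auto
    then show "key_depth T (?x + length Y + 1) \<le> ?h" using Z unfolding key_depth_def L
      by (cases Z1) (auto simp: nth_append hd_conv_nth)
  qed simp
  then show ?thesis by (rule potential_changes)
qed


section \<open>Operations and searches of the model against the potential\<close>

lemma node_sizes_ok_mono: "node_sizes_ok B t \<Longrightarrow> B \<le> B' \<Longrightarrow> node_sizes_ok B' t"
  by (induction t) fastforce+

lemma put_at_sub_at: "valid_address t q \<Longrightarrow> put_at t q (sub_at t q) = t"
  by (induction t q rule: valid_address.induct) auto

text \<open>A rotation is a merger into the joint node \<open>m\<close> and the inverse of another.
  A split merges the node into its parent and extracts the two halves again, three mergers in all,
  and a join is its inverse. Each merger shifts the potential by at most \<open>4 * Suc c\<close>.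
  The joint nodes exceed \<open>B - 1\<close> keys, so node sizes are bounded by
  \<open>3 * B\<close> here.\<close>

lemma step_potential:
  assumes P: "reference_tree N P" and step: "step B cf cf'" and ok: "config_ok B cf" "keys_inorder (fst cf) = [1..<N + 1]"
    and c: "3 * B < 2 ^ Suc c"
  shows "potential (key_depth (fst cf')) P pref \<le> potential (key_depth (fst cf)) P pref + 12 * Suc c"
proof -
  let ?pot = "\<lambda>t. potential (key_depth t) P pref"
  have merge: "?pot (put_at t q s') \<le> ?pot (put_at t q s) + 4 * Suc c \<and> ?pot (put_at t q s) \<le> ?pot (put_at t q s') + 4 * Suc c"
    if t: "valid_address t q" "node_sizes_ok B t" "keys_inorder t = [1..<N + 1]"
      and s: "s = node (as @ cs) (ts1 @ node us vs # ts2)" "s' = node (as @ us @ cs) (ts1 @ vs @ ts2)"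
      and len: "length ts1 = length as" "length vs = length us + 1" "length ts2 = length cs" "us \<noteq> []"
      and sz: "node_sizes_ok (Suc (3 * B)) s" "node_sizes_ok (Suc (3 * B)) s'" "keys_inorder s = keys_inorder (sub_at t q)"
    for t q s s' as us cs ts1 vs ts2
  proof (rule dissolve_potential[OF P t(1,2) len])
    have big: "node_sizes_ok (Suc (3 * B)) t" by (rule node_sizes_ok_mono[OF t(2)]) simp
    show "node_sizes_ok (Suc (3 * B)) (put_at t q s)" "node_sizes_ok (Suc (3 * B)) (put_at t q s')"
      using big t(1) sz(1,2) by (auto intro: node_sizes_ok_put_at)
    show "keys_inorder (put_at t q s) = [1..<N + 1]" using keys_inorder_put_at[OF t(1) sz(3)] t(3) by simp
  qed (use s c in auto)
  have big: "node_sizes_ok (Suc (3 * B)) t" if "node_sizes_ok B t" for t :: "unit btree"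
    by (rule node_sizes_ok_mono[OF that]) simp
  have split3: "?pot (put_at t q s') \<le> ?pot (put_at t q s) + 12 * Suc c \<and> ?pot (put_at t q s) \<le> ?pot (put_at t q s') + 12 * Suc c"
    if t: "valid_address t q" "node_sizes_ok B t" "keys_inorder t = [1..<N + 1]"
      and s: "s = node (ks1 @ ks2) (ts1 @ node (us1 @ k # us2) (vs1 @ vs2) # ts2)"
        "s' = node (ks1 @ k # ks2) (ts1 @ node us1 vs1 # node us2 vs2 # ts2)"
      and sz: "ks1 @ ks2 \<noteq> []" "us1 \<noteq> []" "us2 \<noteq> []" "length (ks1 @ ks2) \<le> B" "length (us1 @ k # us2) \<le> B"
        "length ts1 = length ks1" "length ts2 = length ks2" "length vs1 = length us1 + 1" "length vs2 = length us2 + 1"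
        "\<forall>x\<in>set (ts1 @ vs1 @ vs2 @ ts2). node_sizes_ok B x"
      and keys: "keys_inorder s = keys_inorder (sub_at t q)"
    for t q s s' ks1 ks2 ts1 us1 k us2 vs1 vs2 ts2
  proof -
    \<comment> \<open>\<open>m\<close> is parent and child in one node; in \<open>m1\<close> the
      right half has been extracted again, but not the left one.\<close>
    define m where "m = node (ks1 @ (us1 @ k # us2) @ ks2) (ts1 @ (vs1 @ vs2) @ ts2)"
    define m1 where "m1 = node (ks1 @ us1 @ k # ks2) (ts1 @ vs1 @ node us2 vs2 # ts2)"
    have bb: "\<forall>x\<in>set ts1 \<union> set vs1 \<union> set vs2 \<union> set ts2. node_sizes_ok (Suc (3 * B)) x" using sz(10) big by auto
    have ne: "1 \<le> length us1" "1 \<le> length us2" "1 \<le> length ks1 + length ks2" using sz(1-3) by (auto simp: Suc_le_eq)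
    have ok: "node_sizes_ok (Suc (3 * B)) s" "node_sizes_ok (Suc (3 * B)) s'" "node_sizes_ok (Suc (3 * B)) m" "node_sizes_ok (Suc (3 * B)) m1"
      unfolding s m_def m1_def using sz(4-9) ne bb by auto
    have ki: "keys_inorder m1 = keys_inorder (sub_at t q)" "keys_inorder s' = keys_inorder (sub_at t q)"
    proof -
      show "keys_inorder s' = keys_inorder (sub_at t q)"
        unfolding keys[symmetric] s using keys_inorder_split[of ts1 ks1 ts2 ks2 vs1 us1 vs2 us2 "()" "()" k] sz by simp
      then show "keys_inorder m1 = keys_inorder (sub_at t q)"
        using keys_inorder_flatten[of ts1 ks1 vs1 us1 "node us2 vs2 # ts2" "k # ks2" "()" "()"] sz
        unfolding s m1_def by simp
    qed
    have 1: "?pot (put_at t q m) \<le> ?pot (put_at t q s) + 4 * Suc c \<and> ?pot (put_at t q s) \<le> ?pot (put_at t q m) + 4 * Suc c"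
      by (rule merge[OF t s(1) m_def _ _ _ _ ok(1,3) keys]) (use sz in auto)
    have 2: "?pot (put_at t q m) \<le> ?pot (put_at t q m1) + 4 * Suc c \<and> ?pot (put_at t q m1) \<le> ?pot (put_at t q m) + 4 * Suc c"
      by (rule merge[OF t, of m1 "ks1 @ us1 @ [k]" ks2 "ts1 @ vs1" us2 vs2 ts2 m]) (use sz ok ki in \<open>auto simp: m_def m1_def\<close>)
    have 3: "?pot (put_at t q m1) \<le> ?pot (put_at t q s') + 4 * Suc c \<and> ?pot (put_at t q s') \<le> ?pot (put_at t q m1) + 4 * Suc c"
      by (rule merge[OF t, of s' ks1 "k # ks2" ts1 us1 vs1 "node us2 vs2 # ts2" m1]) (use sz ok ki in \<open>auto simp: s m1_def\<close>)
    show ?thesis using 1 2 3 by linarith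
  qed
  \<comment> \<open>For a root split, or a join of the only two children, there is no larger parent:
    the unsplit node itself plays the part of \<open>m\<close>, and two mergers are enough.\<close>
  have split2: "?pot (put_at t q s') \<le> ?pot (put_at t q s) + 12 * Suc c \<and> ?pot (put_at t q s) \<le> ?pot (put_at t q s') + 12 * Suc c"
    if t: "valid_address t q" "node_sizes_ok B t" "keys_inorder t = [1..<N + 1]"
      and s: "s = node (us1 @ k # us2) (vs1 @ vs2)" "s' = node [k] [node us1 vs1, node us2 vs2]"
      and sz: "us1 \<noteq> []" "us2 \<noteq> []" "length (us1 @ k # us2) \<le> B" "length vs1 = length us1 + 1" "length vs2 = length us2 + 1"
        "\<forall>x\<in>set (vs1 @ vs2). node_sizes_ok B x" and keys: "keys_inorder s = keys_inorder (sub_at t q)"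
    for t q s s' us1 k us2 vs1 vs2
  proof -
    define m1 where "m1 = node (us1 @ [k]) (vs1 @ [node us2 vs2])"
    have bb: "\<forall>x\<in>set vs1 \<union> set vs2. node_sizes_ok (Suc (3 * B)) x" using sz(6) big by auto
    have ne: "1 \<le> length us1" "1 \<le> length us2" using sz(1-2) by (auto simp: Suc_le_eq)
    have ok: "node_sizes_ok (Suc (3 * B)) s" "node_sizes_ok (Suc (3 * B)) s'" "node_sizes_ok (Suc (3 * B)) m1"
      unfolding s m1_def using sz(3-5) ne bb by auto
    have ki: "keys_inorder m1 = keys_inorder (sub_at t q)" "keys_inorder s' = keys_inorder (sub_at t q)"
    proof -
      show "keys_inorder s' = keys_inorder (sub_at t q)"
        unfolding keys[symmetric] s using keys_inorder_split_single[of vs1 us1 vs2 us2 "()" k] sz by simp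
      then show "keys_inorder m1 = keys_inorder (sub_at t q)"
        using keys_inorder_flatten[of "[]" "[]" vs1 us1 "[node us2 vs2]" "[k]" "()" "()"] sz unfolding s m1_def by simp
    qed
    have 2: "?pot (put_at t q s) \<le> ?pot (put_at t q m1) + 4 * Suc c \<and> ?pot (put_at t q m1) \<le> ?pot (put_at t q s) + 4 * Suc c"
      by (rule merge[OF t, of m1 "us1 @ [k]" "[]" vs1 us2 vs2 "[]" s]) (use sz ok ki in \<open>auto simp: s m1_def\<close>)
    have 3: "?pot (put_at t q m1) \<le> ?pot (put_at t q s') + 4 * Suc c \<and> ?pot (put_at t q s') \<le> ?pot (put_at t q m1) + 4 * Suc c"
      by (rule merge[OF t, of s' "[]" "[k]" "[]" us1 vs1 "[node us2 vs2]" m1]) (use sz ok ki in \<open>auto simp: s m1_def\<close>)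
    show ?thesis using 2 3 by linarith
  qed
  show ?thesis using step ok
  proof (induction rule: step.induct)
    case (split t q ks1 ks2 ts1 us1 k us2 vs1 vs2 ts2)
    note q = config_ok_parent[OF split.prems(1)]
    have sub: "node_sizes_ok B (node (ks1 @ ks2) (ts1 @ node (us1 @ k # us2) (vs1 @ vs2) # ts2))" using q(3) split.hyps(1) by simp
    have "?pot (put_at t q (node (ks1 @ k # ks2) (ts1 @ node us1 vs1 # node us2 vs2 # ts2))) \<le>
        ?pot (put_at t q (sub_at t q)) + 12 * Suc c"
      by (rule split3[THEN conjunct1, OF q(2,1) _ split.hyps(1) refl]) (use split sub in auto)
    then show ?case by (simp add: put_at_sub_at[OF q(2)])
  next
    case (split_root vs1 us1 us2 k vs2)
    let ?s = "node (us1 @ k # us2) (vs1 @ vs2)"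
    have sub: "node_sizes_ok B ?s" using split_root by (simp add: config_ok_def)
    have "?pot (put_at ?s [] (node [k] [node us1 vs1, node us2 vs2])) \<le> ?pot (put_at ?s [] ?s) + 12 * Suc c"
      by (rule split2[THEN conjunct1, OF _ sub _ refl refl]) (use split_root sub in auto)
    then show ?case by simp
  next
    case (join t q ks1 k ks2 ts1 us1 vs1 us2 vs2 ts2 i u)
    note q = config_ok_parent[OF join.prems(1)]
    have sub: "node_sizes_ok B (node (ks1 @ k # ks2) (ts1 @ node us1 vs1 # node us2 vs2 # ts2))" using q(3) join.hyps(1) by simp
    have lens: "length ts2 = length ks2" "length vs1 = length us1 + 1" "length vs2 = length us2 + 1" "us1 \<noteq> []" "us2 \<noteq> []"
      using sub join.hyps(2) by auto
    show ?case
    proof (cases "ks1 @ ks2 = []")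
      case True
      then have nil: "ts1 = []" "ts2 = []" "ks1 = []" "ks2 = []" using lens join.hyps(2) by auto
      have "?pot (put_at t q u) \<le> ?pot (put_at t q (node [k] [node us1 vs1, node us2 vs2])) + 12 * Suc c"
        by (rule split2[THEN conjunct2, OF q(2,1) _ join.hyps(5) refl])
           (use join lens sub nil keys_inorder_split_single[of vs1 us1 vs2 us2] in auto)
      moreover have "put_at t q (node [k] [node us1 vs1, node us2 vs2]) = t"
        using put_at_sub_at[OF q(2)] join.hyps(1) nil by simp
      ultimately show ?thesis using True by simp
    next
      case False
      have "?pot (put_at t q (node (ks1 @ ks2) (ts1 @ u # ts2))) \<le> ?pot (put_at t q (sub_at t q)) + 12 * Suc c"
        by (rule split3[THEN conjunct2, OF q(2,1) _ _ join.hyps(1)])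
           (use join lens sub False keys_inorder_split[of ts1 ks1 ts2 ks2 vs1 us1 vs2 us2] in auto)
      then show ?thesis using put_at_sub_at[OF q(2)] by (simp only: if_not_P[OF False] fst_conv)
    qed
  next
    case (rotate t q as cs ts1 us vs ts2 as' us' cs' ts1' vs' ts2')
    note q = config_ok_parent[OF rotate.prems(1)]
    have sub: "node_sizes_ok B (node (as @ cs) (ts1 @ node us vs # ts2))" using q(3) rotate.hyps(1) by simp
    have len: "length vs = length us + 1" "length ts2 = length cs" "us \<noteq> []" using sub rotate.hyps(2) by auto
    define m where "m = node (as @ us @ cs) (ts1 @ vs @ ts2)"
    define s' where "s' = node (as' @ cs') (ts1' @ node us' vs' # ts2')"
    have m': "m = node (as' @ us' @ cs') (ts1' @ vs' @ ts2')" unfolding m_def rotate.hyps ..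
    have all: "\<forall>x\<in>set (ts1 @ vs @ ts2). node_sizes_ok (Suc (3 * B)) x" using sub big by auto
    then have all': "\<forall>x\<in>set (ts1' @ vs' @ ts2'). node_sizes_ok (Suc (3 * B)) x" unfolding rotate.hyps(5) .
    have "1 \<le> length us" "length us \<le> B" "length (as @ cs) \<le> B" using sub by auto
    then have om: "node_sizes_ok (Suc (3 * B)) m" unfolding m_def using all len rotate.hyps(2) by auto
    have "1 \<le> length us'" "1 \<le> length (as' @ cs')" using rotate.hyps(9,10) by (auto simp: Suc_le_eq)
    then have os: "node_sizes_ok (Suc (3 * B)) s'" unfolding s'_def using all' rotate.hyps(6-8,11,12) by auto
    have km: "keys_inorder m = keys_inorder (sub_at t q)"
      using keys_inorder_flatten[of ts1 as vs us ts2 cs "()" "()"] rotate.hyps(1,2) len unfolding m_def by simp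
    have ks: "keys_inorder s' = keys_inorder (sub_at t q)"
      using keys_inorder_flatten[of ts1' as' vs' us' ts2' cs' "()" "()"] rotate.hyps(6-8) unfolding km[symmetric] m' s'_def by simp
    have "?pot (put_at t q m) \<le> ?pot (put_at t q (sub_at t q)) + 4 * Suc c"
      by (rule merge[THEN conjunct1, OF q(2,1) _ rotate.hyps(1) m_def]) (use rotate.prems rotate.hyps(2) len om big[OF q(3)] in auto)
    moreover have "?pot (put_at t q s') \<le> ?pot (put_at t q m) + 4 * Suc c"
      by (rule merge[THEN conjunct2, OF q(2,1) _ s'_def m']) (use rotate.prems rotate.hyps(6-9) om os ks in auto)
    ultimately show ?case using put_at_sub_at[OF q(2)] by (simp add: s'_def)
  qed auto
qed

lemma successively_nth: "successively Q xs \<Longrightarrow> Suc i < length xs \<Longrightarrow> Q (xs ! i) (xs ! Suc i)"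
  by (induction xs arbitrary: i rule: induct_list012) (auto simp: nth_Cons split: nat.splits)

lemma step_pointer: "step B cf cf' \<Longrightarrow> length (snd cf') \<le> Suc (length (snd cf))"
  by (induction rule: step.induct) auto

lemma key_depth_address:
  assumes "node_sizes_ok B t" "valid_address t p" "keys_inorder t = [1..<N + 1]" "x \<in> set (node_keys (sub_at t p))"
  shows "key_depth t x = length p"
proof -
  from key_depths_put_at[OF assms(2,1), of 0] obtain X Z where
    "\<And>s. key_depths_list 0 (put_at t p s) = X @ key_depths_list (length p) s @ Z" by auto
  from this[of "sub_at t p"] have L: "key_depths_list 0 t = X @ key_depths_list (length p) (sub_at t p) @ Z"
    by (simp add: put_at_sub_at[OF assms(2)])
  obtain a ks ts where s: "sub_at t p = BNode a ks ts" using assms(4) by (cases "sub_at t p") auto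
  have "length ts = length ks + 1" using node_sizes_ok_sub_at[OF assms(1,2)] s by simp
  then have "set (map (\<lambda>k. (k, length p)) ks) \<subseteq> set (key_depths_list (length p) (sub_at t p))"
    unfolding s by (induction ts ks rule: interleave_induct) auto
  then have "(x, length p) \<in> set (key_depths_list 0 t)" using assms(4) s unfolding L by auto
  then obtain i where i: "i < length (key_depths_list 0 t)" "key_depths_list 0 t ! i = (x, length p)"
    by (auto simp: in_set_conv_nth)
  have "map fst (key_depths_list 0 t) ! i = [1..<N + 1] ! i" unfolding fst_key_depths assms(3) ..
  moreover have "length (key_depths_list 0 t) = N" using arg_cong[OF fst_key_depths[of 0 t], of length] assms(3) by simp
  ultimately have "x = i + 1" using i by (simp del: upt_Suc)
  then show ?thesis using i by (simp add: key_depth_def)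
qed

text \<open>The pointer descends at most one level per operation, so when \<open>x\<close> is
  touched at time \<open>i\<close> its depth is at most \<open>i\<close>. Switching the preferences
  at that moment, the cost is 12 per operation before and after and 2 per level down to
  \<open>x\<close>, together 14.\<close>

lemma search_potential:
  assumes P: "reference_tree N P" and t: "btree_on B N t" and s: "model_search B x t cs t'" and c: "3 * B < 2 ^ Suc c"
    and x: "x \<in> {1..N}"
  shows "btree_on B N t' \<and> switches P x pref + potential (key_depth t') P (after_search P x pref) \<le>
    potential (key_depth t) P pref + 14 * Suc c * length cs"
proof -
  note PP = reference_tree_facts[OF P]
  have cs: "cs \<noteq> []" "hd cs = (t, [])" "successively (step B) cs" "fst (last cs) = t'" and
    touch: "\<exists>(s, p)\<in>set cs. x \<in> set (node_keys (sub_at s p))" using s by (auto simp: model_search_def)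
  have inv: "config_ok B (cs ! i) \<and> keys_inorder (fst (cs ! i)) = [1..<N + 1] \<and> length (snd (cs ! i)) \<le> i"
    if "i < length cs" for i
    using that
  proof (induction i)
    case 0
    then show ?case using cs t by (simp add: hd_conv_nth[symmetric] config_ok_def btree_on_def)
  next
    case (Suc i)
    have st: "step B (cs ! i) (cs ! Suc i)" by (rule successively_nth[OF cs(3) Suc.prems])
    show ?case using Suc step_preserves[OF st] step_pointer[OF st] by auto
  qed
  have pot: "potential (key_depth (fst (cs ! (i + j)))) P pr \<le> potential (key_depth (fst (cs ! i))) P pr + 12 * Suc c * j"
    if "i + j < length cs" for i j pr
    using that
  proof (induction j)
    case (Suc j)
    have "step B (cs ! (i + j)) (cs ! Suc (i + j))" by (rule successively_nth[OF cs(3)]) (use Suc.prems in simp)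
    from step_potential[OF P this _ _ c, of pr] inv[of "i + j"] Suc show ?case by (simp add: algebra_simps)
  qed simp
  obtain i where i: "i < length cs" "x \<in> set (node_keys (sub_at (fst (cs ! i)) (snd (cs ! i))))"
    using touch by (auto simp: in_set_conv_nth) (metis fst_conv snd_conv)
  let ?s = "fst (cs ! i)"
  have oks: "node_sizes_ok B ?s" "valid_address ?s (snd (cs ! i))" "keys_inorder ?s = [1..<N + 1]" "length (snd (cs ! i)) \<le> i"
    using inv[OF i(1)] by (auto simp: config_ok_def)
  have dx: "key_depth ?s x \<le> i" using key_depth_address[OF oks(1-3) i(2)] oks(4) by simp
  have bl: "bounded_levels (3 * B) (key_depth ?s) P"
    by (rule bounded_key_depth[OF P _ oks(3)], rule node_sizes_ok_mono[OF oks(1)]) simp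
  have lst: "last cs = cs ! (length cs - 1)" using cs(1) by (rule last_conv_nth)
  have p1: "potential (key_depth ?s) P pref \<le> potential (key_depth t) P pref + 12 * Suc c * i"
    using pot[of 0 i pref] i(1) cs(1,2) by (simp add: hd_conv_nth)
  have p2: "potential (key_depth t') P (after_search P x pref) \<le>
      potential (key_depth ?s) P (after_search P x pref) + 12 * Suc c * (length cs - 1 - i)"
    using pot[of i "length cs - 1 - i" "after_search P x pref"] i(1) cs(4) lst by simp
  have p3: "switches P x pref + potential (key_depth ?s) P (after_search P x pref) \<le>
      potential (key_depth ?s) P pref + 2 * ((key_depth ?s x + 1) * Suc c)"
    by (rule potential_search[OF PP(1) _ bl c]) (use x PP(2) in simp)
  \<comment> \<open>Time \<open>i\<close> is an index into \<open>cs\<close>, so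
    \<open>i + 1\<close> is at most its length: the unit for placing the pointer accounts for the
    level of the root.\<close>
  have "2 * ((key_depth ?s x + 1) * Suc c) \<le> 2 * (length cs * Suc c)"
    using dx i(1) by (intro mult_le_mono order_refl) simp
  moreover have "12 * Suc c * i + 12 * Suc c * (length cs - 1 - i) = 12 * Suc c * (length cs - 1)"
    using i(1) by (simp add: distrib_left[symmetric] del: mult_Suc mult_Suc_right)
  moreover have "12 * Suc c * (length cs - 1) \<le> 12 * Suc c * length cs" by (intro mult_le_mono) auto
  moreover have "12 * Suc c * length cs + 2 * (length cs * Suc c) = 14 * Suc c * length cs" by (simp add: algebra_simps)
  ultimately have "switches P x pref + potential (key_depth t') P (after_search P x pref) \<le>
    potential (key_depth t) P pref + 14 * Suc c * length cs" using p1 p2 p3 by linarith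
  moreover have "btree_on B N t'" using inv[of "length cs - 1"] cs(1,4) lst by (simp add: btree_on_def config_ok_def)
  ultimately show ?thesis by simp
qed

text \<open>The number of alternations in the interleave bound, relative to given initial
  preferences.\<close>

fun total_switches :: "nat tree \<Rightarrow> preference \<Rightarrow> nat list \<Rightarrow> nat" where
  "total_switches P pref [] = 0"
| "total_switches P pref (x # X) = switches P x pref + total_switches P (after_search P x pref) X"

lemma model_run_potential:
  assumes "model_run B t X n" "reference_tree N P" "btree_on B N t" "3 * B < 2 ^ Suc c" "set X \<subseteq> {1..N}"
  shows "total_switches P pref X \<le> potential (key_depth t) P pref + 14 * Suc c * n \<and> length X \<le> n"
  using assms(1,3,5)
proof (induction arbitrary: pref rule: model_run.induct)
  case (2 x t cs t' X n)
  have x: "x \<in> {1..N}" using 2 by simp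
  from search_potential[OF assms(2) 2(4) 2(1) assms(4) x, of pref]
  have s: "btree_on B N t'" "switches P x pref + potential (key_depth t') P (after_search P x pref) \<le>
    potential (key_depth t) P pref + 14 * Suc c * length cs" by auto
  from 2(3)[OF s(1), of "after_search P x pref"] 2(5)
  have "total_switches P (after_search P x pref) X \<le> potential (key_depth t') P (after_search P x pref) + 14 * Suc c * n"
    "length X \<le> n" by auto
  moreover have "1 \<le> length cs" using 2(1) by (cases cs) (auto simp: model_search_def)
  ultimately show ?case using s(2) by (simp add: distrib_left del: mult_Suc mult_Suc_right)
qed simp

section \<open>The optimum is attained\<close>

fun binary :: "nat tree \<Rightarrow> unit btree" where
  "binary \<langle>\<rangle> = BNil"
| "binary \<langle>l, v, r\<rangle> = node [v] [binary l, binary r]"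

lemma static_search:
  assumes "x \<in> set_tree P"
  shows "\<exists>cs. model_search B x (binary P) cs (binary P)"
proof -
  let ?T = "binary P"
  have path: "\<exists>p. valid_address (binary Q) p \<and> x \<in> set (node_keys (sub_at (binary Q) p))" if "x \<in> set_tree Q" for Q
    using that
  proof (induction Q)
    case (Node l v r)
    consider "x = v" | "x \<in> set_tree l" | "x \<in> set_tree r" using Node by auto
    then show ?case
    proof cases
      case 1
      then show ?thesis by (intro exI[of _ "[]"]) auto
    next
      case 2
      from Node.IH(1)[OF 2] obtain p where "valid_address (binary l) p" "x \<in> set (node_keys (sub_at (binary l) p))" by blast
      then show ?thesis by (intro exI[of _ "0 # p"]) auto
    next
      case 3
      from Node.IH(2)[OF 3] obtain p where "valid_address (binary r) p" "x \<in> set (node_keys (sub_at (binary r) p))" by blast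
      then show ?thesis by (intro exI[of _ "1 # p"]) auto
    qed
  qed simp
  have walk: "\<exists>cs. cs \<noteq> [] \<and> hd cs = (?T, []) \<and> successively (step B) cs \<and> last cs = (?T, p)"
    if "valid_address ?T p" "sub_at ?T p \<noteq> BNil" for p
    using that
  proof (induction p rule: rev_induct)
    case Nil
    then show ?case by (intro exI[of _ "[(?T, [])]"]) auto
  next
    case (snoc i p)
    have v: "valid_address ?T p" "valid_address (sub_at ?T p) [i]" using snoc.prems by (auto simp: valid_address_append)
    then obtain a ks ts where n: "sub_at ?T p = BNode a ks ts" "i < length ts" by (cases "sub_at ?T p") auto
    have "ts ! i \<noteq> BNil" using snoc.prems sub_at_append[OF v(1), of "[i]"] n by simp
    then have st: "step B (?T, p) (?T, p @ [i])" by (intro step.move_child) (use n in auto)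
    from snoc.IH v n obtain cs where "cs \<noteq> []" "hd cs = (?T, [])" "successively (step B) cs" "last cs = (?T, p)" by auto
    then show ?case using st by (intro exI[of _ "cs @ [(?T, p @ [i])]"]) (auto simp: successively_append_iff)
  qed
  from path[OF assms] obtain p where p: "valid_address ?T p" "x \<in> set (node_keys (sub_at ?T p))" by blast
  then have "sub_at ?T p \<noteq> BNil" by (cases "sub_at ?T p") auto
  from walk[OF p(1) this] obtain cs where "cs \<noteq> []" "hd cs = (?T, [])" "successively (step B) cs" "last cs = (?T, p)" by blast
  then show ?thesis using p(2) last_in_set unfolding model_search_def by (intro exI[of _ cs]) (force)
qed

text \<open>On the naturals \<open>Inf\<close> of the empty set is 0, which would make a comparison
  with the optimum meaningless. The reference tree, kept as a static B-tree with one key per node,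
  shows that every sequence has a run.\<close>

lemma OPT_attained:
  assumes "2 \<le> B" "reference_tree N P" "set X \<subseteq> {1..N}"
  shows "\<exists>t. btree_on B N t \<and> model_run B t X (OPT_Btree B N X)"
proof -
  note PP = reference_tree_facts[OF assms(2)]
  have "keys_inorder (binary Q) = inorder Q" "node_sizes_ok B (binary Q)" for Q using assms(1) by (induction Q) auto
  then have "btree_on B N (binary P)" using assms(2) by (simp add: btree_on_def reference_tree_def)
  moreover have "\<exists>n. model_run B (binary P) X n" using assms(3)
  proof (induction X)
    case (Cons x X)
    then obtain n where "model_run B (binary P) X n" by auto
    moreover obtain cs where "model_search B x (binary P) cs (binary P)" using static_search[of x P B] Cons.prems PP(2) by auto
    ultimately show ?case using model_run.intros(2) by blast
  qed (blast intro: model_run.intros(1))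
  ultimately have "{n. \<exists>t. btree_on B N t \<and> model_run B t X n} \<noteq> {}" by blast
  from Inf_nat_def1[OF this] show ?thesis unfolding OPT_Btree_def by blast
qed

text \<open>The initial potential counts nodes of \<open>P\<close>, so it is at most
  \<open>N\<close> whatever tree the optimum starts from; every search costs the optimum at least
  one unit.\<close>

theorem switches_le_OPT:
  assumes "2 \<le> B" "reference_tree N P" "set X \<subseteq> {1..N}" "3 * B < 2 ^ Suc c"
  shows "total_switches P pref X \<le> N + 14 * Suc c * OPT_Btree B N X" "length X \<le> OPT_Btree B N X"
proof -
  from OPT_attained[OF assms(1-3)] obtain t where t: "btree_on B N t" "model_run B t X (OPT_Btree B N X)" by blast
  have "potential D P pref \<le> card (set_tree P)" for D unfolding potential_def by (intro card_mono) auto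
  moreover have "card (set_tree P) = N" using reference_tree_facts(2)[OF assms(2)] by simp
  ultimately show "total_switches P pref X \<le> N + 14 * Suc c * OPT_Btree B N X" "length X \<le> OPT_Btree B N X"
    using model_run_potential[OF t(2) assms(2) t(1) assms(4,3), of pref] by (metis add_le_mono1 le_trans)+
qed


section \<open>The cost of a Belga B-tree\<close>

lemma preferred_path_length: "length (preferred_path pref P) \<le> height P"
  by (induction P) (auto split: side.splits)

lemma height_subtree_of: "height (subtree_of P v) \<le> height P"
  by (induction P) auto

lemma card_aux_tree:
  assumes "linked B pref q u"
  shows "card (keys (aux_tree u)) \<le> height q"
proof -
  have "keys_inorder (aux_tree u) = preferred_path pref q" using assms by (cases rule: linked.cases) auto
  then have "card (keys (aux_tree u)) \<le> length (preferred_path pref q)" by (simp add: keys_def card_length)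
  then show ?thesis using preferred_path_length[of pref q] by simp
qed

lemma switches_decrease:
  assumes "x \<in> set_tree (subtree_of P w)" "w \<in> set_tree P" "side_of x w \<noteq> pref w"
  shows "switches P x pref = Suc (switches P x (pref(w := side_of x w)))"
proof -
  let ?S = "{v \<in> ancestors P x. pref v \<noteq> side_of x v}"
  have "{v \<in> ancestors P x. (pref(w := side_of x w)) v \<noteq> side_of x v} = ?S - {w}" by auto
  moreover have "w \<in> ?S" "finite ?S" using assms by (auto simp: ancestors_def)
  ultimately show ?thesis unfolding switches_def by (simp only: card_Suc_Diff1)
qed

text \<open>Each round removes one disagreement, and the final one accounts for the extra 1.
  \<open>M\<close> bounds a walk together with a cut and merge: the two paths involved have at most
  \<open>height P\<close> keys each, so the logarithm is of at most \<open>2 * height P\<close>. The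
  absolute value admits any real \<open>K\<close>.\<close>

lemma belga_search_cost:
  assumes "belga_search K B P x pref T n T'" "2 \<le> B" "bst P" "x \<in> set_tree P" "belga_tree B P pref T"
    "M = (5 + \<bar>K\<bar>) * (1 + log (real B) (real (2 * height P)))"
  shows "real n \<le> M * (real (switches P x pref) + 1)"
proof -
  have h1: "1 \<le> height P" using assms(4) by (cases P) auto
  have B1: "1 < real B" using assms(2) by simp
  define Y where "Y = log (real B) (real (2 * height P))"
  have Y0: "0 \<le> Y" unfolding Y_def using B1 h1 by (subst zero_le_log_cancel_iff) auto
  have lg: "log (real B) (real a) \<le> Y" if "1 \<le> a" "a \<le> 2 * height P" for a
    unfolding Y_def using that B1 by (subst log_le_cancel_iff) auto
  have M: "M = (5 + \<bar>K\<bar>) * (1 + Y)" using assms(6) by (simp add: Y_def)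
  have M0: "0 \<le> M" unfolding M using Y0 by (intro mult_nonneg_nonneg) auto
  have path: "real (length p) \<le> 5 * (1 + Y)" "card (keys (aux_tree T)) \<le> height P" "1 \<le> card (keys (aux_tree T))"
      "keys (aux_tree T) = set (preferred_path pref P)"
    if "descent x T p u" "belga_tree B P pref T" for p u T pref
  proof -
    from belga_descent[OF assms(2,3) that(2) assms(4)] obtain p' u' where
      d: "descent x T p' u'" "real (length p') \<le> 5 * (1 + log (real B) (real (card (keys (aux_tree T)))))"
      and k: "keys (aux_tree T) = set (preferred_path pref P)" by blast
    show "keys (aux_tree T) = set (preferred_path pref P)" by (rule k)
    show c: "card (keys (aux_tree T)) \<le> height P" using card_aux_tree that(2) by (auto simp: belga_tree_def)
    have "preferred_path pref P \<noteq> []" using assms(4) by (cases P) (auto split: side.splits)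
    then show c1: "1 \<le> card (keys (aux_tree T))" unfolding k by (simp add: Suc_le_eq card_gt_0_iff)
    have "p = p'" using descent_deterministic[OF that(1) d(1)] by simp
    moreover have "log (real B) (real (card (keys (aux_tree T)))) \<le> Y" using c c1 by (intro lg) auto
    ultimately show "real (length p) \<le> 5 * (1 + Y)" using d(2) by simp
  qed
  have one: "real (length p + j) \<le> M"
    if "descent x T p u" "belga_tree B P pref T" "cut_merge_run K B P T p e S T' j" "card (keys S) \<le> height P" for p u T pref e S T' j
  proof -
    note q = path[OF that(1,2)]
    define Z where "Z = log (real B) (real (card (keys (aux_tree T)) + card (keys S)))"
    have Z: "Z \<le> Y" unfolding Z_def using q that(4) by (intro lg) auto
    have Z0: "0 \<le> Z" unfolding Z_def using q(3) B1 by (subst zero_le_log_cancel_iff) auto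
    have "real j \<le> K * (1 + Z)" using that(3) by (simp add: cut_merge_run_def Z_def)
    also have "\<dots> \<le> \<bar>K\<bar> * (1 + Y)" using Z Z0 by (intro mult_mono) auto
    finally show ?thesis using q(1) unfolding M by (simp add: distrib_right)
  qed
  show ?thesis using assms(1,5)
  proof (induction rule: belga_search.induct)
    case (switch T p u d w pref' pref T' j n T'')
    have bt: "belga_tree B P pref T" by fact
    from belga_descent[OF assms(2,3) bt assms(4)] obtain p' u' where d: "descent x T p' u'"
      and cases: "x \<in> set (preferred_path pref P) \<and> (p' = [] \<or> \<not> marked (label u')) \<or>
       p' \<noteq> [] \<and> marked (label u') \<and> u' \<in> set (links T) \<and> x \<in> keys u' \<and>
       (\<exists>w\<in>set (preferred_path pref P). linked B pref (other_child pref P w) u' \<and> side_of x w \<noteq> pref w \<and>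
          x \<in> set_tree (subtree_of P w) \<and> min_depth (label u') = depth P w + 1)" by blast
    \<comment> \<open>The walk of the given run coincides with the one that
      \<open>belga_descent\<close> describes.\<close>
    have "p' = p" "u' = u" using descent_deterministic[OF d switch(1)] by auto
    with cases switch(2,3) obtain w' where w': "w' \<in> set (preferred_path pref P)" "linked B pref (other_child pref P w') u"
      "side_of x w' \<noteq> pref w'" "x \<in> set_tree (subtree_of P w')" "min_depth (label u) = depth P w' + 1" by blast
    \<comment> \<open>The rule names \<open>w\<close> only by its depth on the topmost path, and
      depths are distinct there.\<close>
    have "w = w'"
      using preferred_path_depth_inj[OF assms(3), of pref] w'(1,5) switch(4-6) path(4)[OF switch(1) bt]
      by (auto simp: inj_on_def)
    then have sw: "switches P x pref = Suc (switches P x pref')"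
      using switches_decrease[of x P w pref] w' preferred_path_subset[of pref P] switch(7) by blast
    have "height (other_child pref P w') \<le> height P"
    proof -
      have "height (left Q) \<le> height Q" "height (right Q) \<le> height Q" for Q :: "nat tree" by (cases Q; simp)+
      then show ?thesis unfolding other_child_def using height_subtree_of[of P w'] le_trans by (cases "pref w'") fastforce+
    qed
    then have "card (keys (aux_tree u)) \<le> height P" using card_aux_tree[OF w'(2)] by simp
    then have c: "real (length p + j) \<le> M" using one[OF switch(1) bt switch(8)] by simp
    have "real n \<le> M * (real (switches P x pref') + 1)" by (rule switch.IH[OF switch(9)])
    then show ?case using c unfolding sw by (simp add: distrib_left)
  next
    case (found_left T p u pref)
    have "real (length p) \<le> 5 * (1 + Y)" using path(1) found_left by blast
    also have "\<dots> \<le> M" unfolding M using Y0 by (intro mult_right_mono) auto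
    also have "\<dots> \<le> M * (real (switches P x pref) + 1)" using M0 by (simp add: distrib_left)
    finally show ?case .
  next
    case (found_right T p u pref S T' j)
    have "card (keys S) \<le> length (preferred_path pref (left (subtree_of P x)))"
      using found_right(5) by (simp add: keys_def) (metis card_length)
    also have "\<dots> \<le> height (left (subtree_of P x))" by (rule preferred_path_length)
    also have "\<dots> \<le> height (subtree_of P x)" by (cases "subtree_of P x") auto
    also have "\<dots> \<le> height P" by (rule height_subtree_of)
    finally have "real (length p + j) \<le> M" using one found_right by blast
    also have "\<dots> \<le> M * (real (switches P x pref) + 1)" using M0 by (simp add: distrib_left)
    finally show ?case .
  qed
qed

lemma belga_run_cost:
  assumes "belga_run K B P pref T X n" "2 \<le> B" "bst P" "set X \<subseteq> set_tree P" "belga_tree B P pref T"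
    "M = (5 + \<bar>K\<bar>) * (1 + log (real B) (real (2 * height P)))"
  shows "real n \<le> real (length X) + M * (real (total_switches P pref X) + real (length X))"
  using assms(1,4,5)
proof (induction rule: belga_run.induct)
  case (2 x pref T n T' X m)
  have "real n \<le> M * (real (switches P x pref) + 1)"
    by (rule belga_search_cost[OF 2(1) assms(2,3) _ 2(6) assms(6)]) (use 2 in auto)
  moreover have "real m \<le> real (length X) + M * (real (total_switches P (after_search P x pref) X) + real (length X))"
    using 2 by auto
  ultimately show ?case by (simp add: algebra_simps)
qed simp

lemma reference_tree_height:
  assumes "reference_tree N P" "1 \<le> N"
  shows "real (height P) \<le> log 2 (real N) + 2"
proof -
  have "height P - min_height P \<le> 1" using assms(1) unfolding reference_tree_def acomplete_def by blast
  then have "height P \<le> min_height P + 1" by linarith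
  moreover have "2 ^ min_height P \<le> N + 1"
    using min_height_size1[of P] reference_tree_facts(4)[OF assms(1)] by (simp add: size1_size)
  then have "real (2 ^ min_height P) \<le> real (2 * N)" using assms(2) by linarith
  then have "2 ^ min_height P \<le> 2 * real N" by simp
  then have "log 2 (2 ^ min_height P) \<le> log 2 (2 * real N)" using assms(2) by (subst log_le_cancel_iff) auto
  then have "real (min_height P) \<le> 1 + log 2 (real N)" using assms(2) by (simp add: log_mult)
  ultimately show ?thesis by linarith
qed

text \<open>On the constants: 57 is 14 * 4 for the switches charged to the optimum plus 1 for the
  searches themselves. The term 1 / \<delta> pays for the initial \<open>N\<close>, since the
  optimum is at least the length of \<open>X\<close>. The leading 2 absorbs the unit per search for
  placing the pointer.\<close>

theorem belga_competitive:
  fixes K a \<delta> :: real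
  assumes "0 < \<delta>" "4 \<le> N" "2 \<le> B" and Ba: "real B \<le> log 2 (real N) powr a" and P: "reference_tree N P"
    and T: "belga_tree B P pref T" and X: "set X \<subseteq> {1..N}" "\<delta> * real N \<le> real (length X)"
    and run: "belga_run K B P pref T X n"
  shows "real n \<le> (2 * (1 / \<delta> + 57) * (5 + \<bar>K\<bar>) * (\<bar>a\<bar> + 3)) * log 2 (log 2 (real N)) * real (OPT_Btree B N X)"
proof -
  note PP = reference_tree_facts[OF P]
  define lN where "lN = log 2 (real N)"
  define ll where "ll = log 2 lN"
  define lB where "lB = log 2 (real B)"
  define OPT where "OPT = real (OPT_Btree B N X)"
  \<comment> \<open>\<open>N\<close> \<ge> 4 makes \<open>ll\<close>, the iterated logarithm, at
    least 1, so that it can absorb additive constants.\<close>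
  have "log 2 (2 ^ 2) \<le> lN" unfolding lN_def using assms(2) by (subst log_le_cancel_iff) auto
  then have lN2: "2 \<le> lN" using log_nat_power[of "2 :: real" 2 2] by simp
  then have "log 2 2 \<le> ll" unfolding ll_def by (subst log_le_cancel_iff) auto
  then have ll1: "1 \<le> ll" by simp
  have "log 2 2 \<le> lB" unfolding lB_def using assms(3) by (subst log_le_cancel_iff) auto
  then have lB1: "1 \<le> lB" by simp
  have "lB \<le> log 2 (lN powr a)" unfolding lB_def lN_def using Ba assms(3) by (subst log_le_cancel_iff) auto
  also have "\<dots> = a * ll" unfolding ll_def using lN2 by (simp add: log_powr)
  also have "\<dots> \<le> \<bar>a\<bar> * ll" using ll1 by (intro mult_right_mono) auto
  finally have lBa: "lB \<le> \<bar>a\<bar> * ll" .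
  \<comment> \<open>\<open>c\<close> is the integer part of log (3 B), so \<open>Suc c\<close> is at
    most 3 + lB and hence at most 4 lB.\<close>
  obtain c where c: "2 ^ c \<le> 3 * B" "3 * B < 2 ^ Suc c"
    using ex_power_ivl1[of 2 "3 * B"] assms(3) by auto
  have "real c = log 2 (2 ^ c)" by (simp add: log_nat_power)
  also have "\<dots> \<le> log 2 (4 * real B)"
  proof -
    have "real (2 ^ c) \<le> real (3 * B)" using c(1) by (simp only: of_nat_le_iff)
    then have "2 ^ c \<le> 4 * real B" by simp
    then show ?thesis using assms(3) by (subst log_le_cancel_iff) auto
  qed
  also have "\<dots> = 2 + lB"
  proof -
    have "log 2 (4 :: real) = 2" using log_nat_power[of 2 2 2] by simp
    then show ?thesis unfolding lB_def using assms(3) by (simp add: log_mult)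
  qed
  finally have cB: "real (Suc c) \<le> 4 * lB" using lB1 by simp
  have sw: "real (total_switches P pref X) \<le> real N + 14 * real (Suc c) * OPT" and lO: "real (length X) \<le> OPT"
  proof -
    note s = switches_le_OPT(1)[OF assms(3) P X(1) c(2), of pref] switches_le_OPT(2)[OF assms(3) P X(1) c(2)]
    have "real (total_switches P pref X) \<le> real (N + 14 * Suc c * OPT_Btree B N X)" using s(1) by (simp only: of_nat_le_iff)
    then show "real (total_switches P pref X) \<le> real N + 14 * real (Suc c) * OPT" by (simp add: OPT_def)
    show "real (length X) \<le> OPT" using s(2) by (simp add: OPT_def)
  qed
  have O0: "0 \<le> OPT" by (simp add: OPT_def)
  have NO: "real N \<le> OPT / \<delta>" using X(2) lO assms(1) by (simp add: field_simps)
  have tot: "real (total_switches P pref X) + real (length X) \<le> (1 / \<delta> + 57) * lB * OPT"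
  proof -
    have "14 * real (Suc c) * OPT \<le> 14 * (4 * lB) * OPT" using cB O0 by (intro mult_right_mono mult_left_mono) auto
    moreover have "OPT \<le> lB * OPT" using lB1 O0 by (simp add: mult_le_cancel_right1)
    moreover have "OPT / \<delta> \<le> lB * OPT / \<delta>" using calculation(2) assms(1) by (intro divide_right_mono) auto
    moreover have "(1 / \<delta> + 57) * lB * OPT = lB * OPT / \<delta> + 14 * (4 * lB) * OPT + lB * OPT" by (simp add: algebra_simps)
    ultimately show ?thesis using sw lO NO by linarith
  qed
  define h where "h = real (height P)"
  have h1: "1 \<le> h" using PP(4) assms(2) unfolding h_def by (cases P) auto
  \<comment> \<open>The height is at most lN + 2, and lN is at least 2.\<close>
  have hN: "2 * h \<le> 4 * lN" using reference_tree_height[OF P] assms(2) lN2 unfolding h_def lN_def by simp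
  define M where "M = (5 + \<bar>K\<bar>) * (1 + log (real B) (real (2 * height P)))"
  have "0 \<le> log (real B) (real (2 * height P))"
    using assms(3) h1 unfolding h_def by (subst zero_le_log_cancel_iff) auto
  then have "1 * 1 \<le> M" unfolding M_def by (intro mult_mono) auto
  then have M1: "1 \<le> M" by simp
  \<comment> \<open>Multiplying by \<open>lB\<close> turns logarithms to base \<open>B\<close> into
    binary ones: the summand \<bar>a\<bar> bounds log B, and 3 comes from log (4 lN) = 2 + ll \<le>
    3 ll.\<close>
  have MB: "M * lB \<le> (5 + \<bar>K\<bar>) * ((\<bar>a\<bar> + 3) * ll)"
  proof -
    have "log (real B) (real (2 * height P)) * lB = log 2 (2 * h)"
      unfolding lB_def h_def using assms(3) by (simp add: log_def)
    then have "(1 + log (real B) (real (2 * height P))) * lB = lB + log 2 (2 * h)" by (simp add: distrib_right)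
    moreover have "log 2 (2 * h) \<le> log 2 (4 * lN)" using hN h1 lN2 by (subst log_le_cancel_iff) auto
    moreover have "log 2 (4 * lN) = 2 + ll"
    proof -
      have "log 2 (4 :: real) = 2" using log_nat_power[of 2 2 2] by simp
      then show ?thesis unfolding ll_def using lN2 by (simp add: log_mult)
    qed
    ultimately have "(1 + log (real B) (real (2 * height P))) * lB \<le> (\<bar>a\<bar> + 3) * ll"
      using lBa ll1 by (simp add: distrib_right)
    then have "(5 + \<bar>K\<bar>) * ((1 + log (real B) (real (2 * height P))) * lB) \<le> (5 + \<bar>K\<bar>) * ((\<bar>a\<bar> + 3) * ll)"
      by (intro mult_left_mono) auto
    then show ?thesis by (simp add: M_def mult.assoc)
  qed
  let ?s = "real (total_switches P pref X) + real (length X)"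
  have "real n \<le> real (length X) + M * ?s"
    by (rule belga_run_cost[OF run assms(3) PP(1) _ T M_def]) (use X(1) PP(2) in simp)
  moreover have "1 * real (length X) \<le> M * ?s" by (rule mult_mono[OF M1]) (use M1 in auto)
  moreover have "M * ?s \<le> M * ((1 / \<delta> + 57) * lB * OPT)" using tot M1 by (intro mult_left_mono) auto
  moreover have "M * ((1 / \<delta> + 57) * lB * OPT) = (1 / \<delta> + 57) * OPT * (M * lB)" by (simp add: algebra_simps)
  moreover have "(1 / \<delta> + 57) * OPT * (M * lB) \<le> (1 / \<delta> + 57) * OPT * ((5 + \<bar>K\<bar>) * ((\<bar>a\<bar> + 3) * ll))"
    using MB O0 assms(1) by (intro mult_left_mono mult_nonneg_nonneg) auto
  ultimately have "real n \<le> 2 * ((1 / \<delta> + 57) * OPT * ((5 + \<bar>K\<bar>) * ((\<bar>a\<bar> + 3) * ll)))" by linarith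
  also have "\<dots> = (2 * (1 / \<delta> + 57) * (5 + \<bar>K\<bar>) * (\<bar>a\<bar> + 3)) * ll * OPT" by (simp only: ac_simps)
  finally show ?thesis unfolding OPT_def ll_def lN_def .
qed

text \<open>The first conjunct keeps the second from being vacuous: for \<open>B\<close> \<ge> 4 and
  one absolute \<open>K\<close>, every sequence has a run from every Belga B-tree. The second holds
  for each \<open>K\<close>, with a constant that depends on \<open>K\<close>, \<open>a\<close> and
  \<delta> alone. Runs start from a Belga B-tree with arbitrary preferences, so the initial
  transformation is not charged.\<close>

theorem theorem2:
  shows
    "(\<exists>K N0. \<forall>N\<ge>N0. \<forall>B\<ge>4. \<forall>P pref. reference_tree N P \<longrightarrow>
        (\<exists>T. belga_tree B P pref T) \<and>
        (\<forall>T X. belga_tree B P pref T \<longrightarrow> set X \<subseteq> {1..N} \<longrightarrow>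
           (\<exists>n. belga_run K B P pref T X n)))
     \<and>
     (\<forall>(K::real) (a::real) (\<delta>::real). \<delta> > 0 \<longrightarrow>
       (\<exists>(C::real) N0. \<forall>N\<ge>N0. \<forall>B\<ge>2. real B \<le> log 2 (real N) powr a \<longrightarrow>
         (\<forall>P pref T X n.
            reference_tree N P \<longrightarrow> belga_tree B P pref T \<longrightarrow>
            set X \<subseteq> {1..N} \<longrightarrow> real (length X) \<ge> \<delta> * real N \<longrightarrow>
            belga_run K B P pref T X n \<longrightarrow>
            real n \<le> C * log 2 (log 2 (real N)) * real (OPT_Btree B N X))))"
proof (intro conjI)
  \<comment> \<open>Five keys are what \<open>refold_cost\<close> asks of the whole tree; hence the
    bound on \<open>N\<close>.\<close>
  have "(\<exists>T. belga_tree B P pref T) \<and> (\<forall>T X. belga_tree B P pref T \<longrightarrow> set X \<subseteq> {1..N} \<longrightarrow>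
      (\<exists>n. belga_run 40000 B P pref T X n))"
    if "5 \<le> N" "4 \<le> B" "reference_tree N P" for N B P pref
    using belga_tree_exists[OF that(2)] belga_run_exists[OF that(2,1,3)] by blast
  then show "\<exists>K N0. \<forall>N\<ge>N0. \<forall>B\<ge>4. \<forall>P pref. reference_tree N P \<longrightarrow>
        (\<exists>T. belga_tree B P pref T) \<and>
        (\<forall>T X. belga_tree B P pref T \<longrightarrow> set X \<subseteq> {1..N} \<longrightarrow> (\<exists>n. belga_run K B P pref T X n))"
    by (intro exI[of _ 40000] exI[of _ 5]) blast
next
  show "\<forall>(K::real) (a::real) (\<delta>::real). \<delta> > 0 \<longrightarrow>
       (\<exists>(C::real) N0. \<forall>N\<ge>N0. \<forall>B\<ge>2. real B \<le> log 2 (real N) powr a \<longrightarrow>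
         (\<forall>P pref T X n.
            reference_tree N P \<longrightarrow> belga_tree B P pref T \<longrightarrow>
            set X \<subseteq> {1..N} \<longrightarrow> real (length X) \<ge> \<delta> * real N \<longrightarrow>
            belga_run K B P pref T X n \<longrightarrow>
            real n \<le> C * log 2 (log 2 (real N)) * real (OPT_Btree B N X)))"
  proof (intro allI impI)
    fix K a \<delta> :: real assume "\<delta> > 0"
    then show "\<exists>(C::real) N0. \<forall>N\<ge>N0. \<forall>B\<ge>2. real B \<le> log 2 (real N) powr a \<longrightarrow>
         (\<forall>P pref T X n.
            reference_tree N P \<longrightarrow> belga_tree B P pref T \<longrightarrow>
            set X \<subseteq> {1..N} \<longrightarrow> real (length X) \<ge> \<delta> * real N \<longrightarrow>
            belga_run K B P pref T X n \<longrightarrow>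
            real n \<le> C * log 2 (log 2 (real N)) * real (OPT_Btree B N X))"
      using belga_competitive
      by (intro exI[of _ "2 * (1 / \<delta> + 57) * (5 + \<bar>K\<bar>) * (\<bar>a\<bar> + 3)"] exI[of _ 4]) blast
  qed
qed

end
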